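(* There exists an even-dimensional real projective variety $V\subset\mathbb{RP}^N$ (for some $N$) whose singular set $\operatorname{sing}V$ consists of a single point, such that the $L^2$-Stokes theorem does not hold for $M=V\setminus\operatorname{sing}V$ equipped with the metric induced by a Riemannian metric on $\mathbb{RP}^N$.
   Context: For a Riemannian manifold $(M,g)$ let $d_k$ be the exterior derivative on smooth compactly supported $k$-forms, regarded as an unbounded operator $L^2(\Lambda^kM)\to L^2(\Lambda^{k+1}M)$, and let $d_k^t$ be its formal adjoint (the codifferential on smooth compactly supported $(k+1)$-forms). For such an operator $D$ with formal adjoint $D^t$, $D_{\min}=\overline{D}$ is the closure of $D$ and $D_{\max}=(D^t)^*$ is the Hilbert space adjoint of $D^t$; equivalently $\operatorname{dom}(D_{\max})=\{s\in L^2 : Ds\in L^2\}$ with $Ds$ taken in the distributional sense. The $L^2$-Stokes theorem holds for $(M,g)$ if $(d_{\max}\omega,\eta)=(\omega,d^t_{\max}\eta)$ for all $\omega\in\operatorname{dom}(d_{\max})$ and $\eta\in\operatorname{dom}(d^t_{\max})$; equivalently $d_{k,\max}=d_{k,\min}$ for all $k$. Here $\operatorname{sing}V$ denotes the singular locus of $V$. Since any two Riemannian metrics on $\mathbb{RP}^N$ are quasi-isometric (each bounded by a constant multiple of the other) and the domains of $d_{\min}$, $d_{\max}$ are quasi-isometry invariants, the validity of the $L^2$-Stokes theorem for $M$ does not depend on the choice of the Riemannian metric on $\mathbb{RP}^N$. *)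

theory Defs
  imports
    "HOL-Analysis.Analysis"
    "HOL-Library.Function_Algebras"
    "Jordan_Normal_Form.Determinant"
begin

section \<open>Real vectors with varying dimension\<close>

text \<open>
  Dimensions have to be quantified inside formulas, so vectors are functions from an
  index type to the reals. Coordinates on a \<open>d\<close>-manifold live in \<open>Rspace d\<close>, which is the carrier
  both of the product measure \<open>Rmeas d\<close> and of the (product) topology inherited from the type.
\<close>

global_interpretation fun_vs:
  vector_space "(\<lambda>c v j. c * v j) :: real \<Rightarrow> ('i \<Rightarrow> real) \<Rightarrow> 'i \<Rightarrow> real"
  by unfold_locales (auto simp: fun_eq_iff algebra_simps)

definition Rspace :: "nat \<Rightarrow> (nat \<Rightarrow> real) set"
  where "Rspace d = ({..<d} \<rightarrow>\<^sub>E UNIV)"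

definition Rmeas :: "nat \<Rightarrow> (nat \<Rightarrow> real) measure"
  where "Rmeas d = (\<Pi>\<^sub>M i\<in>{..<d}. lborel)"

definition partial_deriv :: "nat \<Rightarrow> ((nat \<Rightarrow> real) \<Rightarrow> real) \<Rightarrow> (nat \<Rightarrow> real) \<Rightarrow> real"
  where "partial_deriv i f u = deriv (\<lambda>t. f (u(i := t))) (u i)"

text \<open>
  \<open>U\<close> is meant to be open in \<open>Rspace d\<close>; a function is then smooth iff all its iterated partial
  derivatives exist and are continuous.
\<close>

definition smooth_on :: "nat \<Rightarrow> (nat \<Rightarrow> real) set \<Rightarrow> ((nat \<Rightarrow> real) \<Rightarrow> real) \<Rightarrow> bool"
  where "smooth_on d U f \<longleftrightarrow>
    (\<forall>js. set js \<subseteq> {..<d} \<longrightarrow>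
       continuous_on U (foldr partial_deriv js f) \<and>
       (\<forall>u\<in>U. \<forall>i<d. (\<lambda>t. foldr partial_deriv js f (u(i := t))) differentiable (at (u i))))"


section \<open>Embedded submanifolds and Riemannian metrics\<close>

text \<open>The \<open>i\<close>-th coordinate vector field of a parametrization \<open>\<psi>\<close>.\<close>

definition coord_vec :: "((nat \<Rightarrow> real) \<Rightarrow> 'i \<Rightarrow> real) \<Rightarrow> (nat \<Rightarrow> real) \<Rightarrow> nat \<Rightarrow> 'i \<Rightarrow> real"
  where "coord_vec \<psi> u i = (\<lambda>j. partial_deriv i (\<lambda>u'. \<psi> u' j) u)"

text \<open>
  Local parametrizations (inverses of charts) of a \<open>d\<close>-dimensional embedded submanifold \<open>M\<close>: smooth
  immersions that are homeomorphisms onto an open subset of \<open>M\<close>.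
\<close>

definition local_param ::
    "nat \<Rightarrow> ('i \<Rightarrow> real) set \<Rightarrow> (nat \<Rightarrow> real) set \<Rightarrow> ((nat \<Rightarrow> real) \<Rightarrow> 'i \<Rightarrow> real) \<Rightarrow> bool"
  where "local_param d M U \<psi> \<longleftrightarrow>
    openin (top_of_set (Rspace d)) U \<and>
    openin (top_of_set M) (\<psi> ` U) \<and>
    (\<exists>\<phi>. homeomorphism U (\<psi> ` U) \<psi> \<phi>) \<and>
    (\<forall>j. smooth_on d U (\<lambda>u. \<psi> u j)) \<and>
    (\<forall>u\<in>U. inj_on (coord_vec \<psi> u) {..<d} \<and> fun_vs.independent (coord_vec \<psi> u ` {..<d}))"

definition tangent_space :: "nat \<Rightarrow> ('i \<Rightarrow> real) set \<Rightarrow> ('i \<Rightarrow> real) \<Rightarrow> ('i \<Rightarrow> real) set"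
  where "tangent_space d M p =
    {v. \<exists>U \<psi> u. local_param d M U \<psi> \<and> u \<in> U \<and> \<psi> u = p \<and>
          v \<in> fun_vs.span (coord_vec \<psi> u ` {..<d})}"

text \<open>
  A metric is a function of a point and two ambient vectors, of which only the values on tangent
  vectors matter. In particular the metric induced on a submanifold is given by the same function.
\<close>

type_synonym 'i metric = "('i \<Rightarrow> real) \<Rightarrow> ('i \<Rightarrow> real) \<Rightarrow> ('i \<Rightarrow> real) \<Rightarrow> real"

definition gram :: "'i metric \<Rightarrow> ((nat \<Rightarrow> real) \<Rightarrow> 'i \<Rightarrow> real) \<Rightarrow> (nat \<Rightarrow> real) \<Rightarrow> nat \<Rightarrow> nat \<Rightarrow> real"
  where "gram g \<psi> u i j = g (\<psi> u) (coord_vec \<psi> u i) (coord_vec \<psi> u j)"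

definition riemannian_metric :: "nat \<Rightarrow> ('i \<Rightarrow> real) set \<Rightarrow> 'i metric \<Rightarrow> bool"
  where "riemannian_metric d M g \<longleftrightarrow>
    (\<forall>p\<in>M. \<forall>v\<in>tangent_space d M p. \<forall>w\<in>tangent_space d M p.
       g p v w = g p w v \<and>
       (v \<noteq> 0 \<longrightarrow> g p v v > 0) \<and>
       (\<forall>v'\<in>tangent_space d M p. \<forall>a b.
          g p (\<lambda>j. a * v j + b * v' j) w = a * g p v w + b * g p v' w)) \<and>
    (\<forall>U \<psi>. local_param d M U \<psi> \<longrightarrow> (\<forall>i<d. \<forall>j<d. smooth_on d U (\<lambda>u. gram g \<psi> u i j)))"

definition is_riemannian_volume ::
    "nat \<Rightarrow> ('i \<Rightarrow> real) set \<Rightarrow> 'i metric \<Rightarrow> ('i \<Rightarrow> real) measure \<Rightarrow> bool"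
  where "is_riemannian_volume d M g \<mu> \<longleftrightarrow>
    space \<mu> = M \<and> sets \<mu> = sets (restrict_space borel M) \<and>
    (\<forall>U \<psi> A. local_param d M U \<psi> \<longrightarrow> A \<in> sets (Rmeas d) \<longrightarrow> A \<subseteq> U \<longrightarrow>
       emeasure \<mu> (\<psi> ` A) =
         (\<integral>\<^sup>+ u \<in> A. ennreal (sqrt (Determinant.det (mat d d (\<lambda>(i, j). gram g \<psi> u i j)))) \<partial>Rmeas d))"

definition riemannian_volume ::
    "nat \<Rightarrow> ('i \<Rightarrow> real) set \<Rightarrow> 'i metric \<Rightarrow> ('i \<Rightarrow> real) measure"
  where "riemannian_volume d M g = (THE \<mu>. is_riemannian_volume d M g \<mu>)"


section \<open>Differential forms\<close>

text \<open>
  A \<open>k\<close>-form assigns a number to a point and a list of \<open>k\<close> tangent vectors. As for metrics, values on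
  other arguments are irrelevant.
\<close>

type_synonym 'i dform = "('i \<Rightarrow> real) \<Rightarrow> ('i \<Rightarrow> real) list \<Rightarrow> real"

definition tangent_lists :: "nat \<Rightarrow> ('i \<Rightarrow> real) set \<Rightarrow> nat \<Rightarrow> ('i \<Rightarrow> real) \<Rightarrow> ('i \<Rightarrow> real) list set"
  where "tangent_lists d M k p = {vs. length vs = k \<and> set vs \<subseteq> tangent_space d M p}"

definition is_form :: "nat \<Rightarrow> ('i \<Rightarrow> real) set \<Rightarrow> nat \<Rightarrow> 'i dform \<Rightarrow> bool"
  where "is_form d M k \<omega> \<longleftrightarrow>
    (\<forall>p\<in>M. \<forall>vs\<in>tangent_lists d M k p.
       (\<forall>l<k. \<forall>v\<in>tangent_space d M p. \<forall>w\<in>tangent_space d M p. \<forall>a b.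
          \<omega> p (vs[l := (\<lambda>j. a * v j + b * w j)]) = a * \<omega> p (vs[l := v]) + b * \<omega> p (vs[l := w])) \<and>
       (\<forall>l<k. \<forall>m<k. l \<noteq> m \<longrightarrow> vs ! l = vs ! m \<longrightarrow> \<omega> p vs = 0))"

definition multi_indices :: "nat \<Rightarrow> nat \<Rightarrow> nat list set"
  where "multi_indices d k = {I. length I = k \<and> set I \<subseteq> {..<d}}"

definition form_coeff ::
    "((nat \<Rightarrow> real) \<Rightarrow> 'i \<Rightarrow> real) \<Rightarrow> 'i dform \<Rightarrow> nat list \<Rightarrow> (nat \<Rightarrow> real) \<Rightarrow> real"
  where "form_coeff \<psi> \<omega> I u = \<omega> (\<psi> u) (map (coord_vec \<psi> u) I)"

definition test_form :: "nat \<Rightarrow> ('i \<Rightarrow> real) set \<Rightarrow> nat \<Rightarrow> 'i dform \<Rightarrow> bool"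
  where "test_form d M k \<omega> \<longleftrightarrow>
    is_form d M k \<omega> \<and>
    (\<forall>U \<psi>. local_param d M U \<psi> \<longrightarrow>
       (\<forall>I\<in>multi_indices d k. smooth_on d U (form_coeff \<psi> \<omega> I))) \<and>
    (\<exists>K\<subseteq>M. compact K \<and> (\<forall>p\<in>M - K. \<forall>vs\<in>tangent_lists d M k p. \<omega> p vs = 0))"

definition is_ext_deriv :: "nat \<Rightarrow> ('i \<Rightarrow> real) set \<Rightarrow> nat \<Rightarrow> 'i dform \<Rightarrow> 'i dform \<Rightarrow> bool"
  where "is_ext_deriv d M k \<omega> \<sigma> \<longleftrightarrow>
    (\<forall>U \<psi>. local_param d M U \<psi> \<longrightarrow> (\<forall>u\<in>U. \<forall>I\<in>multi_indices d (Suc k).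
       form_coeff \<psi> \<sigma> I u =
         (\<Sum>l\<le>k. (-1) ^ l * partial_deriv (I ! l) (form_coeff \<psi> \<omega> (take l I @ drop (Suc l) I)) u)))"


section \<open>Square-integrable forms and the \<open>L\<^sup>2\<close>-Stokes theorem\<close>

definition orthonormal_frame ::
    "nat \<Rightarrow> ('i \<Rightarrow> real) set \<Rightarrow> 'i metric \<Rightarrow> ('i \<Rightarrow> real) \<Rightarrow> (nat \<Rightarrow> 'i \<Rightarrow> real) \<Rightarrow> bool"
  where "orthonormal_frame d M g p e \<longleftrightarrow>
    (\<forall>i<d. e i \<in> tangent_space d M p) \<and>
    (\<forall>i<d. \<forall>j<d. g p (e i) (e j) = (if i = j then 1 else 0))"

text \<open>
  The inner product on alternating \<open>k\<close>-forms does not depend on the orthonormal frame. All \<open>k\<close>-tuples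
  of indices are summed, hence the factor \<open>1/k!\<close> compared to a sum over increasing tuples.
\<close>

definition form_inner ::
    "nat \<Rightarrow> ('i \<Rightarrow> real) set \<Rightarrow> 'i metric \<Rightarrow> nat \<Rightarrow> 'i dform \<Rightarrow> 'i dform \<Rightarrow> ('i \<Rightarrow> real) \<Rightarrow> real"
  where "form_inner d M g k \<alpha> \<beta> p =
    (let e = (SOME e. orthonormal_frame d M g p e)
     in (\<Sum>I\<in>multi_indices d k. \<alpha> p (map e I) * \<beta> p (map e I)) / fact k)"

definition L2_form :: "nat \<Rightarrow> ('i \<Rightarrow> real) set \<Rightarrow> 'i metric \<Rightarrow> nat \<Rightarrow> 'i dform \<Rightarrow> bool"
  where "L2_form d M g k \<omega> \<longleftrightarrow>
    is_form d M k \<omega> \<and>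
    (\<forall>U \<psi>. local_param d M U \<psi> \<longrightarrow> (\<forall>I\<in>multi_indices d k.
       form_coeff \<psi> \<omega> I \<in> borel_measurable (restrict_space (Rmeas d) U))) \<and>
    (\<integral>\<^sup>+ p. ennreal (form_inner d M g k \<omega> \<omega> p) \<partial>riemannian_volume d M g) < \<infinity>"

definition L2_inner ::
    "nat \<Rightarrow> ('i \<Rightarrow> real) set \<Rightarrow> 'i metric \<Rightarrow> nat \<Rightarrow> 'i dform \<Rightarrow> 'i dform \<Rightarrow> real"
  where "L2_inner d M g k \<alpha> \<beta> =
    (\<integral>p. form_inner d M g k \<alpha> \<beta> p \<partial>riemannian_volume d M g)"

text \<open>
  Unbounded operators are represented by their graphs, on representatives of \<open>L\<^sup>2\<close>-classes:
  \<open>d_graph\<close> is \<open>d\<^sub>k\<close>, \<open>dt_graph\<close> its formal adjoint, and \<open>d_max = (d\<^sub>k\<^sup>t)\<^sup>*\<close>,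
  \<open>dt_max = (d\<^sub>k)\<^sup>*\<close> are Hilbert space adjoints.
\<close>

definition d_graph :: "nat \<Rightarrow> ('i \<Rightarrow> real) set \<Rightarrow> nat \<Rightarrow> ('i dform \<times> 'i dform) set"
  where "d_graph d M k =
    {(\<omega>, \<sigma>). test_form d M k \<omega> \<and> test_form d M (Suc k) \<sigma> \<and> is_ext_deriv d M k \<omega> \<sigma>}"

definition dt_graph ::
    "nat \<Rightarrow> ('i \<Rightarrow> real) set \<Rightarrow> 'i metric \<Rightarrow> nat \<Rightarrow> ('i dform \<times> 'i dform) set"
  where "dt_graph d M g k =
    {(\<eta>, \<zeta>). test_form d M (Suc k) \<eta> \<and> test_form d M k \<zeta> \<and>
       (\<forall>(\<omega>, \<sigma>)\<in>d_graph d M k. L2_inner d M g (Suc k) \<sigma> \<eta> = L2_inner d M g k \<omega> \<zeta>)}"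

definition d_max ::
    "nat \<Rightarrow> ('i \<Rightarrow> real) set \<Rightarrow> 'i metric \<Rightarrow> nat \<Rightarrow> ('i dform \<times> 'i dform) set"
  where "d_max d M g k =
    {(\<omega>, \<sigma>). L2_form d M g k \<omega> \<and> L2_form d M g (Suc k) \<sigma> \<and>
       (\<forall>(\<eta>, \<zeta>)\<in>dt_graph d M g k. L2_inner d M g k \<zeta> \<omega> = L2_inner d M g (Suc k) \<eta> \<sigma>)}"

definition dt_max ::
    "nat \<Rightarrow> ('i \<Rightarrow> real) set \<Rightarrow> 'i metric \<Rightarrow> nat \<Rightarrow> ('i dform \<times> 'i dform) set"
  where "dt_max d M g k =
    {(\<eta>, \<zeta>). L2_form d M g (Suc k) \<eta> \<and> L2_form d M g k \<zeta> \<and>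
       (\<forall>(\<omega>, \<sigma>)\<in>d_graph d M k. L2_inner d M g (Suc k) \<sigma> \<eta> = L2_inner d M g k \<omega> \<zeta>)}"

definition L2_Stokes :: "nat \<Rightarrow> ('i \<Rightarrow> real) set \<Rightarrow> 'i metric \<Rightarrow> bool"
  where "L2_Stokes d M g \<longleftrightarrow>
    (\<forall>k. \<forall>(\<omega>, \<sigma>)\<in>d_max d M g k. \<forall>(\<eta>, \<zeta>)\<in>dt_max d M g k.
       L2_inner d M g (Suc k) \<sigma> \<eta> = L2_inner d M g k \<omega> \<zeta>)"


section \<open>Real projective varieties\<close>

text \<open>
  Real projective space is embedded as the manifold of orthogonal projections of rank one, the line
  through \<open>x\<close> corresponding to \<open>x x\<^sup>T / |x|\<^sup>2\<close>. Only the homogeneous coordinates \<open>x 0, \<dots>, x N\<close> of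
  \<open>x\<close> are relevant.
\<close>

definition hom_coords :: "nat \<Rightarrow> (nat \<Rightarrow> real) set"
  where "hom_coords N = {x. \<exists>i\<le>N. x i \<noteq> 0}"

definition proj_pt :: "nat \<Rightarrow> (nat \<Rightarrow> real) \<Rightarrow> nat \<times> nat \<Rightarrow> real"
  where "proj_pt N x = (\<lambda>(i, j). if i \<le> N \<and> j \<le> N then x i * x j / (\<Sum>l\<le>N. (x l)\<^sup>2) else 0)"

definition RP :: "nat \<Rightarrow> (nat \<times> nat \<Rightarrow> real) set"
  where "RP N = proj_pt N ` hom_coords N"

definition hom_poly :: "nat \<Rightarrow> nat \<Rightarrow> ((nat \<Rightarrow> real) \<Rightarrow> real) \<Rightarrow> bool"
  where "hom_poly N m f \<longleftrightarrow>
    (\<exists>c. \<forall>x. f x = (\<Sum>\<alpha> | \<alpha> \<in> {..N} \<rightarrow>\<^sub>E {..m} \<and> (\<Sum>i\<le>N. \<alpha> i) = m. c \<alpha> * (\<Prod>i\<le>N. x i ^ \<alpha> i)))"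

definition proj_algebraic_set :: "nat \<Rightarrow> (nat \<times> nat \<Rightarrow> real) set \<Rightarrow> bool"
  where "proj_algebraic_set N V \<longleftrightarrow>
    (\<exists>F. (\<forall>f\<in>F. \<exists>m. hom_poly N m f) \<and> V = proj_pt N ` {x\<in>hom_coords N. \<forall>f\<in>F. f x = 0})"

definition projective_variety :: "nat \<Rightarrow> (nat \<times> nat \<Rightarrow> real) set \<Rightarrow> bool"
  where "projective_variety N V \<longleftrightarrow>
    proj_algebraic_set N V \<and> V \<noteq> {} \<and>
    (\<forall>A B. proj_algebraic_set N A \<longrightarrow> proj_algebraic_set N B \<longrightarrow> V = A \<union> B \<longrightarrow> V = A \<or> V = B)"

text \<open>The homogeneous elements of the vanishing ideal, which they generate.\<close>

definition hom_ideal :: "nat \<Rightarrow> (nat \<times> nat \<Rightarrow> real) set \<Rightarrow> ((nat \<Rightarrow> real) \<Rightarrow> real) set"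
  where "hom_ideal N V = {f. (\<exists>m. hom_poly N m f) \<and> (\<forall>x\<in>hom_coords N. proj_pt N x \<in> V \<longrightarrow> f x = 0)}"

text \<open>
  Following Whitney and Milnor (\<open>Singular points of complex hypersurfaces\<close>, Section 2), a point is
  singular iff the rank of the Jacobian matrix of the vanishing ideal is not maximal there; this
  maximal rank is the codimension of the variety, and the nonsingular points form a smooth manifold
  of the complementary dimension.
\<close>

definition jacobian_rank :: "nat \<Rightarrow> (nat \<times> nat \<Rightarrow> real) set \<Rightarrow> (nat \<Rightarrow> real) \<Rightarrow> nat"
  where "jacobian_rank N V x =
    fun_vs.dim ((\<lambda>f i. if i \<le> N then partial_deriv i f x else 0) ` hom_ideal N V)"

definition variety_codim :: "nat \<Rightarrow> (nat \<times> nat \<Rightarrow> real) set \<Rightarrow> nat"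
  where "variety_codim N V = Max {jacobian_rank N V x | x. x \<in> hom_coords N \<and> proj_pt N x \<in> V}"

definition variety_dim :: "nat \<Rightarrow> (nat \<times> nat \<Rightarrow> real) set \<Rightarrow> nat"
  where "variety_dim N V = N - variety_codim N V"

definition sing :: "nat \<Rightarrow> (nat \<times> nat \<Rightarrow> real) set \<Rightarrow> (nat \<times> nat \<Rightarrow> real) set"
  where "sing N V =
    {proj_pt N x | x. x \<in> hom_coords N \<and> proj_pt N x \<in> V \<and> jacobian_rank N V x < variety_codim N V}"


section \<open>Existence of Riemannian metrics on projective space\<close>

text \<open>The condition of \<open>smooth_on\<close> for partial derivatives of order at most \<open>n\<close> only.\<close>

definition Cn :: "nat \<Rightarrow> nat \<Rightarrow> (nat \<Rightarrow> real) set \<Rightarrow> ((nat \<Rightarrow> real) \<Rightarrow> real) \<Rightarrow> bool"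
  where "Cn n d U f \<longleftrightarrow>
    (\<forall>js. length js \<le> n \<longrightarrow> set js \<subseteq> {..<d} \<longrightarrow>
       continuous_on U (foldr partial_deriv js f) \<and>
       (\<forall>u\<in>U. \<forall>i<d. (\<lambda>t. foldr partial_deriv js f (u(i := t))) differentiable (at (u i))))"

lemma smooth_on_iff_Cn: "smooth_on d U f \<longleftrightarrow> (\<forall>n. Cn n d U f)"
  unfolding smooth_on_def Cn_def by blast

lemma Cn_0: "Cn 0 d U f \<longleftrightarrow> continuous_on U f \<and>
    (\<forall>u\<in>U. \<forall>i<d. (\<lambda>t. f (u(i := t))) differentiable (at (u i)))"
  unfolding Cn_def by auto

lemma Cn_Suc: "Cn (Suc n) d U f \<longleftrightarrow> Cn 0 d U f \<and> (\<forall>i<d. Cn n d U (partial_deriv i f))"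
proof
  assume L: "Cn (Suc n) d U f"
  have "Cn n d U (partial_deriv i f)" if "i < d" for i
    unfolding Cn_def
  proof (intro allI impI)
    fix js :: "nat list" assume "length js \<le> n" "set js \<subseteq> {..<d}"
    with L[unfolded Cn_def, rule_format, of "js @ [i]"] that
    show "continuous_on U (foldr partial_deriv js (partial_deriv i f)) \<and>
       (\<forall>u\<in>U. \<forall>k<d. (\<lambda>t. foldr partial_deriv js (partial_deriv i f) (u(k := t))) differentiable (at (u k)))"
      by simp
  qed
  moreover have "Cn 0 d U f" using L[unfolded Cn_def, rule_format, of "[]"] by (simp add: Cn_0)
  ultimately show "Cn 0 d U f \<and> (\<forall>i<d. Cn n d U (partial_deriv i f))" by blast
next
  assume R: "Cn 0 d U f \<and> (\<forall>i<d. Cn n d U (partial_deriv i f))"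
  show "Cn (Suc n) d U f"
    unfolding Cn_def
  proof (intro allI impI)
    fix js :: "nat list" assume js: "length js \<le> Suc n" "set js \<subseteq> {..<d}"
    show "continuous_on U (foldr partial_deriv js f) \<and>
       (\<forall>u\<in>U. \<forall>k<d. (\<lambda>t. foldr partial_deriv js f (u(k := t))) differentiable (at (u k)))"
    proof (cases js rule: rev_cases)
      case Nil then show ?thesis using R by (simp add: Cn_0)
    next
      case (snoc ks i)
      then have "Cn n d U (partial_deriv i f)" "length ks \<le> n" "set ks \<subseteq> {..<d}" using js R by auto
      then show ?thesis unfolding Cn_def snoc by simp
    qed
  qed
qed

lemma eventually_in_open:
  assumes U: "openin (top_of_set (Rspace d)) U" and "u \<in> U" "i < d"
  shows "\<forall>\<^sub>F t in nhds (u i). u(i := t) \<in> U"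
proof -
  obtain W where W: "open W" "U = Rspace d \<inter> W" using U by (auto simp: openin_open)
  have "continuous_on UNIV (\<lambda>t. u(i := t))"
  proof (rule continuous_on_coordinatewise_then_product)
    show "continuous_on UNIV (\<lambda>t. (u(i := t)) k)" for k
      by (cases "k = i") (auto intro!: continuous_intros)
  qed
  then have "open ((\<lambda>t. u(i := t)) -` W)" using W(1) by (rule open_vimage[rotated])
  moreover have "u i \<in> (\<lambda>t. u(i := t)) -` W" using assms W by simp
  ultimately have "\<forall>\<^sub>F t in nhds (u i). u(i := t) \<in> W"
    using eventually_nhds_in_open by fastforce
  moreover have "u(i := t) \<in> Rspace d" for t
    using assms W unfolding Rspace_def by (auto simp: PiE_def extensional_def)
  ultimately show ?thesis using W by (auto elim: eventually_mono)
qed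

context
  fixes d and U :: "(nat \<Rightarrow> real) set"
  assumes U: "openin (top_of_set (Rspace d)) U"
begin

lemma partial_deriv_cong:
  assumes "\<And>u. u \<in> U \<Longrightarrow> f u = g u" "u \<in> U" "i < d"
  shows "partial_deriv i f u = partial_deriv i g u"
  unfolding partial_deriv_def
  by (rule deriv_cong_ev[OF _ refl])
    (use eventually_in_open[OF U assms(2,3)] assms(1) in \<open>auto elim: eventually_mono\<close>)

lemma differentiable_cong_U:
  assumes "\<And>u. u \<in> U \<Longrightarrow> f u = g u" "u \<in> U" "i < d"
    "(\<lambda>t. g (u(i := t))) differentiable (at (u i))"
  shows "(\<lambda>t. f (u(i := t)) :: real) differentiable (at (u i))"
proof -
  obtain D where "((\<lambda>t. g (u(i := t))) has_real_derivative D) (at (u i))"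
    using assms(4) real_differentiableE by blast
  then have "((\<lambda>t. f (u(i := t))) has_real_derivative D) (at (u i))"
    by (rule has_field_derivative_cong_eventually[THEN iffD1, rotated -1])
      (use eventually_in_open[OF U assms(2,3)] assms(1,2) in
        \<open>auto simp: eventually_at_filter elim!: eventually_mono\<close>)
  then show ?thesis by (auto simp: real_differentiable_def)
qed

lemma Cn_0_cong:
  assumes "\<And>u. u \<in> U \<Longrightarrow> f u = g u" "Cn 0 d U g"
  shows "Cn 0 d U f"
proof -
  have "continuous_on U f"
    using assms continuous_on_cong[OF refl, of U f g] unfolding Cn_0 by blast
  moreover have "(\<lambda>t. f (u(i := t))) differentiable (at (u i))" if "u \<in> U" "i < d" for u i
  proof (rule differentiable_cong_U[of f g, OF assms(1) that])
    show "(\<lambda>t. g (u(i := t))) differentiable (at (u i))"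
      by (rule assms(2)[unfolded Cn_0, THEN conjunct2, rule_format, OF that])
  qed
  ultimately show ?thesis unfolding Cn_0 by blast
qed

lemma Cn_cong:
  assumes "\<And>u. u \<in> U \<Longrightarrow> f u = g u" "Cn n d U g"
  shows "Cn n d U f"
  using assms
proof (induction n arbitrary: f g)
  case 0
  then show ?case by (rule Cn_0_cong)
next
  case (Suc n)
  from Suc.prems(2) have g: "Cn 0 d U g" "\<And>i. i < d \<Longrightarrow> Cn n d U (partial_deriv i g)"
    unfolding Cn_Suc by blast+
  have "Cn 0 d U f" using Suc.prems(1) g(1) by (rule Cn_0_cong)
  moreover have "Cn n d U (partial_deriv i f)" if "i < d" for i
    by (rule Suc.IH[OF partial_deriv_cong[OF Suc.prems(1) _ that] g(2)[OF that]])
  ultimately show ?case unfolding Cn_Suc by blast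
qed

lemma partial_deriv_add:
  assumes "Cn 0 d U f" "Cn 0 d U g" "u \<in> U" "i < d"
  shows "partial_deriv i (\<lambda>u. f u + g u) u = partial_deriv i f u + partial_deriv i g u"
  unfolding partial_deriv_def using assms unfolding Cn_0
  by (intro deriv_add) (auto simp: field_differentiable_def real_differentiable_def)

lemma partial_deriv_mult:
  assumes "Cn 0 d U f" "Cn 0 d U g" "u \<in> U" "i < d"
  shows "partial_deriv i (\<lambda>u. f u * g u) u = f u * partial_deriv i g u + partial_deriv i f u * g u"
  unfolding partial_deriv_def using assms unfolding Cn_0
  by (subst deriv_mult) (auto simp: field_differentiable_def real_differentiable_def)

lemma Cn_mono: "Cn (Suc n) d U f \<Longrightarrow> Cn n d U f"
  unfolding Cn_def by auto

lemma Cn_add: "Cn n d U f \<Longrightarrow> Cn n d U g \<Longrightarrow> Cn n d U (\<lambda>u. f u + g u)"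
proof (induction n arbitrary: f g)
  case 0
  then show ?case unfolding Cn_0 by (auto intro!: continuous_intros derivative_intros)
next
  case (Suc n)
  then have 0: "Cn 0 d U f" "Cn 0 d U g" by (auto simp: Cn_Suc)
  have "Cn 0 d U (\<lambda>u. f u + g u)"
    using 0 unfolding Cn_0 by (auto intro!: continuous_intros derivative_intros)
  moreover have "Cn n d U (partial_deriv i (\<lambda>u. f u + g u))" if i: "i < d" for i
    by (rule Cn_cong[OF partial_deriv_add[OF 0 _ i]])
      (use Suc i in \<open>auto simp: Cn_Suc\<close>)
  ultimately show ?case by (simp add: Cn_Suc)
qed

lemma Cn_mult: "Cn n d U f \<Longrightarrow> Cn n d U g \<Longrightarrow> Cn n d U (\<lambda>u. f u * g u)"
proof (induction n arbitrary: f g)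
  case 0
  then show ?case unfolding Cn_0 by (auto intro!: continuous_intros derivative_intros)
next
  case (Suc n)
  then have 0: "Cn 0 d U f" "Cn 0 d U g" by (auto simp: Cn_Suc)
  have "Cn 0 d U (\<lambda>u. f u * g u)"
    using 0 unfolding Cn_0 by (auto intro!: continuous_intros derivative_intros)
  moreover have "Cn n d U (partial_deriv i (\<lambda>u. f u * g u))" if i: "i < d" for i
  proof (rule Cn_cong[OF partial_deriv_mult[OF 0 _ i]])
    have "Cn n d U f" "Cn n d U g" using Suc.prems Cn_mono by blast+
    moreover have "Cn n d U (partial_deriv i f)" "Cn n d U (partial_deriv i g)"
      using Suc.prems i unfolding Cn_Suc by blast+
    ultimately show "Cn n d U (\<lambda>u. f u * partial_deriv i g u + partial_deriv i f u * g u)"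
      by (intro Cn_add Suc.IH)
  qed
  ultimately show ?case by (simp add: Cn_Suc)
qed

lemma Cn_const: "Cn n d U (\<lambda>u. c)"
proof (induction n arbitrary: c)
  case (Suc n)
  have "partial_deriv i (\<lambda>u. c) = (\<lambda>u. 0)" for i by (auto simp: partial_deriv_def)
  then show ?case using Suc by (auto simp: Cn_Suc Cn_0)
qed (auto simp: Cn_0)

lemma smooth_on_mult: "smooth_on d U f \<Longrightarrow> smooth_on d U g \<Longrightarrow> smooth_on d U (\<lambda>u. f u * g u)"
  using Cn_mult by (auto simp: smooth_on_iff_Cn)

lemma smooth_on_sum:
  "finite A \<Longrightarrow> (\<And>a. a \<in> A \<Longrightarrow> smooth_on d U (f a)) \<Longrightarrow> smooth_on d U (\<lambda>u. \<Sum>a\<in>A. f a u)"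
proof (induction A rule: finite_induct)
  case empty show ?case using Cn_const by (auto simp: smooth_on_iff_Cn)
next
  case (insert a A)
  then show ?case using Cn_add[of _ "f a" "\<lambda>u. \<Sum>a\<in>A. f a u"] by (auto simp: smooth_on_iff_Cn)
qed

lemma smooth_on_partial_deriv: "smooth_on d U f \<Longrightarrow> i < d \<Longrightarrow> smooth_on d U (partial_deriv i f)"
  unfolding smooth_on_iff_Cn
proof
  fix n assume "\<forall>n. Cn n d U f" "i < d"
  then have "Cn (Suc n) d U f" by blast
  then show "Cn n d U (partial_deriv i f)" using \<open>i < d\<close> unfolding Cn_Suc by blast
qed

end

text \<open>
  Riemannian metrics on \<open>RP N\<close> exist: the Frobenius inner product induces a multiple of the
  Fubini-Study metric.
\<close>

lemma riemannian_metric_RP: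
  "riemannian_metric N (RP N) (\<lambda>p v w. \<Sum>ij\<in>{..N} \<times> {..N}. v ij * w ij)"
proof -
  have supp: "v ij = 0" if v: "v \<in> tangent_space N (RP N) p" and ij: "ij \<notin> {..N} \<times> {..N}" for p v ij
  proof -
    obtain U \<psi> u where P: "local_param N (RP N) U \<psi>" "u \<in> U"
      and v: "v \<in> fun_vs.span (coord_vec \<psi> u ` {..<N})"
      using v unfolding tangent_space_def by blast
    have U: "openin (top_of_set (Rspace N)) U" using P unfolding local_param_def by blast
    have "\<psi> ` U \<subseteq> RP N" using P unfolding local_param_def by (auto dest: openin_imp_subset)
    then have "\<psi> u' ij = 0" if "u' \<in> U" for u'
      using that ij unfolding RP_def proj_pt_def by (force split: prod.splits)
    then have "coord_vec \<psi> u ` {..<N} \<subseteq> {v. v ij = 0}"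
      using partial_deriv_cong[OF U, of "\<lambda>u. \<psi> u ij" "\<lambda>u. 0" u] P
      by (auto simp: coord_vec_def partial_deriv_def)
    moreover have "fun_vs.subspace {v. v ij = 0}"
      by (rule fun_vs.subspaceI) auto
    ultimately show ?thesis
      using v fun_vs.span_minimal by blast
  qed
  have pos: "(\<Sum>ij\<in>{..N} \<times> {..N}. v ij * v ij) > 0"
    if "v \<in> tangent_space N (RP N) p" "v \<noteq> 0" for p v
  proof -
    obtain ij where "v ij \<noteq> 0" using \<open>v \<noteq> 0\<close> by (auto simp: fun_eq_iff)
    then show ?thesis
      using supp[OF that(1), of ij] by (intro sum_pos2[of _ ij]) (auto simp: zero_less_mult_iff)
  qed
  have smooth: "smooth_on N U (\<lambda>u. \<Sum>ij\<in>{..N} \<times> {..N}. coord_vec \<psi> u i ij * coord_vec \<psi> u j ij)"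
    if P: "local_param N (RP N) U \<psi>" and ij: "i < N" "j < N" for U \<psi> i j
  proof -
    have U: "openin (top_of_set (Rspace N)) U" and "\<And>k. smooth_on N U (\<lambda>u. \<psi> u k)"
      using P unfolding local_param_def by blast+
    then have "smooth_on N U (\<lambda>u. coord_vec \<psi> u l ij)" if "l < N" for l ij
      unfolding coord_vec_def using smooth_on_partial_deriv[OF U _ that] by blast
    then show ?thesis
      using ij by (intro smooth_on_sum[OF U] smooth_on_mult[OF U]) simp_all
  qed
  have lin: "(\<Sum>ij\<in>{..N} \<times> {..N}. (a * v ij + b * v' ij) * w ij) =
      a * (\<Sum>ij\<in>{..N} \<times> {..N}. v ij * w ij) + b * (\<Sum>ij\<in>{..N} \<times> {..N}. v' ij * w ij)"
    for a b and v v' w :: "nat \<times> nat \<Rightarrow> real"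
    unfolding distrib_right sum.distrib sum_distrib_left mult.assoc by (rule refl)
  have sym: "(\<Sum>ij\<in>{..N} \<times> {..N}. v ij * w ij) = (\<Sum>ij\<in>{..N} \<times> {..N}. w ij * v ij)"
    for v w :: "nat \<times> nat \<Rightarrow> real"
    by (rule sum.cong[OF refl mult.commute])
  show ?thesis
    unfolding riemannian_metric_def gram_def
  proof (intro conjI ballI allI impI, goal_cases)
    case 1 show ?case by (rule sym)
  next
    case 2 then show ?case by (intro pos)
  next
    case 3 show ?case by (rule lin)
  next
    case 4 then show ?case by (rule smooth)
  qed
qed

end

theory Submission
  imports Defs
begin

text \<open>
  The inversion \<open>a \<mapsto> a / |a|\<^sup>2\<close> maps the cylinder \<open>R\<^sup>3 \<times> S\<^sup>1\<close> in \<open>R\<^sup>5\<close> onto the hypersurface \<open>|w|\<^sup>2 = |a|\<^sup>4\<close>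
  without its singular point \<open>0\<close>, where \<open>a = (x, w)\<close> with \<open>w\<close> in \<open>R\<^sup>2\<close>. The projective closure has no further points.
  Since inversions are conformal, the induced metric is quasi-isometric to \<open>q\<^sup>-\<^sup>2 (dy\<^sup>2 + d\<theta>\<^sup>2)\<close> with
  \<open>q = 1 + |y|\<^sup>2\<close>, and the volume form is comparable to \<open>q\<^sup>-\<^sup>4 dy d\<theta>\<close>. The closed form \<open>d\<theta>\<close> is square-integrable because
  \<open>|d\<theta>|\<^sup>2 dvol\<close> is comparable to \<open>q\<^sup>-\<^sup>2 dy d\<theta>\<close>, hence it lies in the kernel of \<open>d\<^sub>m\<^sub>a\<^sub>x\<close>. On the
  other hand, let \<open>B\<close> be the vector field \<open>y / q\<^sup>3\<^sup>/\<^sup>2\<close> on \<open>R\<^sup>3\<close>. The metric dual of \<open>\<partial>\<^sub>\<theta> \<and> B\<close>, divided by the volume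
  density, is a square-integrable 2-form whose codifferential pairs with \<open>d\<theta>\<close> to the integral of
  \<open>div B\<close>. This is positive, being the flux of \<open>B\<close> into the singular point.
\<close>

section \<open>Smooth functions of several variables\<close>

text \<open>An isolated conical singularity in even dimension never violates the theorem, since its
  link has odd dimension and no middle cohomology. The singularity must not be conical: with r =
  1/|y| the metric is comparable to dr^2 + r^2 g_S + r^4 dtheta^2, where g_S is the metric of S^2,
  so the circle collapses faster than in a cone. The metric \<open>g\<close> is arbitrary, but
  compactness of a box in the affine chart gives uniform two-sided bounds. Beyond these bounds
  little about \<open>g\<close> enters: pairing a form with the metric dual of a multivector field
  is plain evaluation, and division by \<open>rho\<close> cancels the volume density. The exponent
  3/2 is critical. For a field of faster decay the integral of the divergence would vanish; for this
  one the densities of all three square norms are bounded by multiples of q^(-2), which is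
  integrable over R^3 because |y|^(-4) outweighs the growth |y|^2 of spheres. No single chart covers
  the circle, so angles relative to 0 and to pi are used, and a half-open strip of parameters
  carries the integrals.\<close>

lemma smooth_on_DERIV:
  assumes "smooth_on d U f" "u \<in> U" "i < d"
  shows "((\<lambda>t. f (u(i := t))) has_real_derivative partial_deriv i f u) (at (u i))"
proof -
  have "(\<lambda>t. foldr partial_deriv [] f (u(i := t))) differentiable (at (u i))"
    using assms unfolding smooth_on_def by (metis empty_subsetI list.set(1))
  then show ?thesis
    unfolding partial_deriv_def by (simp add: DERIV_deriv_iff_real_differentiable)
qed

lemma smooth_on_imp_continuous_on: "smooth_on d U f \<Longrightarrow> continuous_on U f"
  unfolding smooth_on_def by (metis empty_subsetI foldr.simps(1) id_apply list.set(1))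

lemma partial_deriv_eqI:
  "((\<lambda>t. f (u(i := t))) has_real_derivative D) (at (u i)) \<Longrightarrow> partial_deriv i f u = D"
  unfolding partial_deriv_def by (rule DERIV_imp_deriv)

lemma smooth_on_subset: "smooth_on d U f \<Longrightarrow> V \<subseteq> U \<Longrightarrow> smooth_on d V f"
  unfolding smooth_on_def by (meson continuous_on_subset subsetD)

lemma Cn_0_compose:
  assumes "Cn 0 d U f" "\<And>u. u \<in> U \<Longrightarrow> (h has_real_derivative h' (f u)) (at (f u))"
  shows "Cn 0 d U (\<lambda>u. h (f u))"
  unfolding Cn_0
proof (intro conjI ballI allI impI)
  have "continuous_on (f ` U) h"
    using assms(2) by (auto intro!: DERIV_isCont continuous_at_imp_continuous_on)
  then show "continuous_on U (\<lambda>u. h (f u))"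
    using assms(1) unfolding Cn_0 by (metis continuous_on_compose2 order_refl)
next
  fix u i assume "u \<in> U" "i < d"
  then have "(\<lambda>t. f (u(i := t))) differentiable at (u i)"
    using assms(1) unfolding Cn_0 by blast
  then obtain D where "((\<lambda>t. f (u(i := t))) has_real_derivative D) (at (u i))"
    using real_differentiableE by blast
  then have "((\<lambda>t. h (f (u(i := t)))) has_real_derivative h' (f u) * D) (at (u i))"
    using assms(2)[OF \<open>u \<in> U\<close>] by (intro DERIV_chain2[of h]) auto
  then show "(\<lambda>t. h (f (u(i := t)))) differentiable at (u i)"
    using real_differentiable_def by blast
qed

context
  fixes d and U :: "(nat \<Rightarrow> real) set"
  assumes U: "openin (top_of_set (Rspace d)) U"
begin

text \<open>Induction step for composing with a function of one variable. The derivative is only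
  asked to satisfy \<open>Cn n\<close> after composition with \<open>f\<close>; when
  \<open>h'\<close> is built from \<open>h\<close> itself, this is the induction hypothesis.\<close>

lemma Cn_Suc_compose:
  assumes f: "Cn (Suc n) d U f"
    and h: "\<And>u. u \<in> U \<Longrightarrow> (h has_real_derivative h' (f u)) (at (f u))"
    and h': "Cn n d U (\<lambda>u. h' (f u))"
  shows "Cn (Suc n) d U (\<lambda>u. h (f u))"
  unfolding Cn_Suc
proof (intro conjI allI impI)
  have f0: "Cn 0 d U f" using f unfolding Cn_Suc by blast
  then show "Cn 0 d U (\<lambda>u. h (f u))" using h by (rule Cn_0_compose)
  fix i assume i: "i < d"
  show "Cn n d U (partial_deriv i (\<lambda>u. h (f u)))"
  proof (rule Cn_cong[OF U])
    show "Cn n d U (\<lambda>u. h' (f u) * partial_deriv i f u)"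
      using f i h' unfolding Cn_Suc by (intro Cn_mult[OF U]) auto
    fix u assume u: "u \<in> U"
    have "(\<lambda>t. f (u(i := t))) differentiable at (u i)"
      using f0 u i unfolding Cn_0 by blast
    then have "((\<lambda>t. f (u(i := t))) has_real_derivative partial_deriv i f u) (at (u i))"
      unfolding partial_deriv_def by (simp add: DERIV_deriv_iff_real_differentiable)
    then have "((\<lambda>t. h (f (u(i := t)))) has_real_derivative h' (f u) * partial_deriv i f u) (at (u i))"
      using h[OF u] by (intro DERIV_chain2[of h]) auto
    then show "partial_deriv i (\<lambda>u. h (f u)) u = h' (f u) * partial_deriv i f u"
      by (rule partial_deriv_eqI)
  qed
qed

lemma smooth_on_cong:
  assumes "\<And>u. u \<in> U \<Longrightarrow> f u = g u" "smooth_on d U g"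
  shows "smooth_on d U f"
  using assms(2) Cn_cong[OF U, of f g] assms(1) unfolding smooth_on_iff_Cn by blast

lemma smooth_on_const: "smooth_on d U (\<lambda>u. c)"
  using Cn_const[OF U] unfolding smooth_on_iff_Cn by blast

lemma smooth_on_add: "smooth_on d U f \<Longrightarrow> smooth_on d U g \<Longrightarrow> smooth_on d U (\<lambda>u. f u + g u)"
  using Cn_add[OF U] unfolding smooth_on_iff_Cn by blast

lemma smooth_on_diff: "smooth_on d U f \<Longrightarrow> smooth_on d U g \<Longrightarrow> smooth_on d U (\<lambda>u. f u - g u)"
  using smooth_on_add[of f "\<lambda>u. (-1) * g u"] smooth_on_mult[OF U smooth_on_const, of g "-1"]
  by simp

lemma smooth_on_power: "smooth_on d U f \<Longrightarrow> smooth_on d U (\<lambda>u. f u ^ n)"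
  by (induction n) (auto intro: smooth_on_const smooth_on_mult[OF U])

lemma smooth_on_coord: "smooth_on d U (\<lambda>u. u k)"
proof -
  have 0: "Cn 0 d U (\<lambda>u. u k)"
    unfolding Cn_0
  proof (intro conjI ballI allI impI)
    show "continuous_on U (\<lambda>u. u k)"
      by (rule continuous_on_product_then_coordinatewise) (rule continuous_on_id)
    show "(\<lambda>t. (u(i := t)) k) differentiable at (u i)" for u :: "nat \<Rightarrow> real" and i
      by (cases "i = k") auto
  qed
  have "partial_deriv i (\<lambda>u. u k) = (\<lambda>u. if i = k then 1 else 0)" for i
    by (auto simp: fun_eq_iff intro!: partial_deriv_eqI derivative_eq_intros)
  then have "Cn (Suc n) d U (\<lambda>u. u k)" for n
    using 0 Cn_const[OF U] unfolding Cn_Suc by auto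
  then show ?thesis unfolding smooth_on_iff_Cn using Cn_mono[OF U] by blast
qed

lemma smooth_on_inverse:
  assumes "smooth_on d U f" "\<And>u. u \<in> U \<Longrightarrow> f u \<noteq> 0"
  shows "smooth_on d U (\<lambda>u. inverse (f u))"
  unfolding smooth_on_iff_Cn
proof
  fix n
  have f: "Cn n d U f" for n using assms(1) unfolding smooth_on_iff_Cn by blast
  \<comment> \<open>Written as a product of values of \<open>inverse\<close>, the derivative falls
    under \<open>Cn_mult\<close> and the induction hypothesis.\<close>
  have D: "u \<in> U \<Longrightarrow> (inverse has_real_derivative - 1 * (inverse (f u) * inverse (f u))) (at (f u))" for u
    using assms(2) by (auto intro!: derivative_eq_intros)
  show "Cn n d U (\<lambda>u. inverse (f u))"
  proof (induction n)
    case 0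
    show ?case by (rule Cn_0_compose[OF f, of _ "\<lambda>x. -1 * (inverse x * inverse x)"]) (rule D)
  next
    case (Suc n)
    show ?case
      by (rule Cn_Suc_compose[OF f, of _ "\<lambda>x. -1 * (inverse x * inverse x)"])
        (intro D Suc Cn_mult[OF U] Cn_const[OF U] | assumption)+
  qed
qed

lemma smooth_on_divide:
  assumes "smooth_on d U f" "smooth_on d U g" "\<And>u. u \<in> U \<Longrightarrow> g u \<noteq> 0"
  shows "smooth_on d U (\<lambda>u. f u / g u)"
  unfolding divide_inverse by (intro smooth_on_mult[OF U] smooth_on_inverse assms)

lemma smooth_on_sqrt:
  assumes "smooth_on d U f" "\<And>u. u \<in> U \<Longrightarrow> f u > 0"
  shows "smooth_on d U (\<lambda>u. sqrt (f u))"
  unfolding smooth_on_iff_Cn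
proof
  fix n
  have f: "Cn n d U f" and i: "Cn n d U (\<lambda>u. inverse (f u))" for n
    using assms(1) smooth_on_inverse[OF assms(1)] assms(2) unfolding smooth_on_iff_Cn by fastforce+
  \<comment> \<open>1/(2 sqrt x) is rewritten as (1/x) (sqrt x) / 2: \<open>sqrt\<close> occurs only
    as a factor, covered by the induction hypothesis.\<close>
  have D: "u \<in> U \<Longrightarrow> (sqrt has_real_derivative inverse (f u) * (sqrt (f u) * (1/2))) (at (f u))" for u
  proof (rule DERIV_cong[OF DERIV_real_sqrt])
    assume "u \<in> U"
    then show *: "0 < f u" by (rule assms(2))
    then have "inverse (f u) = inverse (sqrt (f u)) * inverse (sqrt (f u))"
      by (metis inverse_mult_distrib less_imp_le real_sqrt_mult_self abs_of_pos)
    then show "inverse (sqrt (f u)) / 2 = inverse (f u) * (sqrt (f u) * (1/2))"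
      using * by simp
  qed
  show "Cn n d U (\<lambda>u. sqrt (f u))"
  proof (induction n)
    case 0
    show ?case by (rule Cn_0_compose[OF f, of _ "\<lambda>x. inverse x * (sqrt x * (1/2))"]) (rule D)
  next
    case (Suc n)
    show ?case
      by (rule Cn_Suc_compose[OF f, of _ "\<lambda>x. inverse x * (sqrt x * (1/2))"])
        (intro D Suc Cn_mult[OF U] Cn_const[OF U] i | assumption)+
  qed
qed

lemma smooth_on_arctan:
  assumes "smooth_on d U f"
  shows "smooth_on d U (\<lambda>u. arctan (f u))"
  unfolding smooth_on_iff_Cn
proof
  fix n
  have f: "Cn n d U f" for n
    using assms(1) unfolding smooth_on_iff_Cn by fastforce+
  have "smooth_on d U (\<lambda>u. inverse (1 + (f u)\<^sup>2))"
    by (intro smooth_on_inverse smooth_on_add smooth_on_const smooth_on_power assms)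
      (smt (verit) zero_le_power2)
  then have i: "Cn n d U (\<lambda>u. inverse (1 + (f u)\<^sup>2))" for n
    unfolding smooth_on_iff_Cn by blast
  show "Cn n d U (\<lambda>u. arctan (f u))"
  proof (cases n)
    case 0
    show ?thesis
      unfolding 0 by (rule Cn_0_compose[OF f, of _ "\<lambda>x. inverse (1 + x\<^sup>2)"]) (rule DERIV_arctan)
  next
    case (Suc n)
    show ?thesis unfolding Suc
      by (rule Cn_Suc_compose[OF f, of _ "\<lambda>x. inverse (1 + x\<^sup>2)"]) (auto intro!: DERIV_arctan i)
  qed
qed

text \<open>Both at once, since each is up to sign the derivative of the other.\<close>

lemma smooth_on_sin_cos:
  assumes "smooth_on d U f"
  shows "smooth_on d U (\<lambda>u. sin (f u))" "smooth_on d U (\<lambda>u. cos (f u))"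
proof -
  have f: "Cn n d U f" for n
    using assms(1) unfolding smooth_on_iff_Cn by fastforce+
  have "Cn n d U (\<lambda>u. sin (f u)) \<and> Cn n d U (\<lambda>u. cos (f u))" for n
  proof (induction n)
    case 0
    show ?case
      by (intro conjI Cn_0_compose[OF f, of sin cos] Cn_0_compose[OF f, of cos "\<lambda>x. -1 * sin x"])
        (auto intro!: derivative_eq_intros)
  next
    case (Suc n)
    show ?case
      by (intro conjI Cn_Suc_compose[OF f, of sin cos] Cn_Suc_compose[OF f, of cos "\<lambda>x. -1 * sin x"])
        (use Suc Cn_mult[OF U Cn_const[OF U, of n "-1"], of "\<lambda>u. sin (f u)"]
          in \<open>auto intro!: derivative_eq_intros\<close>)
  qed
  then show "smooth_on d U (\<lambda>u. sin (f u))" "smooth_on d U (\<lambda>u. cos (f u))"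
    unfolding smooth_on_iff_Cn by blast+
qed

text \<open>Relatively open sets containing \<open>u\<close> induce the same filter at
  \<open>u\<close>, so continuity of iterated derivatives is a local matter. This serves charts of
  the cylinder, on which a smooth angle exists only piecewise.\<close>

lemma smooth_on_local:
  assumes loc: "\<And>u. u \<in> U \<Longrightarrow> \<exists>V. u \<in> V \<and> openin (top_of_set (Rspace d)) V \<and> smooth_on d V f"
  shows "smooth_on d U f"
  unfolding smooth_on_def
proof (intro allI impI conjI ballI)
  fix js :: "nat list" assume js: "set js \<subseteq> {..<d}"
  show "continuous_on U (foldr partial_deriv js f)"
    unfolding continuous_on_eq_continuous_within
  proof
    fix u assume "u \<in> U"
    then obtain V where V: "u \<in> V" "openin (top_of_set (Rspace d)) V" "smooth_on d V f"
      using loc by blast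
    obtain W W' where W: "open W" "V = Rspace d \<inter> W" "open W'" "U = Rspace d \<inter> W'"
      using V(2) U by (auto simp: openin_open)
    have "continuous (at u within V) (foldr partial_deriv js f)"
      using V js unfolding smooth_on_def continuous_on_eq_continuous_within by blast
    moreover have "at u within V = at u within U"
      by (rule at_within_nhd[of u "W \<inter> W'"]) (use W V \<open>u \<in> U\<close> in auto)
    ultimately show "continuous (at u within U) (foldr partial_deriv js f)" by simp
  qed
  show "(\<lambda>t. foldr partial_deriv js f (u(i := t))) differentiable at (u i)" if "u \<in> U" "i < d" for u i
    using loc[OF \<open>u \<in> U\<close>] js \<open>i < d\<close> unfolding smooth_on_def by blast
qed

end

section \<open>Symmetry of second derivatives\<close>

lemma continuous_fun_upd2:
  "continuous_on UNIV (\<lambda>(s :: real, t :: real). (u :: nat \<Rightarrow> real)(i := s, j := t))"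
proof (rule continuous_on_coordinatewise_then_product)
  show "continuous_on UNIV (\<lambda>x. (case x of (s, t) \<Rightarrow> u(i := s, j := t)) k)" for k
    by (cases "k = j"; cases "k = i") (auto intro!: continuous_intros simp: case_prod_unfold)
qed

lemma fun_upd_in_Rspace: "u \<in> Rspace d \<Longrightarrow> i < d \<Longrightarrow> u(i := t) \<in> Rspace d"
  unfolding Rspace_def by (auto simp: PiE_def extensional_def)

text \<open>The second difference over a small square equals the mixed derivative at an interior point,
  whatever the order of differentiation.\<close>

lemma second_difference_mean_value:
  assumes sm: "smooth_on d U f" and ij: "i < d" "j < d" "i \<noteq> j" and h: "0 < h"
    and sq: "\<And>s t. s \<in> {u i..u i + h} \<Longrightarrow> t \<in> {u j..u j + h} \<Longrightarrow> u(i := s, j := t) \<in> U"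
    and U: "openin (top_of_set (Rspace d)) U"
  shows "\<exists>s\<in>{u i..u i + h}. \<exists>t\<in>{u j..u j + h}.
    f (u(i := u i + h, j := u j + h)) - f (u(i := u i + h, j := u j))
      - f (u(i := u i, j := u j + h)) + f (u(i := u i, j := u j))
    = h\<^sup>2 * partial_deriv j (partial_deriv i f) (u(i := s, j := t))"
proof -
  define \<phi> where "\<phi> s = f (u(i := s, j := u j + h)) - f (u(i := s, j := u j))" for s
  have D: "((\<lambda>s. f (u(i := s, j := t))) has_real_derivative partial_deriv i f (u(i := s, j := t))) (at s)"
    if "s \<in> {u i..u i + h}" "t \<in> {u j..u j + h}" for s t
    using smooth_on_DERIV[OF sm sq[OF that] ij(1)] ij(3) by (simp add: fun_upd_twist)
  have "(\<phi> has_real_derivative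
      partial_deriv i f (u(i := s, j := u j + h)) - partial_deriv i f (u(i := s, j := u j))) (at s)"
    if "s \<in> {u i..u i + h}" for s
    unfolding \<phi>_def using that h by (intro derivative_intros D) auto
  then obtain s where s: "u i < s" "s < u i + h"
    "\<phi> (u i + h) - \<phi> (u i) = (u i + h - u i) *
      (partial_deriv i f (u(i := s, j := u j + h)) - partial_deriv i f (u(i := s, j := u j)))"
    using MVT2[of "u i" "u i + h" \<phi> "\<lambda>s. partial_deriv i f (u(i := s, j := u j + h)) -
      partial_deriv i f (u(i := s, j := u j))"] h by auto
  have D2: "((\<lambda>t. partial_deriv i f (u(i := s, j := t))) has_real_derivative
       partial_deriv j (partial_deriv i f) (u(i := s, j := t))) (at t)" if "t \<in> {u j..u j + h}" for t
    using smooth_on_DERIV[OF smooth_on_partial_deriv[OF U sm ij(1)] sq[of s t] ij(2)] s that by auto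
  obtain t where t: "u j < t" "t < u j + h"
    "partial_deriv i f (u(i := s, j := u j + h)) - partial_deriv i f (u(i := s, j := u j)) =
      (u j + h - u j) * partial_deriv j (partial_deriv i f) (u(i := s, j := t))"
    using MVT2[of "u j" "u j + h" "\<lambda>t. partial_deriv i f (u(i := s, j := t))", OF _ D2] h by auto
  show ?thesis
    using s t by (intro bexI[of _ s] bexI[of _ t]) (auto simp: \<phi>_def power2_eq_square algebra_simps)
qed

text \<open>The second difference over a square is symmetric in its two directions. The mean value
  form therefore gives equal values of the two mixed derivatives at two points of an arbitrarily
  small square, and continuity moves both points to \<open>u\<close>.\<close>

lemma partial_deriv_commute:
  assumes U: "openin (top_of_set (Rspace d)) U" and sm: "smooth_on d U f"
    and u: "u \<in> U" and ij: "i < d" "j < d"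
  shows "partial_deriv i (partial_deriv j f) u = partial_deriv j (partial_deriv i f) u"
proof (cases "i = j")
  case False
  let ?A = "partial_deriv i (partial_deriv j f)" and ?B = "partial_deriv j (partial_deriv i f)"
  have cont: "continuous_on U ?A" "continuous_on U ?B"
    using smooth_on_partial_deriv[OF U smooth_on_partial_deriv[OF U sm]] ij
    by (auto intro: smooth_on_imp_continuous_on)
  obtain W where W: "open W" "U = Rspace d \<inter> W" using U by (auto simp: openin_open)
  have "\<bar>?A u - ?B u\<bar> \<le> e" if e: "e > 0" for e
  proof -
    have "openin (top_of_set U) (U \<inter> ?A -` {?A u - e/2<..<?A u + e/2})"
      "openin (top_of_set U) (U \<inter> ?B -` {?B u - e/2<..<?B u + e/2})"
      using cont by (auto intro: continuous_openin_preimage_gen)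
    then obtain W1 W2 where W12: "open W1" "U \<inter> ?A -` {?A u - e/2<..<?A u + e/2} = U \<inter> W1"
      "open W2" "U \<inter> ?B -` {?B u - e/2<..<?B u + e/2} = U \<inter> W2"
      by (auto simp: openin_open)
    let ?W = "W \<inter> W1 \<inter> W2"
    have "open ((\<lambda>(s, t). u(i := s, j := t)) -` ?W)"
      by (rule open_vimage[OF _ continuous_fun_upd2]) (use W W12 in auto)
    moreover have "(u i, u j) \<in> (\<lambda>(s, t). u(i := s, j := t)) -` ?W"
      using W W12 u e by auto
    ultimately obtain S T where ST: "open S" "open T" "u i \<in> S" "u j \<in> T"
      "S \<times> T \<subseteq> (\<lambda>(s, t). u(i := s, j := t)) -` ?W"
      by (rule open_prod_elim[of "(\<lambda>(s, t). u(i := s, j := t)) -` ?W" "(u i, u j)"])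
        (blast dest: mem_Sigma_iff[THEN iffD1])
    obtain h1 h2 where h: "h1 > 0" "cball (u i) h1 \<subseteq> S" "h2 > 0" "cball (u j) h2 \<subseteq> T"
      using ST by (meson open_contains_cball)
    let ?h = "min h1 h2"
    have inW: "u(i := s, j := t) \<in> ?W" if "s \<in> {u i..u i + ?h}" "t \<in> {u j..u j + ?h}" for s t
    proof -
      have "s \<in> cball (u i) h1" "t \<in> cball (u j) h2" using that by (auto simp: dist_real_def)
      then have "(s, t) \<in> S \<times> T" using h by blast
      from subsetD[OF ST(5) this] show ?thesis by simp
    qed
    have inU: "u(i := s, j := t) \<in> U" if "s \<in> {u i..u i + ?h}" "t \<in> {u j..u j + ?h}" for s t
      using inW[OF that] W u ij by (auto simp: fun_upd_in_Rspace)
    have "?h > 0" using h by simp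
    obtain s t where st: "s \<in> {u i..u i + ?h}" "t \<in> {u j..u j + ?h}"
      "f (u(i := u i + ?h, j := u j + ?h)) - f (u(i := u i + ?h, j := u j))
        - f (u(i := u i, j := u j + ?h)) + f (u(i := u i, j := u j))
      = ?h\<^sup>2 * ?B (u(i := s, j := t))"
      using second_difference_mean_value[OF sm ij False \<open>?h > 0\<close> inU U] by blast
    have inU': "u(j := t, i := s) \<in> U" if "t \<in> {u j..u j + ?h}" "s \<in> {u i..u i + ?h}" for s t
      using inU[OF that(2,1)] False by (metis fun_upd_twist)
    obtain t' s' where st': "s' \<in> {u i..u i + ?h}" "t' \<in> {u j..u j + ?h}"
      "f (u(j := u j + ?h, i := u i + ?h)) - f (u(j := u j + ?h, i := u i))
        - f (u(j := u j, i := u i + ?h)) + f (u(j := u j, i := u i))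
      = ?h\<^sup>2 * ?A (u(j := t', i := s'))"
      using second_difference_mean_value[OF sm ij(2,1) False[symmetric] \<open>?h > 0\<close> inU' U] by blast
    have "?h\<^sup>2 * ?B (u(i := s, j := t)) = ?h\<^sup>2 * ?A (u(i := s', j := t'))"
    proof -
      have 1: "u(j := x, i := y) = u(i := y, j := x)" for x y
        using False by (rule fun_upd_twist[symmetric])
      have 2: "u(i := x, j := u j) = u(i := x)" for x
        using False by (simp add: fun_eq_iff)
      show ?thesis using st(3) st'(3) unfolding 1 2 fun_upd_triv by linarith
    qed
    then have "?B (u(i := s, j := t)) = ?A (u(i := s', j := t'))" using \<open>?h > 0\<close> by simp
    moreover have "?B (u(i := s, j := t)) \<in> {?B u - e/2<..<?B u + e/2}"
      using inU[OF st(1,2)] inW[OF st(1,2)] W12 by blast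
    moreover have "?A (u(i := s', j := t')) \<in> {?A u - e/2<..<?A u + e/2}"
      using inU[OF st'(1,2)] inW[OF st'(1,2)] W12 by blast
    ultimately show ?thesis by auto
  qed
  then have "\<bar>?A u - ?B u\<bar> \<le> 0" by (rule field_le_epsilon[of _ 0, simplified]) 
  then show ?thesis by simp
qed simp

section \<open>Lebesgue measure on coordinate space\<close>

interpretation lborel_prod: product_sigma_finite "\<lambda>_::nat. lborel :: real measure"
  by standard

lemma space_Rmeas [simp]: "space (Rmeas d) = Rspace d"
  by (simp add: Rmeas_def Rspace_def space_PiM)

lemma measurable_Rmeas_component: "(\<lambda>u. u i) \<in> borel_measurable (Rmeas d)"
proof (cases "i < d")
  case True
  then have "(\<lambda>u. u i) \<in> measurable (Rmeas d) (lborel :: real measure)"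
    unfolding Rmeas_def by (intro measurable_component_singleton) simp
  then show ?thesis by simp
next
  case False
  \<comment> \<open>Outside the index range every point of the space has the value
    \<open>undefined\<close>.\<close>
  have "(\<lambda>u. u i) \<in> borel_measurable (Rmeas d) \<longleftrightarrow> (\<lambda>u. undefined :: real) \<in> borel_measurable (Rmeas d)"
    by (rule measurable_cong) (use False in \<open>auto simp: Rspace_def PiE_def extensional_def\<close>)
  then show ?thesis by simp
qed

lemma measurable_ident_Rmeas: "(\<lambda>u. u) \<in> borel_measurable (Rmeas d)"
  by (rule measurable_coordinatewise_then_product) (rule measurable_Rmeas_component)

lemma measurable_into_Rmeas:
  assumes "\<And>i. i < d \<Longrightarrow> (\<lambda>x. f x i) \<in> borel_measurable N" "\<And>x. x \<in> space N \<Longrightarrow> f x \<in> Rspace d"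
  shows "f \<in> measurable N (Rmeas d)"
  unfolding Rmeas_def
  by (rule measurable_PiM_single'[of "{..<d}" "\<lambda>i x. f x i"])
    (use assms in \<open>auto simp: Rspace_def\<close>)

lemma openin_imp_sets_Rmeas:
  assumes "openin (top_of_set (Rspace d)) U"
  shows "U \<in> sets (Rmeas d)"
proof -
  obtain W where W: "open W" "U = Rspace d \<inter> W" using assms by (auto simp: openin_open)
  have "(\<lambda>u. u) -` W \<inter> space (Rmeas d) \<in> sets (Rmeas d)"
    by (rule measurable_sets[OF measurable_ident_Rmeas]) (use W in auto)
  then show ?thesis using W by (simp add: Int_commute)
qed

lemma continuous_on_imp_measurable_Rmeas:
  fixes f :: "(nat \<Rightarrow> real) \<Rightarrow> 'a::topological_space"
  assumes "continuous_on U f" "U \<subseteq> Rspace d"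
  shows "f \<in> borel_measurable (restrict_space (Rmeas d) U)"
proof -
  have "f \<in> borel_measurable (restrict_space borel U)"
    by (rule borel_measurable_continuous_on_restrict[OF assms(1)])
  moreover have "(\<lambda>u. u) \<in> measurable (restrict_space (Rmeas d) U) (restrict_space borel U)"
    by (rule measurable_restrict_space3[OF measurable_ident_Rmeas]) auto
  ultimately show ?thesis using measurable_compose by blast
qed

text \<open>The Leibniz formula exposes the determinant as a polynomial in the entries. Continuity,
  size estimates and the comparison with determinants over \<open>real^'n\<close> all go through
  it.\<close>

lemma det_mat_eq_sum:
  "Determinant.det (Matrix.mat d d (\<lambda>(i, j). f i j)) =
    (\<Sum>p | p permutes {0..<d}. of_int (sign p) * (\<Prod>i = 0..<d. f i (p i)))"
proof -
  have "p i < d" if "p permutes {0..<d}" "i < d" for p i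
    using permutes_in_image[of p "{0..<d}" i] that by auto
  then show ?thesis by (subst det_def'[of _ d]) (auto intro!: sum.cong prod.cong)
qed

subsection \<open>Comparison with the standard Euclidean space\<close>

text \<open>The change of variables formula is stated for \<open>real^'n\<close>. A bijection
  \<open>b\<close> from \<open>'n\<close> onto the indices below \<open>d\<close> carries it over to
  \<open>Rspace d\<close>.\<close>

definition vec_of :: "('n::finite \<Rightarrow> nat) \<Rightarrow> (nat \<Rightarrow> real) \<Rightarrow> real^'n"
  where "vec_of b u = (\<chi> i. u (b i))"

definition fun_of :: "nat \<Rightarrow> ('n::finite \<Rightarrow> nat) \<Rightarrow> real^'n \<Rightarrow> nat \<Rightarrow> real"
  where "fun_of d b x = (\<lambda>k. if k < d then vec_nth x (inv_into UNIV b k) else undefined)"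

context
  fixes b :: "'n::{finite,wellorder} \<Rightarrow> nat" and d :: nat
  assumes b: "bij_betw b UNIV {..<d}"
begin

lemma inj_b: "inj b" using b by (auto simp: bij_betw_def)

lemma b_less: "b i < d" using b by (auto simp: bij_betw_def)

lemma b_inv: "k < d \<Longrightarrow> b (inv_into UNIV b k) = k" using b by (auto simp: bij_betw_def intro!: f_inv_into_f)

lemma fun_of_in_Rspace: "fun_of d b x \<in> Rspace d"
  by (simp add: Rspace_def fun_of_def PiE_def extensional_def)

lemma vec_of_fun_of: "vec_of b (fun_of d b x) = x"
  by (simp add: vec_of_def fun_of_def vec_eq_iff b_less inj_b)

lemma fun_of_vec_of: "u \<in> Rspace d \<Longrightarrow> fun_of d b (vec_of b u) = u"
  by (auto simp: vec_of_def fun_of_def fun_eq_iff b_inv Rspace_def PiE_def extensional_def)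

lemma measurable_vec_of: "vec_of b \<in> measurable (Rmeas d) borel"
  by (subst borel_measurable_euclidean_space)
    (auto simp: vec_of_def Basis_vec_def inner_axis intro: measurable_Rmeas_component)

lemma continuous_fun_of: "continuous_on UNIV (fun_of d b)"
proof (rule continuous_on_coordinatewise_then_product)
  show "continuous_on UNIV (\<lambda>x. fun_of d b x k)" for k
    by (cases "k < d") (auto simp: fun_of_def intro!: continuous_intros)
qed

lemma measurable_fun_of: "fun_of d b \<in> measurable borel (Rmeas d)"
proof (rule measurable_into_Rmeas)
  show "(\<lambda>x. fun_of d b x i) \<in> borel_measurable borel" for i
    by (cases "i < d") (auto simp: fun_of_def)
qed (rule fun_of_in_Rspace)

text \<open>Preimages of boxes are products of intervals, and boxes determine the measure.\<close>

lemma lborel_eq_distr_Rmeas: "lborel = distr (Rmeas d) borel (vec_of b)"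
proof (rule lborel_eqI)
  fix l u :: "real^'n::_"
  assume le: "\<And>x. x \<in> Basis \<Longrightarrow> l \<bullet> x \<le> u \<bullet> x"
  have le': "vec_nth l i \<le> vec_nth u i" for i
    using le[of "axis i 1"] by (auto simp: Basis_vec_def inner_axis)
  have "emeasure (distr (Rmeas d) borel (vec_of b)) (box l u) =
      emeasure (Rmeas d) (vec_of b -` box l u \<inter> space (Rmeas d))"
    by (rule emeasure_distr[OF measurable_vec_of]) simp
  also have "vec_of b -` box l u \<inter> space (Rmeas d) =
      (\<Pi>\<^sub>E k\<in>{..<d}. {vec_nth l (inv_into UNIV b k)<..<vec_nth u (inv_into UNIV b k)})"
  proof (intro equalityI subsetI)
    fix v assume v: "v \<in> vec_of b -` box l u \<inter> space (Rmeas d)"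
    then have *: "vec_nth l i < v (b i)" "v (b i) < vec_nth u i" for i
      by (auto simp: mem_box_cart vec_of_def)
    show "v \<in> (\<Pi>\<^sub>E k\<in>{..<d}. {vec_nth l (inv_into UNIV b k)<..<vec_nth u (inv_into UNIV b k)})"
    proof (rule PiE_I)
      fix k assume "k \<in> {..<d}"
      then show "v k \<in> {vec_nth l (inv_into UNIV b k)<..<vec_nth u (inv_into UNIV b k)}"
        using *[of "inv_into UNIV b k"] by (simp add: b_inv)
    next
      fix k assume "k \<notin> {..<d}"
      then show "v k = undefined" using v by (auto simp: Rspace_def PiE_iff extensional_def)
    qed
  next
    fix v assume v: "v \<in> (\<Pi>\<^sub>E k\<in>{..<d}. {vec_nth l (inv_into UNIV b k)<..<vec_nth u (inv_into UNIV b k)})"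
    have "vec_nth l i < v (b i) \<and> v (b i) < vec_nth u i" for i
      using v b_less[of i] inj_b by (force simp: PiE_iff)
    then show "v \<in> vec_of b -` box l u \<inter> space (Rmeas d)"
      using v by (auto simp: mem_box_cart vec_of_def Rspace_def PiE_iff)
  qed
  also have "emeasure (Rmeas d) \<dots> =
      (\<Prod>k<d. emeasure lborel {vec_nth l (inv_into UNIV b k)<..<vec_nth u (inv_into UNIV b k)})"
    unfolding Rmeas_def by (rule lborel_prod.emeasure_PiM) auto
  also have "\<dots> = (\<Prod>k<d. ennreal (vec_nth u (inv_into UNIV b k) - vec_nth l (inv_into UNIV b k)))"
    using le' by (intro prod.cong) auto
  also have "\<dots> = (\<Prod>i\<in>UNIV. ennreal (vec_nth u i - vec_nth l i))"
    using inj_b by (subst prod.reindex_bij_betw[OF b, symmetric]) simp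
  also have "\<dots> = ennreal (\<Prod>i\<in>UNIV. vec_nth u i - vec_nth l i)"
    using le' by (intro prod_ennreal) (simp add: )
  also have "(\<Prod>i\<in>UNIV. vec_nth u i - vec_nth l i) = (\<Prod>x\<in>Basis. (u - l) \<bullet> x)"
  proof -
    have B: "(Basis :: (real^'n::_) set) = (\<lambda>i. axis i 1) ` UNIV"
      by (auto simp: Basis_vec_def)
    have "inj (\<lambda>i. axis i 1 :: real^'n::_)"
      by (auto simp: inj_on_def axis_eq_axis)
    then show ?thesis
      unfolding B by (subst prod.reindex) (simp_all add: inner_axis)
  qed
  finally show "emeasure (distr (Rmeas d) borel (vec_of b)) (box l u) =
    ennreal (\<Prod>x\<in>Basis. (u - l) \<bullet> x)" .
qed simp

text \<open>Conjugation with \<open>b\<close> turns permutations of \<open>'n\<close> into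
  permutations of the indices and preserves both the signs and the products in the Leibniz
  formula.\<close>

lemma det_mat_eq_det_vec:
  "Determinant.det (Matrix.mat d d (\<lambda>(i, j). f i j)) =
    Determinants.det ((\<chi> i j. f (b i) (b j)) :: real^'n::_^'n::_)"
proof -
  have "Determinants.det ((\<chi> i j. f (b i) (b j)) :: real^'n::_^'n::_) =
      (\<Sum>p | p permutes UNIV. of_int (sign p) * (\<Prod>i\<in>UNIV. f (b i) (b (p i))))"
    unfolding Determinants.det_def by simp
  also have "\<dots> = (\<Sum>p | p permutes {0..<d}. of_int (sign p) * (\<Prod>i = 0..<d. f i (p i)))"
  proof (rule sum.reindex_bij_witness)
    have b': "bij_betw (inv_into UNIV b) {0..<d} UNIV" "bij_betw b UNIV {0..<d}"
      using b bij_betw_inv_into[OF b] by (auto simp: lessThan_atLeast0)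
    show "map_permutation {0..<d} (inv_into UNIV b) (map_permutation UNIV b p) = p"
      if "p \<in> {p. p permutes UNIV}" for p
      by (rule map_permutation_compose_inv[OF b'(2)]) (use that inv_into_f_f[OF inj_b] in blast)+
    show "map_permutation UNIV b (map_permutation {0..<d} (inv_into UNIV b) p) = p"
      if "p \<in> {p. p permutes {0..<d}}" for p
      by (rule map_permutation_compose_inv[OF b'(1)]) (use that b_inv in auto)
    show "map_permutation {0..<d} (inv_into UNIV b) p \<in> {p. p permutes UNIV}"
      if "p \<in> {p. p permutes {0..<d}}" for p
      using that b' by (auto intro: map_permutation_permutes)
    show "map_permutation UNIV b p \<in> {p. p permutes {0..<d}}"
      if "p \<in> {p. p permutes UNIV}" for p
      using that b' by (auto intro: map_permutation_permutes)
    fix p :: "'n \<Rightarrow> 'n" assume p: "p \<in> {p. p permutes UNIV}"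
    have "map_permutation UNIV b p (b i) = b (p i)" for i
      using inj_b b_less by (simp add: map_permutation_def restrict_id_def)
    then have "(\<Prod>i = 0..<d. f i (map_permutation UNIV b p i)) = (\<Prod>i\<in>UNIV. f (b i) (b (p i)))"
      by (subst prod.reindex_bij_betw[OF b'(2), symmetric]) simp
    moreover have "sign (map_permutation UNIV b p) = sign p"
      using p inj_b by (intro sign_map_permutation) auto
    ultimately show "of_int (sign (map_permutation UNIV b p)) *
        (\<Prod>i = 0..<d. f i (map_permutation UNIV b p i)) =
        of_int (sign p) * (\<Prod>i\<in>UNIV. f (b i) (b (p i)))"
      by simp
  qed
  also have "\<dots> = Determinant.det (Matrix.mat d d (\<lambda>(i, j). f i j))"
    by (rule det_mat_eq_sum[symmetric])
  finally show ?thesis ..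
qed

lemma fun_of_upd:
  assumes "k < d"
  shows "(fun_of d b y)(k := t) = fun_of d b (\<chi> i. if b i = k then t else vec_nth y i)"
  using assms b_inv by (auto simp: fun_of_def fun_eq_iff)

text \<open>Continuous partial derivatives give a total derivative: move from \<open>x\<close> to
  \<open>y\<close> one coordinate at a time and apply a mean value estimate to each move.\<close>

lemma smooth_on_imp_has_derivative:
  assumes V: "openin (top_of_set (Rspace d)) V" and f: "smooth_on d V f"
    and x: "fun_of d b x \<in> V"
  shows "((\<lambda>x. f (fun_of d b x)) has_derivative
    (\<lambda>h. \<Sum>i\<in>UNIV. vec_nth h i * partial_deriv (b i) f (fun_of d b x))) (at x)"
proof -
  let ?F = "fun_of d b" and ?D = "\<lambda>k. partial_deriv k f"
  obtain W where W: "open W" "V = Rspace d \<inter> W" using V by (auto simp: openin_open)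
  let ?V = "?F -` W"
  have oV: "open ?V" using W(1) continuous_fun_of by (rule open_vimage)
  have inV: "?F y \<in> V \<longleftrightarrow> y \<in> ?V" for y using W fun_of_in_Rspace by auto
  have cont: "continuous_on ?V (\<lambda>y. ?D k (?F y))" if "k < d" for k
    by (rule continuous_on_compose2[OF smooth_on_imp_continuous_on[OF smooth_on_partial_deriv[OF V f that]],
          of ?V ?F])
      (use inV continuous_fun_of in \<open>auto intro: continuous_on_subset\<close>)
  have est: "\<exists>r>0. \<forall>y. norm (y - x) < r \<longrightarrow>
      norm (f (?F y) - f (?F x) - (\<Sum>i\<in>UNIV. vec_nth (y - x) i * ?D (b i) (?F x))) \<le> e * norm (y - x)"
    if e: "e > 0" for e
  proof -
    \<comment> \<open>Each of the \<open>d\<close> moves may contribute \<open>e'\<close>; the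
      summand 1 keeps the denominator positive without a case distinction.\<close>
    define e' where "e' = e / (d + 1)"
    have e': "e' > 0" "e' * d \<le> e" using e by (auto simp: e'_def field_simps)
    have "\<exists>r>0. \<forall>y. norm (y - x) < r \<longrightarrow> y \<in> ?V \<and> \<bar>?D k (?F y) - ?D k (?F x)\<bar> < e'" if k: "k < d" for k
    proof -
      have "isCont (\<lambda>y. ?D k (?F y)) x"
        using cont[OF k] oV x inV by (simp add: continuous_on_eq_continuous_at)
      then obtain r1 where r1: "r1 > 0" "\<And>y. norm (y - x) < r1 \<Longrightarrow> \<bar>?D k (?F y) - ?D k (?F x)\<bar> < e'"
        using e'(1) unfolding continuous_at_eps_delta dist_norm real_norm_def by blast
      obtain r2 where r2: "r2 > 0" "\<And>y. norm (y - x) < r2 \<Longrightarrow> y \<in> ?V"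
        using oV x inV unfolding open_dist dist_norm by blast
      show ?thesis using r1 r2 by (intro exI[of _ "min r1 r2"]) auto
    qed
    then obtain r where r: "\<And>k. k < d \<Longrightarrow> r k > 0"
      "\<And>k y. k < d \<Longrightarrow> norm (y - x) < r k \<Longrightarrow> y \<in> ?V \<and> \<bar>?D k (?F y) - ?D k (?F x)\<bar> < e'"
      by metis
    define R where "R = Min (insert 1 (r ` {..<d}))"
    have R: "R > 0" "\<And>k. k < d \<Longrightarrow> R \<le> r k"
      unfolding R_def using r(1) by (auto intro!: Min_le)
    show ?thesis
    proof (intro exI[of _ R] conjI allI impI R(1))
      fix y assume y: "norm (y - x) < R"
      \<comment> \<open>\<open>z k\<close> has the coordinates of \<open>y\<close> below
        \<open>k\<close> and those of \<open>x\<close> from \<open>k\<close> on.\<close>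
      define z where "z k = (\<chi> i. if b i < k then vec_nth y i else vec_nth x i)" for k
      have z0: "z 0 = x" and zd: "z d = y"
        using b_less by (auto simp: z_def vec_eq_iff)
      have step: "\<bar>f (?F (z (Suc k))) - f (?F (z k)) - vec_nth (y - x) (inv_into UNIV b k) * ?D k (?F x)\<bar>
          \<le> e' * norm (y - x)" if k: "k < d" for k
      proof -
        let ?s = "vec_nth x (inv_into UNIV b k)" and ?t = "vec_nth y (inv_into UNIV b k)"
        let ?S = "closed_segment ?s ?t"
        let ?g = "\<lambda>t. f ((?F (z k))(k := t)) - t * ?D k (?F x)"
        have upd: "(?F (z k))(k := t) = ?F (\<chi> i. if b i = k then t else vec_nth (z k) i)" for t
          by (rule fun_of_upd[OF k])
        have near: "norm ((\<chi> i. if b i = k then t else vec_nth (z k) i) - x) < r k" if "t \<in> ?S" for t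
        proof -
          have "\<bar>t - ?s\<bar> \<le> \<bar>?t - ?s\<bar>"
            using that unfolding closed_segment_eq_real_ivl by (auto split: if_splits)
          then have "norm ((\<chi> i. if b i = k then t else vec_nth (z k) i) - x) \<le> norm (y - x)"
            using inj_b by (intro norm_le_componentwise_cart) (auto simp: z_def)
          then show ?thesis using y R(2)[OF k] by simp
        qed
        have zz: "(\<chi> i. if b i = k then ?t else vec_nth (z k) i) = z (Suc k)"
          "(\<chi> i. if b i = k then ?s else vec_nth (z k) i) = z k"
          using inv_into_f_f[OF inj_b, of _] k by (auto simp: z_def fun_eq_iff less_Suc_eq)
        \<comment> \<open>The derivative of \<open>?g\<close> is the deviation of a partial
          derivative from its value at \<open>x\<close>, which is at most \<open>e'\<close> this
          close to \<open>x\<close>.\<close>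
        have bd: "norm (?g ?t - ?g ?s) \<le> e' * norm (?t - ?s)"
        proof (rule field_differentiable_bound[of ?S])
          fix t assume t: "t \<in> ?S"
          have inVt: "(?F (z k))(k := t) \<in> V" using r(2)[OF k near[OF t]] upd inV by simp
          have "((\<lambda>t. f ((?F (z k))(k := t))) has_real_derivative ?D k ((?F (z k))(k := t))) (at t)"
            using smooth_on_DERIV[OF f inVt k] by simp
          then show "(?g has_real_derivative (?D k ((?F (z k))(k := t)) - ?D k (?F x))) (at t within ?S)"
            by (auto intro!: derivative_eq_intros intro: has_field_derivative_at_within)
          show "norm (?D k ((?F (z k))(k := t)) - ?D k (?F x)) \<le> e'"
            using r(2)[OF k near[OF t]] unfolding upd by simp
        qed auto
        have "?g ?t - ?g ?s = f (?F (z (Suc k))) - f (?F (z k)) - (?t - ?s) * ?D k (?F x)"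
          unfolding upd zz by (simp add: algebra_simps)
        then have "\<bar>f (?F (z (Suc k))) - f (?F (z k)) - (?t - ?s) * ?D k (?F x)\<bar> \<le> e' * \<bar>?t - ?s\<bar>"
          using bd by simp
        also have "\<dots> \<le> e' * norm (y - x)"
          using e'(1) component_le_norm_cart[of "y - x" "inv_into UNIV b k"]
          by (intro mult_left_mono) simp_all
        finally show ?thesis by simp
      qed
      have "f (?F y) - f (?F x) = (\<Sum>k<d. f (?F (z (Suc k))) - f (?F (z k)))"
        by (subst sum_lessThan_telescope) (simp add: z0 zd)
      moreover have "(\<Sum>i\<in>UNIV. vec_nth (y - x) i * ?D (b i) (?F x)) =
          (\<Sum>k<d. vec_nth (y - x) (inv_into UNIV b k) * ?D k (?F x))"
        by (subst sum.reindex_bij_betw[OF b, symmetric]) (simp add: inj_b)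
      ultimately have "norm (f (?F y) - f (?F x) - (\<Sum>i\<in>UNIV. vec_nth (y - x) i * ?D (b i) (?F x))) =
          \<bar>\<Sum>k<d. f (?F (z (Suc k))) - f (?F (z k)) - vec_nth (y - x) (inv_into UNIV b k) * ?D k (?F x)\<bar>"
        by (simp add: sum_subtractf)
      also have "\<dots> \<le> (\<Sum>k<d. e' * norm (y - x))"
        by (rule order_trans[OF sum_abs sum_mono]) (use step in auto)
      also have "\<dots> = (e' * d) * norm (y - x)" by simp
      also have "\<dots> \<le> e * norm (y - x)" using e' by (intro mult_right_mono) auto
      finally show "norm (f (?F y) - f (?F x) - (\<Sum>i\<in>UNIV. vec_nth (y - x) i * ?D (b i) (?F x)))
        \<le> e * norm (y - x)" .
    qed
  qed
  have "bounded_linear (\<lambda>h. \<Sum>i\<in>UNIV. vec_nth h i * ?D (b i) (?F x))"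
    by (auto intro!: bounded_linear_intros bounded_linear_vec_nth)
  then show ?thesis unfolding has_derivative_at_alt using est by blast
qed

subsection \<open>Change of variables\<close>

text \<open>The formula \<open>has_measure_differentiable_image\<close> for Euclidean space, carried
  over by \<open>vec_of\<close> and \<open>fun_of\<close>.\<close>

lemma emeasure_smooth_image:
  assumes V: "openin (top_of_set (Rspace d)) V" and T: "\<And>k. k < d \<Longrightarrow> smooth_on d V (\<lambda>u. T u k)"
    and TR: "\<And>u. u \<in> V \<Longrightarrow> T u \<in> Rspace d" and inj: "inj_on T V"
    and A: "A \<in> sets (Rmeas d)" "A \<subseteq> V" and TA: "T ` A \<in> sets (Rmeas d)"
  shows "emeasure (Rmeas d) (T ` A) =
    (\<integral>\<^sup>+ u \<in> A. ennreal \<bar>Determinant.det (Matrix.mat d d (\<lambda>(i, j). partial_deriv j (\<lambda>u. T u i) u))\<bar> \<partial>Rmeas d)"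
proof -
  let ?F = "fun_of d b" and ?P = "vec_of b"
  define J where "J u = Determinant.det (Matrix.mat d d (\<lambda>(i, j). partial_deriv j (\<lambda>u. T u i) u))" for u
  define S where "S = ?F -` A"
  have S: "S \<in> sets borel" using measurable_sets[OF measurable_fun_of A(1)] by (simp add: S_def)
  define g where "g x = ?P (T (?F x))" for x
  define g' where "g' x = (\<lambda>h. \<chi> i. \<Sum>j\<in>UNIV. vec_nth h j * partial_deriv (b j) (\<lambda>u. T u (b i)) (?F x))" for x
  have der: "(g has_derivative g' x) (at x within S)" if "x \<in> S" for x
  proof -
    have "?F x \<in> V" using that A by (auto simp: S_def)
    then have "((\<lambda>x. T (?F x) (b i)) has_derivative
        (\<lambda>h. \<Sum>j\<in>UNIV. vec_nth h j * partial_deriv (b j) (\<lambda>u. T u (b i)) (?F x))) (at x within S)" for i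
      using smooth_on_imp_has_derivative[OF V T[OF b_less]] has_derivative_at_withinI by blast
    then show ?thesis unfolding g_def g'_def vec_of_def
      by (subst has_derivative_componentwise_within)
        (auto simp: Basis_vec_def inner_axis)
  qed
  have injS: "inj_on g S"
  proof (rule inj_onI)
    fix x y assume xy: "x \<in> S" "y \<in> S" "g x = g y"
    then have "T (?F x) = T (?F y)"
      unfolding g_def using TR A(2) fun_of_vec_of S_def by (metis subsetD vimageE)
    then have "?F x = ?F y" using inj xy A(2) by (auto simp: S_def dest!: inj_onD)
    then show "x = y" using vec_of_fun_of by metis
  qed
  have gS: "g ` S = ?P ` (T ` A)"
  proof -
    have "?F ` S = A"
    proof (intro equalityI subsetI)
      fix u assume "u \<in> A"
      then have "?F (?P u) = u" using sets.sets_into_space[OF A(1)] fun_of_vec_of by auto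
      then show "u \<in> ?F ` S" using \<open>u \<in> A\<close> unfolding S_def by (metis imageI vimageI2)
    qed (auto simp: S_def)
    then show ?thesis unfolding g_def by (metis image_image)
  qed
  have PF: "?P ` B = ?F -` B" if "B \<subseteq> Rspace d" for B
  proof (intro equalityI subsetI)
    fix x assume "x \<in> ?P ` B"
    then show "x \<in> ?F -` B" using that fun_of_vec_of by auto
  next
    fix x assume "x \<in> ?F -` B"
    then show "x \<in> ?P ` B" using vec_of_fun_of[of x] by (metis imageI vimageD)
  qed
  have preim: "?P -` (?P ` B) \<inter> Rspace d = B" if "B \<subseteq> Rspace d" for B
    using that by (auto simp: PF fun_of_vec_of)
  have gSb: "g ` S \<in> sets borel"
    unfolding gS PF[OF sets.sets_into_space[OF TA, simplified]]
    using measurable_sets[OF measurable_fun_of TA] by simp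
  have eq1: "emeasure lborel (g ` S) = emeasure (Rmeas d) (T ` A)"
    using gSb TR A(2) unfolding gS
    by (simp add: lborel_eq_distr_Rmeas emeasure_distr[OF measurable_vec_of]
          preim[OF sets.sets_into_space[OF TA, simplified]])
  have mat: "Determinants.det (matrix (g' x)) = J (?F x)" for x
  proof -
    have "matrix (g' x) = (\<chi> i j. partial_deriv (b j) (\<lambda>u. T u (b i)) (?F x))"
      by (simp add: matrix_def g'_def vec_eq_iff axis_def if_distrib[of "\<lambda>x. x * _"] cong: if_cong)
    then show ?thesis unfolding J_def det_mat_eq_det_vec by simp
  qed
  have contJ: "continuous_on V J"
    unfolding J_def det_mat_eq_sum
  proof (intro continuous_on_sum continuous_on_mult continuous_on_const continuous_on_prod)
    fix p i assume "p \<in> {p. p permutes {0..<d}}" "i \<in> {0..<d}"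
    then have "p i < d" "i < d" using permutes_in_image[of p "{0..<d}" i] by auto
    then show "continuous_on V (\<lambda>u. partial_deriv (p i) (\<lambda>u. T u i) u)"
      using smooth_on_imp_continuous_on[OF smooth_on_partial_deriv[OF V T]] by simp
  qed
  have Vm: "V \<in> sets (Rmeas d)" using V by (rule openin_imp_sets_Rmeas)
  have Jm: "J \<in> borel_measurable (restrict_space (Rmeas d) V)"
    using contJ V by (intro continuous_on_imp_measurable_Rmeas) (auto dest: openin_imp_subset)
  then have Jm': "(\<lambda>u. J u * indicator A u) \<in> borel_measurable (Rmeas d)"
  proof -
    have "(\<lambda>u. J u * indicator V u) \<in> borel_measurable (Rmeas d)"
      using Jm Vm borel_measurable_restrict_space_iff[of V "Rmeas d" J]
      by (simp add: mult.commute[of "indicat_real V _"] sets.Int_space_eq2[OF Vm, simplified])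
    then have "(\<lambda>u. (J u * indicator V u) * indicator A u) \<in> borel_measurable (Rmeas d)"
      using A(1) by measurable
    moreover have "(J u * indicator V u) * indicator A u = J u * indicator A u" for u
      using A(2) by (auto simp: indicator_def)
    ultimately show ?thesis by simp
  qed
  define h where "h x = \<bar>J (?F x)\<bar> * indicator S x" for x
  have hm: "h \<in> borel_measurable borel"
  proof -
    have m: "(\<lambda>x. \<bar>J (?F x) * indicator A (?F x)\<bar>) \<in> borel_measurable borel"
      using measurable_compose[OF measurable_fun_of Jm'] by measurable
    have e: "(\<lambda>x. \<bar>J (?F x) * indicator A (?F x)\<bar>) = h"
      by (auto simp: h_def S_def indicator_def)
    show ?thesis using m unfolding e .
  qed
  have h0: "0 \<le> h x" for x by (simp add: h_def)
  have nn: "(\<integral>\<^sup>+ x. ennreal (h x) \<partial>lborel) = (\<integral>\<^sup>+ u \<in> A. ennreal \<bar>J u\<bar> \<partial>Rmeas d)"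
  proof -
    have "(\<lambda>x. ennreal (h x)) \<in> borel_measurable borel" using hm by measurable
    then have "(\<integral>\<^sup>+ x. ennreal (h x) \<partial>lborel) = (\<integral>\<^sup>+ u. ennreal (h (?P u)) \<partial>Rmeas d)"
      by (subst lborel_eq_distr_Rmeas) (rule nn_integral_distr[OF measurable_vec_of], simp)
    also have "\<dots> = (\<integral>\<^sup>+ u \<in> A. ennreal \<bar>J u\<bar> \<partial>Rmeas d)"
      by (intro nn_integral_cong) (auto simp: h_def S_def fun_of_vec_of indicator_def)
    finally show ?thesis .
  qed
  have key: "g ` S \<in> lmeasurable \<and> measure lebesgue (g ` S) = m \<longleftrightarrow> (h has_integral m) UNIV" for m
  proof -
    have "(\<lambda>x. \<bar>J (?F x)\<bar>) = (\<lambda>x. \<bar>Determinants.det (matrix (g' x))\<bar>)" by (simp add: mat)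
    moreover have "(h has_integral m) UNIV \<longleftrightarrow> ((\<lambda>x. \<bar>J (?F x)\<bar>) has_integral m) S"
    proof -
      have "h = (\<lambda>x. if x \<in> S then \<bar>J (?F x)\<bar> else 0)" by (auto simp: h_def)
      then show ?thesis by (simp only: has_integral_restrict_UNIV)
    qed
    ultimately show ?thesis
      using has_measure_differentiable_image[OF _ der injS, of m] S by simp
  qed
  \<comment> \<open>The equivalence \<open>key\<close> speaks of finite values only. If the integral
    is infinite, a finite measure of the image would by \<open>key\<close> make \<open>h\<close>
    integrable, which is a contradiction.\<close>
  have "emeasure lborel (g ` S) = (\<integral>\<^sup>+ x. ennreal (h x) \<partial>lborel)"
  proof (cases "(\<integral>\<^sup>+ x. ennreal (h x) \<partial>lborel) = \<infinity>")
    case False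
    then obtain r where r: "0 \<le> r" "(\<integral>\<^sup>+ x. ennreal (h x) \<partial>lborel) = ennreal r"
      by (cases "(\<integral>\<^sup>+ x. ennreal (h x) \<partial>lborel)") auto
    then have "(h has_integral r) UNIV"
      using hm h0 by (intro nn_integral_has_integral) auto
    then have *: "g ` S \<in> lmeasurable" "measure lebesgue (g ` S) = r" using key by blast+
    then have "emeasure lebesgue (g ` S) = ennreal r"
      by (simp add: emeasure_eq_measure2 fmeasurableD2)
    then show ?thesis using r(2) gSb by simp
  next
    case True
    have "emeasure lborel (g ` S) = \<infinity>"
    proof (rule ccontr)
      assume "emeasure lborel (g ` S) \<noteq> \<infinity>"
      then have "g ` S \<in> lmeasurable"
        using gSb by (intro fmeasurableI) (auto simp: top.not_eq_extremum)
      then have "(h has_integral measure lebesgue (g ` S)) UNIV" using key by blast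
      then have "(\<integral>\<^sup>+ x. ennreal (h x) \<partial>lborel) = ennreal (measure lebesgue (g ` S))"
        using hm h0 by (intro nn_integral_has_integral_lborel) auto
      then show False using True by simp
    qed
    then show ?thesis using True by simp
  qed
  then show ?thesis unfolding eq1 nn J_def .
qed

lemma nn_integral_smooth_image:
  assumes V: "openin (top_of_set (Rspace d)) V" and T: "\<And>k. k < d \<Longrightarrow> smooth_on d V (\<lambda>u. T u k)"
    and TR: "\<And>u. u \<in> V \<Longrightarrow> T u \<in> Rspace d" and inj: "inj_on T V"
    and A: "A \<in> sets (Rmeas d)" "A \<subseteq> V"
    and TB: "\<And>B. B \<in> sets (Rmeas d) \<Longrightarrow> B \<subseteq> V \<Longrightarrow> T ` B \<in> sets (Rmeas d)"
    and f: "f \<in> borel_measurable (Rmeas d)"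
  shows "(\<integral>\<^sup>+ v \<in> T ` A. f v \<partial>Rmeas d) =
    (\<integral>\<^sup>+ u \<in> A. f (T u) *
      ennreal \<bar>Determinant.det (Matrix.mat d d (\<lambda>(i, j). partial_deriv j (\<lambda>u. T u i) u))\<bar> \<partial>Rmeas d)"
proof -
  define J where "J u = ennreal \<bar>Determinant.det (Matrix.mat d d (\<lambda>(i, j). partial_deriv j (\<lambda>u. T u i) u))\<bar>" for u
  have Tm: "T \<in> measurable (restrict_space (Rmeas d) V) (Rmeas d)"
  proof (rule measurable_into_Rmeas)
    show "(\<lambda>u. T u i) \<in> borel_measurable (restrict_space (Rmeas d) V)" if "i < d" for i
      using smooth_on_imp_continuous_on[OF T[OF that]] V
      by (intro continuous_on_imp_measurable_Rmeas) (auto dest: openin_imp_subset)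
  qed (use TR in \<open>auto simp: space_restrict_space\<close>)
  have TA: "T \<in> measurable (restrict_space (Rmeas d) A) (Rmeas d)"
    by (rule measurable_restrict_mono[OF Tm A(2)])
  have Am: "A \<inter> space (Rmeas d) \<in> sets (Rmeas d)" using A(1) by (rule sets.Int) (rule sets.top)
  have contJ: "J \<in> borel_measurable (restrict_space (Rmeas d) V)"
  proof -
    have "continuous_on V (\<lambda>u. Determinant.det (Matrix.mat d d (\<lambda>(i, j). partial_deriv j (\<lambda>u. T u i) u)))"
      unfolding det_mat_eq_sum
    proof (intro continuous_on_sum continuous_on_mult continuous_on_const continuous_on_prod)
      fix p i assume "p \<in> {p. p permutes {0..<d}}" "i \<in> {0..<d}"
      then have "p i < d" "i < d" using permutes_in_image[of p "{0..<d}" i] by auto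
      then show "continuous_on V (\<lambda>u. partial_deriv (p i) (\<lambda>u. T u i) u)"
        using smooth_on_imp_continuous_on[OF smooth_on_partial_deriv[OF V T]] by simp
    qed
    then have "continuous_on V (\<lambda>u. \<bar>Determinant.det (Matrix.mat d d (\<lambda>(i, j). partial_deriv j (\<lambda>u. T u i) u))\<bar>)"
      by (rule continuous_on_rabs)
    then have "(\<lambda>u. \<bar>Determinant.det (Matrix.mat d d (\<lambda>(i, j). partial_deriv j (\<lambda>u. T u i) u))\<bar>)
        \<in> borel_measurable (restrict_space (Rmeas d) V)"
      using V by (intro continuous_on_imp_measurable_Rmeas) (auto dest: openin_imp_subset)
    then show ?thesis unfolding J_def by measurable
  qed
  have JA: "J \<in> borel_measurable (restrict_space (Rmeas d) A)"
    by (rule measurable_restrict_mono[OF contJ A(2)])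
  define N where "N = distr (density (restrict_space (Rmeas d) A) J) (Rmeas d) T"
  \<comment> \<open>The push-forward of the density |det| on \<open>A\<close> and Lebesgue measure
    restricted to the image of \<open>A\<close> agree on every measurable set, by the formula for
    measures of images. Equality of the measures then covers all integrands.\<close>
  have NE: "N = density (Rmeas d) (indicator (T ` A))"
  proof (rule measure_eqI)
    show "sets N = sets (density (Rmeas d) (indicator (T ` A)))" by (simp add: N_def)
    fix E assume "E \<in> sets N"
    then have E: "E \<in> sets (Rmeas d)" by (simp add: N_def)
    let ?B = "T -` E \<inter> A"
    have B': "?B \<in> sets (restrict_space (Rmeas d) A)"
      using measurable_sets[OF TA E] A(1) sets.sets_into_space[OF A(1)]
      by (simp add: space_restrict_space Int_absorb2)
    then have B: "?B \<in> sets (Rmeas d)"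
      using A(1) by (simp add: sets_restrict_space_iff[OF Am])
    have "emeasure N E = emeasure (density (restrict_space (Rmeas d) A) J) ?B"
      unfolding N_def using TA E sets.sets_into_space[OF A(1)]
      by (subst emeasure_distr) (auto simp: space_restrict_space Int_absorb2)
    also have "\<dots> = (\<integral>\<^sup>+ u. J u * indicator ?B u \<partial>restrict_space (Rmeas d) A)"
      by (rule emeasure_density[OF JA B'])
    also have "\<dots> = (\<integral>\<^sup>+ u. J u * indicator ?B u * indicator A u \<partial>Rmeas d)"
      by (rule nn_integral_restrict_space[OF Am])
    also have "\<dots> = (\<integral>\<^sup>+ u \<in> ?B. J u \<partial>Rmeas d)"
      by (rule nn_integral_cong) (auto simp: indicator_def)
    also have "\<dots> = emeasure (Rmeas d) (T ` ?B)"
      unfolding J_def using A(2) B TB[OF B]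
      by (subst emeasure_smooth_image[OF V T TR inj B]) auto
    also have "T ` ?B = T ` A \<inter> E" by auto
    also have "emeasure (Rmeas d) (T ` A \<inter> E) = emeasure (density (Rmeas d) (indicator (T ` A))) E"
      using TB[OF A] E by (subst emeasure_density) (auto simp: indicator_inter_arith[symmetric])
    finally show "emeasure N E = emeasure (density (Rmeas d) (indicator (T ` A))) E" .
  qed
  have "(\<integral>\<^sup>+ v \<in> T ` A. f v \<partial>Rmeas d) = (\<integral>\<^sup>+ v. f v \<partial>N)"
    unfolding NE using f TB[OF A] by (subst nn_integral_density) (auto simp: mult.commute)
  also have "\<dots> = (\<integral>\<^sup>+ u. J u * f (T u) \<partial>restrict_space (Rmeas d) A)"
    unfolding N_def using f TA JA by (subst nn_integral_distr) (auto simp: nn_integral_density)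
  also have "\<dots> = (\<integral>\<^sup>+ u \<in> A. f (T u) * J u \<partial>Rmeas d)"
    by (subst nn_integral_restrict_space[OF Am]) (simp add: mult.commute mult.left_commute)
  finally show ?thesis unfolding J_def .
qed

end

section \<open>Integration over the parameter domain\<close>

text \<open>A fundamental domain for the angle. It is half-open, so that \<open>Psi\<close> maps it
  bijectively onto the regular part and no overlap has to be corrected in integrals.\<close>

definition strip :: "(nat \<Rightarrow> real) set"
  where "strip = {u \<in> Rspace 4. 0 \<le> u 3 \<and> u 3 < 2 * pi}"

definition qq :: "(nat \<Rightarrow> real) \<Rightarrow> real"
  where "qq u = 1 + (u 0)\<^sup>2 + (u 1)\<^sup>2 + (u 2)\<^sup>2"

lemma qq_ge_1: "qq u \<ge> 1"
  by (simp add: qq_def)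

lemma qq_pos: "qq u > 0"
  using qq_ge_1[of u] by linarith

lemma lessThan_3: "{..<3::nat} = {0, 1, 2}" and lessThan_4: "{..<4::nat} = {0, 1, 2, 3}"
  and lessThan_5: "{..<5::nat} = {0, 1, 2, 3, 4}" and atMost_5: "{..5::nat} = {0, 1, 2, 3, 4, 5}"
  by auto

lemma compact_PiE:
  fixes S :: "'i \<Rightarrow> real set"
  assumes "\<And>i. compact (S i)"
  shows "compact (PiE UNIV S)"
proof -
  have "compactin (product_topology (\<lambda>i. euclidean) UNIV) (PiE UNIV S)"
    using assms by (simp add: compactin_PiE compactin_euclidean_iff)
  then show ?thesis by (simp add: euclidean_product_topology compactin_euclidean_iff)
qed

text \<open>Coordinates from \<open>d\<close> on have the fixed value \<open>undefined\<close>, so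
  the box is a full product of compact sets and Tychonoff's theorem applies.\<close>

lemma compact_box_Rspace: "compact {u \<in> Rspace d. \<forall>k<d. a k \<le> u k \<and> u k \<le> b k}"
proof -
  have "{u \<in> Rspace d. \<forall>k<d. a k \<le> u k \<and> u k \<le> b k} =
      PiE UNIV (\<lambda>k. if k < d then {a k..b k} else {undefined :: real})"
    by (auto simp: Rspace_def PiE_iff extensional_def split: if_splits)
  then show ?thesis using compact_PiE[of "\<lambda>k. if k < d then {a k..b k} else {undefined}"] by simp
qed

lemma strip_in_sets [measurable]: "strip \<in> sets (Rmeas 4)"
proof -
  have "strip = {u \<in> space (Rmeas 4). 0 \<le> u 3 \<and> u 3 < 2 * pi}" by (simp add: strip_def)
  also have "\<dots> \<in> sets (Rmeas 4)"
    using measurable_Rmeas_component[measurable] by measurable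
  finally show ?thesis .
qed

lemma measurable_continuous_Rspace:
  fixes D :: "(nat \<Rightarrow> real) \<Rightarrow> real"
  assumes "continuous_on (Rspace d) D"
  shows "D \<in> borel_measurable (Rmeas d)"
proof (rule borel_measurableI)
  fix S :: "real set" assume "open S"
  then have "openin (top_of_set (Rspace d)) (Rspace d \<inter> D -` S)"
    using assms by (intro continuous_openin_preimage_gen)
  then show "D -` S \<inter> space (Rmeas d) \<in> sets (Rmeas d)"
    using openin_imp_sets_Rmeas by (simp add: Int_commute)
qed

text \<open>The support condition concerns the three unbounded coordinates only. The angle is
  already bounded on \<open>strip\<close>, so the integrand is bounded and lives on a box of finite
  measure.\<close>

lemma integrable_on_strip:
  fixes D :: "(nat \<Rightarrow> real) \<Rightarrow> real"
  assumes cont: "continuous_on (Rspace 4) D"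
    and supp: "\<And>u k. u \<in> Rspace 4 \<Longrightarrow> k < 3 \<Longrightarrow> \<bar>u k\<bar> > R \<Longrightarrow> D u = 0"
  shows "integrable (Rmeas 4) (\<lambda>u. indicator strip u * D u)"
proof -
  define a where "a k = (if k < 3 then - \<bar>R\<bar> else 0)" for k :: nat
  define b where "b k = (if k < 3 then \<bar>R\<bar> else 2 * pi)" for k :: nat
  let ?K = "{u \<in> Rspace 4. \<forall>k<4. a k \<le> u k \<and> u k \<le> b k}"
  have cK: "compact ?K" by (rule compact_box_Rspace)
  have "compact (D ` ?K)"
    by (rule compact_continuous_image[OF continuous_on_subset[OF cont] cK]) auto
  then have "bounded (D ` ?K)" by (rule compact_imp_bounded)
  then obtain C where "\<forall>x\<in>D ` ?K. norm x \<le> C" unfolding bounded_iff by blast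
  then have C: "\<And>u. u \<in> ?K \<Longrightarrow> \<bar>D u\<bar> \<le> C" by auto
  have K: "?K = (\<Pi>\<^sub>E k\<in>{..<4}. {a k..b k})"
    unfolding Rspace_def PiE_def by auto
  show ?thesis
  proof (rule integrableI_bounded_set[where A = ?K and B = C])
    show "?K \<in> sets (Rmeas 4)" unfolding K Rmeas_def by (intro sets_PiM_I_finite) auto
    show "(\<lambda>u. indicator strip u * D u) \<in> borel_measurable (Rmeas 4)"
      using measurable_continuous_Rspace[OF cont] by measurable
    have "emeasure (Rmeas 4) ?K = (\<Prod>k<4. emeasure lborel {a k..b k})"
      unfolding K Rmeas_def by (rule lborel_prod.emeasure_PiM) auto
    also have "\<dots> < \<infinity>" by (simp add: lessThan_4 ennreal_mult_less_top emeasure_lborel_Icc_eq)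
    finally show "emeasure (Rmeas 4) ?K < \<infinity>" .
    show "AE u in Rmeas 4. u \<in> ?K \<longrightarrow> norm (indicator strip u * D u) \<le> C"
      using C by (intro AE_I2) (force simp: indicator_def intro: order_trans[OF abs_ge_zero])
    show "AE u in Rmeas 4. u \<notin> ?K \<longrightarrow> indicator strip u * D u = 0"
    proof (intro AE_I2 impI)
      fix u assume u: "u \<in> space (Rmeas 4)" "u \<notin> ?K"
      show "indicator strip u * D u = 0"
      proof (cases "u \<in> strip")
        case True
        then obtain k where k: "k < 4" "\<not> (a k \<le> u k \<and> u k \<le> b k)" using u by auto
        then have "k < 3"
          using True by (cases "k = 3") (auto simp: a_def b_def strip_def)
        then have "\<bar>u k\<bar> > R" using k by (auto simp: a_def b_def)
        then show ?thesis using supp[OF _ \<open>k < 3\<close>] u by simp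
      qed simp
    qed
  qed
qed

section \<open>Integration by parts over the strip\<close>

lemma integral_Rmeas_eq_0:
  fixes h :: "(nat \<Rightarrow> real) \<Rightarrow> real"
  assumes "integrable (Rmeas d) h" "i < d"
    and zero: "\<And>u. u \<in> Rspace d \<Longrightarrow> (\<integral>t. h (u(i := t)) \<partial>lborel) = 0"
  shows "(\<integral>u. h u \<partial>Rmeas d) = 0"
proof -
  have ins: "insert i ({..<d} - {i}) = {..<d}" using assms(2) by auto
  have "(\<integral>u. h u \<partial>Rmeas d) = (\<integral>u. h u \<partial>Pi\<^sub>M (insert i ({..<d} - {i})) (\<lambda>_. lborel))"
    unfolding Rmeas_def ins ..
  also have "\<dots> = (\<integral>x. (\<integral>t. h (x(i := t)) \<partial>lborel) \<partial>Pi\<^sub>M ({..<d} - {i}) (\<lambda>_. lborel))"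
    by (rule lborel_prod.product_integral_insert) (use assms(1) ins in \<open>auto simp: Rmeas_def\<close>)
  also have "\<dots> = (\<integral>x. 0 \<partial>Pi\<^sub>M ({..<d} - {i}) (\<lambda>_. lborel :: real measure))"
  proof (rule Bochner_Integration.integral_cong[OF refl])
    fix x assume "x \<in> space (Pi\<^sub>M ({..<d} - {i}) (\<lambda>_. lborel :: real measure))"
    \<comment> \<open>\<open>x\<close> has no coordinate \<open>i\<close>; any value put there gives
      a point of \<open>Rspace d\<close> with the same slice in direction \<open>i\<close>.\<close>
    then have "x(i := 0) \<in> Rspace d"
      using assms(2) by (auto simp: space_PiM Rspace_def PiE_iff extensional_def)
    from zero[OF this] show "(\<integral>t. h (x(i := t)) \<partial>lborel) = 0" by simp
  qed
  finally show ?thesis by simp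
qed

lemma continuous_on_upd:
  fixes D :: "(nat \<Rightarrow> real) \<Rightarrow> real"
  assumes "continuous_on (Rspace d) D" "u \<in> Rspace d" "i < d"
  shows "continuous_on X (\<lambda>t. D (u(i := t)))"
proof (rule continuous_on_compose2[OF assms(1)])
  show "continuous_on X (\<lambda>t. u(i := t))"
  proof (rule continuous_on_coordinatewise_then_product)
    show "continuous_on X (\<lambda>t. (u(i := t)) k)" for k
      by (cases "k = i") (auto intro!: continuous_intros)
  qed
qed (use assms fun_upd_in_Rspace in auto)

lemma integral_strip_deriv_radial:
  fixes D F :: "(nat \<Rightarrow> real) \<Rightarrow> real"
  assumes cont: "continuous_on (Rspace 4) D" and i: "i < 3"
    and der: "\<And>u. u \<in> Rspace 4 \<Longrightarrow> ((\<lambda>t. F (u(i := t))) has_real_derivative D u) (at (u i))"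
    and supp: "\<And>u k. u \<in> Rspace 4 \<Longrightarrow> k < 3 \<Longrightarrow> \<bar>u k\<bar> > R \<Longrightarrow> D u = 0 \<and> F u = 0"
  shows "(\<integral>u. indicator strip u * D u \<partial>Rmeas 4) = 0"
proof (rule integral_Rmeas_eq_0[where i = i])
  show "integrable (Rmeas 4) (\<lambda>u. indicator strip u * D u)"
    by (rule integrable_on_strip[OF cont]) (use supp in blast)
  fix u assume u: "u \<in> Rspace 4"
  have uR: "u(i := t) \<in> Rspace 4" for t using u i by (intro fun_upd_in_Rspace) auto
  \<comment> \<open>Strictly beyond the support on both sides, also for negative \<open>R\<close>,
    so that both boundary values vanish.\<close>
  define R' where "R' = \<bar>R\<bar> + 1"
  have "(\<integral>t. indicator {-R'..R'} t *\<^sub>R D (u(i := t)) \<partial>lborel) = F (u(i := R')) - F (u(i := -R'))"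
  proof (rule integral_FTC_atLeastAtMost)
    show "-R' \<le> R'" by (simp add: R'_def)
    show "continuous_on {-R'..R'} (\<lambda>t. D (u(i := t)))"
      by (rule continuous_on_upd[OF cont u]) (use i in simp)
    fix t
    have "((\<lambda>t. F (u(i := t))) has_real_derivative D (u(i := t))) (at t)"
      using der[OF uR[of t]] by simp
    then show "((\<lambda>t. F (u(i := t))) has_vector_derivative D (u(i := t))) (at t within {-R'..R'})"
      using has_field_derivative_at_within has_real_derivative_iff_has_vector_derivative by blast
  qed
  also have "F (u(i := R')) = 0" using supp[OF uR i, of R'] by (simp add: R'_def)
  also have "F (u(i := -R')) = 0" using supp[OF uR i, of "-R'"] by (simp add: R'_def)
  also have "(\<lambda>t. indicator {-R'..R'} t *\<^sub>R D (u(i := t))) = (\<lambda>t. D (u(i := t)))"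
  proof
    fix t show "indicator {-R'..R'} t *\<^sub>R D (u(i := t)) = D (u(i := t))"
    proof (cases "t \<in> {-R'..R'}")
      case False
      then have "\<bar>t\<bar> > R" by (auto simp: R'_def)
      then show ?thesis using supp[OF uR i, of t] by simp
    qed simp
  qed
  finally have "(\<integral>t. D (u(i := t)) \<partial>lborel) = 0" by simp
  moreover have "indicator strip (u(i := t)) = (indicator strip u :: real)" for t
    using u uR[of t] i by (auto simp: indicator_def strip_def)
  ultimately show "(\<integral>t. indicator strip (u(i := t)) * D (u(i := t)) \<partial>lborel) = 0" by simp
qed (use i in auto)

text \<open>Periodicity cancels the two boundary terms. The closed interval of the fundamental
  theorem and the half-open fibre of \<open>strip\<close> differ by a null set.\<close>

lemma integral_strip_deriv_periodic:
  fixes D F :: "(nat \<Rightarrow> real) \<Rightarrow> real"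
  assumes cont: "continuous_on (Rspace 4) D"
    and der: "\<And>u. u \<in> Rspace 4 \<Longrightarrow> ((\<lambda>t. F (u(3 := t))) has_real_derivative D u) (at (u 3))"
    and per: "\<And>u. u \<in> Rspace 4 \<Longrightarrow> F (u(3 := 2 * pi)) = F (u(3 := 0))"
    and supp: "\<And>u k. u \<in> Rspace 4 \<Longrightarrow> k < 3 \<Longrightarrow> \<bar>u k\<bar> > R \<Longrightarrow> D u = 0"
  shows "(\<integral>u. indicator strip u * D u \<partial>Rmeas 4) = 0"
proof (rule integral_Rmeas_eq_0[where i = 3])
  show "integrable (Rmeas 4) (\<lambda>u. indicator strip u * D u)"
    by (rule integrable_on_strip[OF cont]) (use supp in blast)
  fix u assume u: "u \<in> Rspace 4"
  have uR: "u(3 := t) \<in> Rspace 4" for t using u by (intro fun_upd_in_Rspace) auto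
  have cD: "continuous_on X (\<lambda>t. D (u(3 := t)))" for X
    by (rule continuous_on_upd[OF cont u]) simp
  have "(\<integral>t. indicator {0..2 * pi} t *\<^sub>R D (u(3 := t)) \<partial>lborel) = F (u(3 := 2 * pi)) - F (u(3 := 0))"
  proof (rule integral_FTC_atLeastAtMost)
    fix t
    have "((\<lambda>t. F (u(3 := t))) has_real_derivative D (u(3 := t))) (at t)"
      using der[OF uR[of t]] by simp
    then show "((\<lambda>t. F (u(3 := t))) has_vector_derivative D (u(3 := t))) (at t within {0..2 * pi})"
      using has_field_derivative_at_within has_real_derivative_iff_has_vector_derivative by blast
  qed (use cD in auto)
  also have "\<dots> = 0" using per[OF u] by simp
  also have "(\<integral>t. indicator {0..2 * pi} t *\<^sub>R D (u(3 := t)) \<partial>lborel) =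
      (\<integral>t. indicator strip (u(3 := t)) * D (u(3 := t)) \<partial>lborel)"
  proof (rule integral_cong_AE)
    define E where "E t = D (u(3 := t))" for t
    have m [measurable]: "E \<in> borel_measurable borel"
      unfolding E_def by (rule borel_measurable_continuous_onI[OF cD])
    have "(\<lambda>t. indicator {0..2 * pi} t *\<^sub>R E t) \<in> borel_measurable lborel"
      by measurable
    then show "(\<lambda>t. indicator {0..2 * pi} t *\<^sub>R D (u(3 := t))) \<in> borel_measurable lborel"
      by (simp only: E_def)
    have m': "(\<lambda>t. indicator {0..<2 * pi} t * E t) \<in> borel_measurable lborel"
      by measurable
    have "(\<lambda>t. indicator strip (u(3 := t)) * D (u(3 := t))) = (\<lambda>t. indicator {0..<2 * pi} t * D (u(3 := t)))"
      using uR by (auto simp: indicator_def strip_def fun_eq_iff)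
    then show "(\<lambda>t. indicator strip (u(3 := t)) * D (u(3 := t))) \<in> borel_measurable lborel"
      using m' by (simp only: E_def)
    show "AE t in lborel. indicator {0..2 * pi} t *\<^sub>R D (u(3 := t)) = indicator strip (u(3 := t)) * D (u(3 := t))"
      using AE_lborel_singleton[of "2 * pi"]
      by eventually_elim (use uR in \<open>auto simp: indicator_def strip_def\<close>)
  qed
  finally show "(\<integral>t. indicator strip (u(3 := t)) * D (u(3 := t)) \<partial>lborel) = 0" .
qed auto

text \<open>The exponent -2/3 comes from sharing q^(-2) evenly among three variables. By 1 + t^2 >=
  (1 + |t|)^2 / 2 the integrand is at most a constant times (1 + |t|)^(-4/3), which has an explicit
  antiderivative.\<close>

lemma nn_integral_powr_finite: "(\<integral>\<^sup>+ t. ennreal ((1 + t\<^sup>2) powr (-2/3)) \<partial>lborel) < \<infinity>"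
proof -
  let ?f = "\<lambda>t::real. (1 + t) powr (-4/3)"
  have 1: "(\<integral>\<^sup>+ t. ennreal (?f t) * indicator {0..} t \<partial>lborel) = ennreal (0 - (-3) * (1 + 0) powr (-1/3))"
  proof (rule nn_integral_FTC_atLeast[where F = "\<lambda>t. (-3) * (1 + t) powr (-1/3)"])
    show "((\<lambda>t. (-3) * (1 + t) powr (-1/3)) has_real_derivative ?f t) (at t)" if "0 \<le> t" for t :: real
      using that by (auto intro!: derivative_eq_intros)
    have "((\<lambda>t::real. (1 + t) powr (-1/3)) \<longlongrightarrow> 0) at_top"
      by (rule tendsto_neg_powr) (auto intro!: filterlim_tendsto_add_at_top filterlim_ident)
    from tendsto_mult_left[OF this, of "-3"]
    show "((\<lambda>t::real. (-3) * (1 + t) powr (-1/3)) \<longlongrightarrow> 0) at_top" by simp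
  qed auto
  have 2: "(\<integral>\<^sup>+ t. ennreal (?f (-t)) * indicator {..0} t \<partial>lborel) =
      (\<integral>\<^sup>+ t. ennreal (?f t) * indicator {0..} t \<partial>lborel)"
    by (subst nn_integral_real_affine[of _ "-1" 0]) (auto simp: indicator_def intro!: nn_integral_cong)
  have le: "ennreal ((1 + t\<^sup>2) powr (-2/3)) \<le>
      2 * (ennreal (?f t) * indicator {0..} t + ennreal (?f (-t)) * indicator {..0} t)" for t :: real
  proof -
    have "(1 + t\<^sup>2) powr (-2/3) \<le> ((1 + \<bar>t\<bar>)\<^sup>2 / 2) powr (-2/3)"
    proof (rule powr_mono2')
      have "0 \<le> (1 - \<bar>t\<bar>)\<^sup>2" by simp
      then show "(1 + \<bar>t\<bar>)\<^sup>2 / 2 \<le> 1 + t\<^sup>2" by (simp add: power2_eq_square algebra_simps)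
    qed auto
    also have "\<dots> = (1 + \<bar>t\<bar>) powr (-4/3) * 2 powr (2/3)"
    proof -
      have "((1 + \<bar>t\<bar>)\<^sup>2 / 2) powr (-2/3) = ((1 + \<bar>t\<bar>)\<^sup>2) powr (-2/3) / 2 powr (-2/3)"
        by (simp add: powr_divide)
      also have "((1 + \<bar>t\<bar>)\<^sup>2) powr (-2/3) = (1 + \<bar>t\<bar>) powr (-4/3)"
      proof -
        have "(1 + \<bar>t\<bar>)\<^sup>2 = (1 + \<bar>t\<bar>) powr 2" by simp
        then show ?thesis by (simp only: powr_powr) simp
      qed
      finally show ?thesis by (simp add: powr_minus field_simps)
    qed
    also have "\<dots> \<le> (1 + \<bar>t\<bar>) powr (-4/3) * 2"
      using powr_mono[of "2/3" 1 "2::real"] by (intro mult_left_mono) auto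
    finally have *: "(1 + t\<^sup>2) powr (-2/3) \<le> 2 * ?f \<bar>t\<bar>" by simp
    have "ennreal ((1 + t\<^sup>2) powr (-2/3)) \<le> ennreal (2 * ?f \<bar>t\<bar>)" using * by (rule ennreal_leI)
    also have "\<dots> = 2 * ennreal (?f \<bar>t\<bar>)" by (simp add: ennreal_mult)
    also have "\<dots> \<le> 2 * (ennreal (?f t) * indicator {0..} t + ennreal (?f (-t)) * indicator {..0} t)"
      by (intro mult_left_mono) (auto simp: indicator_def abs_if)
    finally show ?thesis .
  qed
  have "(\<integral>\<^sup>+ t. ennreal ((1 + t\<^sup>2) powr (-2/3)) \<partial>lborel) \<le>
    (\<integral>\<^sup>+ t. 2 * (ennreal (?f t) * indicator {0..} t + ennreal (?f (-t)) * indicator {..0} t) \<partial>lborel)"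
    by (rule nn_integral_mono) (rule le)
  also have "\<dots> = 2 * ((\<integral>\<^sup>+ t. ennreal (?f t) * indicator {0..} t \<partial>lborel) +
      (\<integral>\<^sup>+ t. ennreal (?f (-t)) * indicator {..0} t \<partial>lborel))"
    by (subst nn_integral_cmult) (auto simp: nn_integral_add)
  also have "\<dots> < \<infinity>" unfolding 2 1 by (auto simp: ennreal_mult_less_top)
  finally show ?thesis .
qed

text \<open>By \<open>(1 + |y|\<^sup>2)\<^sup>3 \<ge> (1 + y\<^sub>0\<^sup>2) (1 + y\<^sub>1\<^sup>2) (1 + y\<^sub>2\<^sup>2)\<close> the integral is bounded by a product.\<close>

lemma nn_integral_strip_finite: "(\<integral>\<^sup>+ u \<in> strip. ennreal (1 / (qq u)\<^sup>2) \<partial>Rmeas 4) < \<infinity>"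
proof -
  define m :: "nat \<Rightarrow> real \<Rightarrow> ennreal" where
    "m k t = (if k < 3 then ennreal ((1 + t\<^sup>2) powr (-2/3)) else indicator {0..<2*pi} t)" for k t
  have mm: "m k \<in> borel_measurable lborel" for k
    by (cases "k < 3") (auto simp: m_def[abs_def])
  have "(\<integral>\<^sup>+ u \<in> strip. ennreal (1 / (qq u)\<^sup>2) \<partial>Rmeas 4) \<le> (\<integral>\<^sup>+ u. (\<Prod>k<4. m k (u k)) \<partial>Rmeas 4)"
  proof (rule nn_integral_mono)
    fix u assume "u \<in> space (Rmeas 4)"
    define p where "p k = (1 + (u k)\<^sup>2) powr (-2/3)" for k :: nat
    have p: "p k > 0" for k by (auto simp: p_def add_pos_nonneg intro!: powr_gt_zero[THEN iffD2])
      (metis add_pos_nonneg less_numeral_extra(1,3) zero_le_power2)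
    have pq: "qq u powr (-2/3) \<le> p k" if "k < 3" for k
      unfolding p_def
    proof (rule powr_mono2')
      have "k = 0 \<or> k = 1 \<or> k = 2" using that by auto
      then show "1 + (u k)\<^sup>2 \<le> qq u" by (auto simp: qq_def)
    qed (auto intro: add_pos_nonneg)
    have "1 / (qq u)\<^sup>2 = qq u powr (-2/3) * qq u powr (-2/3) * qq u powr (-2/3)"
      using qq_pos[of u] by (simp flip: powr_add add: powr_minus_divide powr_numeral)
    also have "\<dots> \<le> p 0 * p 1 * p 2"
      using pq[of 0] pq[of 1] pq[of 2] p by (intro mult_mono) (auto intro!: mult_nonneg_nonneg less_imp_le)
    finally have le: "1 / (qq u)\<^sup>2 \<le> p 0 * p 1 * p 2" .
    have "(\<Prod>k<4. m k (u k)) = ennreal (p 0) * ennreal (p 1) * ennreal (p 2) * indicator {0..<2*pi} (u 3)"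
      by (simp add: lessThan_4 m_def p_def mult.assoc)
    also have "ennreal (p 0) * ennreal (p 1) * ennreal (p 2) = ennreal (p 0 * p 1 * p 2)"
      using p by (simp add: ennreal_mult less_imp_le)
    finally show "ennreal (1 / (qq u)\<^sup>2) * indicator strip u \<le> (\<Prod>k<4. m k (u k))"
      using ennreal_leI[OF le] by (auto simp: indicator_def strip_def)
  qed
  also have "\<dots> = (\<Prod>k<4. integral\<^sup>N lborel (m k))"
    unfolding Rmeas_def by (rule lborel_prod.product_nn_integral_prod) (use mm in auto)
  also have "\<dots> < \<infinity>"
  proof -
    have "integral\<^sup>N lborel (m k) < \<infinity>" if "k < 4" for k
      using nn_integral_powr_finite by (cases "k < 3") (auto simp: m_def[abs_def])
    then show ?thesis by (simp add: lessThan_4 ennreal_mult_less_top)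
  qed
  finally show ?thesis .
qed

section \<open>Homogeneous polynomials\<close>

definition hom_idx :: "nat \<Rightarrow> nat \<Rightarrow> (nat \<Rightarrow> nat) set"
  where "hom_idx N m = {\<alpha> \<in> {..N} \<rightarrow>\<^sub>E {..m}. (\<Sum>i\<le>N. \<alpha> i) = m}"

lemma finite_hom_idx: "finite (hom_idx N m)"
  unfolding hom_idx_def by (rule finite_subset[of _ "{..N} \<rightarrow>\<^sub>E {..m}"]) (auto intro: finite_PiE)

lemma hom_poly_iff:
  "hom_poly N m f \<longleftrightarrow> (\<exists>c. \<forall>x. f x = (\<Sum>\<alpha>\<in>hom_idx N m. c \<alpha> * (\<Prod>i\<le>N. x i ^ \<alpha> i)))"
  unfolding hom_poly_def hom_idx_def by simp

lemma hom_poly_monomial: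
  assumes "\<alpha> \<in> hom_idx N m"
  shows "hom_poly N m (\<lambda>x. \<Prod>i\<le>N. x i ^ \<alpha> i)"
  unfolding hom_poly_iff
proof (intro exI allI)
  fix x :: "nat \<Rightarrow> real"
  show "(\<Prod>i\<le>N. x i ^ \<alpha> i) =
    (\<Sum>\<beta>\<in>hom_idx N m. (if \<beta> = \<alpha> then 1 else 0) * (\<Prod>i\<le>N. x i ^ \<beta> i))"
    using assms finite_hom_idx by (simp add: if_distrib[of "\<lambda>c. c * _"] cong: if_cong)
qed

lemma hom_poly_add: "hom_poly N m f \<Longrightarrow> hom_poly N m g \<Longrightarrow> hom_poly N m (\<lambda>x. f x + g x)"
  unfolding hom_poly_iff
proof (elim exE)
  fix c d assume "\<forall>x. f x = (\<Sum>\<alpha>\<in>hom_idx N m. c \<alpha> * (\<Prod>i\<le>N. x i ^ \<alpha> i))"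
    "\<forall>x. g x = (\<Sum>\<alpha>\<in>hom_idx N m. d \<alpha> * (\<Prod>i\<le>N. x i ^ \<alpha> i))"
  then show "\<exists>c. \<forall>x. f x + g x = (\<Sum>\<alpha>\<in>hom_idx N m. c \<alpha> * (\<Prod>i\<le>N. x i ^ \<alpha> i))"
    by (intro exI[of _ "\<lambda>\<alpha>. c \<alpha> + d \<alpha>"]) (simp add: sum.distrib distrib_right)
qed

lemma hom_poly_cmult: "hom_poly N m f \<Longrightarrow> hom_poly N m (\<lambda>x. a * f x)"
  unfolding hom_poly_iff
proof (elim exE)
  fix c assume "\<forall>x. f x = (\<Sum>\<alpha>\<in>hom_idx N m. c \<alpha> * (\<Prod>i\<le>N. x i ^ \<alpha> i))"
  then show "\<exists>c. \<forall>x. a * f x = (\<Sum>\<alpha>\<in>hom_idx N m. c \<alpha> * (\<Prod>i\<le>N. x i ^ \<alpha> i))"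
    by (intro exI[of _ "\<lambda>\<alpha>. a * c \<alpha>"]) (simp add: sum_distrib_left mult.assoc)
qed

lemma hom_poly_diff: "hom_poly N m f \<Longrightarrow> hom_poly N m g \<Longrightarrow> hom_poly N m (\<lambda>x. f x - g x)"
  using hom_poly_add[of N m f "\<lambda>x. (-1) * g x"] hom_poly_cmult[of N m g "-1"] by simp

lemma hom_poly_sum:
  "finite A \<Longrightarrow> (\<And>a. a \<in> A \<Longrightarrow> hom_poly N m (f a)) \<Longrightarrow> hom_poly N m (\<lambda>x. \<Sum>a\<in>A. f a x)"
proof (induction A rule: finite_induct)
  case empty
  show ?case unfolding hom_poly_iff by (intro exI[of _ "\<lambda>_. 0"]) simp
next
  case (insert a A)
  then show ?case using hom_poly_add[of N m "f a" "\<lambda>x. \<Sum>a\<in>A. f a x"] by simp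
qed

lemma hom_poly_mult:
  assumes "hom_poly N m f" "hom_poly N n g"
  shows "hom_poly N (m + n) (\<lambda>x. f x * g x)"
proof -
  obtain c d where cd0: "\<forall>x. f x = (\<Sum>\<alpha>\<in>hom_idx N m. c \<alpha> * (\<Prod>i\<le>N. x i ^ \<alpha> i))"
    "\<forall>x. g x = (\<Sum>\<beta>\<in>hom_idx N n. d \<beta> * (\<Prod>i\<le>N. x i ^ \<beta> i))"
    using assms unfolding hom_poly_iff by (elim exE)
  note cd = cd0[rule_format]
  have eq: "f x * g x = (\<Sum>\<alpha>\<in>hom_idx N m. \<Sum>\<beta>\<in>hom_idx N n.
      (c \<alpha> * d \<beta>) * (\<Prod>i\<le>N. x i ^ (\<lambda>i\<in>{..N}. \<alpha> i + \<beta> i) i))" for x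
  proof -
    have "(\<Prod>i\<le>N. x i ^ (\<lambda>i\<in>{..N}. \<alpha> i + \<beta> i) i) = (\<Prod>i\<le>N. x i ^ \<alpha> i) * (\<Prod>i\<le>N. x i ^ \<beta> i)"
      for \<alpha> \<beta> :: "nat \<Rightarrow> nat"
      by (simp add: power_add prod.distrib)
    then show ?thesis unfolding cd sum_product by (simp only: mult_ac)
  qed
  have "(\<lambda>i\<in>{..N}. \<alpha> i + \<beta> i) \<in> hom_idx N (m + n)" if "\<alpha> \<in> hom_idx N m" "\<beta> \<in> hom_idx N n" for \<alpha> \<beta>
    using that by (auto simp: hom_idx_def sum.distrib PiE_iff add_mono)
  then show ?thesis unfolding eq
    by (intro hom_poly_sum finite_hom_idx hom_poly_cmult hom_poly_monomial)
qed

lemma hom_poly_coord: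
  assumes "k \<le> N"
  shows "hom_poly N 1 (\<lambda>x. x k)"
proof -
  let ?\<alpha> = "\<lambda>i\<in>{..N}. if i = k then 1 else 0 :: nat"
  have "?\<alpha> \<in> hom_idx N 1" using assms by (auto simp: hom_idx_def PiE_iff)
  from hom_poly_monomial[OF this] show ?thesis
    using assms by (simp add: if_distrib[of "\<lambda>e. _ ^ e"] prod.delta cong: if_cong)
qed

lemma hom_poly_scale:
  assumes "hom_poly N m f"
  shows "f (\<lambda>i. a * x i) = a ^ m * f x"
proof -
  obtain c where c: "\<And>x. f x = (\<Sum>\<alpha>\<in>hom_idx N m. c \<alpha> * (\<Prod>i\<le>N. x i ^ \<alpha> i))"
    using assms unfolding hom_poly_iff by metis
  have "(\<Prod>i\<le>N. (a * x i) ^ \<alpha> i) = a ^ m * (\<Prod>i\<le>N. x i ^ \<alpha> i)" if "\<alpha> \<in> hom_idx N m" for \<alpha>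
    using that by (simp add: power_mult_distrib prod.distrib hom_idx_def flip: power_sum)
  then show ?thesis unfolding c sum_distrib_left by (intro sum.cong) auto
qed

lemma hom_poly_cong:
  assumes "hom_poly N m f" "\<And>i. i \<le> N \<Longrightarrow> x i = y i"
  shows "f x = f y"
  using assms unfolding hom_poly_iff by (metis (no_types, lifting) prod.cong sum.cong atMost_iff)

text \<open>Along a polynomial curve a form becomes a polynomial in one variable. The absence of
  zero divisors there replaces an argument with prime ideals in the proof of irreducibility.\<close>

lemma hom_poly_poly:
  assumes "hom_poly N m f"
  shows "\<exists>Q. \<forall>s. f (\<lambda>i. poly (P i) s) = poly Q s"
proof -
  obtain c where c: "\<And>x. f x = (\<Sum>\<alpha>\<in>hom_idx N m. c \<alpha> * (\<Prod>i\<le>N. x i ^ \<alpha> i))"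
    using assms unfolding hom_poly_iff by metis
  show ?thesis
    by (intro exI[of _ "\<Sum>\<alpha>\<in>hom_idx N m. Polynomial.smult (c \<alpha>) (\<Prod>i\<le>N. P i ^ \<alpha> i)"])
      (simp add: c poly_sum poly_prod)
qed

text \<open>Gradients are needed along curves inside the variety and in limits towards the apex.
  \<open>G\<close> is the termwise derivative of the monomials, for which the chain rule and
  sequential continuity in the coordinates up to \<open>N\<close> are direct.\<close>

lemma hom_poly_gradient:
  assumes "hom_poly N m f"
  shows "\<exists>G. (\<forall>c c' t0. (\<forall>i\<le>N. ((\<lambda>t. c t i) has_real_derivative c' i) (at t0)) \<longrightarrow>
      ((\<lambda>t. f (c t)) has_real_derivative (\<Sum>i\<le>N. G i (c t0) * c' i)) (at t0)) \<and>
    (\<forall>i\<le>N. \<forall>x X. (\<forall>j\<le>N. (\<lambda>n. X n j) \<longlonglongrightarrow> x j) \<longrightarrow> (\<lambda>n. G i (X n)) \<longlonglongrightarrow> G i x)"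
proof -
  obtain c where c: "\<And>x. f x = (\<Sum>\<alpha>\<in>hom_idx N m. c \<alpha> * (\<Prod>i\<le>N. x i ^ \<alpha> i))"
    using assms unfolding hom_poly_iff by metis
  define G where "G i x = (\<Sum>\<alpha>\<in>hom_idx N m. c \<alpha> *
    (real (\<alpha> i) * x i ^ (\<alpha> i - 1) * (\<Prod>j\<in>{..N} - {i}. x j ^ \<alpha> j)))" for i :: nat and x :: "nat \<Rightarrow> real"
  have "((\<lambda>t. f (k t)) has_real_derivative (\<Sum>i\<le>N. G i (k t0) * k' i)) (at t0)"
    if k: "\<forall>i\<le>N. ((\<lambda>t. k t i) has_real_derivative k' i) (at t0)" for k k' t0
  proof -
    have "((\<lambda>t. \<Prod>i\<le>N. k t i ^ \<alpha> i) has_derivative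
        (\<lambda>h. \<Sum>i\<le>N. (real (\<alpha> i) * (h * k' i) * k t0 i ^ (\<alpha> i - 1)) * (\<Prod>j\<in>{..N} - {i}. k t0 j ^ \<alpha> j))) (at t0)"
      for \<alpha> :: "nat \<Rightarrow> nat"
    proof (rule has_derivative_prod)
      fix i assume "i \<in> {..N}"
      then have "((\<lambda>t. k t i) has_derivative (\<lambda>h. h * k' i)) (at t0)"
      proof -
        have "(\<lambda>h. h * k' i) = (*) (k' i)" by (simp add: fun_eq_iff)
        then show ?thesis using k \<open>i \<in> {..N}\<close> by (simp add: has_field_derivative_def)
      qed
      from has_derivative_power[OF this, of "\<alpha> i"]
      show "((\<lambda>t. k t i ^ \<alpha> i) has_derivative (\<lambda>h. real (\<alpha> i) * (h * k' i) * k t0 i ^ (\<alpha> i - 1))) (at t0)"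
        by simp
    qed
    then have "((\<lambda>t. \<Sum>\<alpha>\<in>hom_idx N m. c \<alpha> * (\<Prod>i\<le>N. k t i ^ \<alpha> i)) has_derivative
        (\<lambda>h. \<Sum>\<alpha>\<in>hom_idx N m. c \<alpha> * (\<Sum>i\<le>N. (real (\<alpha> i) * (h * k' i) * k t0 i ^ (\<alpha> i - 1)) *
          (\<Prod>j\<in>{..N} - {i}. k t0 j ^ \<alpha> j)))) (at t0)"
      by (intro has_derivative_sum has_derivative_mult_right) auto
    moreover have "(\<lambda>h. \<Sum>\<alpha>\<in>hom_idx N m. c \<alpha> * (\<Sum>i\<le>N. (real (\<alpha> i) * (h * k' i) * k t0 i ^ (\<alpha> i - 1)) *
          (\<Prod>j\<in>{..N} - {i}. k t0 j ^ \<alpha> j))) = (*) (\<Sum>i\<le>N. G i (k t0) * k' i)"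
    proof
      fix h
      show "(\<Sum>\<alpha>\<in>hom_idx N m. c \<alpha> * (\<Sum>i\<le>N. (real (\<alpha> i) * (h * k' i) * k t0 i ^ (\<alpha> i - 1)) *
          (\<Prod>j\<in>{..N} - {i}. k t0 j ^ \<alpha> j))) = (\<Sum>i\<le>N. G i (k t0) * k' i) * h"
        unfolding G_def sum_distrib_left sum_distrib_right
        by (subst sum.swap) (intro sum.cong refl, simp add: mult_ac)
    qed
    ultimately show ?thesis unfolding c has_field_derivative_def by simp
  qed
  moreover have "(\<lambda>n. G i (X n)) \<longlonglongrightarrow> G i x"
    if "i \<le> N" "\<forall>j\<le>N. (\<lambda>n. X n j) \<longlonglongrightarrow> x j" for i x and X :: "nat \<Rightarrow> nat \<Rightarrow> real"
    unfolding G_def using that by (intro tendsto_intros) auto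
  ultimately show ?thesis by (intro exI[of _ G]) blast
qed

text \<open>Coordinate lines are curves too, so the chain rule itself identifies \<open>G\<close>
  with \<open>partial_deriv\<close>.\<close>

lemma hom_poly_gradient_partial:
  assumes "hom_poly N m f"
  obtains "\<And>c c' t0. (\<And>i. i \<le> N \<Longrightarrow> ((\<lambda>t. c t i) has_real_derivative c' i) (at t0)) \<Longrightarrow>
      ((\<lambda>t. f (c t)) has_real_derivative (\<Sum>i\<le>N. partial_deriv i f (c t0) * c' i)) (at t0)"
    "\<And>i x (X :: nat \<Rightarrow> nat \<Rightarrow> real). i \<le> N \<Longrightarrow> (\<And>j. j \<le> N \<Longrightarrow> (\<lambda>n. X n j) \<longlonglongrightarrow> x j) \<Longrightarrow>
      (\<lambda>n. partial_deriv i f (X n)) \<longlonglongrightarrow> partial_deriv i f x"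
proof -
  obtain G where G0: "\<forall>c c' t0. (\<forall>i\<le>N. ((\<lambda>t. c t i) has_real_derivative c' i) (at t0)) \<longrightarrow>
      ((\<lambda>t. f (c t)) has_real_derivative (\<Sum>i\<le>N. G i (c t0) * c' i)) (at t0)"
    "\<forall>i\<le>N. \<forall>x X. (\<forall>j\<le>N. (\<lambda>n. X n j) \<longlonglongrightarrow> x j) \<longrightarrow> (\<lambda>n. G i (X n)) \<longlonglongrightarrow> G i x"
    using hom_poly_gradient[OF assms] by (elim exE conjE)
  note G = G0(1)[rule_format] G0(2)[rule_format]
  have eq: "partial_deriv i f x = G i x" if "i \<le> N" for i x
  proof (rule partial_deriv_eqI)
    have "((\<lambda>t. f (x(i := t))) has_real_derivative
        (\<Sum>j\<le>N. G j (x(i := x i)) * (if j = i then 1 else 0))) (at (x i))"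
    proof (rule G(1))
      show "((\<lambda>t. (x(i := t)) j) has_real_derivative (if j = i then 1 else 0)) (at (x i))" for j
        by (cases "j = i") auto
    qed
    then show "((\<lambda>t. f (x(i := t))) has_real_derivative G i x) (at (x i))"
      using that by (simp add: if_distrib[of "\<lambda>c. _ * c"] cong: if_cong)
  qed
  show thesis
  proof (rule that)
    fix c c' t0 assume "\<And>i. i \<le> N \<Longrightarrow> ((\<lambda>t. c t i) has_real_derivative c' i) (at t0)"
    then have "((\<lambda>t. f (c t)) has_real_derivative (\<Sum>i\<le>N. G i (c t0) * c' i)) (at t0)"
      by (rule G(1))
    then show "((\<lambda>t. f (c t)) has_real_derivative (\<Sum>i\<le>N. partial_deriv i f (c t0) * c' i)) (at t0)"
      by (simp add: eq)
  next
    fix i x and X :: "nat \<Rightarrow> nat \<Rightarrow> real"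
    assume "i \<le> N" "\<And>j. j \<le> N \<Longrightarrow> (\<lambda>n. X n j) \<longlonglongrightarrow> x j"
    then show "(\<lambda>n. partial_deriv i f (X n)) \<longlonglongrightarrow> partial_deriv i f x"
      using G(2)[of i X x] by (simp add: eq)
  qed
qed

section \<open>The variety\<close>

lemma proj_pt_eq_scale:
  assumes "\<And>i. i \<le> N \<Longrightarrow> x i = a * y i" "a \<noteq> 0"
  shows "proj_pt N x = proj_pt N y"
proof -
  have "(\<Sum>l\<le>N. (x l)\<^sup>2) = a\<^sup>2 * (\<Sum>l\<le>N. (y l)\<^sup>2)"
    using assms(1) by (simp add: power_mult_distrib sum_distrib_left)
  then show ?thesis using assms by (auto simp: proj_pt_def fun_eq_iff power2_eq_square)
qed

lemma sum_squares_pos: "x \<in> hom_coords N \<Longrightarrow> (\<Sum>l\<le>N. (x l)\<^sup>2) > (0 :: real)"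
  by (auto simp: hom_coords_def intro!: sum_pos2)

lemma proj_pt_eqD:
  assumes "proj_pt N x = proj_pt N y" "x \<in> hom_coords N" "y \<in> hom_coords N"
  shows "\<exists>a. a \<noteq> 0 \<and> (\<forall>i\<le>N. x i = a * y i)"
proof -
  let ?X = "\<Sum>l\<le>N. (x l)\<^sup>2" and ?Y = "\<Sum>l\<le>N. (y l)\<^sup>2"
  have pos: "?X > 0" "?Y > 0" using assms sum_squares_pos by blast+
  obtain k where k: "k \<le> N" "y k \<noteq> 0" using assms(3) by (auto simp: hom_coords_def)
  have eq: "x i * x j / ?X = y i * y j / ?Y" if "i \<le> N" "j \<le> N" for i j
    using fun_cong[OF assms(1), of "(i, j)"] that by (simp add: proj_pt_def)
  have "x k \<noteq> 0" using eq[OF k(1) k(1)] k(2) pos by auto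
  \<comment> \<open>The factor is read off from the entry \<open>(i, k)\<close> of the two matrices,
    solved for \<open>x i\<close>.\<close>
  show ?thesis
  proof (intro exI[of _ "y k * ?X / (?Y * x k)"] conjI allI impI)
    show "y k * ?X / (?Y * x k) \<noteq> 0" using pos k \<open>x k \<noteq> 0\<close> by simp
    fix i assume "i \<le> N"
    then show "x i = y k * ?X / (?Y * x k) * y i"
      using eq[OF _ k(1), of i] pos \<open>x k \<noteq> 0\<close> by (simp add: field_simps)
  qed
qed

text \<open>Where \<open>X 5 = 1\<close>, the equation \<open>FF = 0\<close> is \<open>|w| = |a|\<^sup>2\<close> for \<open>a = (x, w)\<close>. Its nonzero solutions are the image of the
  cylinder \<open>|w| = 1\<close> under the inversion \<open>a \<mapsto> a / |a|\<^sup>2\<close>, and \<open>apex\<close> is the point \<open>a = 0\<close>.\<close>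

definition wsq :: "(nat \<Rightarrow> real) \<Rightarrow> real" where "wsq X = (X 3)\<^sup>2 + (X 4)\<^sup>2"
definition xsq :: "(nat \<Rightarrow> real) \<Rightarrow> real" where "xsq X = (X 0)\<^sup>2 + (X 1)\<^sup>2 + (X 2)\<^sup>2"
definition FF :: "(nat \<Rightarrow> real) \<Rightarrow> real" where "FF X = (X 5)\<^sup>2 * wsq X - (wsq X + xsq X)\<^sup>2"
definition VV :: "(nat \<times> nat \<Rightarrow> real) set" where "VV = proj_pt 5 ` {x \<in> hom_coords 5. FF x = 0}"
definition apex :: "nat \<times> nat \<Rightarrow> real" where "apex = proj_pt 5 (\<lambda>i. if i = 5 then 1 else 0)"

lemma hom_poly_FF: "hom_poly 5 4 FF"
proof -
  have sq: "hom_poly 5 2 (\<lambda>x. (x k)\<^sup>2)" if "k \<le> 5" for k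
    using hom_poly_mult[OF hom_poly_coord[OF that] hom_poly_coord[OF that]]
    by (simp add: power2_eq_square numeral_2_eq_2)
  have w: "hom_poly 5 2 wsq" and x: "hom_poly 5 2 xsq"
    unfolding wsq_def[abs_def] xsq_def[abs_def] by (intro hom_poly_add sq; simp)+
  have "hom_poly 5 (2 + 2) (\<lambda>X. (X 5)\<^sup>2 * wsq X)" by (intro hom_poly_mult sq w) simp
  moreover have "hom_poly 5 (2 + 2) (\<lambda>X. (wsq X + xsq X) * (wsq X + xsq X))"
    by (intro hom_poly_mult hom_poly_add w x)
  ultimately show ?thesis
    using hom_poly_diff unfolding FF_def[abs_def] power2_eq_square[of "_ + _"] by fastforce
qed

text \<open>Homogeneity makes vanishing independent of the representative, so membership can be
  tested on any homogeneous coordinates of the point.\<close>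

lemma proj_pt_mem_algebraic:
  assumes "\<forall>f\<in>F. \<exists>m. hom_poly N m f" "x \<in> hom_coords N"
  shows "proj_pt N x \<in> proj_pt N ` {x \<in> hom_coords N. \<forall>f\<in>F. f x = 0} \<longleftrightarrow> (\<forall>f\<in>F. f x = 0)"
proof
  assume "proj_pt N x \<in> proj_pt N ` {x \<in> hom_coords N. \<forall>f\<in>F. f x = 0}"
  then obtain y where y: "y \<in> hom_coords N" "\<forall>f\<in>F. f y = 0" "proj_pt N x = proj_pt N y" by blast
  obtain a where a: "\<And>i. i \<le> N \<Longrightarrow> x i = a * y i" using proj_pt_eqD[OF y(3) assms(2) y(1)] by blast
  show "\<forall>f\<in>F. f x = 0"
  proof
    fix f assume f: "f \<in> F"
    then obtain m where m: "hom_poly N m f" using assms by blast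
    have "f x = f (\<lambda>i. a * y i)" by (rule hom_poly_cong[OF m a])
    then show "f x = 0" using hom_poly_scale[OF m, of a y] y(2) f by simp
  qed
qed (use assms in blast)

lemma VV_eq: "VV = proj_pt 5 ` {x \<in> hom_coords 5. \<forall>f\<in>{FF}. f x = 0}"
  by (simp add: VV_def)

lemma proj_pt_in_VV: "x \<in> hom_coords 5 \<Longrightarrow> proj_pt 5 x \<in> VV \<longleftrightarrow> FF x = 0"
  unfolding VV_eq using hom_poly_FF by (subst proj_pt_mem_algebraic) auto

text \<open>Away from the apex one may scale to \<open>|w| = 1\<close>, and then the equation gives \<open>z = \<plusminus>(1 + |x|\<^sup>2)\<close>.\<close>

lemma hom_coords_5_cases: "(\<And>X :: nat \<Rightarrow> real. X \<in> hom_coords 5 \<longleftrightarrow>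
  X 0 \<noteq> 0 \<or> X 1 \<noteq> 0 \<or> X 2 \<noteq> 0 \<or> X 3 \<noteq> 0 \<or> X 4 \<noteq> 0 \<or> X 5 \<noteq> 0)"
proof -
  have *: "(\<exists>i\<le>5. P i) \<longleftrightarrow> P 0 \<or> P 1 \<or> P 2 \<or> P 3 \<or> P 4 \<or> P (5::nat)" for P
  proof -
    have "(\<exists>i\<le>5. P i) \<longleftrightarrow> (\<exists>i\<in>{..5}. P i)" by auto
    then show ?thesis unfolding atMost_5 by simp
  qed
  show "X \<in> hom_coords 5 \<longleftrightarrow> X 0 \<noteq> 0 \<or> X 1 \<noteq> 0 \<or> X 2 \<noteq> 0 \<or> X 3 \<noteq> 0 \<or> X 4 \<noteq> 0 \<or> X 5 \<noteq> 0"
    for X :: "nat \<Rightarrow> real" unfolding hom_coords_def using *[of "\<lambda>i. X i \<noteq> 0"] by simp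
qed

text \<open>For w = 0 the equation becomes |x|^4 = 0, which over the reals forces x = 0. Hence no
  further points of the projective closure have w = 0.\<close>

lemma FF_zero_apex:
  assumes "X \<in> hom_coords 5" "FF X = 0" "wsq X = 0"
  shows "\<forall>i\<le>4. X i = 0" "X 5 \<noteq> 0" "proj_pt 5 X = apex"
proof -
  have "xsq X = 0" using assms by (simp add: FF_def)
  then have z: "X 0 = 0" "X 1 = 0" "X 2 = 0" "X 3 = 0" "X 4 = 0"
    using assms(3) by (auto simp: xsq_def wsq_def add_nonneg_eq_0_iff)
  then show 5: "X 5 \<noteq> 0" using assms(1) by (simp add: hom_coords_5_cases)
  have "i = 0 \<or> i = 1 \<or> i = 2 \<or> i = 3 \<or> i = 4" if "i \<le> 4" for i :: nat using that by auto
  with z show z': "\<forall>i\<le>4. X i = 0" by metis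
  show "proj_pt 5 X = apex" unfolding apex_def
  proof (rule proj_pt_eq_scale[OF _ 5])
    fix i :: nat assume "i \<le> 5"
    then show "X i = X 5 * (if i = 5 then 1 else 0)" using z' by (cases "i = 5") auto
  qed
qed

text \<open>The cylinder point (y, e^(i theta)) has squared norm q, so its inversion is (y, e^(i
  theta)) / q. Clearing the denominator gives these homogeneous coordinates.\<close>

definition hvec :: "(nat \<Rightarrow> real) \<Rightarrow> nat \<Rightarrow> real"
  where "hvec u = (\<lambda>i. if i < 3 then u i else if i = 3 then cos (u 3) else if i = 4 then sin (u 3) else qq u)"

definition Psi :: "(nat \<Rightarrow> real) \<Rightarrow> nat \<times> nat \<Rightarrow> real"
  where "Psi u = proj_pt 5 (hvec u)"

lemma hvec_simps: "hvec u 0 = u 0" "hvec u (Suc 0) = u 1" "hvec u 1 = u 1" "hvec u 2 = u 2"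
  "hvec u 3 = cos (u 3)" "hvec u 4 = sin (u 3)" "hvec u 5 = qq u"
  by (simp_all add: hvec_def)

lemma hvec_in_hom_coords: "hvec u \<in> hom_coords 5"
  using qq_pos[of u] by (simp add: hom_coords_5_cases hvec_simps)

lemma wsq_hvec: "wsq (hvec u) = 1" and FF_hvec: "FF (hvec u) = 0"
  by (simp_all add: wsq_def FF_def hvec_simps xsq_def qq_def)

lemma FF_zero_param:
  assumes "FF X = 0" "wsq X \<noteq> 0"
  obtains a y c s where "a \<noteq> 0" "c\<^sup>2 + s\<^sup>2 = 1" "X 0 = a * y 0" "X 1 = a * y 1" "X 2 = a * y 2"
    "X 3 = a * c" "X 4 = a * s" "X 5 = a * qq y"
proof -
  define \<rho> where "\<rho> = sqrt (wsq X)"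
  have W: "wsq X > 0" using assms(2) by (auto simp: wsq_def intro: neq_le_trans)
  then have \<rho>: "\<rho> > 0" "\<rho>\<^sup>2 = wsq X" by (auto simp: \<rho>_def)
  have "(X 5 * \<rho>)\<^sup>2 = (\<rho>\<^sup>2 + xsq X)\<^sup>2"
    using assms(1) \<rho> by (simp add: FF_def power_mult_distrib)
  then consider "X 5 * \<rho> = \<rho>\<^sup>2 + xsq X" | "X 5 * \<rho> = - (\<rho>\<^sup>2 + xsq X)"
    unfolding power2_eq_iff by blast
  \<comment> \<open>The sign is absorbed into the scale, because multiplication by -1 exchanges the
    two sheets of the cone.\<close>
  then obtain e where e: "e = 1 \<or> e = -1" "X 5 * \<rho> = e * (\<rho>\<^sup>2 + xsq X)"
    by cases (metis mult_1, metis mult_minus1)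
  let ?a = "e * \<rho>"
  have a: "?a \<noteq> 0" "?a\<^sup>2 = wsq X" using e \<rho> by auto
  show thesis
  proof (rule that[of ?a "X 3 / ?a" "X 4 / ?a" "\<lambda>i. X i / ?a"])
    show "(X 3 / ?a)\<^sup>2 + (X 4 / ?a)\<^sup>2 = 1"
    proof -
      have "(X 3)\<^sup>2 / wsq X + (X 4)\<^sup>2 / wsq X = wsq X / wsq X"
        unfolding add_divide_distrib[symmetric] by (simp add: wsq_def)
      then show ?thesis using W unfolding power_divide a(2) by simp
    qed
    have "qq (\<lambda>i. X i / ?a) = 1 + xsq X / \<rho>\<^sup>2"
      unfolding qq_def power_divide a(2) \<rho>(2) by (simp add: xsq_def add_divide_distrib)
    also have "\<dots> = (\<rho>\<^sup>2 + xsq X) / \<rho>\<^sup>2" using \<rho>(1) by (simp add: field_simps)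
    finally have "?a * qq (\<lambda>i. X i / ?a) = e * (\<rho>\<^sup>2 + xsq X) / \<rho>"
      using \<rho>(1) by (simp add: power2_eq_square)
    moreover have "X 5 = e * (\<rho>\<^sup>2 + xsq X) / \<rho>"
      using e(2) \<rho>(1) by (metis nonzero_mult_div_cancel_right order_less_irrefl)
    ultimately show "X 5 = ?a * qq (\<lambda>i. X i / ?a)" by simp
  qed (use a in auto)
qed

lemma all_le_5: "(\<forall>i\<le>5. P i) \<longleftrightarrow> P 0 \<and> P 1 \<and> P 2 \<and> P 3 \<and> P 4 \<and> P (5::nat)"
proof -
  have "(\<forall>i\<le>5. P i) \<longleftrightarrow> (\<forall>i\<in>{..5}. P i)" by auto
  then show ?thesis unfolding atMost_5 by simp
qed

lemma VV_minus_apex: "VV - {apex} = Psi ` strip"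
proof (intro equalityI subsetI)
  fix P assume "P \<in> VV - {apex}"
  then obtain X where X: "X \<in> hom_coords 5" "FF X = 0" "P = proj_pt 5 X" "P \<noteq> apex"
    by (auto simp: VV_def)
  then have "wsq X \<noteq> 0" using FF_zero_apex by blast
  then obtain a y c s where p: "a \<noteq> 0" "c\<^sup>2 + s\<^sup>2 = 1" "X 0 = a * y 0" "X 1 = a * y 1" "X 2 = a * y 2"
    "X 3 = a * c" "X 4 = a * s" "X 5 = a * qq y"
    using X(2) FF_zero_param by metis
  obtain t where t: "0 \<le> t" "t < 2 * pi" "c = cos t" "s = sin t" using p(2) sincos_total_2pi by metis
  define u where "u = (\<lambda>i\<in>{..<4}. if i < 3 then y i else t)"
  have "qq u = qq y" by (simp add: u_def qq_def)
  then have "\<forall>i\<le>5. X i = a * hvec u i"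
    unfolding all_le_5 using p t by (simp add: hvec_simps) (simp add: u_def)
  then have "P = Psi u" unfolding Psi_def X(3) by (intro proj_pt_eq_scale[OF _ p(1)]) blast
  moreover have "u \<in> strip" using t by (simp add: strip_def u_def Rspace_def)
  ultimately show "P \<in> Psi ` strip" by blast
next
  fix P assume "P \<in> Psi ` strip"
  then obtain u where u: "P = Psi u" by blast
  have "P \<in> VV" unfolding u Psi_def using FF_hvec hvec_in_hom_coords proj_pt_in_VV by blast
  moreover have "P \<noteq> apex"
  proof
    assume "P = apex"
    then have "proj_pt 5 (hvec u) = proj_pt 5 (\<lambda>i. if i = 5 then 1 else 0)"
      by (simp add: u Psi_def apex_def)
    then obtain a where "\<forall>i\<le>5. hvec u i = a * (if i = 5 then 1 else 0)"
      using proj_pt_eqD[OF _ hvec_in_hom_coords] by (force simp: hom_coords_def)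
    then have "wsq (hvec u) = 0" by (simp add: wsq_def)
    then show False by (simp add: wsq_hvec)
  qed
  ultimately show "P \<in> VV - {apex}" by blast
qed

lemma hom_poly_chain:
  assumes "hom_poly N m f" "\<And>i. i \<le> N \<Longrightarrow> ((\<lambda>t. c t i) has_real_derivative c' i) (at t0)"
  shows "((\<lambda>t. f (c t)) has_real_derivative (\<Sum>i\<le>N. partial_deriv i f (c t0) * c' i)) (at t0)"
proof (rule hom_poly_gradient_partial[OF assms(1)], goal_cases)
  case 1
  show ?case by (rule 1(1)) (rule assms(2))
qed

lemma hom_poly_partial_tendsto:
  fixes X :: "nat \<Rightarrow> nat \<Rightarrow> real"
  assumes "hom_poly N m f" "i \<le> N" "\<And>j. j \<le> N \<Longrightarrow> (\<lambda>n. X n j) \<longlonglongrightarrow> x j"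
  shows "(\<lambda>n. partial_deriv i f (X n)) \<longlonglongrightarrow> partial_deriv i f x"
proof (rule hom_poly_gradient_partial[OF assms(1)], goal_cases)
  case 1
  show ?case by (rule 1(2)[OF assms(2)]) (rule assms(3))
qed

subsection \<open>Irreducibility\<close>

text \<open>This is \<open>hvec\<close> with y = (p 0, p 1, p 2) / p 3 and e^(i theta) = (p 4 + i p
  5)^2 / |p 4 + i p 5|^2, multiplied by the common denominator. The ring is left general because
  \<open>Phi\<close> is applied to real numbers and to polynomials.\<close>

definition Phi :: "(nat \<Rightarrow> 'a::comm_ring_1) \<Rightarrow> nat \<Rightarrow> 'a"
  where "Phi p = (\<lambda>i. let K = p 4 * p 4 + p 5 * p 5; t = p 3 in
    if i < 3 then t * p i * K else if i = 3 then t * t * (p 4 * p 4 - p 5 * p 5)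
    else if i = 4 then t * t * (2 * p 4 * p 5)
    else (t * t + p 0 * p 0 + p 1 * p 1 + p 2 * p 2) * K)"

lemma Phi_simps:
  "Phi p 0 = p 3 * p 0 * (p 4 * p 4 + p 5 * p 5)" "Phi p 1 = p 3 * p 1 * (p 4 * p 4 + p 5 * p 5)"
  "Phi p (Suc 0) = p 3 * p 1 * (p 4 * p 4 + p 5 * p 5)"
  "Phi p 2 = p 3 * p 2 * (p 4 * p 4 + p 5 * p 5)" "Phi p 3 = p 3 * p 3 * (p 4 * p 4 - p 5 * p 5)"
  "Phi p 4 = p 3 * p 3 * (2 * p 4 * p 5)"
  "Phi p 5 = (p 3 * p 3 + p 0 * p 0 + p 1 * p 1 + p 2 * p 2) * (p 4 * p 4 + p 5 * p 5)"
  by (simp_all add: Phi_def Let_def)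

lemma FF_Phi: "FF (Phi p) = 0"
proof -
  let ?K = "p 4 * p 4 + p 5 * p 5" and ?q = "p 3 * p 3 + p 0 * p 0 + p 1 * p 1 + p 2 * p 2"
  have w: "wsq (Phi p) = (p 3)^4 * ?K\<^sup>2"
    unfolding wsq_def Phi_simps by (simp add: power2_eq_square power4_eq_xxxx algebra_simps)
  have "wsq (Phi p) + xsq (Phi p) = (p 3)\<^sup>2 * ?K\<^sup>2 * ?q"
    unfolding w unfolding xsq_def Phi_simps by (simp add: power2_eq_square power4_eq_xxxx algebra_simps)
  then have "FF (Phi p) = (?q * ?K)\<^sup>2 * ((p 3)^4 * ?K\<^sup>2) - ((p 3)\<^sup>2 * ?K\<^sup>2 * ?q)\<^sup>2"
    unfolding FF_def w Phi_simps by simp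
  also have "\<dots> = 0" by (simp add: power_mult_distrib mult_ac flip: power_mult power_add)
  finally show ?thesis .
qed

text \<open>The circle is parametrized by half angles, and \<open>p 3\<close> = 0 produces the apex.
  The condition on \<open>Phi p 5\<close> later ensures that a line of parameters is not mapped
  identically to the zero vector.\<close>

lemma Phi_surj:
  assumes "X \<in> hom_coords 5" "FF X = 0"
  obtains a p where "a \<noteq> 0" "\<And>i. i \<le> 5 \<Longrightarrow> X i = a * Phi p i" "Phi p 5 \<noteq> 0"
proof (cases "wsq X = 0")
  case True
  note X = FF_zero_apex[OF assms True]
  let ?p = "\<lambda>i::nat. if i = 0 \<or> i = 4 then 1 else 0 :: real"
  have *: "\<forall>i\<le>5. X i = X 5 * Phi ?p i" unfolding all_le_5 using X(1) by (simp add: Phi_simps)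
  show thesis by (rule that[of "X 5" ?p, OF X(2)]) (use * in blast, simp add: Phi_simps)
next
  case False
  obtain a y c s where p: "a \<noteq> 0" "c\<^sup>2 + s\<^sup>2 = 1" "X 0 = a * y 0" "X 1 = a * y 1" "X 2 = a * y 2"
    "X 3 = a * c" "X 4 = a * s" "X 5 = a * qq y"
    using assms(2) False FF_zero_param by metis
  show thesis
  proof (cases "c = -1")
    case True
    \<comment> \<open>The angle pi has to be treated apart: the half-angle vector (1 + c, s) of the
      general case vanishes here.\<close>
    let ?p = "\<lambda>i::nat. if i < 3 then y i else if i = 4 then 0 else 1 :: real"
    have "s = 0" using p(2) True by simp
    then have "\<forall>i\<le>5. X i = a * Phi ?p i"
      unfolding all_le_5 using p True by (simp add: Phi_simps qq_def power2_eq_square)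
    moreover have "Phi ?p 5 = qq y" by (simp add: Phi_simps qq_def power2_eq_square)
    ultimately show thesis using p(1) qq_pos[of y] that[of a ?p] by force
  next
    case False
    then have c: "1 + c \<noteq> 0" by simp
    \<comment> \<open>On the unit circle (1 + c + i s)^2 = 2 (1 + c) (c + i s).\<close>
    let ?p = "\<lambda>i::nat. if i < 3 then y i else if i = 3 then 1 else if i = 4 then 1 + c else s"
    have s2: "s * s = (1 - c) * (1 + c)" using p(2) by (simp add: power2_eq_square algebra_simps)
    have K: "(1 + c) * (1 + c) + s * s = 2 * (1 + c)" "(1 + c) * (1 + c) - s * s = 2 * (1 + c) * c"
      unfolding s2 by (simp_all add: algebra_simps)
    have "\<forall>i\<le>5. X i = a / (2 * (1 + c)) * Phi ?p i"
      unfolding all_le_5 using p c by (simp add: Phi_simps K qq_def power2_eq_square)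
    moreover have "Phi ?p 5 = 2 * (1 + c) * qq y" by (simp add: Phi_simps K qq_def power2_eq_square)
    ultimately show thesis using p(1) qq_pos[of y] c that[of "a / (2 * (1 + c))" ?p] by force
  qed
qed

text \<open>Two points of the cone over \<open>VV\<close> are joined by the image of a line under \<open>Phi\<close>, along which all
  forms are polynomials in one variable.\<close>

lemma projective_variety_VV: "projective_variety 5 VV"
  unfolding projective_variety_def
proof (intro conjI allI impI)
  show "proj_algebraic_set 5 VV"
    unfolding proj_algebraic_set_def VV_eq using hom_poly_FF by blast
  show "VV \<noteq> {}" using proj_pt_in_VV[OF hvec_in_hom_coords] FF_hvec by blast
  fix A B
  assume "proj_algebraic_set 5 A" "proj_algebraic_set 5 B" and V: "VV = A \<union> B"
  then obtain F H where F: "\<forall>f\<in>F. \<exists>m. hom_poly 5 m f" "A = proj_pt 5 ` {x \<in> hom_coords 5. \<forall>f\<in>F. f x = 0}"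
    and H: "\<forall>f\<in>H. \<exists>m. hom_poly 5 m f" "B = proj_pt 5 ` {x \<in> hom_coords 5. \<forall>f\<in>H. f x = 0}"
    unfolding proj_algebraic_set_def by blast
  show "VV = A \<or> VV = B"
  proof (rule ccontr)
    assume "\<not> (VV = A \<or> VV = B)"
    then obtain P Q where PQ: "P \<in> VV" "P \<notin> A" "Q \<in> VV" "Q \<notin> B" using V by blast
    obtain X where X: "X \<in> hom_coords 5" "FF X = 0" "P = proj_pt 5 X" using PQ by (auto simp: VV_def)
    obtain Y where Y: "Y \<in> hom_coords 5" "FF Y = 0" "Q = proj_pt 5 Y" using PQ by (auto simp: VV_def)
    obtain f m where f: "f \<in> F" "f X \<noteq> 0" "hom_poly 5 m f"
      using PQ(2) X F by blast
    obtain h n where h: "h \<in> H" "h Y \<noteq> 0" "hom_poly 5 n h"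
      using PQ(4) Y H by blast
    obtain a p where p: "\<And>i. i \<le> 5 \<Longrightarrow> X i = a * Phi p i" "Phi p 5 \<noteq> 0"
      using Phi_surj[OF X(1,2)] by metis
    obtain b r where r: "\<And>i. i \<le> 5 \<Longrightarrow> Y i = b * Phi r i" "Phi r 5 \<noteq> 0"
      using Phi_surj[OF Y(1,2)] by metis
    have fp: "f (Phi p) \<noteq> 0"
      using f(2) hom_poly_cong[OF f(3), of X "\<lambda>i. a * Phi p i"] p(1) hom_poly_scale[OF f(3), of a "Phi p"] by auto
    have hr: "h (Phi r) \<noteq> 0"
      using h(2) hom_poly_cong[OF h(3), of Y "\<lambda>i. b * Phi r i"] r(1) hom_poly_scale[OF h(3), of b "Phi r"] by auto
    define L :: "nat \<Rightarrow> real poly" where "L i = [:p i, r i - p i:]" for i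
    have PL: "(\<lambda>i. poly (Phi L i) s) = Phi (\<lambda>i. poly (L i) s)" for s
      by (simp add: Phi_def Let_def fun_eq_iff)
    have L01: "(\<lambda>i. poly (L i) 0) = p" "(\<lambda>i. poly (L i) 1) = r" by (simp_all add: L_def)
    obtain Qf Qh where Qf: "\<And>s. f (Phi (\<lambda>i. poly (L i) s)) = poly Qf s"
      and Qh: "\<And>s. h (Phi (\<lambda>i. poly (L i) s)) = poly Qh s"
      using hom_poly_poly[OF f(3), of "Phi L"] hom_poly_poly[OF h(3), of "Phi L"] unfolding PL by blast
    \<comment> \<open>Where \<open>Phi L 5\<close> vanishes the curve may pass through the zero
      vector, which represents no point. The third factor takes care of these parameters.\<close>
    have "poly (Qf * Qh * Phi L 5) s = 0" for s
    proof (cases "poly (Phi L 5) s = 0")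
      case False
      let ?X = "Phi (\<lambda>i. poly (L i) s)"
      have "?X 5 \<noteq> 0" using False PL[of s] by metis
      then have hc: "?X \<in> hom_coords 5" by (auto simp: hom_coords_def)
      then have "proj_pt 5 ?X \<in> A \<union> B" using proj_pt_in_VV FF_Phi V by blast
      then have "f ?X = 0 \<or> h ?X = 0"
        using proj_pt_mem_algebraic[OF F(1) hc] proj_pt_mem_algebraic[OF H(1) hc] F(2) H(2) f(1) h(1) by blast
      then show ?thesis using Qf Qh by auto
    qed simp
    then have "Qf * Qh * Phi L 5 = 0" using poly_all_0_iff_0 by blast
    moreover have "Qf \<noteq> 0" using Qf[of 0] fp L01 by auto
    moreover have "Qh \<noteq> 0" using Qh[of 1] hr L01 by auto
    moreover have "Phi L 5 \<noteq> 0" using p(2) L01(1) PL[of 0] by (metis poly_0)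
    ultimately show False by simp
  qed
qed

subsection \<open>The singular locus\<close>

lemma hom_ideal_VV:
  "f \<in> hom_ideal 5 VV \<longleftrightarrow> (\<exists>m. hom_poly 5 m f) \<and> (\<forall>x\<in>hom_coords 5. FF x = 0 \<longrightarrow> f x = 0)"
  unfolding hom_ideal_def using proj_pt_in_VV by auto

text \<open>In each x direction there is a curve in the cone with that tangent. In the w directions
  the cone instead contains pairs of points that differ in a single coordinate of w and approach the
  apex, so a mean value argument and a limit apply. In the last direction it contains the line over
  the apex.\<close>

lemma rank_apex:
  assumes f: "f \<in> hom_ideal 5 VV" and X: "\<forall>i\<le>4. X i = 0" "X 5 = l" "l \<noteq> 0" and i: "i \<le> 5"
  shows "partial_deriv i f X = 0"
proof -
  obtain m where m: "hom_poly 5 m f" and f0: "\<And>x. x \<in> hom_coords 5 \<Longrightarrow> FF x = 0 \<Longrightarrow> f x = 0"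
    using f unfolding hom_ideal_VV by blast
  note grad = hom_poly_chain[OF m] and cont = hom_poly_partial_tendsto[OF m]
  have X0: "X 0 = 0" "X 1 = 0" "X 2 = 0" "X 3 = 0" "X 4 = 0" using X(1) by auto
  have fz: "f x = 0" if "(x 5)\<^sup>2 * wsq x = (wsq x + xsq x)\<^sup>2" "x 5 \<noteq> 0" for x
    by (rule f0) (use that in \<open>auto simp: hom_coords_def FF_def\<close>)
  \<comment> \<open>For s = t^2 and s = -t^2 the point lies on the cone: both sides of the equation
    are l^4 t^4 (1 + t^2)^2.\<close>
  define C where "C k j t s = (\<lambda>i::nat. if i = k then l * t else if i = j then l * s
    else if i = 5 then l * (1 + t\<^sup>2) else 0)" for k j :: nat and t s :: real
  have Cz: "f (C k j t s) = 0" if "k < 3" "j = 3 \<or> j = 4" "s = t\<^sup>2 \<or> s = - t\<^sup>2" for k j t s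
  proof (rule fz)
    have w: "wsq (C k j t s) = l\<^sup>2 * t^4" and x: "xsq (C k j t s) = l\<^sup>2 * t\<^sup>2"
      using that by (auto simp: wsq_def xsq_def C_def power2_eq_square power4_eq_xxxx)
    have z: "C k j t s 5 = l * (1 + t\<^sup>2)" using that by (auto simp: C_def)
    show "(C k j t s 5)\<^sup>2 * wsq (C k j t s) = (wsq (C k j t s) + xsq (C k j t s))\<^sup>2"
      unfolding w x z by (simp add: power_mult_distrib algebra_simps power2_eq_square power4_eq_xxxx)
    show "C k j t s 5 \<noteq> 0" unfolding z using X(3) by (simp add: add_nonneg_eq_0_iff)
  qed
  consider "i < 3" | "i = 3 \<or> i = 4" | "i = 5" using i by linarith
  then show ?thesis
  proof cases
    case 1
    let ?c = "\<lambda>t. C i 3 t (t\<^sup>2)"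
    have "((\<lambda>t. f (?c t)) has_real_derivative
        (\<Sum>j\<le>5. partial_deriv j f (?c 0) * (if j = i then l else 0))) (at 0)"
    proof (rule grad)
      fix j :: nat
      show "((\<lambda>t. ?c t j) has_real_derivative (if j = i then l else 0)) (at 0)"
        using 1 by (cases "j = i"; cases "j = 3"; cases "j = 5") (auto simp: C_def intro!: derivative_eq_intros)
    qed
    moreover have "((\<lambda>t. f (?c t)) has_real_derivative 0) (at 0)"
      using Cz[of i 3] 1 by simp
    ultimately have "(\<Sum>j\<le>5. partial_deriv j f (?c 0) * (if j = i then l else 0)) = 0"
      by (rule DERIV_unique)
    then have "partial_deriv i f (?c 0) = 0"
      using i X(3) by (simp add: if_distrib[of "\<lambda>c. _ * c"] cong: if_cong)
    \<comment> \<open>\<open>?c 0\<close> and \<open>X\<close> may differ beyond index 5, so the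
      value is transferred by continuity along a constant sequence.\<close>
    moreover have "(\<lambda>n. partial_deriv i f (?c 0)) \<longlonglongrightarrow> partial_deriv i f X"
    proof (rule cont[OF i])
      have "\<forall>j\<le>5. ?c 0 j = X j" unfolding all_le_5 using X0 X(2) 1 by (simp add: C_def)
      then show "(\<lambda>n. ?c 0 j) \<longlonglongrightarrow> X j" if "j \<le> 5" for j using that by auto
    qed
    ultimately show ?thesis using LIMSEQ_unique tendsto_const by metis
  next
    case 2
    \<comment> \<open>Rolle's argument: \<open>f\<close> vanishes for s = t^2 and for s = -t^2, so
      its derivative in s vanishes somewhere in between.\<close>
    have "\<exists>s. \<bar>s\<bar> \<le> t\<^sup>2 \<and> partial_deriv i f (C 0 i t s) = 0" if t: "t > 0" for t
    proof -
      have D: "((\<lambda>s. f (C 0 i t s)) has_real_derivative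
          (\<Sum>j\<le>5. partial_deriv j f (C 0 i t s) * (if j = i then l else 0))) (at s)" for s
      proof (rule grad)
        fix j :: nat
        show "((\<lambda>s. C 0 i t s j) has_real_derivative (if j = i then l else 0)) (at s)"
          using 2 by (cases "j = i"; cases "j = 0"; cases "j = 5") (auto simp: C_def intro!: derivative_eq_intros)
      qed
      have "\<exists>s>-(t\<^sup>2). s < t\<^sup>2 \<and> f (C 0 i t (t\<^sup>2)) - f (C 0 i t (-(t\<^sup>2))) = (t\<^sup>2 - (-(t\<^sup>2))) *
          (\<Sum>j\<le>5. partial_deriv j f (C 0 i t s) * (if j = i then l else 0))"
        by (rule MVT2) (use t D in auto)
      then obtain s where s: "-(t\<^sup>2) < s" "s < t\<^sup>2"
        "(t\<^sup>2 - (-(t\<^sup>2))) * (\<Sum>j\<le>5. partial_deriv j f (C 0 i t s) * (if j = i then l else 0)) = 0"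
        using Cz[of 0 i] 2 by auto
      then have "(\<Sum>j\<le>5. partial_deriv j f (C 0 i t s) * (if j = i then l else 0)) = 0" using t by simp
      then have "partial_deriv i f (C 0 i t s) = 0"
        using i X(3) by (simp add: if_distrib[of "\<lambda>c. _ * c"] cong: if_cong)
      then show ?thesis using s by (intro exI[of _ s]) auto
    qed
    then obtain S where S: "\<And>t. t > 0 \<Longrightarrow> \<bar>S t\<bar> \<le> t\<^sup>2" "\<And>t. t > 0 \<Longrightarrow> partial_deriv i f (C 0 i t (S t)) = 0"
      by metis
    define T where "T n = inverse (real (Suc n))" for n
    have T: "T \<longlonglongrightarrow> 0" "\<And>n. T n > 0" unfolding T_def by (rule LIMSEQ_inverse_real_of_nat) auto
    have T2: "(\<lambda>n. (T n)\<^sup>2) \<longlonglongrightarrow> 0" using tendsto_power[OF T(1), of 2] by simp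
    have S0: "(\<lambda>n. S (T n)) \<longlonglongrightarrow> 0"
      by (rule tendsto_rabs_zero_cancel, rule tendsto_sandwich[OF _ _ tendsto_const T2])
        (use S(1) T(2) in auto)
    have "(\<lambda>n. partial_deriv i f (C 0 i (T n) (S (T n)))) \<longlonglongrightarrow> partial_deriv i f X"
    proof (rule cont[OF i])
      fix j :: nat assume "j \<le> 5"
      then have Xj: "X j = (if j = 5 then l else 0)" using X by auto
      have "(\<lambda>n. l * (1 + (T n)\<^sup>2)) \<longlonglongrightarrow> l * (1 + 0)" by (intro tendsto_intros T2)
      moreover have "(\<lambda>n. l * T n) \<longlonglongrightarrow> l * 0" by (intro tendsto_intros T)
      moreover have "(\<lambda>n. l * S (T n)) \<longlonglongrightarrow> l * 0" by (intro tendsto_intros S0)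
      ultimately show "(\<lambda>n. C 0 i (T n) (S (T n)) j) \<longlonglongrightarrow> X j"
        unfolding C_def Xj using 2 by (cases "j = 0"; cases "j = i"; cases "j = 5") auto
    qed
    then have "(\<lambda>n. 0) \<longlonglongrightarrow> partial_deriv i f X" using S(2) T(2) by simp
    then show ?thesis using LIMSEQ_unique tendsto_const by metis
  next
    case 3
    \<comment> \<open>All nonzero multiples of the last basis vector represent the apex, so
      \<open>f\<close> vanishes along them.\<close>
    have "((\<lambda>t. f ((\<lambda>j::nat. if j = 5 then t else 0))) has_real_derivative
        (\<Sum>j\<le>5. partial_deriv j f (\<lambda>j::nat. if j = 5 then l else 0) * (if j = 5 then 1 else 0))) (at l)"
      by (rule grad) (auto intro!: derivative_eq_intros)
    moreover have "((\<lambda>t. f ((\<lambda>j::nat. if j = 5 then t else 0))) has_real_derivative 0) (at l)"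
    proof (rule has_field_derivative_transform_within_open[of "\<lambda>_. 0"])
      show "open (UNIV - {0::real})" by (simp add: open_delete)
      show "0 = f (\<lambda>j. if j = 5 then t else 0)" if "t \<in> UNIV - {0}" for t
        using fz[of "\<lambda>j. if j = 5 then t else 0"] that by (simp add: wsq_def xsq_def)
    qed (use X in auto)
    ultimately have "(\<Sum>j\<le>5. partial_deriv j f (\<lambda>j::nat. if j = 5 then l else 0) * (if j = 5 then 1 else 0)) = 0"
      by (rule DERIV_unique)
    then have "partial_deriv 5 f (\<lambda>j::nat. if j = 5 then l else 0) = 0"
      by (simp add: if_distrib[of "\<lambda>c. _ * c"] cong: if_cong)
    moreover have "(\<lambda>n. partial_deriv 5 f (\<lambda>j::nat. if j = 5 then l else 0)) \<longlonglongrightarrow> partial_deriv 5 f X"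
    proof (rule cont)
      have "\<forall>j\<le>5. (if j = 5 then l else 0) = X j" unfolding all_le_5 using X0 X(2) by simp
      then show "(\<lambda>n. if j = 5 then l else 0) \<longlonglongrightarrow> X j" if "j \<le> 5" for j using that by auto
    qed simp
    ultimately show ?thesis unfolding 3 using LIMSEQ_unique tendsto_const by metis
  qed
qed

lemma partial_deriv_FF_5: "partial_deriv 5 FF X = 2 * X 5 * wsq X"
proof (rule partial_deriv_eqI)
  show "((\<lambda>t. FF (X(5 := t))) has_real_derivative 2 * X 5 * wsq X) (at (X 5))"
    unfolding FF_def wsq_def xsq_def by (auto intro!: derivative_eq_intros)
qed

text \<open>Near a point with \<open>w \<noteq> 0\<close> the cone over \<open>VV\<close> is a graph over the first five coordinates, and
  the gradients of all forms vanishing on it are normal to this graph.\<close>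

lemma rank_regular:
  assumes f: "f \<in> hom_ideal 5 VV" and X: "FF X = 0" "wsq X \<noteq> 0" and i: "i \<le> 5"
  shows "partial_deriv i f X = partial_deriv 5 f X / partial_deriv 5 FF X * partial_deriv i FF X"
proof (cases "i = 5")
  case True
  have "X 5 \<noteq> 0" using X by (auto simp: FF_def wsq_def xsq_def add_nonneg_eq_0_iff)
  then show ?thesis using True X(2) by (simp add: partial_deriv_FF_5)
next
  case False
  have X5: "X 5 \<noteq> 0" using X by (auto simp: FF_def wsq_def xsq_def add_nonneg_eq_0_iff)
  obtain m where m: "hom_poly 5 m f" and f0: "\<And>x. x \<in> hom_coords 5 \<Longrightarrow> FF x = 0 \<Longrightarrow> f x = 0"
    using f unfolding hom_ideal_VV by blast
  have W: "wsq X > 0" using X(2) by (auto simp: wsq_def intro: neq_le_trans)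
  have "(X 5 * sqrt (wsq X))\<^sup>2 = (wsq X + xsq X)\<^sup>2"
    using X W by (simp add: FF_def power_mult_distrib)
  then consider "X 5 * sqrt (wsq X) = wsq X + xsq X" | "X 5 * sqrt (wsq X) = - (wsq X + xsq X)"
    unfolding power2_eq_iff by blast
  then obtain e where e: "e = 1 \<or> e = -1" "X 5 * sqrt (wsq X) = e * (wsq X + xsq X)"
    by cases (metis mult_1, metis mult_minus1)
  define w where "w t = wsq (X(i := t))" for t
  define x where "x t = xsq (X(i := t))" for t
  \<comment> \<open>The equation solved for the last coordinate; \<open>e\<close> selects the sheet
    through \<open>X\<close>.\<close>
  define z where "z t = e * (w t + x t) / sqrt (w t)" for t
  define c where "c t = (X(i := t))(5 := z t)" for t
  have w0: "w (X i) = wsq X" and x0: "x (X i) = xsq X" by (simp_all add: w_def x_def)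
  have z0: "z (X i) = X 5"
    unfolding z_def w0 x0 using e(2) W by (metis nonzero_mult_div_cancel_right real_sqrt_gt_zero order_less_irrefl)
  then have c0: "c (X i) = X" by (simp add: c_def)
  have id: "(\<lambda>t. (X(i := t)) j) differentiable (at (X i))" for j
    by (cases "j = i") auto
  have dw: "w differentiable (at (X i))" and dx: "x differentiable (at (X i))"
    unfolding w_def wsq_def x_def xsq_def by (intro derivative_intros id)+
  have "(sqrt has_real_derivative (inverse (sqrt (wsq X)) / 2)) (at (w (X i)))"
    unfolding w0 by (rule DERIV_real_sqrt[OF W])
  then have ds: "(\<lambda>t. sqrt (w t)) differentiable (at (X i))"
    using dw unfolding real_differentiable_def by (metis DERIV_chain2)
  have "z differentiable (at (X i))"
    unfolding z_def using dw dx ds W w0 by (intro derivative_intros) auto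
  then obtain z' where z': "(z has_real_derivative z') (at (X i))" using real_differentiableE by blast
  define c' where "c' j = (if j = 5 then z' else if j = i then 1 else 0)" for j
  have dc: "((\<lambda>t. c t j) has_real_derivative c' j) (at (X i))" for j
    using z' False by (cases "j = 5"; cases "j = i") (auto simp: c_def c'_def)
  have ev: "\<forall>\<^sub>F t in nhds (X i). w t > 0"
  proof -
    have "isCont w (X i)" using dw by (rule differentiable_imp_continuous_within)
    then have "(w \<longlongrightarrow> w (X i)) (nhds (X i))" by (simp add: isCont_def tendsto_at_iff_tendsto_nhds)
    then show ?thesis by (rule order_tendstoD) (simp add: w0 W)
  qed
  have sumc: "(\<Sum>j\<le>5. g j * c' j) = g i + g 5 * z'" for g :: "nat \<Rightarrow> real"
  proof -
    have "g j * c' j = (if j = 5 then g 5 * z' else 0) + (if j = i then g i else 0)" for j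
      using False by (auto simp: c'_def)
    then show ?thesis using i by (simp add: sum.distrib)
  qed
  have key: "partial_deriv i g X + partial_deriv 5 g X * z' = 0"
    if g: "hom_poly 5 k g" "\<And>x. x \<in> hom_coords 5 \<Longrightarrow> FF x = 0 \<Longrightarrow> g x = 0" for g k
  proof -
    have "((\<lambda>t. g (c t)) has_real_derivative (\<Sum>j\<le>5. partial_deriv j g (c (X i)) * c' j)) (at (X i))"
      by (rule hom_poly_chain[OF g(1) dc])
    moreover have "((\<lambda>t. g (c t)) has_real_derivative 0) (at (X i))"
    proof (rule DERIV_cong_ev[THEN iffD1, OF refl _ refl])
      show "\<forall>\<^sub>F t in nhds (X i). 0 = g (c t)"
        using ev
      proof eventually_elim
        case (elim t)
        have wc: "wsq (c t) = w t" and xc: "xsq (c t) = x t" by (simp_all add: w_def x_def c_def wsq_def xsq_def)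
        have "(c t 5)\<^sup>2 * w t = (w t + x t)\<^sup>2"
          using elim e(1) by (auto simp: c_def z_def power_divide power_mult_distrib)
        then have "FF (c t) = 0" by (simp add: FF_def wc xc)
        moreover have "c t \<in> hom_coords 5"
        proof -
          have "c t 3 \<noteq> 0 \<or> c t 4 \<noteq> 0" using elim unfolding wc[symmetric] by (auto simp: wsq_def)
          then show ?thesis by (simp add: hom_coords_5_cases) blast
        qed
        ultimately show ?case using g(2) by simp
      qed
    qed simp
    ultimately have "(\<Sum>j\<le>5. partial_deriv j g (c (X i)) * c' j) = 0" by (rule DERIV_unique)
    then show ?thesis unfolding sumc c0 .
  qed
  \<comment> \<open>The slope \<open>z'\<close> is the same for all forms. \<open>FF\<close> itself
    determines it, because its last partial derivative is nonzero, and so \<open>z'\<close> can be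
    eliminated.\<close>
  have "partial_deriv i f X = - partial_deriv 5 f X * z'" using key[OF m f0] by simp
  moreover have "partial_deriv i FF X = - partial_deriv 5 FF X * z'" using key[OF hom_poly_FF] by simp
  moreover have "partial_deriv 5 FF X \<noteq> 0" using X5 X(2) by (simp add: partial_deriv_FF_5)
  ultimately show ?thesis by simp
qed

lemma FF_in_hom_ideal: "FF \<in> hom_ideal 5 VV"
  unfolding hom_ideal_VV using hom_poly_FF by blast

lemma jacobian_rank_VV:
  assumes X: "X \<in> hom_coords 5" "FF X = 0"
  shows "jacobian_rank 5 VV X = (if wsq X = 0 then 0 else 1)"
proof -
  let ?G = "\<lambda>f i. if i \<le> 5 then partial_deriv i f X else 0 :: real"
  show ?thesis
  proof (cases "wsq X = 0")
    case True
    have z: "?G f = 0" if "f \<in> hom_ideal 5 VV" for f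
      using rank_apex[OF that FF_zero_apex(1)[OF X True] refl FF_zero_apex(2)[OF X True]]
      by (auto simp: fun_eq_iff)
    have "?G ` hom_ideal 5 VV = {0}"
    proof
      show "?G ` hom_ideal 5 VV \<subseteq> {0}"
      proof (rule image_subsetI)
        fix f assume "f \<in> hom_ideal 5 VV"
        then have "?G f = 0" by (rule z)
        then show "?G f \<in> {0}" by (rule ssubst) (rule singletonI)
      qed
      show "{0} \<subseteq> ?G ` hom_ideal 5 VV"
        using imageI[OF FF_in_hom_ideal, of ?G] unfolding z[OF FF_in_hom_ideal] by simp
    qed
    then have "fun_vs.dim (?G ` hom_ideal 5 VV) = card ({} :: (nat \<Rightarrow> real) set)"
      by (intro fun_vs.dim_eq_card) (auto simp: fun_vs.span_empty fun_vs.span_insert_0 fun_vs.independent_empty)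
    then show ?thesis using True by (simp add: jacobian_rank_def)
  next
    case False
    have X5: "X 5 \<noteq> 0" using X False by (auto simp: FF_def wsq_def xsq_def add_nonneg_eq_0_iff)
    have n0: "?G FF \<noteq> 0"
    proof
      assume "?G FF = 0"
      then have "?G FF 5 = (0 :: nat \<Rightarrow> real) 5" by (rule fun_cong)
      then show False using X5 False by (simp add: partial_deriv_FF_5)
    qed
    have "fun_vs.dim (?G ` hom_ideal 5 VV) = card {?G FF}"
    proof (rule fun_vs.dim_eq_card)
      show "fun_vs.independent {?G FF}"
        using n0 by (simp add: fun_vs.independent_insert fun_vs.independent_empty)
      show "fun_vs.span {?G FF} = fun_vs.span (?G ` hom_ideal 5 VV)"
      proof
        show "fun_vs.span {?G FF} \<subseteq> fun_vs.span (?G ` hom_ideal 5 VV)"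
          using FF_in_hom_ideal by (intro fun_vs.span_mono) blast
        have "?G f \<in> fun_vs.span {?G FF}" if f: "f \<in> hom_ideal 5 VV" for f
        proof -
          let ?k = "partial_deriv 5 f X / partial_deriv 5 FF X"
          have "?G f = (\<lambda>j. ?k * ?G FF j)"
          proof
            fix j
            show "?G f j = ?k * ?G FF j"
              using rank_regular[OF f X(2) False, of j] by (cases "j \<le> 5") (simp_all only: if_True if_False mult_zero_right)
          qed
          moreover have "(\<lambda>j. ?k * ?G FF j) \<in> fun_vs.span {?G FF}"
            by (intro fun_vs.span_scale fun_vs.span_base) simp
          ultimately show ?thesis by simp
        qed
        then show "fun_vs.span (?G ` hom_ideal 5 VV) \<subseteq> fun_vs.span {?G FF}"
          by (intro fun_vs.span_minimal fun_vs.subspace_span) blast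
      qed
    qed
    then show ?thesis using False by (simp add: jacobian_rank_def)
  qed
qed

lemma variety_codim_VV: "variety_codim 5 VV = 1"
proof -
  have "{jacobian_rank 5 VV x |x. x \<in> hom_coords 5 \<and> proj_pt 5 x \<in> VV} = {0, 1}"
  proof (intro equalityI subsetI)
    fix r assume "r \<in> {jacobian_rank 5 VV x |x. x \<in> hom_coords 5 \<and> proj_pt 5 x \<in> VV}"
    then obtain x where "r = jacobian_rank 5 VV x" "x \<in> hom_coords 5" "FF x = 0"
      using proj_pt_in_VV by blast
    then show "r \<in> {0, 1}" using jacobian_rank_VV[of x] by simp
  next
    let ?o = "\<lambda>i::nat. if i = 5 then 1 else 0 :: real"
    have o: "?o \<in> hom_coords 5" "FF ?o = 0" "wsq ?o = 0" by (auto simp: hom_coords_def FF_def wsq_def xsq_def)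
    let ?h = "hvec (\<lambda>_. 0)"
    have "jacobian_rank 5 VV ?o = 0" "jacobian_rank 5 VV ?h = 1"
      using jacobian_rank_VV[OF o(1,2)] o(3) jacobian_rank_VV[OF hvec_in_hom_coords FF_hvec] by (auto simp: wsq_hvec)
    moreover have "proj_pt 5 ?o \<in> VV" "proj_pt 5 ?h \<in> VV"
      using proj_pt_in_VV[OF o(1)] o(2) proj_pt_in_VV[OF hvec_in_hom_coords] FF_hvec by blast+
    ultimately have "\<exists>x. 0 = jacobian_rank 5 VV x \<and> x \<in> hom_coords 5 \<and> proj_pt 5 x \<in> VV"
      "\<exists>x. 1 = jacobian_rank 5 VV x \<and> x \<in> hom_coords 5 \<and> proj_pt 5 x \<in> VV"
      using o(1) hvec_in_hom_coords[of "\<lambda>_. 0"] by (intro exI[of _ ?o] exI[of _ ?h]; simp)+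
    then show "r \<in> {jacobian_rank 5 VV x |x. x \<in> hom_coords 5 \<and> proj_pt 5 x \<in> VV}" if "r \<in> {0, 1}" for r
      using that by blast
  qed
  then show ?thesis by (simp add: variety_codim_def)
qed

lemma variety_dim_VV: "variety_dim 5 VV = 4"
  by (simp add: variety_dim_def variety_codim_VV)

lemma sing_VV: "sing 5 VV = {apex}"
proof (intro equalityI subsetI)
  fix P assume "P \<in> sing 5 VV"
  then obtain x where x: "P = proj_pt 5 x" "x \<in> hom_coords 5" "proj_pt 5 x \<in> VV" "jacobian_rank 5 VV x < 1"
    by (auto simp: sing_def variety_codim_VV)
  then show "P \<in> {apex}"
    using proj_pt_in_VV jacobian_rank_VV[of x] FF_zero_apex[of x] by (auto split: if_splits)
next
  fix P assume "P \<in> {apex}"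
  let ?o = "\<lambda>i::nat. if i = 5 then 1 else 0 :: real"
  have o: "?o \<in> hom_coords 5" "FF ?o = 0" "wsq ?o = 0" by (auto simp: hom_coords_def FF_def wsq_def xsq_def)
  have "P = proj_pt 5 ?o" "proj_pt 5 ?o \<in> VV" "jacobian_rank 5 VV ?o < 1"
    using \<open>P \<in> {apex}\<close> proj_pt_in_VV o jacobian_rank_VV[OF o(1,2)] by (auto simp: apex_def)
  then show "P \<in> sing 5 VV" unfolding sing_def variety_codim_VV using o(1) by blast
qed

section \<open>Linear families\<close>

lemma fun_sum_apply: "(sum f A) j = (\<Sum>a\<in>A. f a j)"
  by (induction A rule: infinite_finite_induct) auto

text \<open>A criterion on coefficients yields both clauses of \<open>local_param\<close>: a
  repetition in the family would itself be a relation, with coefficients 1 and -1.\<close>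

lemma family_independent:
  fixes v :: "nat \<Rightarrow> 'i \<Rightarrow> real"
  assumes ind: "\<And>c. (\<lambda>j. \<Sum>i<d. c i * v i j) = (\<lambda>j. 0) \<Longrightarrow> \<forall>i<d. c i = 0"
  shows "inj_on v {..<d} \<and> fun_vs.independent (v ` {..<d})"
proof -
  have inj: "inj_on v {..<d}"
  proof (rule inj_onI, rule ccontr)
    fix i k assume ik: "i \<in> {..<d}" "k \<in> {..<d}" "v i = v k" "i \<noteq> k"
    let ?c = "\<lambda>l. (if l = i then 1 else 0) - (if l = k then 1 else 0 :: real)"
    have "(\<Sum>l<d. ?c l * v l j) = 0" for j
    proof -
      have "(\<Sum>l<d. ?c l * v l j) = (\<Sum>l<d. (if l = i then v i j else 0) - (if l = k then v k j else 0))"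
        by (rule sum.cong) (auto simp: left_diff_distrib)
      also have "\<dots> = 0" using ik by (simp add: sum_subtractf)
      finally show ?thesis .
    qed
    then have "?c i = 0" using ind[of ?c] ik by auto
    then show False using ik by simp
  qed
  moreover have "fun_vs.independent (v ` {..<d})"
  proof
    assume "fun_vs.dependent (v ` {..<d})"
    then obtain r where r: "\<exists>w\<in>v ` {..<d}. r w \<noteq> 0" "(\<Sum>w\<in>v ` {..<d}. (\<lambda>j. r w * w j)) = 0"
      by (subst (asm) fun_vs.dependent_finite) auto
    have "(\<Sum>i<d. r (v i) * v i j) = 0" for j
    proof -
      have "(\<Sum>w\<in>v ` {..<d}. (\<lambda>j. r w * w j)) j = (\<Sum>i<d. r (v i) * v i j)"
        unfolding fun_sum_apply by (simp add: sum.reindex[OF inj])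
      then show ?thesis using r(2) by (metis zero_fun_apply)
    qed
    then have "\<forall>i<d. r (v i) = 0" by (intro ind) auto
    then show False using r(1) by auto
  qed
  ultimately show ?thesis by blast
qed

lemma span_family:
  fixes v :: "nat \<Rightarrow> 'i \<Rightarrow> real"
  shows "w \<in> fun_vs.span (v ` {..<d}) \<longleftrightarrow> (\<exists>c. w = (\<lambda>j. \<Sum>i<d. c i * v i j))"
proof
  let ?R = "{w. \<exists>c. w = (\<lambda>j. \<Sum>i<d. c i * v i j)}"
  have sub: "fun_vs.subspace ?R"
  proof (rule fun_vs.subspaceI)
    show "0 \<in> ?R" by (auto intro!: exI[of _ "\<lambda>_. 0"])
  next
    fix x y assume "x \<in> ?R" "y \<in> ?R"
    then obtain c c' where "x = (\<lambda>j. \<Sum>i<d. c i * v i j)" "y = (\<lambda>j. \<Sum>i<d. c' i * v i j)" by blast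
    then have "x + y = (\<lambda>j. \<Sum>i<d. (c i + c' i) * v i j)" by (auto simp: sum.distrib distrib_right)
    then show "x + y \<in> ?R" by (intro CollectI exI[of _ "\<lambda>i. c i + c' i"])
  next
    fix a x assume "x \<in> ?R"
    then obtain c where "x = (\<lambda>j. \<Sum>i<d. c i * v i j)" by blast
    then have "(\<lambda>j. a * x j) = (\<lambda>j. \<Sum>i<d. (a * c i) * v i j)" by (auto simp: sum_distrib_left mult.assoc)
    then show "(\<lambda>j. a * x j) \<in> ?R" by (intro CollectI exI[of _ "\<lambda>i. a * c i"])
  qed
  have "v ` {..<d} \<subseteq> ?R"
  proof
    fix x assume "x \<in> v ` {..<d}"
    then obtain k where k: "k < d" "x = v k" by blast
    have "x = (\<lambda>j. \<Sum>i<d. (if i = k then 1 else 0) * v i j)"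
    proof
      fix j
      have "(\<Sum>i<d. (if i = k then 1 else 0) * v i j) = (\<Sum>i<d. if i = k then v k j else 0)"
        by (rule sum.cong) auto
      then show "x j = (\<Sum>i<d. (if i = k then 1 else 0) * v i j)" using k by simp
    qed
    then show "x \<in> ?R" by (intro CollectI exI[of _ "\<lambda>i. if i = k then 1 else 0"])
  qed
  then have "fun_vs.span (v ` {..<d}) \<subseteq> ?R" using sub by (rule fun_vs.span_minimal)
  then show "w \<in> fun_vs.span (v ` {..<d}) \<Longrightarrow> \<exists>c. w = (\<lambda>j. \<Sum>i<d. c i * v i j)" by blast
next
  assume "\<exists>c. w = (\<lambda>j. \<Sum>i<d. c i * v i j)"
  then obtain c where "w = (\<lambda>j. \<Sum>i<d. c i * v i j)" by blast
  then have "w = (\<Sum>i<d. (\<lambda>j. c i * v i j))" by (auto simp: fun_sum_apply)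
  also have "\<dots> \<in> fun_vs.span (v ` {..<d})"
    by (intro fun_vs.span_sum fun_vs.span_scale fun_vs.span_base) auto
  finally show "w \<in> fun_vs.span (v ` {..<d})" .
qed

definition e_vec :: "nat \<Rightarrow> nat \<Rightarrow> real"
  where "e_vec i = (\<lambda>j. if j = i then 1 else 0)"

section \<open>The affine chart of projective space\<close>

definition hat :: "(nat \<Rightarrow> real) \<Rightarrow> nat \<Rightarrow> real"
  where "hat a = (\<lambda>i. if i < 5 then a i else 1)"

definition Pi5 :: "(nat \<Rightarrow> real) \<Rightarrow> nat \<times> nat \<Rightarrow> real"
  where "Pi5 a = proj_pt 5 (hat a)"

definition hatsq :: "(nat \<Rightarrow> real) \<Rightarrow> real"
  where "hatsq a = (\<Sum>l\<le>5. (hat a l)\<^sup>2)"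

text \<open>The differential of \<open>Pi5\<close> at \<open>a\<close> in the direction
  \<open>b\<close>, by the quotient rule. Only coordinates below 5 enter.\<close>

definition dPi5 :: "(nat \<Rightarrow> real) \<Rightarrow> (nat \<Rightarrow> real) \<Rightarrow> nat \<times> nat \<Rightarrow> real"
  where "dPi5 a b = (\<lambda>(j, l). if j \<le> 5 \<and> l \<le> 5 then
    (((if j < 5 then b j else 0) * hat a l + hat a j * (if l < 5 then b l else 0)) * hatsq a
      - hat a j * hat a l * (\<Sum>k<5. 2 * a k * b k)) / (hatsq a)\<^sup>2 else 0)"

definition aff :: "(nat \<times> nat \<Rightarrow> real) \<Rightarrow> nat \<Rightarrow> real"
  where "aff P k = P (k, 5) / P (5, 5)"

definition daff :: "(nat \<times> nat \<Rightarrow> real) \<Rightarrow> (nat \<times> nat \<Rightarrow> real) \<Rightarrow> nat \<Rightarrow> real"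
  where "daff P v k = (v (k, 5) * P (5, 5) - P (k, 5) * v (5, 5)) / (P (5, 5))\<^sup>2"

lemma hat_in_hom_coords: "hat a \<in> hom_coords 5"
  by (auto simp: hom_coords_def hat_def)

lemma hatsq_pos: "hatsq a > 0"
  unfolding hatsq_def by (rule sum_squares_pos[OF hat_in_hom_coords])

lemma hatsq_eq: "hatsq a = 1 + (\<Sum>k<5. (a k)\<^sup>2)"
  unfolding hatsq_def by (simp add: atMost_5 lessThan_5 hat_def)

lemma Pi5_apply: "j \<le> 5 \<Longrightarrow> l \<le> 5 \<Longrightarrow> Pi5 a (j, l) = hat a j * hat a l / hatsq a"
  by (simp add: Pi5_def proj_pt_def hatsq_def)

lemma Pi5_apply0: "\<not> (j \<le> 5 \<and> l \<le> 5) \<Longrightarrow> Pi5 a (j, l) = 0"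
  by (auto simp: Pi5_def proj_pt_def)

lemma Pi5_55: "Pi5 a (5, 5) = 1 / hatsq a" "Pi5 a (5, 5) > 0"
  using hatsq_pos[of a] by (simp_all add: Pi5_apply hat_def)

lemma aff_Pi5: "k < 5 \<Longrightarrow> aff (Pi5 a) k = a k"
  using hatsq_pos[of a] by (simp add: aff_def Pi5_apply hat_def)

lemma Pi5_cong: "(\<And>k. k < 5 \<Longrightarrow> a k = b k) \<Longrightarrow> Pi5 a = Pi5 b"
  by (metis (no_types, lifting) Pi5_def hat_def ext)

lemma dPi5_cong:
  assumes "\<And>k. k < 5 \<Longrightarrow> a k = a' k" "\<And>k. k < 5 \<Longrightarrow> b k = b' k"
  shows "dPi5 a b = dPi5 a' b'"
proof -
  have "hat a = hat a'" using assms by (auto simp: hat_def)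
  then show ?thesis using assms by (auto simp: dPi5_def hatsq_def fun_eq_iff)
qed

lemma hatsq_curve:
  assumes "\<And>k. k < 5 \<Longrightarrow> ((\<lambda>t. a t k) has_real_derivative b k) (at t0)"
  shows "((\<lambda>t. hatsq (a t)) has_real_derivative (\<Sum>k<5. 2 * a t0 k * b k)) (at t0)"
proof -
  have "((\<lambda>t. (\<Sum>k<5. (a t k)\<^sup>2)) has_real_derivative (\<Sum>k<5. 2 * a t0 k * b k)) (at t0)"
    by (rule DERIV_sum) (use assms in \<open>auto intro!: derivative_eq_intros\<close>)
  from DERIV_add[OF DERIV_const this] show ?thesis unfolding hatsq_eq by simp
qed

lemma Pi5_curve:
  assumes "\<And>k. k < 5 \<Longrightarrow> ((\<lambda>t. a t k) has_real_derivative b k) (at t0)"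
  shows "((\<lambda>t. Pi5 (a t) jl) has_real_derivative dPi5 (a t0) b jl) (at t0)"
proof -
  obtain j l where jl: "jl = (j, l)" by (cases jl)
  show ?thesis
  proof (cases "j \<le> 5 \<and> l \<le> 5")
    case True
    have h: "((\<lambda>t. hat (a t) j) has_real_derivative (if j < 5 then b j else 0)) (at t0)" for j
      using assms by (auto simp: hat_def)
    have "((\<lambda>t. hat (a t) j * hat (a t) l / hatsq (a t)) has_real_derivative
      (((if j < 5 then b j else 0) * hat (a t0) l + (if l < 5 then b l else 0) * hat (a t0) j) * hatsq (a t0)
      - hat (a t0) j * hat (a t0) l * (\<Sum>k<5. 2 * a t0 k * b k)) / (hatsq (a t0) * hatsq (a t0))) (at t0)"
      using hatsq_pos[of "a t0"]
      by (intro DERIV_divide DERIV_mult h hatsq_curve[OF assms]) auto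
    then show ?thesis
      unfolding jl using True by (simp add: Pi5_apply dPi5_def power2_eq_square mult.commute[of "hat _ _" "if _ then _ else _"])
  next
    case False
    then have "dPi5 (a t0) b jl = 0" by (simp only: jl dPi5_def prod.case if_False)
    then show ?thesis using False by (simp add: jl Pi5_apply0)
  qed
qed

lemma aff_curve:
  assumes "((\<lambda>t. P t (k, 5)) has_real_derivative v (k, 5)) (at t0)"
    "((\<lambda>t. P t (5, 5)) has_real_derivative v (5, 5)) (at t0)" "P t0 (5, 5) \<noteq> 0"
  shows "((\<lambda>t. aff (P t) k) has_real_derivative daff (P t0) v k) (at t0)"
  unfolding aff_def daff_def power2_eq_square
  using DERIV_divide[OF assms] by simp

text \<open>Differentiate \<open>aff\<close> along the image of the line a + t b in two ways. This
  avoids any computation with the entries of \<open>dPi5\<close> and makes it injective on the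
  coordinates below 5.\<close>

lemma daff_dPi5:
  assumes "k < 5"
  shows "daff (Pi5 a) (dPi5 a b) k = b k"
proof -
  let ?a = "\<lambda>t j. a j + t * b j"
  have D: "((\<lambda>t. ?a t j) has_real_derivative b j) (at 0)" for j
    by (auto intro!: derivative_eq_intros)
  have "((\<lambda>t. Pi5 (?a t) jl) has_real_derivative dPi5 a b jl) (at 0)" for jl
    using Pi5_curve[of ?a b 0, OF D] by simp
  then have "((\<lambda>t. aff (Pi5 (?a t)) k) has_real_derivative daff (Pi5 (?a 0)) (dPi5 a b) k) (at 0)"
    using Pi5_55(2)[of a] by (intro aff_curve) auto
  then have "((\<lambda>t. ?a t k) has_real_derivative daff (Pi5 a) (dPi5 a b) k) (at 0)"
    by (simp add: aff_Pi5[OF assms])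
  then show ?thesis using D[of k] by (rule DERIV_unique)
qed

lemma dPi5_linear:
  "dPi5 a (\<lambda>k. x * b k + y * b' k) = (\<lambda>jl. x * dPi5 a b jl + y * dPi5 a b' jl)"
proof
  fix jl :: "nat \<times> nat"
  obtain j l where jl: "jl = (j, l)" by (cases jl)
  have s: "(\<Sum>k<5. 2 * a k * (x * b k + y * b' k)) = x * (\<Sum>k<5. 2 * a k * b k) + y * (\<Sum>k<5. 2 * a k * b' k)"
    by (simp add: sum_distrib_left sum.distrib algebra_simps)
  show "dPi5 a (\<lambda>k. x * b k + y * b' k) jl = x * dPi5 a b jl + y * dPi5 a b' jl"
  proof (cases "j \<le> 5 \<and> l \<le> 5")
    case True
    let ?b = "\<lambda>j. if j < 5 then b j else 0" and ?b' = "\<lambda>j. if j < 5 then b' j else 0"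
    let ?r = "\<Sum>k<5. 2 * a k * b k" and ?r' = "\<Sum>k<5. 2 * a k * b' k"
    have i: "(if j < 5 then x * b j + y * b' j else 0) = x * ?b j + y * ?b' j" for j by simp
    have "dPi5 a (\<lambda>k. x * b k + y * b' k) jl =
      (((x * ?b j + y * ?b' j) * hat a l + hat a j * (x * ?b l + y * ?b' l)) * hatsq a
        - hat a j * hat a l * (x * ?r + y * ?r')) / (hatsq a)\<^sup>2"
      unfolding jl dPi5_def s i using True by simp
    also have "\<dots> = x * (((?b j * hat a l + hat a j * ?b l) * hatsq a - hat a j * hat a l * ?r) / (hatsq a)\<^sup>2)
      + y * (((?b' j * hat a l + hat a j * ?b' l) * hatsq a - hat a j * hat a l * ?r') / (hatsq a)\<^sup>2)"
    proof -
      have "(((x * p + y * p') * h + k * (x * r + y * r')) * S - k * h * (x * s + y * s')) / D =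
        x * (((p * h + k * r) * S - k * h * s) / D) + y * (((p' * h + k * r') * S - k * h * s') / D)"
        for p p' h k r r' S s s' D :: real
        by (simp add: add_divide_distrib diff_divide_distrib algebra_simps)
      then show ?thesis .
    qed
    finally show ?thesis unfolding jl dPi5_def using True by simp
  qed (auto simp: jl dPi5_def)
qed

lemma dPi5_0: "dPi5 a (\<lambda>_. 0) = (\<lambda>_. 0)"
  by (auto simp: dPi5_def fun_eq_iff)

lemma dPi5_sum:
  "finite I \<Longrightarrow> dPi5 a (\<lambda>k. \<Sum>i\<in>I. c i * b i k) = (\<lambda>jl. \<Sum>i\<in>I. c i * dPi5 a (b i) jl)"
proof (induction I rule: finite_induct)
  case (insert i I)
  have "dPi5 a (\<lambda>k. \<Sum>i\<in>insert i I. c i * b i k) = dPi5 a (\<lambda>k. c i * b i k + 1 * (\<Sum>i\<in>I. c i * b i k))"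
    using insert by simp
  also have "\<dots> = (\<lambda>jl. c i * dPi5 a (b i) jl + 1 * dPi5 a (\<lambda>k. \<Sum>i\<in>I. c i * b i k) jl)"
    by (rule dPi5_linear)
  finally show ?case using insert by simp
qed (simp add: dPi5_0)

lemma dPi5_expand: "dPi5 a b = (\<lambda>jl. \<Sum>k<5. b k * dPi5 a (e_vec k) jl)"
proof -
  have "dPi5 a b = dPi5 a (\<lambda>k. \<Sum>i<5. b i * e_vec i k)"
    by (rule dPi5_cong) (auto simp: e_vec_def if_distrib[of "\<lambda>c. _ * c"] cong: if_cong)
  then show ?thesis using dPi5_sum[of "{..<5}" a b e_vec] by simp
qed

lemma coord_vec_Pi5: "i < 5 \<Longrightarrow> coord_vec Pi5 a i = dPi5 a (e_vec i)"
  unfolding coord_vec_def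
proof
  fix jl assume "i < 5"
  show "partial_deriv i (\<lambda>a. Pi5 a jl) a = dPi5 a (e_vec i) jl"
  proof (rule partial_deriv_eqI)
    have "((\<lambda>t. Pi5 (a(i := t)) jl) has_real_derivative dPi5 (a(i := a i)) (e_vec i) jl) (at (a i))"
    proof (rule Pi5_curve)
      show "((\<lambda>t. (a(i := t)) k) has_real_derivative e_vec i k) (at (a i))" for k
        by (cases "k = i") (auto simp: e_vec_def)
    qed
    then show "((\<lambda>t. Pi5 (a(i := t)) jl) has_real_derivative dPi5 a (e_vec i) jl) (at (a i))" by simp
  qed
qed

lemma RP_55: "P \<in> RP 5 \<Longrightarrow> P (5, 5) \<noteq> 0 \<Longrightarrow> Pi5 (aff P) = P"
proof -
  assume "P \<in> RP 5" "P (5, 5) \<noteq> 0"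
  then obtain x where x: "x \<in> hom_coords 5" "P = proj_pt 5 x" "x 5 \<noteq> 0"
    by (auto simp: RP_def proj_pt_def)
  show ?thesis unfolding Pi5_def x(2)
  proof (rule proj_pt_eq_scale)
    fix i :: nat assume "i \<le> 5"
    then show "hat (aff (proj_pt 5 x)) i = inverse (x 5) * x i"
      using x sum_squares_pos[OF x(1)]
      by (cases "i = 5") (auto simp: hat_def aff_def proj_pt_def field_simps power2_eq_square)
  qed (use x in simp)
qed

lemma continuous_on_coord: "continuous_on X (\<lambda>P. P (jl :: 'i) :: real)"
  by (rule continuous_on_product_then_coordinatewise) (rule continuous_on_id)

lemma smooth_on_Pi5:
  assumes U: "openin (top_of_set (Rspace d)) U" and a: "\<And>k. k < 5 \<Longrightarrow> smooth_on d U (\<lambda>u. a u k)"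
  shows "smooth_on d U (\<lambda>u. Pi5 (a u) jl)"
proof -
  obtain j l where jl: "jl = (j, l)" by (cases jl)
  have h: "smooth_on d U (\<lambda>u. hat (a u) j)" for j
    using a smooth_on_const[OF U] by (cases "j < 5") (auto simp: hat_def)
  have s: "smooth_on d U (\<lambda>u. hatsq (a u))"
    unfolding hatsq_def by (intro smooth_on_sum[OF U] smooth_on_power[OF U] h) auto
  show ?thesis
  proof (cases "j \<le> 5 \<and> l \<le> 5")
    case True
    have "smooth_on d U (\<lambda>u. hat (a u) j * hat (a u) l / hatsq (a u))"
      using hatsq_pos by (intro smooth_on_divide[OF U] smooth_on_mult[OF U] h s) (metis less_irrefl)
    then show ?thesis using True by (simp add: jl Pi5_apply)
  qed (use smooth_on_const[OF U] in \<open>simp add: jl Pi5_apply0\<close>)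
qed

text \<open>The regular part avoids the hyperplane where the last homogeneous coordinate vanishes,
  so this single chart of projective space suffices to evaluate \<open>g\<close>.\<close>

lemma local_param_Pi5: "local_param 5 (RP 5) (Rspace 5) Pi5"
  unfolding local_param_def
proof (intro conjI ballI allI)
  let ?R = "Rspace 5" and ?f = "\<lambda>P. \<lambda>k\<in>{..<5}. aff P k"
  show o: "openin (top_of_set ?R) ?R" by simp
  have im: "Pi5 ` ?R = {P \<in> RP 5. P (5, 5) \<noteq> 0}"
  proof (intro equalityI subsetI)
    fix P assume "P \<in> Pi5 ` ?R"
    then obtain a where a: "P = Pi5 a" by blast
    have "P \<in> RP 5" unfolding a Pi5_def RP_def using hat_in_hom_coords by blast
    then show "P \<in> {P \<in> RP 5. P (5, 5) \<noteq> 0}" using Pi5_55(2)[of a] by (simp add: a)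
  next
    fix P assume "P \<in> {P \<in> RP 5. P (5, 5) \<noteq> 0}"
    then have "Pi5 (aff P) = P" using RP_55 by blast
    moreover have "Pi5 (?f P) = Pi5 (aff P)" by (rule Pi5_cong) simp
    moreover have "?f P \<in> ?R" by (auto simp: Rspace_def)
    ultimately show "P \<in> Pi5 ` ?R" by (metis imageI)
  qed
  show "openin (top_of_set (RP 5)) (Pi5 ` ?R)"
  proof -
    have "openin (top_of_set (RP 5)) (RP 5 \<inter> (\<lambda>P. P (5, 5)) -` (UNIV - {0}))"
      by (intro continuous_openin_preimage_gen continuous_on_coord) (simp add: open_delete)
    then show ?thesis unfolding im by (simp add: Int_def vimage_def)
  qed
  show sm: "smooth_on 5 ?R (\<lambda>a. Pi5 a j)" for j
    by (intro smooth_on_Pi5[OF o] smooth_on_coord[OF o])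
  show "\<exists>\<phi>. homeomorphism ?R (Pi5 ` ?R) Pi5 \<phi>"
  proof (intro exI[of _ ?f] homeomorphismI)
    show "continuous_on ?R Pi5"
      by (rule continuous_on_coordinatewise_then_product) (rule smooth_on_imp_continuous_on[OF sm])
    show "continuous_on (Pi5 ` ?R) ?f"
    proof (rule continuous_on_coordinatewise_then_product)
      fix k show "continuous_on (Pi5 ` ?R) (\<lambda>P. ?f P k)"
        using Pi5_55(2) by (cases "k < 5")
          (auto simp: aff_def im intro!: continuous_intros continuous_on_coord)
    qed
    show "?f (Pi5 a) = a" if "a \<in> ?R" for a
      using that by (auto simp: aff_Pi5 fun_eq_iff Rspace_def PiE_iff extensional_def)
    then show "Pi5 (?f P) = P" if "P \<in> Pi5 ` ?R" for P using that by force
    show "?f ` (Pi5 ` ?R) \<subseteq> ?R" by (auto simp: Rspace_def)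
  qed auto
  fix a :: "nat \<Rightarrow> real"
  have "inj_on (coord_vec Pi5 a) {..<5} \<and> fun_vs.independent (coord_vec Pi5 a ` {..<5})"
  proof (rule family_independent, intro allI impI)
    fix c i assume z: "(\<lambda>j. \<Sum>i<5. c i * coord_vec Pi5 a i j) = (\<lambda>j. 0)" and i: "i < (5::nat)"
    have "(\<Sum>i<5. c i * coord_vec Pi5 a i j) = (\<Sum>i<5. c i * dPi5 a (e_vec i) j)" for j
      by (rule sum.cong) (simp_all add: coord_vec_Pi5)
    then have "dPi5 a c = (\<lambda>j. 0)" using z dPi5_expand[of a c] by simp
    then have "c i = daff (Pi5 a) (\<lambda>_. 0) i" using daff_dPi5[OF i, of a c] by simp
    then show "c i = 0" by (simp add: daff_def)
  qed
  then show "inj_on (coord_vec Pi5 a) {..<5}" "fun_vs.independent (coord_vec Pi5 a ` {..<5})" by auto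
qed

section \<open>The regular part as a cylinder\<close>

definition MM :: "(nat \<times> nat \<Rightarrow> real) set" where "MM = VV - {apex}"

text \<open>The inversion itself: the affine coordinates of \<open>Psi u\<close> are those of the
  cylinder point divided by its squared norm.\<close>

definition A5 :: "(nat \<Rightarrow> real) \<Rightarrow> nat \<Rightarrow> real"
  where "A5 u = (\<lambda>k\<in>{..<5}. hvec u k / qq u)"

text \<open>Half the derivative of \<open>qq\<close> at \<open>u\<close> in the direction
  \<open>c\<close>.\<close>

definition ydot :: "(nat \<Rightarrow> real) \<Rightarrow> (nat \<Rightarrow> real) \<Rightarrow> real"
  where "ydot u c = u 0 * c 0 + u 1 * c 1 + u 2 * c 2"

definition dA5 :: "(nat \<Rightarrow> real) \<Rightarrow> (nat \<Rightarrow> real) \<Rightarrow> nat \<Rightarrow> real"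
  where "dA5 u c k = (if k < 3 then c k else if k = 3 then - sin (u 3) * c 3 else cos (u 3) * c 3) / qq u
    - hvec u k * (2 * ydot u c) / (qq u)\<^sup>2"

definition dPsi :: "(nat \<Rightarrow> real) \<Rightarrow> (nat \<Rightarrow> real) \<Rightarrow> nat \<times> nat \<Rightarrow> real"
  where "dPsi u c = dPi5 (A5 u) (dA5 u c)"

lemma qq_nz: "qq u \<noteq> 0"
  using qq_pos[of u] by simp

lemma A5_in_Rspace: "A5 u \<in> Rspace 5"
  by (simp add: A5_def Rspace_def)

lemma Psi_eq: "Psi u = Pi5 (A5 u)"
  unfolding Psi_def Pi5_def
proof (rule proj_pt_eq_scale)
  have "i < 5 \<or> i = 5" if "i \<le> 5" for i :: nat using that by auto
  then show "hvec u i = qq u * hat (A5 u) i" if "i \<le> 5" for i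
    using that qq_pos[of u] by (auto simp: hat_def A5_def hvec_simps)
qed (use qq_pos[of u] in simp)

text \<open>Periodicity in the angle, in a form that also covers parameters with arbitrary values
  outside the index range.\<close>

lemma Psi_cong: "(\<And>i. i < 3 \<Longrightarrow> u i = v i) \<Longrightarrow> cos (u 3) = cos (v 3) \<Longrightarrow> sin (u 3) = sin (v 3) \<Longrightarrow> Psi u = Psi v"
  and dPsi_cong: "(\<And>i. i < 3 \<Longrightarrow> u i = v i) \<Longrightarrow> cos (u 3) = cos (v 3) \<Longrightarrow> sin (u 3) = sin (v 3) \<Longrightarrow> dPsi u c = dPsi v c"
proof -
  assume *: "\<And>i. i < 3 \<Longrightarrow> u i = v i" "cos (u 3) = cos (v 3)" "sin (u 3) = sin (v 3)"
  have q: "qq u = qq v" and yd: "ydot u c = ydot v c" using *(1)[of 0] *(1)[of 1] *(1)[of 2] by (simp_all add: qq_def ydot_def)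
  then have h: "hvec u = hvec v" using * by (auto simp: hvec_def)
  show "Psi u = Psi v" by (simp add: Psi_def h)
  have "dA5 u c = dA5 v c" by (rule ext) (simp add: dA5_def q h yd *)
  then show "dPsi u c = dPsi v c" by (simp add: dPsi_def A5_def h q)
qed

lemma Psi_in_MM: "Psi u \<in> MM"
proof -
  obtain t where t: "0 \<le> t" "t < 2 * pi" "cos (u 3) = cos t" "sin (u 3) = sin t"
    using sincos_total_2pi[of "cos (u 3)" "sin (u 3)"] by auto
  define v where "v = (\<lambda>i\<in>{..<4}. if i < 3 then u i else t)"
  have "Psi u = Psi v" using t by (intro Psi_cong) (auto simp: v_def)
  moreover have "v \<in> strip" using t by (simp add: strip_def v_def Rspace_def)
  ultimately show ?thesis unfolding MM_def VV_minus_apex by blast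
qed

lemma MM_cases: "P \<in> MM \<Longrightarrow> \<exists>u\<in>strip. P = Psi u"
  unfolding MM_def VV_minus_apex by blast

lemma MM_55: "P \<in> MM \<Longrightarrow> P (5, 5) > 0"
  using MM_cases[of P] Pi5_55(2) by (auto simp: Psi_eq)

lemma aff_Psi: "k < 5 \<Longrightarrow> aff (Psi u) k = hvec u k / qq u"
  by (simp add: Psi_eq aff_Pi5 A5_def)

lemma daff_dPsi: "k < 5 \<Longrightarrow> daff (Psi u) (dPsi u c) k = dA5 u c k"
  by (simp add: Psi_eq dPsi_def daff_dPi5)

text \<open>The chart is conformal for the Euclidean metric of the affine coordinates.\<close>

lemma norm_dA5: "(\<Sum>k<5. (dA5 u c k)\<^sup>2) = (\<Sum>i<4. (c i)\<^sup>2) / (qq u)\<^sup>2"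
proof -
  let ?q = "qq u" and ?y = "ydot u c"
  have cs: "(cos (u 3))\<^sup>2 = 1 - (sin (u 3))\<^sup>2" by (simp add: cos_squared_eq)
  have "?q\<^sup>2 * ?q\<^sup>2 * (\<Sum>k<5. (dA5 u c k)\<^sup>2) = (\<Sum>k<5. (?q\<^sup>2 * dA5 u c k)\<^sup>2)"
    by (simp add: sum_distrib_left power_mult_distrib power2_eq_square mult_ac)
  also have "\<dots> = (\<Sum>k<5. (?q * (if k < 3 then c k else if k = 3 then - sin (u 3) * c 3 else cos (u 3) * c 3)
      - hvec u k * (2 * ?y))\<^sup>2)"
  proof (rule sum.cong[OF refl])
    fix k :: nat
    have "?q\<^sup>2 * dA5 u c k = ?q * (if k < 3 then c k else if k = 3 then - sin (u 3) * c 3 else cos (u 3) * c 3)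
      - hvec u k * (2 * ?y)"
      unfolding dA5_def right_diff_distrib using qq_pos[of u] by (simp add: power2_eq_square)
    then show "(?q\<^sup>2 * dA5 u c k)\<^sup>2 = (?q * (if k < 3 then c k else if k = 3 then - sin (u 3) * c 3 else cos (u 3) * c 3)
      - hvec u k * (2 * ?y))\<^sup>2" by simp
  qed
  also have "\<dots> = (?q * c 0 - u 0 * (2 * ?y))\<^sup>2 + (?q * c 1 - u 1 * (2 * ?y))\<^sup>2 + (?q * c 2 - u 2 * (2 * ?y))\<^sup>2
      + (?q * (- sin (u 3) * c 3) - cos (u 3) * (2 * ?y))\<^sup>2 + (?q * (cos (u 3) * c 3) - sin (u 3) * (2 * ?y))\<^sup>2"
    by (simp add: lessThan_5 hvec_simps)
  also have "\<dots> = ?q\<^sup>2 * ((c 0)\<^sup>2 + (c 1)\<^sup>2 + (c 2)\<^sup>2) - 4 * ?q * ?y * ydot u c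
      + 4 * ?y\<^sup>2 * ((u 0)\<^sup>2 + (u 1)\<^sup>2 + (u 2)\<^sup>2)
      + ((sin (u 3))\<^sup>2 + (cos (u 3))\<^sup>2) * (?q\<^sup>2 * (c 3)\<^sup>2 + 4 * ?y\<^sup>2)"
  proof -
    have "(q * c0 - u0 * (2 * y))\<^sup>2 + (q * c1 - u1 * (2 * y))\<^sup>2 + (q * c2 - u2 * (2 * y))\<^sup>2
      + (q * (- s * c3) - r * (2 * y))\<^sup>2 + (q * (r * c3) - s * (2 * y))\<^sup>2 =
      q\<^sup>2 * (c0\<^sup>2 + c1\<^sup>2 + c2\<^sup>2) - 4 * q * y * (u0 * c0 + u1 * c1 + u2 * c2)
      + 4 * y\<^sup>2 * (u0\<^sup>2 + u1\<^sup>2 + u2\<^sup>2) + (s\<^sup>2 + r\<^sup>2) * (q\<^sup>2 * c3\<^sup>2 + 4 * y\<^sup>2)"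
      for q y c0 c1 c2 c3 u0 u1 u2 s r :: real
      by (simp add: power2_eq_square algebra_simps)
    then show ?thesis unfolding ydot_def .
  qed
  \<comment> \<open>The terms with the square of \<open>ydot u c\<close> have the total coefficient
    4 (|y|^2 + 1 - q) = 0.\<close>
  also have "\<dots> = ?q\<^sup>2 * (\<Sum>i<4. (c i)\<^sup>2)"
    by (simp add: lessThan_4 qq_def power2_eq_square algebra_simps)
  finally have *: "?q\<^sup>2 * ?q\<^sup>2 * (\<Sum>k<5. (dA5 u c k)\<^sup>2) = ?q\<^sup>2 * (\<Sum>i<4. (c i)\<^sup>2)" .
  have "?q\<^sup>2 > 0" using qq_pos[of u] by simp
  then have "?q\<^sup>2 * (\<Sum>k<5. (dA5 u c k)\<^sup>2) = (\<Sum>i<4. (c i)\<^sup>2)"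
    using iffD1[OF mult_left_cancel *[unfolded mult.assoc]] by simp
  then show ?thesis using \<open>?q\<^sup>2 > 0\<close> by (simp add: field_simps)
qed

lemma qq_curve:
  assumes "\<And>k. k < 4 \<Longrightarrow> ((\<lambda>t. T t k) has_real_derivative c k) (at t0)"
  shows "((\<lambda>t. qq (T t)) has_real_derivative 2 * ydot (T t0) c) (at t0)"
  unfolding qq_def ydot_def
  by (auto intro!: derivative_eq_intros assms)

lemma hvec_curve:
  assumes "\<And>k. k < 4 \<Longrightarrow> ((\<lambda>t. T t k) has_real_derivative c k) (at t0)" "k < 5"
  shows "((\<lambda>t. hvec (T t) k) has_real_derivative
    (if k < 3 then c k else if k = 3 then - sin (T t0 3) * c 3 else cos (T t0 3) * c 3)) (at t0)"
proof -
  consider "k < 3" | "k = 3" | "k = 4" using assms(2) by linarith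
  then show ?thesis
    by cases (use assms(1)[of k] assms(1)[of 3] in \<open>auto simp: hvec_def intro!: derivative_eq_intros\<close>)
qed

lemma Psi_curve:
  assumes "\<And>k. k < 4 \<Longrightarrow> ((\<lambda>t. T t k) has_real_derivative c k) (at t0)"
  shows "((\<lambda>t. Psi (T t) jl) has_real_derivative dPsi (T t0) c jl) (at t0)"
  unfolding Psi_eq dPsi_def
proof (rule Pi5_curve)
  fix k :: nat assume k: "k < 5"
  have "((\<lambda>t. hvec (T t) k / qq (T t)) has_real_derivative
      ((if k < 3 then c k else if k = 3 then - sin (T t0 3) * c 3 else cos (T t0 3) * c 3) * qq (T t0)
        - hvec (T t0) k * (2 * ydot (T t0) c)) / (qq (T t0) * qq (T t0))) (at t0)"
    using qq_pos[of "T t0"] by (intro DERIV_divide hvec_curve qq_curve assms k) auto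
  also have "((if k < 3 then c k else if k = 3 then - sin (T t0 3) * c 3 else cos (T t0 3) * c 3) * qq (T t0)
        - hvec (T t0) k * (2 * ydot (T t0) c)) / (qq (T t0) * qq (T t0)) = dA5 (T t0) c k"
    using qq_pos[of "T t0"] unfolding dA5_def by (simp add: diff_divide_distrib power2_eq_square)
  finally show "((\<lambda>t. A5 (T t) k) has_real_derivative dA5 (T t0) c k) (at t0)"
    using k by (simp add: A5_def)
qed

lemma dA5_expand: "dA5 u c k = (\<Sum>i<4. c i * dA5 u (e_vec i) k)"
proof -
  have e: "ydot u c = (\<Sum>i<4. c i * ydot u (e_vec i))" by (simp add: lessThan_4 ydot_def e_vec_def)
  have f: "(if k < 3 then c k else if k = 3 then - sin (u 3) * c 3 else cos (u 3) * c 3) =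
    (\<Sum>i<4. c i * (if k < 3 then e_vec i k else if k = 3 then - sin (u 3) * e_vec i 3 else cos (u 3) * e_vec i 3))"
  proof -
    consider "k = 0" | "k = 1" | "k = 2" | "\<not> k < 3" by linarith
    then show ?thesis by cases (auto simp: lessThan_4 e_vec_def)
  qed
  show ?thesis
    unfolding dA5_def e f sum_distrib_left sum_divide_distrib sum_subtractf[symmetric]
    by (rule sum.cong) (auto simp: algebra_simps)
qed

lemma dPsi_expand: "dPsi u c = (\<lambda>jl. \<Sum>i<4. c i * dPsi u (e_vec i) jl)"
proof -
  have "dPsi u c = dPi5 (A5 u) (\<lambda>k. \<Sum>i<4. c i * dA5 u (e_vec i) k)"
    unfolding dPsi_def by (rule arg_cong[of _ _ "dPi5 (A5 u)"]) (rule ext, rule dA5_expand)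
  then show ?thesis unfolding dPsi_def using dPi5_sum[of "{..<4}" "A5 u" c "\<lambda>i. dA5 u (e_vec i)"] by simp
qed

lemma dPsi_linear: "dPsi u (\<lambda>i. x * c i + y * c' i) = (\<lambda>jl. x * dPsi u c jl + y * dPsi u c' jl)"
  by (subst (1 2 3) dPsi_expand) (auto simp: sum_distrib_left sum.distrib algebra_simps)

lemma coord_vec_Psi: "i < 4 \<Longrightarrow> coord_vec Psi u i = dPsi u (e_vec i)"
  unfolding coord_vec_def
proof
  fix jl assume "i < 4"
  show "partial_deriv i (\<lambda>a. Psi a jl) u = dPsi u (e_vec i) jl"
  proof (rule partial_deriv_eqI)
    have "((\<lambda>t. Psi (u(i := t)) jl) has_real_derivative dPsi (u(i := u i)) (e_vec i) jl) (at (u i))"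
    proof (rule Psi_curve)
      show "((\<lambda>t. (u(i := t)) k) has_real_derivative e_vec i k) (at (u i))" for k
        by (cases "k = i") (auto simp: e_vec_def)
    qed
    then show "((\<lambda>t. Psi (u(i := t)) jl) has_real_derivative dPsi u (e_vec i) jl) (at (u i))" by simp
  qed
qed

text \<open>By conformality a vector with zero image has zero length.\<close>

lemma dPsi_inj:
  assumes "\<And>k. k < 5 \<Longrightarrow> dA5 u c k = 0" "i < 4"
  shows "c i = 0"
proof -
  have "(\<Sum>i<4. (c i)\<^sup>2) / (qq u)\<^sup>2 = 0" using assms(1) norm_dA5[of u c] by simp
  then have "(\<Sum>i<4. (c i)\<^sup>2) = 0" using qq_pos[of u] by simp
  then show ?thesis using assms(2) by (simp add: sum_nonneg_eq_0_iff)
qed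

lemma dPsi_eq_0D:
  assumes "dPsi u c = (\<lambda>_. 0)" "i < 4"
  shows "c i = 0"
proof (rule dPsi_inj[OF _ assms(2)])
  show "dA5 u c k = 0" if "k < 5" for k
    using daff_dPsi[OF that, of u c] assms(1) by (simp add: daff_def)
qed

subsection \<open>Inverse charts\<close>

text \<open>|w| in affine coordinates. On the regular part it equals 1/q, hence is positive and
  measures how close a point is to the apex; the cutoffs will be functions of it.\<close>

definition wnorm :: "(nat \<times> nat \<Rightarrow> real) \<Rightarrow> real"
  where "wnorm P = sqrt ((aff P 3)\<^sup>2 + (aff P 4)\<^sup>2)"

text \<open>The half-angle formula for the angle relative to \<open>m\<close>, valid where \<open>w\<close> is not a negative multiple of \<open>e\<^sup>i\<^sup>m\<close>.\<close>

definition den :: "real \<Rightarrow> (nat \<times> nat \<Rightarrow> real) \<Rightarrow> real"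
  where "den m P = wnorm P + aff P 3 * cos m + aff P 4 * sin m"

definition Tm :: "real \<Rightarrow> (nat \<times> nat \<Rightarrow> real) \<Rightarrow> nat \<Rightarrow> real"
  where "Tm m P = (\<lambda>i\<in>{..<4}. if i < 3 then aff P i / wnorm P
    else m + 2 * arctan ((aff P 4 * cos m - aff P 3 * sin m) / den m P))"

definition Um :: "real \<Rightarrow> (nat \<Rightarrow> real) set"
  where "Um m = {u \<in> Rspace 4. \<bar>u 3 - m\<bar> < pi}"

lemma Tm_in_Rspace: "Tm m P \<in> Rspace 4"
  by (simp add: Tm_def Rspace_def)

lemma wnorm_Psi: "wnorm (Psi u) = 1 / qq u"
proof -
  have "(hvec u 3 / qq u)\<^sup>2 + (hvec u 4 / qq u)\<^sup>2 = (1 / qq u)\<^sup>2"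
    by (simp add: power_divide hvec_simps flip: add_divide_distrib)
  then show ?thesis using qq_pos[of u] by (simp add: wnorm_def aff_Psi)
qed

lemma den_Psi: "den m (Psi u) = (1 + cos (u 3 - m)) / qq u"
  by (simp add: den_def wnorm_Psi aff_Psi hvec_simps cos_diff add_divide_distrib)

lemma wnorm_pos: "P \<in> MM \<Longrightarrow> wnorm P > 0"
  using MM_cases[of P] qq_pos by (auto simp: wnorm_Psi)

lemma Tm_Psi_y: "i < 3 \<Longrightarrow> Tm m (Psi u) i = u i"
  using qq_pos[of u] by (simp add: Tm_def wnorm_Psi aff_Psi hvec_def)

lemma Tm_Psi_angle: "Tm m (Psi u) 3 = m + 2 * arctan (sin (u 3 - m) / (1 + cos (u 3 - m)))"
proof -
  have "aff (Psi u) 4 * cos m - aff (Psi u) 3 * sin m = sin (u 3 - m) / qq u"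
    by (simp add: aff_Psi hvec_simps sin_diff diff_divide_distrib)
  then show ?thesis using qq_pos[of u] by (simp add: Tm_def den_Psi)
qed

text \<open>With t = sin / (1 + cos) one has t^2 = (1 - cos) / (1 + cos). Arguing with this identity
  instead of t = tan(tau/2) imposes no range on tau.\<close>

lemma double_arctan:
  assumes "1 + cos \<tau> > 0"
  shows "cos (2 * arctan (sin \<tau> / (1 + cos \<tau>))) = cos \<tau>"
    and "sin (2 * arctan (sin \<tau> / (1 + cos \<tau>))) = sin \<tau>"
proof -
  let ?t = "sin \<tau> / (1 + cos \<tau>)"
  have s2: "(sin \<tau>)\<^sup>2 = (1 - cos \<tau>) * (1 + cos \<tau>)"
    by (simp add: sin_squared_eq power2_eq_square algebra_simps)
  have t2: "?t\<^sup>2 = (1 - cos \<tau>) / (1 + cos \<tau>)"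
    using assms unfolding power_divide s2 by (simp add: power2_eq_square)
  have q: "1 + ?t\<^sup>2 = 2 / (1 + cos \<tau>)" unfolding t2 using assms by (simp add: field_simps)
  have ct: "(cos (arctan t))\<^sup>2 = 1 / (1 + t\<^sup>2)" for t :: real
    by (simp add: cos_arctan power_divide)
  have c2: "(cos (arctan ?t))\<^sup>2 = (1 + cos \<tau>) / 2"
    unfolding ct[of ?t] q by simp
  show "cos (2 * arctan ?t) = cos \<tau>"
    unfolding cos_double_cos c2 by (simp add: field_simps)
  have "sin (arctan ?t) = ?t * cos (arctan ?t)" by (simp add: sin_arctan cos_arctan)
  then have "sin (2 * arctan ?t) = 2 * ?t * (cos (arctan ?t))\<^sup>2"
    by (simp add: sin_double power2_eq_square)
  then show "sin (2 * arctan ?t) = sin \<tau>" unfolding c2 using assms by simp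
qed

lemma Tm_Psi:
  assumes "u \<in> Um m"
  shows "Tm m (Psi u) = u"
proof -
  let ?\<tau> = "u 3 - m"
  have \<tau>: "- pi < ?\<tau>" "?\<tau> < pi" using assms by (auto simp: Um_def abs_less_iff)
  have "tan (?\<tau> / 2) = sin (2 * (?\<tau> / 2)) / (cos (2 * (?\<tau> / 2)) + 1)" by (rule tan_half)
  moreover have "2 * (?\<tau> / 2) = ?\<tau>" by simp
  ultimately have "sin ?\<tau> / (1 + cos ?\<tau>) = tan (?\<tau> / 2)" by (simp only: add.commute)
  then have "arctan (sin ?\<tau> / (1 + cos ?\<tau>)) = ?\<tau> / 2" using \<tau> by (simp add: arctan_tan)
  then have "Tm m (Psi u) 3 = u 3" by (simp add: Tm_Psi_angle)
  have "i < 3 \<or> i = 3 \<or> i \<ge> 4" for i :: nat by linarith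
  moreover have "Tm m (Psi u) i = u i" if "i \<ge> 4" for i
    using that assms by (simp add: Tm_def Um_def Rspace_def PiE_iff extensional_def)
  ultimately show ?thesis using \<open>Tm m (Psi u) 3 = u 3\<close> Tm_Psi_y by (metis ext)
qed

lemma Psi_Tm:
  assumes "P \<in> MM" "den m P > 0"
  shows "Psi (Tm m P) = P" "Tm m P \<in> Um m"
proof -
  obtain u where u: "P = Psi u" using MM_cases[OF assms(1)] by blast
  let ?\<tau> = "u 3 - m"
  have "1 + cos ?\<tau> > 0" using assms(2) qq_pos[of u] unfolding u den_Psi by (simp add: zero_less_divide_iff)
  note da = double_arctan[OF this]
  show "Psi (Tm m P) = P" unfolding u
  proof (rule Psi_cong)
    show "Tm m (Psi u) i = u i" if "i < 3" for i using Tm_Psi_y[OF that] .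
    have "cos (m + ?\<tau>) = cos (u 3)" "sin (m + ?\<tau>) = sin (u 3)" by simp_all
    then show "cos (Tm m (Psi u) 3) = cos (u 3)" "sin (Tm m (Psi u) 3) = sin (u 3)"
      unfolding Tm_Psi_angle cos_add sin_add da by simp_all
  qed
  show "Tm m P \<in> Um m"
    using arctan_bounded[of "sin ?\<tau> / (1 + cos ?\<tau>)"] Tm_in_Rspace
    unfolding u Um_def by (simp add: Tm_Psi_angle abs_less_iff)
qed

lemma den_pos_Um: "u \<in> Um m \<Longrightarrow> den m (Psi u) > 0"
proof -
  assume u: "u \<in> Um m"
  have "cos (u 3 - m) > -1"
  proof -
    have "cos (\<bar>u 3 - m\<bar>) > cos pi" by (rule cos_monotone_0_pi) (use u in \<open>auto simp: Um_def\<close>)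
    then show ?thesis by (simp add: cos_abs_real)
  qed
  then show ?thesis using qq_pos[of u] by (simp add: den_Psi)
qed

text \<open>The two denominators add up to 2/q, so at every point one of the two angles is
  available.\<close>

lemma den_0_or_pi: "P \<in> MM \<Longrightarrow> den 0 P > 0 \<or> den pi P > 0"
proof -
  assume "P \<in> MM"
  then obtain u where u: "P = Psi u" using MM_cases by blast
  have "den 0 P + den pi P = 2 / qq u"
    unfolding u den_Psi by (simp add: flip: add_divide_distrib)
  then have "den 0 P + den pi P > 0" using qq_pos[of u] by simp
  then show ?thesis by linarith
qed

lemma Psi_image_Um: "Psi ` Um m = {P \<in> MM. den m P > 0}"
proof (intro equalityI subsetI)
  fix P assume "P \<in> Psi ` Um m"
  then show "P \<in> {P \<in> MM. den m P > 0}" using Psi_in_MM den_pos_Um by auto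
next
  fix P assume "P \<in> {P \<in> MM. den m P > 0}"
  then have "P = Psi (Tm m P)" "Tm m P \<in> Um m" using Psi_Tm by auto
  then show "P \<in> Psi ` Um m" by (rule image_eqI)
qed

lemma continuous_on_aff: "continuous_on MM (\<lambda>P. aff P k)"
  unfolding aff_def by (intro continuous_on_divide continuous_on_coord) (use MM_55 in force)

lemma continuous_on_wnorm: "continuous_on MM wnorm"
  unfolding wnorm_def by (intro continuous_intros continuous_on_aff)

lemma continuous_on_den: "continuous_on MM (den m)"
  unfolding den_def by (intro continuous_intros continuous_on_aff continuous_on_wnorm)

lemma continuous_on_Tm: "continuous_on {P \<in> MM. den m P > 0} (Tm m)"
proof (rule continuous_on_coordinatewise_then_product)
  fix i :: nat
  let ?S = "{P \<in> MM. den m P > 0}"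
  have c: "continuous_on ?S (\<lambda>P. aff P k)" "continuous_on ?S wnorm" "continuous_on ?S (den m)" for k
    using continuous_on_aff continuous_on_wnorm continuous_on_den by (auto intro: continuous_on_subset)
  consider "i < 3" | "i = 3" | "i \<ge> 4" by linarith
  then show "continuous_on ?S (\<lambda>P. Tm m P i)"
  proof cases
    case 1
    have "continuous_on ?S (\<lambda>P. aff P i / wnorm P)"
      by (intro continuous_on_divide c) (use wnorm_pos in force)
    then show ?thesis using 1 by (simp add: Tm_def)
  next
    case 2
    have "continuous_on ?S (\<lambda>P. m + 2 * arctan ((aff P 4 * cos m - aff P 3 * sin m) / den m P))"
      by (intro continuous_intros c) auto
    then show ?thesis using 2 by (simp add: Tm_def)
  qed (simp add: Tm_def)
qed

lemma openin_den_pos: "openin (top_of_set MM) {P \<in> MM. den m P > 0}"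
proof -
  have "openin (top_of_set MM) (MM \<inter> den m -` {0<..})"
    by (intro continuous_openin_preimage_gen continuous_on_den) simp
  also have "MM \<inter> den m -` {0<..} = {P \<in> MM. den m P > 0}" by auto
  finally show ?thesis .
qed

lemma openin_Rspace: "openin (top_of_set (Rspace d)) (Rspace d)"
  by simp

lemma openin_Um: "openin (top_of_set (Rspace 4)) (Um m)"
proof -
  have "openin (top_of_set (Rspace 4)) (Rspace 4 \<inter> (\<lambda>u. u 3) -` {m - pi<..<m + pi})"
    by (intro continuous_openin_preimage_gen continuous_on_coord) simp
  also have "Rspace 4 \<inter> (\<lambda>u. u 3) -` {m - pi<..<m + pi} = Um m"
    by (auto simp: Um_def abs_less_iff)
  finally show ?thesis .
qed

lemma smooth_on_qq: "openin (top_of_set (Rspace d)) U \<Longrightarrow> smooth_on d U qq"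
  unfolding qq_def[abs_def]
  by (intro smooth_on_add smooth_on_power smooth_on_const smooth_on_coord)

lemma smooth_on_A5:
  assumes U: "openin (top_of_set (Rspace d)) U" and k: "k < 5"
  shows "smooth_on d U (\<lambda>u. A5 u k)"
proof -
  have "smooth_on d U (\<lambda>u. hvec u k)"
  proof -
    consider "k < 3" | "k = 3" | "k = 4" using k by linarith
    then show ?thesis
      by cases (auto simp: hvec_def intro!: smooth_on_coord[OF U] smooth_on_sin_cos[OF U smooth_on_coord[OF U]])
  qed
  then have "smooth_on d U (\<lambda>u. hvec u k / qq u)"
    by (intro smooth_on_divide[OF U] smooth_on_qq[OF U] qq_nz)
  then show ?thesis using k by (simp add: A5_def)
qed

lemma smooth_on_Psi: "openin (top_of_set (Rspace d)) U \<Longrightarrow> smooth_on d U (\<lambda>u. Psi u jl)"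
  unfolding Psi_eq by (intro smooth_on_Pi5 smooth_on_A5)

lemma local_param_Psi: "local_param 4 MM (Um m) Psi"
  unfolding local_param_def
proof (intro conjI ballI allI)
  show "openin (top_of_set (Rspace 4)) (Um m)" by (rule openin_Um)
  show "openin (top_of_set MM) (Psi ` Um m)" unfolding Psi_image_Um by (rule openin_den_pos)
  show sm: "smooth_on 4 (Um m) (\<lambda>u. Psi u j)" for j by (rule smooth_on_Psi[OF openin_Um])
  show "\<exists>\<phi>. homeomorphism (Um m) (Psi ` Um m) Psi \<phi>"
  proof (intro exI[of _ "Tm m"] homeomorphismI)
    show "continuous_on (Um m) Psi"
      by (rule continuous_on_coordinatewise_then_product) (rule smooth_on_imp_continuous_on[OF sm])
    show "continuous_on (Psi ` Um m) (Tm m)" unfolding Psi_image_Um by (rule continuous_on_Tm)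
    show "Tm m ` Psi ` Um m \<subseteq> Um m" using Tm_Psi by force
  qed (use Tm_Psi in auto)
  fix u
  have "inj_on (coord_vec Psi u) {..<4} \<and> fun_vs.independent (coord_vec Psi u ` {..<4})"
  proof (rule family_independent, intro allI impI)
    fix c i assume z: "(\<lambda>j. \<Sum>i<4. c i * coord_vec Psi u i j) = (\<lambda>j. 0)" and i: "i < (4::nat)"
    have "(\<Sum>i<4. c i * coord_vec Psi u i j) = (\<Sum>i<4. c i * dPsi u (e_vec i) j)" for j
      by (rule sum.cong) (simp_all add: coord_vec_Psi)
    then have "dPsi u c = (\<lambda>j. 0)" using z dPsi_expand[of u c] by simp
    then show "c i = 0" using i by (rule dPsi_eq_0D)
  qed
  then show "inj_on (coord_vec Psi u) {..<4}" "fun_vs.independent (coord_vec Psi u ` {..<4})" by auto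
qed

subsection \<open>Transition maps\<close>

context
  fixes U and \<psi> :: "(nat \<Rightarrow> real) \<Rightarrow> nat \<times> nat \<Rightarrow> real"
  assumes lp: "local_param 4 MM U \<psi>"
begin

lemma lp_openin: "openin (top_of_set (Rspace 4)) U"
  and lp_smooth: "smooth_on 4 U (\<lambda>u. \<psi> u jl)"
  using lp unfolding local_param_def by blast+

lemma lp_MM: "u \<in> U \<Longrightarrow> \<psi> u \<in> MM"
  using lp unfolding local_param_def by (blast dest: openin_imp_subset)

lemma lp_inj: "inj_on \<psi> U"
  using lp unfolding local_param_def homeomorphism_def by (metis inj_on_inverseI)

lemma lp_continuous: "continuous_on U \<psi>"
  using lp unfolding local_param_def homeomorphism_def by blast

text \<open>The part of a given chart on which the angle relative to \<open>m\<close> exists. The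
  values 0 and pi of \<open>m\<close> suffice to cover the chart.\<close>

definition trans_dom :: "real \<Rightarrow> (nat \<Rightarrow> real) set"
  where "trans_dom m = {u \<in> U. den m (\<psi> u) > 0}"

lemma trans_dom_subset: "trans_dom m \<subseteq> U"
  by (auto simp: trans_dom_def)

lemma openin_trans_dom: "openin (top_of_set (Rspace 4)) (trans_dom m)"
proof -
  have c: "continuous_on U (\<lambda>u. den m (\<psi> u))"
    by (rule continuous_on_compose2[OF continuous_on_den lp_continuous]) (use lp_MM in auto)
  have "openin (top_of_set U) (U \<inter> (\<lambda>u. den m (\<psi> u)) -` {0<..})"
    by (intro continuous_openin_preimage_gen c) simp
  also have "U \<inter> (\<lambda>u. den m (\<psi> u)) -` {0<..} = trans_dom m" by (auto simp: trans_dom_def)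
  finally show ?thesis using lp_openin by (rule openin_trans)
qed

lemma trans_cover: "u \<in> U \<Longrightarrow> u \<in> trans_dom 0 \<or> u \<in> trans_dom pi"
  using den_0_or_pi[OF lp_MM] by (auto simp: trans_dom_def)

lemma smooth_on_aff: "smooth_on 4 U (\<lambda>u. aff (\<psi> u) k)"
  unfolding aff_def by (intro smooth_on_divide[OF lp_openin] lp_smooth) (use lp_MM MM_55 in force)

lemma smooth_on_wnorm: "smooth_on 4 U (\<lambda>u. wnorm (\<psi> u))"
  unfolding wnorm_def
proof (intro smooth_on_sqrt[OF lp_openin] smooth_on_add[OF lp_openin] smooth_on_power[OF lp_openin] smooth_on_aff)
  fix u assume "u \<in> U"
  then have "wnorm (\<psi> u) > 0" using wnorm_pos lp_MM by blast
  then show "0 < (aff (\<psi> u) 3)\<^sup>2 + (aff (\<psi> u) 4)\<^sup>2" by (simp add: wnorm_def)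
qed

lemma smooth_on_trans: "k < 4 \<Longrightarrow> smooth_on 4 (trans_dom m) (\<lambda>u. Tm m (\<psi> u) k)"
proof -
  let ?V = "trans_dom m"
  note V = openin_trans_dom[of m]
  have a: "smooth_on 4 ?V (\<lambda>u. aff (\<psi> u) k)" "smooth_on 4 ?V (\<lambda>u. wnorm (\<psi> u))" for k
    using smooth_on_aff smooth_on_wnorm smooth_on_subset trans_dom_subset by blast+
  have dn: "smooth_on 4 ?V (\<lambda>u. den m (\<psi> u))"
    unfolding den_def by (intro smooth_on_add[OF V] smooth_on_mult[OF V] smooth_on_const[OF V] a)
  assume "k < 4"
  then consider "k < 3" | "k = 3" by linarith
  then show ?thesis
  proof cases
    case 1
    have "smooth_on 4 ?V (\<lambda>u. aff (\<psi> u) k / wnorm (\<psi> u))"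
    proof (intro smooth_on_divide[OF V] a)
      fix u assume "u \<in> ?V"
      then have "u \<in> U" using trans_dom_subset by blast
      then show "wnorm (\<psi> u) \<noteq> 0" using wnorm_pos[OF lp_MM, of u] by simp
    qed
    then show ?thesis using 1 by (simp add: Tm_def)
  next
    case 2
    have "smooth_on 4 ?V (\<lambda>u. m + 2 * arctan ((aff (\<psi> u) 4 * cos m - aff (\<psi> u) 3 * sin m) / den m (\<psi> u)))"
      by (intro smooth_on_add[OF V] smooth_on_mult[OF V] smooth_on_const[OF V] smooth_on_arctan[OF V]
          smooth_on_divide[OF V] smooth_on_diff[OF V] a dn) (auto simp: trans_dom_def)
    then show ?thesis using 2 by (simp add: Tm_def)
  qed
qed

lemma Psi_trans: "u \<in> trans_dom m \<Longrightarrow> Psi (Tm m (\<psi> u)) = \<psi> u"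
  using Psi_Tm lp_MM by (auto simp: trans_dom_def)

lemma trans_in_Um: "u \<in> trans_dom m \<Longrightarrow> Tm m (\<psi> u) \<in> Um m"
  using Psi_Tm lp_MM by (auto simp: trans_dom_def)

lemma trans_inj: "inj_on (\<lambda>u. Tm m (\<psi> u)) (trans_dom m)"
proof (rule inj_onI)
  fix u v assume uv: "u \<in> trans_dom m" "v \<in> trans_dom m" "Tm m (\<psi> u) = Tm m (\<psi> v)"
  then have "\<psi> u = \<psi> v" using Psi_trans by metis
  then show "u = v" using lp_inj uv trans_dom_subset by (auto dest: inj_onD)
qed

text \<open>Row \<open>j\<close> lists the cylinder components of the \<open>j\<close>-th coordinate
  field, so this is the transpose of the usual Jacobian matrix.\<close>

definition jac :: "real \<Rightarrow> (nat \<Rightarrow> real) \<Rightarrow> nat \<Rightarrow> nat \<Rightarrow> real"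
  where "jac m u j i = partial_deriv j (\<lambda>v. Tm m (\<psi> v) i) u"

text \<open>The chain rule for a chart factored through \<open>Psi\<close>. Every statement about
  arbitrary charts is reduced to the cylinder by it.\<close>

lemma coord_vec_trans:
  assumes "u \<in> trans_dom m" "j < 4"
  shows "coord_vec \<psi> u j = dPsi (Tm m (\<psi> u)) (jac m u j)"
  unfolding coord_vec_def
proof
  fix jl
  have "((\<lambda>t. Psi (Tm m (\<psi> (u(j := t)))) jl) has_real_derivative
      dPsi (Tm m (\<psi> (u(j := u j)))) (jac m u j) jl) (at (u j))"
  proof (rule Psi_curve)
    fix k :: nat assume k: "k < 4"
    show "((\<lambda>t. Tm m (\<psi> (u(j := t))) k) has_real_derivative jac m u j k) (at (u j))"
      unfolding jac_def using smooth_on_DERIV[OF smooth_on_trans[OF k] assms] .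
  qed
  then have "partial_deriv j (\<lambda>v. Psi (Tm m (\<psi> v)) jl) u = dPsi (Tm m (\<psi> u)) (jac m u j) jl"
    by (intro partial_deriv_eqI) simp
  moreover have "partial_deriv j (\<lambda>v. \<psi> v jl) u = partial_deriv j (\<lambda>v. Psi (Tm m (\<psi> v)) jl) u"
    by (rule partial_deriv_cong[OF openin_trans_dom[of m]]) (use Psi_trans assms in auto)
  ultimately show "partial_deriv j (\<lambda>v. \<psi> v jl) u = dPsi (Tm m (\<psi> u)) (jac m u j) jl" by simp
qed

end

lemma Psi_eqD:
  assumes "Psi u = Psi v"
  shows "i < 3 \<Longrightarrow> u i = v i" "cos (u 3) = cos (v 3)" "sin (u 3) = sin (v 3)"
proof -
  show y: "u i = v i" if "i < 3" for i using Tm_Psi_y[OF that, of 0] assms by metis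
  then have "qq u = qq v" by (simp add: qq_def)
  then show "cos (u 3) = cos (v 3)" "sin (u 3) = sin (v 3)"
    using aff_Psi[of 3 u] aff_Psi[of 3 v] aff_Psi[of 4 u] aff_Psi[of 4 v] assms qq_pos[of v]
    by (auto simp: hvec_simps)
qed

text \<open>\<open>tangent_space\<close> is a union over all charts. By
  \<open>coord_vec_trans\<close> every chart contributes to the same subspace, which one window of
  \<open>Psi\<close> already fills.\<close>

lemma tangent_space_MM: "tangent_space 4 MM (Psi u) = range (dPsi u)"
proof (intro equalityI subsetI)
  fix v assume "v \<in> tangent_space 4 MM (Psi u)"
  then obtain U \<psi> w where lp: "local_param 4 MM U \<psi>" and w: "w \<in> U" "\<psi> w = Psi u"
    "v \<in> fun_vs.span (coord_vec \<psi> w ` {..<4})"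
    unfolding tangent_space_def by blast
  obtain m where m: "w \<in> trans_dom U \<psi> m" using trans_cover[OF lp w(1)] by blast
  obtain c where c: "v = (\<lambda>j. \<Sum>i<4. c i * coord_vec \<psi> w i j)" using w(3) unfolding span_family by blast
  let ?T = "Tm m (\<psi> w)" and ?J = "jac \<psi> m w"
  have "Psi ?T = Psi u" using Psi_trans[OF lp m] w(2) by simp
  then have dP: "dPsi ?T b = dPsi u b" for b using Psi_eqD[of ?T u] by (intro dPsi_cong) auto
  have "v = (\<lambda>j. \<Sum>i<4. c i * dPsi u (?J i) j)"
  proof
    fix j show "v j = (\<Sum>i<4. c i * dPsi u (?J i) j)"
      unfolding c by (rule sum.cong) (simp_all add: coord_vec_trans[OF lp m] dP)
  qed
  also have "\<dots> = dPsi u (\<lambda>k. \<Sum>i<4. c i * ?J i k)"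
  proof
    fix j
    show "(\<Sum>i<4. c i * dPsi u (?J i) j) = dPsi u (\<lambda>k. \<Sum>i<4. c i * ?J i k) j"
      unfolding dPsi_expand[of u "?J _"] dPsi_expand[of u "\<lambda>k. \<Sum>i<4. c i * ?J i k"] sum_distrib_left sum_distrib_right
      by (subst sum.swap) (simp add: mult.assoc)
  qed
  finally show "v \<in> range (dPsi u)" by blast
next
  fix v assume "v \<in> range (dPsi u)"
  then obtain c where c: "v = dPsi u c" by blast
  \<comment> \<open>Cut down to the index range, since \<open>u\<close> need not lie in
    \<open>Rspace 4\<close>.\<close>
  let ?u = "\<lambda>i\<in>{..<4}. u i"
  have P: "Psi ?u = Psi u" "\<And>b. dPsi ?u b = dPsi u b" by (auto intro!: Psi_cong dPsi_cong)
  have "?u \<in> Um (u 3)" by (simp add: Um_def Rspace_def)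
  moreover have "v \<in> fun_vs.span (coord_vec Psi ?u ` {..<4})"
    unfolding span_family
  proof (intro exI[of _ c] ext)
    fix j
    have "v j = (\<Sum>i<4. c i * dPsi u (e_vec i) j)" unfolding c by (subst dPsi_expand) simp
    also have "\<dots> = (\<Sum>i<4. c i * coord_vec Psi ?u i j)" by (rule sum.cong) (simp_all add: coord_vec_Psi P)
    finally show "v j = (\<Sum>i<4. c i * coord_vec Psi ?u i j)" .
  qed
  ultimately show "v \<in> tangent_space 4 MM (Psi u)"
    unfolding tangent_space_def using local_param_Psi P(1) by blast
qed

section \<open>Positive definite forms and orthonormal frames\<close>

text \<open>A single equation for two properties: linearity, and dependence on the coordinates 0 to
  3 only.\<close>

definition lin4 :: "((nat \<Rightarrow> real) \<Rightarrow> real) \<Rightarrow> bool"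
  where "lin4 f \<longleftrightarrow> (\<forall>b. f b = (\<Sum>k<4. b k * f (e_vec k)))"

lemma lin4I:
  assumes lin: "\<And>x y b c. f (\<lambda>i. x * b i + y * c i) = x * f b + y * f c"
    and cong: "\<And>b c. (\<And>i. i < 4 \<Longrightarrow> b i = c i) \<Longrightarrow> f b = f c"
  shows "lin4 f"
  unfolding lin4_def
proof
  fix b :: "nat \<Rightarrow> real"
  have "f (\<lambda>i. \<Sum>k<n. b k * e_vec k i) = (\<Sum>k<n. b k * f (e_vec k))" for n
  proof (induction n)
    case 0
    show ?case using lin[of 0 "\<lambda>_. 0" 0 "\<lambda>_. 0"] by simp
  next
    case (Suc n)
    then show ?case using lin[of 1 "\<lambda>i. \<Sum>k<n. b k * e_vec k i" "b n" "e_vec n"] by simp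
  qed
  moreover have "f b = f (\<lambda>i. \<Sum>k<4. b k * e_vec k i)"
  proof (rule cong)
    fix i :: nat assume "i < 4"
    then show "b i = (\<Sum>k<4. b k * e_vec k i)"
      by (simp add: e_vec_def if_distrib[of "\<lambda>c. _ * c"] cong: if_cong)
  qed
  ultimately show "f b = (\<Sum>k<4. b k * f (e_vec k))" by simp
qed

lemma lin4_cong: "lin4 f \<Longrightarrow> (\<And>i. i < 4 \<Longrightarrow> b i = c i) \<Longrightarrow> f b = f c"
  unfolding lin4_def by (metis (no_types, lifting) lessThan_iff sum.cong)

lemma lin4_add: "lin4 f \<Longrightarrow> f (\<lambda>i. x * b i + y * c i) = x * f b + y * f c"
proof -
  assume f: "lin4 f"
  have "f (\<lambda>i. x * b i + y * c i) = (\<Sum>k<4. (x * b k + y * c k) * f (e_vec k))"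
    by (rule f[unfolded lin4_def, rule_format])
  also have "\<dots> = x * (\<Sum>k<4. b k * f (e_vec k)) + y * (\<Sum>k<4. c k * f (e_vec k))"
    by (simp add: sum_distrib_left sum.distrib algebra_simps)
  finally show ?thesis using f[unfolded lin4_def, rule_format, of b] f[unfolded lin4_def, rule_format, of c] by simp
qed

lemma lin4_sum: "lin4 f \<Longrightarrow> f (\<lambda>i. \<Sum>j<n. x j * b j i) = (\<Sum>j<(n::nat). x j * f (b j))"
proof (induction n)
  case 0
  then show ?case using lin4_add[of f 0 "\<lambda>_. 0" 0 "\<lambda>_. 0"] by simp
next
  case (Suc n)
  then show ?case using lin4_add[of f 1 "\<lambda>i. \<Sum>j<n. x j * b j i" "x n" "b n"] by simp
qed

section \<open>Bilinear forms with two-sided bounds\<close>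

lemma det_mat_upper:
  assumes "\<And>i j. i < d \<Longrightarrow> j < d \<Longrightarrow> \<bar>f i j\<bar> \<le> K"
  shows "\<bar>Determinant.det (Matrix.mat d d (\<lambda>(i, j). f i j)) :: real\<bar> \<le> fact d * K ^ d"
proof -
  have "\<bar>Determinant.det (Matrix.mat d d (\<lambda>(i, j). f i j))\<bar> \<le>
      (\<Sum>p | p permutes {0..<d}. \<bar>of_int (sign p) * (\<Prod>i = 0..<d. f i (p i))\<bar>)"
    unfolding det_mat_eq_sum by (rule sum_abs)
  also have "\<dots> \<le> (\<Sum>p | p permutes {0..<d}. K ^ d)"
  proof (rule sum_mono)
    fix p assume "p \<in> {p. p permutes {0..<d}}"
    then have p: "p i < d" if "i < d" for i using permutes_in_image[of p "{0..<d}" i] that by auto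
    have "\<bar>of_int (sign p) * (\<Prod>i = 0..<d. f i (p i))\<bar> = (\<Prod>i = 0..<d. \<bar>f i (p i)\<bar>)"
      by (simp add: abs_mult abs_prod sign_def)
    also have "\<dots> \<le> (\<Prod>i = 0..<d. K)" by (rule prod_mono) (use assms p in auto)
    finally show "\<bar>of_int (sign p) * (\<Prod>i = 0..<d. f i (p i))\<bar> \<le> K ^ d" by simp
  qed
  also have "\<dots> = fact d * K ^ d" by (simp add: card_permutations)
  finally show ?thesis .
qed

locale inner4 =
  fixes B :: "(nat \<Rightarrow> real) \<Rightarrow> (nat \<Rightarrow> real) \<Rightarrow> real" and l L :: real
  assumes lin: "lin4 (\<lambda>b. B b c)" and sym: "B b c = B c b"
    and lower: "l * (\<Sum>i<4. (b i)\<^sup>2) \<le> B b b" and upper: "B b b \<le> L * (\<Sum>i<4. (b i)\<^sup>2)" and l: "l > 0"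
begin

lemma lin': "lin4 (\<lambda>b. B c b)"
proof -
  have "(\<lambda>b. B c b) = (\<lambda>b. B b c)" by (rule ext) (rule sym)
  then show ?thesis using lin[of c] by simp
qed

lemma nonneg: "B b b \<ge> 0"
proof -
  have "0 \<le> l * (\<Sum>i<4. (b i)\<^sup>2)" using l by (intro mult_nonneg_nonneg sum_nonneg) auto
  then show ?thesis using lower[of b] by linarith
qed

text \<open>Nonnegativity on the sum and on the difference of two basis vectors bounds twice the
  mixed entry by the sum of the two diagonal entries.\<close>

lemma entry_le: "i < 4 \<Longrightarrow> j < 4 \<Longrightarrow> \<bar>B (e_vec i) (e_vec j)\<bar> \<le> L"
proof -
  assume ij: "i < 4" "j < 4"
  have e: "(\<Sum>k<4. (e_vec i k)\<^sup>2) = 1" if "i < 4" for i :: nat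
    using that by (simp add: e_vec_def if_distrib[of "\<lambda>c. c\<^sup>2"] cong: if_cong)
  have u: "B (e_vec i) (e_vec i) \<le> L" "B (e_vec j) (e_vec j) \<le> L" using upper[of "e_vec _"] e ij by (metis mult.right_neutral)+
  have "B (\<lambda>k. 1 * e_vec i k + s * e_vec j k) (\<lambda>k. 1 * e_vec i k + s * e_vec j k) =
    B (e_vec i) (e_vec i) + 2 * s * B (e_vec i) (e_vec j) + s * s * B (e_vec j) (e_vec j)" for s
    unfolding lin4_add[OF lin] lin4_add[OF lin'] using sym[of "e_vec j" "e_vec i"] by (simp add: algebra_simps)
  from this[of 1] this[of "-1"] show ?thesis
    using nonneg[of "\<lambda>k. 1 * e_vec i k + 1 * e_vec j k"] nonneg[of "\<lambda>k. 1 * e_vec i k + (-1) * e_vec j k"] u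
    by linarith
qed

text \<open>Gram-Schmidt. The triangular shape of the vectors is carried along because it gives
  \<open>v n = 1\<close>, hence a nonzero vector to normalize.\<close>

lemma orthonormal_exists:
  "\<exists>E :: nat \<Rightarrow> nat \<Rightarrow> real. \<forall>i<4. \<forall>j<4. B (E i) (E j) = (if i = j then 1 else 0)"
proof -
  have "\<exists>E. (\<forall>i<n. \<forall>j<n. B (E i) (E j) = (if i = j then 1 else 0)) \<and> (\<forall>i<n. \<forall>k>i. E i k = 0)"
    if "n \<le> 4" for n
    using that
  proof (induction n)
    case (Suc n)
    then have "\<exists>E. (\<forall>i<n. \<forall>j<n. B (E i) (E j) = (if i = j then 1 else 0)) \<and> (\<forall>i<n. \<forall>k>i. E i k = 0)"
      by simp
    then obtain E where E0: "\<forall>i<n. \<forall>j<n. B (E i) (E j) = (if i = j then 1 else 0)"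
      "\<forall>i<n. \<forall>k>i. E i k = 0" by blast
    note E = E0[rule_format]
    define w where "w = (\<lambda>k. \<Sum>i<n. B (e_vec n) (E i) * E i k)"
    define v where "v = (\<lambda>k. 1 * e_vec n k + (-1) * w k)"
    have wn: "w k = 0" if "k \<ge> n" for k using E(2) that by (simp add: w_def)
    have vn: "v n = 1" "\<And>k. k > n \<Longrightarrow> v k = 0" using wn by (auto simp: v_def e_vec_def)
    have orth: "B v (E j) = 0" if "j < n" for j
    proof -
      have "B w (E j) = (\<Sum>i<n. B (e_vec n) (E i) * B (E i) (E j))" unfolding w_def by (rule lin4_sum[OF lin])
      also have "\<dots> = B (e_vec n) (E j)"
        using that by (simp add: E(1) if_distrib[of "\<lambda>c. _ * c"] cong: if_cong)
      finally show ?thesis unfolding v_def lin4_add[OF lin] by simp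
    qed
    have "(\<Sum>i<4. (v i)\<^sup>2) > 0"
      by (rule sum_pos2[of _ n]) (use Suc.prems vn in auto)
    then have pos: "B v v > 0" using lower[of v] l by (meson less_le_trans mult_pos_pos)
    define x where "x = 1 / sqrt (B v v)"
    define e where "e = (\<lambda>k. x * v k + 0 * v k)"
    have be: "B e b = x * B v b" for b unfolding e_def lin4_add[OF lin] by simp
    have be': "B b e = x * B b v" for b using be sym by metis
    have ee: "B e e = 1"
    proof -
      have "B e e = x * x * B v v" unfolding be be' by simp
      also have "x * x = 1 / B v v" using pos by (simp add: x_def)
      finally show ?thesis using pos by simp
    qed
    have eE: "B e (E j) = 0" if "j < n" for j
      unfolding be using orth[OF that] by simp
    then have eE': "B (E j) e = 0" if "j < n" for j
      using sym[of "E j" e] that by simp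
    show ?case
    proof (intro exI[of _ "E(n := e)"] conjI allI impI)
      fix i j assume "i < Suc n" "j < Suc n"
      then show "B ((E(n := e)) i) ((E(n := e)) j) = (if i = j then 1 else 0)"
        using E(1)[of i j] ee eE eE' by (auto simp: less_Suc_eq)
    next
      fix i k assume "i < Suc n" "i < k"
      then show "(E(n := e)) i k = 0" using E(2)[of i k] vn(2)[of k] by (auto simp: less_Suc_eq e_def)
    qed
  qed auto
  from this[of 4] show ?thesis by blast
qed

definition Gmat :: "real Matrix.mat" where "Gmat = Matrix.mat 4 4 (\<lambda>(i, j). B (e_vec i) (e_vec j))"

lemma gram_matrix:
  fixes E :: "nat \<Rightarrow> nat \<Rightarrow> real"
  defines "EM \<equiv> Matrix.mat 4 4 (\<lambda>(i, j). E i j)"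
  shows "EM * Gmat * transpose_mat EM = Matrix.mat 4 4 (\<lambda>(i, j). B (E i) (E j))"
proof (rule eq_matI)
  show "dim_row (EM * Gmat * transpose_mat EM) = dim_row (Matrix.mat 4 4 (\<lambda>(i, j). B (E i) (E j)))"
    "dim_col (EM * Gmat * transpose_mat EM) = dim_col (Matrix.mat 4 4 (\<lambda>(i, j). B (E i) (E j)))"
    by (simp_all add: EM_def)
  fix i j assume "i < dim_row (Matrix.mat 4 4 (\<lambda>(i, j). B (E i) (E j)))"
    "j < dim_col (Matrix.mat 4 4 (\<lambda>(i, j). B (E i) (E j)))"
  then have ij: "i < 4" "j < 4" by auto
  have "(EM * Gmat * transpose_mat EM) $$ (i, j) = (\<Sum>l<4. (\<Sum>k<4. E i k * B (e_vec k) (e_vec l)) * E j l)"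
    using ij by (simp add: EM_def Gmat_def scalar_prod_def lessThan_atLeast0)
  also have "\<dots> = (\<Sum>l<4. E j l * B (E i) (e_vec l))"
  proof (rule sum.cong[OF refl])
    fix l
    have "B (E i) (e_vec l) = (\<Sum>k<4. E i k * B (e_vec k) (e_vec l))"
      using lin[of "e_vec l"] unfolding lin4_def by blast
    then show "(\<Sum>k<4. E i k * B (e_vec k) (e_vec l)) * E j l = E j l * B (E i) (e_vec l)" by simp
  qed
  also have "\<dots> = B (E i) (E j)" using lin'[of "E i"] unfolding lin4_def by metis
  finally show "(EM * Gmat * transpose_mat EM) $$ (i, j) = Matrix.mat 4 4 (\<lambda>(i, j). B (E i) (E j)) $$ (i, j)"
    using ij by simp
qed

lemma det_gram_matrix:
  "Determinant.det (Matrix.mat 4 4 (\<lambda>(i, j). B (E i) (E j))) =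
    (Determinant.det (Matrix.mat 4 4 (\<lambda>(i, j). E i j)))\<^sup>2 * Determinant.det Gmat"
proof -
  let ?EM = "Matrix.mat 4 4 (\<lambda>(i, j). E i j)"
  have c: "?EM \<in> carrier_mat 4 4" "Gmat \<in> carrier_mat 4 4" "transpose_mat ?EM \<in> carrier_mat 4 4"
    by (auto simp: Gmat_def)
  have "Determinant.det (?EM * Gmat * transpose_mat ?EM) = Determinant.det ?EM * Determinant.det Gmat * Determinant.det ?EM"
    by (simp only: det_mult[OF mult_carrier_mat[OF c(1,2)] c(3)] det_mult[OF c(1,2)] det_transpose[OF c(1)])
  then show ?thesis unfolding gram_matrix by (simp add: power2_eq_square mult_ac)
qed

context
  fixes E :: "nat \<Rightarrow> nat \<Rightarrow> real"
  assumes E: "\<And>i j. i < 4 \<Longrightarrow> j < 4 \<Longrightarrow> B (E i) (E j) = (if i = j then 1 else 0)"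
begin

lemma frame_matrix: "Matrix.mat 4 4 (\<lambda>(i, j). B (E i) (E j)) = 1\<^sub>m 4"
  by (rule eq_matI) (auto simp: E)

text \<open>Orthonormality reads E G E^T = 1. A one-sided inverse of a square matrix is two-sided,
  hence E^T (E G) = 1.\<close>

lemma frame_complete:
  assumes "j < 4" "k < 4"
  shows "(\<Sum>i<4. B (E i) (e_vec j) * E i k) = (if j = k then 1 else 0)"
proof -
  let ?EM = "Matrix.mat 4 4 (\<lambda>(i, j). E i j)"
  have "transpose_mat ?EM * (?EM * Gmat) = 1\<^sub>m 4"
    by (rule mat_mult_left_right_inverse[OF _ _ gram_matrix[of E, unfolded frame_matrix]]) (auto simp: Gmat_def)
  then have "(transpose_mat ?EM * (?EM * Gmat)) $$ (k, j) = 1\<^sub>m 4 $$ (k, j)" by simp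
  moreover have "(transpose_mat ?EM * (?EM * Gmat)) $$ (k, j) = (\<Sum>i<4. E i k * (\<Sum>m<4. E i m * B (e_vec m) (e_vec j)))"
    using assms by (simp add: Gmat_def scalar_prod_def lessThan_atLeast0)
  moreover have "(\<Sum>m<4. E i m * B (e_vec m) (e_vec j)) = B (E i) (e_vec j)" for i
    using lin[of "e_vec j"] unfolding lin4_def by metis
  ultimately show ?thesis using assms by (simp add: mult.commute)
qed

text \<open>The inner product of a covector with the metric dual of a basis vector is evaluation at
  that vector, in whatever orthonormal frame it is computed.\<close>

lemma contract1:
  assumes f: "lin4 f" and "j < 4"
  shows "(\<Sum>i<4. f (E i) * B (E i) (e_vec j)) = f (e_vec j)"
proof -
  have "(\<Sum>i<4. f (E i) * B (E i) (e_vec j)) = (\<Sum>i<4. B (E i) (e_vec j) * f (E i))"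
    by (simp add: mult.commute)
  also have "\<dots> = f (\<lambda>k. \<Sum>i<4. B (E i) (e_vec j) * E i k)" by (rule lin4_sum[OF f, symmetric])
  also have "\<dots> = f (e_vec j)"
    by (rule lin4_cong[OF f]) (use frame_complete assms(2) in \<open>auto simp: e_vec_def\<close>)
  finally show ?thesis .
qed

lemma contract2:
  assumes f: "\<And>b. lin4 (\<lambda>c. f b c)" "\<And>c. lin4 (\<lambda>b. f b c)" and "j < 4" "k < 4"
  shows "(\<Sum>i<4. \<Sum>m<4. f (E i) (E m) * (B (E i) (e_vec j) * B (E m) (e_vec k))) = f (e_vec j) (e_vec k)"
proof -
  have "(\<Sum>i<4. \<Sum>m<4. f (E i) (E m) * (B (E i) (e_vec j) * B (E m) (e_vec k))) =
    (\<Sum>i<4. (\<Sum>m<4. f (E i) (E m) * B (E m) (e_vec k)) * B (E i) (e_vec j))"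
    unfolding sum_distrib_right by (intro sum.cong refl) (simp add: mult_ac)
  also have "\<dots> = (\<Sum>i<4. f (E i) (e_vec k) * B (E i) (e_vec j))"
    using contract1[OF f(1) assms(4)] by simp
  also have "\<dots> = f (e_vec j) (e_vec k)" by (rule contract1[OF f(2) assms(3)])
  finally show ?thesis .
qed

lemma frame_entry: "i < 4 \<Longrightarrow> k < 4 \<Longrightarrow> (E i k)\<^sup>2 \<le> 1 / l"
proof -
  assume ik: "i < 4" "k < 4"
  have "(E i k)\<^sup>2 \<le> (\<Sum>k<4. (E i k)\<^sup>2)" using ik by (intro member_le_sum) auto
  moreover have "l * (\<Sum>k<4. (E i k)\<^sup>2) \<le> 1" using lower[of "E i"] E[OF ik(1) ik(1)] by simp
  ultimately have "l * (E i k)\<^sup>2 \<le> 1" using l by (meson mult_left_mono order_trans less_imp_le)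
  then show ?thesis using l by (simp add: field_simps)
qed

lemma det_frame:
  "(Determinant.det (Matrix.mat 4 4 (\<lambda>(i, j). E i j)))\<^sup>2 * Determinant.det Gmat = 1"
  using det_gram_matrix[of E] unfolding frame_matrix by simp

end

text \<open>Above, the Leibniz bound with 4! = 24 <= 5^2. Below, the determinant of an orthonormal
  frame is bounded in the same way, and its square is the reciprocal of the determinant of
  \<open>Gmat\<close>.\<close>

lemma det_Gmat_bounds:
  shows "Determinant.det Gmat > 0" "sqrt (Determinant.det Gmat) \<le> 5 * L\<^sup>2"
    "1 / sqrt (Determinant.det Gmat) \<le> 24 / l\<^sup>2"
proof -
  obtain E :: "nat \<Rightarrow> nat \<Rightarrow> real" where E: "\<And>i j. i < 4 \<Longrightarrow> j < 4 \<Longrightarrow> B (E i) (E j) = (if i = j then 1 else 0)"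
    using orthonormal_exists by blast
  let ?D = "Determinant.det Gmat" and ?e = "Determinant.det (Matrix.mat 4 4 (\<lambda>(i, j). E i j))"
  have eq: "?e\<^sup>2 * ?D = 1" using det_frame E by blast
  then have e0: "?e \<noteq> 0" by auto
  have D: "?D = 1 / ?e\<^sup>2" using eq e0 by (simp add: field_simps)
  then show pos: "?D > 0" using e0 by simp
  have f4: "fact 4 = (24 :: real)" by (simp add: fact_numeral)
  have "\<bar>?D\<bar> \<le> 24 * L ^ 4"
    using det_mat_upper[of 4 "\<lambda>i j. B (e_vec i) (e_vec j)" L] entry_le f4 by (simp add: Gmat_def)
  then have "?D \<le> (5 * L\<^sup>2)\<^sup>2" by (simp add: power_mult_distrib flip: power_mult)
  then show "sqrt ?D \<le> 5 * L\<^sup>2" by (intro real_le_lsqrt) auto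
  have "\<bar>E i k\<bar> \<le> sqrt (1 / l)" if "i < 4" "k < 4" for i k
    using frame_entry[of E, OF E that] by (metis real_sqrt_abs real_sqrt_le_iff)
  then have "\<bar>?e\<bar> \<le> 24 * (sqrt (1 / l)) ^ 4"
    using det_mat_upper[of 4 E "sqrt (1 / l)"] f4 by simp
  moreover have "(sqrt (1 / l)) ^ 4 = ((sqrt (1 / l))\<^sup>2)\<^sup>2" by (simp flip: power_mult)
  then have "(sqrt (1 / l)) ^ 4 = 1 / l\<^sup>2" using l by (simp add: power_divide)
  moreover have "sqrt ?D = 1 / \<bar>?e\<bar>" unfolding D by (simp add: real_sqrt_divide)
  ultimately show "1 / sqrt ?D \<le> 24 / l\<^sup>2" by simp
qed

end

section \<open>The metric on the cylinder\<close>

lemma dPi5_in_tangent_space: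
  assumes "a \<in> Rspace 5"
  shows "dPi5 a b \<in> tangent_space 5 (RP 5) (Pi5 a)"
proof -
  have "dPi5 a b \<in> fun_vs.span (coord_vec Pi5 a ` {..<5})"
    unfolding span_family
  proof (intro exI[of _ b] ext)
    fix j
    have "dPi5 a b j = (\<Sum>i<5. b i * dPi5 a (e_vec i) j)" by (subst dPi5_expand) simp
    also have "\<dots> = (\<Sum>i<5. b i * coord_vec Pi5 a i j)" by (rule sum.cong) (simp_all add: coord_vec_Pi5)
    finally show "dPi5 a b j = (\<Sum>i<5. b i * coord_vec Pi5 a i j)" .
  qed
  then show ?thesis unfolding tangent_space_def using local_param_Pi5 assms by blast
qed

text \<open>A compact part of the affine chart that contains the whole regular part. The uniform
  bounds on \<open>g\<close> come from it.\<close>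

definition unit_box :: "(nat \<Rightarrow> real) set"
  where "unit_box = {a \<in> Rspace 5. \<forall>k<5. -1 \<le> a k \<and> a k \<le> 1}"

lemma A5_in_unit_box: "A5 u \<in> unit_box"
proof -
  have a: "\<bar>x\<bar> \<le> 1 + x\<^sup>2" for x :: real
  proof -
    have "0 \<le> (\<bar>x\<bar> - 1)\<^sup>2" by simp
    then have "2 * \<bar>x\<bar> \<le> 1 + x\<^sup>2" by (simp add: power2_eq_square algebra_simps)
    then show ?thesis using abs_ge_zero[of x] by linarith
  qed
  have "\<bar>hvec u k\<bar> \<le> qq u" if "k < 5" for k
  proof -
    consider "k = 0" | "k = 1" | "k = 2" | "k = 3" | "k = 4" using \<open>k < 5\<close> by linarith
    then show ?thesis
    proof cases
      case 1
      show ?thesis unfolding 1 hvec_simps qq_def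
        using a[of "u 0"] zero_le_power2[of "u 1"] zero_le_power2[of "u 2"] by linarith
    next
      case 2
      show ?thesis unfolding 2 hvec_simps qq_def
        using a[of "u 1"] zero_le_power2[of "u 0"] zero_le_power2[of "u 2"] by linarith
    next
      case 3
      show ?thesis unfolding 3 hvec_simps qq_def
        using a[of "u 2"] zero_le_power2[of "u 0"] zero_le_power2[of "u 1"] by linarith
    next
      case 4 then show ?thesis using order_trans[OF abs_cos_le_one qq_ge_1] by (simp add: hvec_simps)
    next
      case 5 then show ?thesis using order_trans[OF abs_sin_le_one qq_ge_1] by (simp add: hvec_simps)
    qed
  qed
  then have "\<bar>A5 u k\<bar> \<le> 1" if "k < 5" for k
    using that qq_pos[of u] by (simp add: A5_def abs_divide)
  then show ?thesis unfolding unit_box_def using A5_in_Rspace by (auto simp: abs_le_iff)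
qed

section \<open>Uniform comparison of \<open>g\<close> with the Euclidean metric\<close>

context
  fixes g :: "(nat \<times> nat) metric"
  assumes g: "riemannian_metric 5 (RP 5) g"
begin

definition G5 :: "(nat \<Rightarrow> real) \<Rightarrow> (nat \<Rightarrow> real) \<Rightarrow> (nat \<Rightarrow> real) \<Rightarrow> real"
  where "G5 a b c = g (Pi5 a) (dPi5 a b) (dPi5 a c)"

lemma Pi5_in_RP: "Pi5 a \<in> RP 5"
  unfolding RP_def Pi5_def using hat_in_hom_coords by blast

lemma G5_facts:
  assumes a: "a \<in> Rspace 5"
  shows "G5 a b c = G5 a c b"
    and "G5 a (\<lambda>k. x * b k + y * b' k) c = x * G5 a b c + y * G5 a b' c"
    and "k < 5 \<Longrightarrow> b k \<noteq> 0 \<Longrightarrow> G5 a b b > 0"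
proof -
  note t = dPi5_in_tangent_space[OF a]
  note gg = g[unfolded riemannian_metric_def, THEN conjunct1, rule_format, OF Pi5_in_RP]
  show "G5 a b c = G5 a c b" unfolding G5_def using gg[OF t t] by blast
  show "G5 a (\<lambda>k. x * b k + y * b' k) c = x * G5 a b c + y * G5 a b' c"
    unfolding G5_def dPi5_linear using gg[OF t[of b] t[of c]] t[of b'] by blast
  assume k: "k < 5" "b k \<noteq> 0"
  have "dPi5 a b \<noteq> 0"
  proof
    assume "dPi5 a b = 0"
    then have "daff (Pi5 a) 0 k = b k" using daff_dPi5[OF k(1), of a b] by simp
    then show False using k(2) by (simp add: daff_def)
  qed
  then show "G5 a b b > 0" unfolding G5_def using gg[OF t t] by blast
qed

lemma G5_expand1: "a \<in> Rspace 5 \<Longrightarrow> G5 a b c = (\<Sum>k<5. b k * G5 a (e_vec k) c)"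
proof -
  assume a: "a \<in> Rspace 5"
  have "G5 a (\<lambda>i. \<Sum>k<n. b k * e_vec k i) c = (\<Sum>k<n. b k * G5 a (e_vec k) c)" for n
  proof (induction n)
    case 0
    show ?case using G5_facts(2)[OF a, of 0 "\<lambda>_. 0" 0 "\<lambda>_. 0" c] by simp
  next
    case (Suc n)
    then show ?case using G5_facts(2)[OF a, of 1 "\<lambda>i. \<Sum>k<n. b k * e_vec k i" "b n" "e_vec n" c] by simp
  qed
  moreover have "G5 a b c = G5 a (\<lambda>i. \<Sum>k<5. b k * e_vec k i) c"
  proof -
    have "dPi5 a b = dPi5 a (\<lambda>i. \<Sum>k<5. b k * e_vec k i)"
      by (rule dPi5_cong) (auto simp: e_vec_def if_distrib[of "\<lambda>c. _ * c"] cong: if_cong)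
    then show ?thesis by (simp add: G5_def)
  qed
  ultimately show ?thesis by simp
qed

lemma G5_expand: "a \<in> Rspace 5 \<Longrightarrow> G5 a b c = (\<Sum>k<5. \<Sum>m<5. b k * c m * G5 a (e_vec k) (e_vec m))"
proof -
  assume a: "a \<in> Rspace 5"
  have "G5 a (e_vec k) c = (\<Sum>m<5. c m * G5 a (e_vec k) (e_vec m))" for k
    using G5_expand1[OF a, of c "e_vec k"] by (simp add: G5_facts(1)[OF a, of "e_vec k"])
  then show ?thesis by (subst G5_expand1[OF a]) (simp add: sum_distrib_left mult.assoc)
qed

lemma continuous_on_G5:
  assumes "k < 5" "m < 5"
  shows "continuous_on (Rspace 5) (\<lambda>a. G5 a (e_vec k) (e_vec m))"
proof -
  have "smooth_on 5 (Rspace 5) (\<lambda>a. gram g Pi5 a k m)"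
    by (rule g[unfolded riemannian_metric_def, THEN conjunct2, rule_format, OF local_param_Pi5 assms])
  then have "continuous_on (Rspace 5) (\<lambda>a. gram g Pi5 a k m)" by (rule smooth_on_imp_continuous_on)
  then show ?thesis using assms by (simp add: gram_def coord_vec_Pi5 G5_def)
qed

text \<open>A continuous positive function attains its extrema on the product of the box and the
  unit sphere; homogeneity extends the bounds to all vectors.\<close>

lemma G5_bounds:
  "\<exists>l L. l > 0 \<and> L > 0 \<and> (\<forall>a\<in>unit_box. \<forall>b. l * (\<Sum>k<5. (b k)\<^sup>2) \<le> G5 a b b \<and> G5 a b b \<le> L * (\<Sum>k<5. (b k)\<^sup>2))"
proof -
  let ?S = "{b \<in> Rspace 5. (\<Sum>k<5. (b k)\<^sup>2) = 1}"
  have cK: "compact unit_box" unfolding unit_box_def by (rule compact_box_Rspace)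
  have "?S = unit_box \<inter> {b. (\<Sum>k<5. (b k)\<^sup>2) = 1}"
  proof -
    have "-1 \<le> b k \<and> b k \<le> 1" if "(\<Sum>k<5. (b k)\<^sup>2) = 1" "k < 5" for b :: "nat \<Rightarrow> real" and k
    proof -
      have "(b k)\<^sup>2 \<le> (\<Sum>k<5. (b k)\<^sup>2)" using that(2) by (intro member_le_sum) auto
      then show ?thesis using that(1) abs_square_le_1[of "b k"] by (auto simp: abs_le_iff)
    qed
    then show ?thesis by (auto simp: unit_box_def)
  qed
  moreover have "closed {b :: nat \<Rightarrow> real. (\<Sum>k<5. (b k)\<^sup>2) = 1}"
    by (intro closed_Collect_eq continuous_intros continuous_on_coord)
  ultimately have cS: "compact ?S" using cK by (simp add: compact_Int_closed)
  have cKS: "compact (unit_box \<times> ?S)" using cK cS by (rule compact_Times)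
  define h where "h p = G5 (fst p) (snd p) (snd p)" for p
  have cs: "continuous_on (unit_box \<times> ?S) (\<lambda>p. snd p k)" for k
    by (rule continuous_on_compose2[OF continuous_on_coord[of UNIV k] continuous_on_snd[OF continuous_on_id]]) simp
  have cG: "continuous_on (unit_box \<times> ?S) (\<lambda>p. G5 (fst p) (e_vec k) (e_vec m))" if "k \<in> {..<5}" "m \<in> {..<5}" for k m
    by (rule continuous_on_compose2[OF continuous_on_G5 continuous_on_fst[OF continuous_on_id]])
      (use that in \<open>auto simp: unit_box_def\<close>)
  have "continuous_on (unit_box \<times> ?S)
    (\<lambda>p. \<Sum>k<5. \<Sum>m<5. snd p k * snd p m * G5 (fst p) (e_vec k) (e_vec m))"
    by (intro continuous_on_sum continuous_on_mult cs cG)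
  moreover have "h p = (\<Sum>k<5. \<Sum>m<5. snd p k * snd p m * G5 (fst p) (e_vec k) (e_vec m))"
    if "p \<in> unit_box \<times> ?S" for p
    unfolding h_def by (rule G5_expand) (use that in \<open>auto simp: unit_box_def\<close>)
  ultimately have ch: "continuous_on (unit_box \<times> ?S) h" by (simp cong: continuous_on_cong)
  have e0: "(\<lambda>k\<in>{..<5}. e_vec 0 k) \<in> ?S" "(\<lambda>k\<in>{..<5}. 0) \<in> unit_box"
    by (auto simp: Rspace_def unit_box_def lessThan_5 e_vec_def)
  then have ne: "unit_box \<times> ?S \<noteq> {}" by blast
  obtain p where p: "p \<in> unit_box \<times> ?S" "\<And>y. y \<in> unit_box \<times> ?S \<Longrightarrow> h p \<le> h y"
    using continuous_attains_inf[OF cKS ne ch] by blast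
  obtain r where r: "r \<in> unit_box \<times> ?S" "\<And>y. y \<in> unit_box \<times> ?S \<Longrightarrow> h y \<le> h r"
    using continuous_attains_sup[OF cKS ne ch] by blast
  have pos: "h y > 0" if y: "y \<in> unit_box \<times> ?S" for y
  proof -
    have "\<exists>k<5. snd y k \<noteq> 0"
    proof (rule ccontr)
      assume "\<not> (\<exists>k<5. snd y k \<noteq> 0)"
      then have "(\<Sum>k<5. (snd y k)\<^sup>2) = 0" by simp
      then show False using y by auto
    qed
    moreover have "fst y \<in> Rspace 5" using y by (auto simp: unit_box_def)
    ultimately show ?thesis unfolding h_def using G5_facts(3) by blast
  qed
  show ?thesis
  proof (rule exI[of _ "h p"], rule exI[of _ "h r"], intro conjI ballI allI)
    show "h p > 0" "h r > 0" using pos p r by blast+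
    fix a b :: "nat \<Rightarrow> real" assume a: "a \<in> unit_box"
    then have aR: "a \<in> Rspace 5" by (simp add: unit_box_def)
    define n where "n = sqrt (\<Sum>k<5. (b k)\<^sup>2)"
    have n2: "n\<^sup>2 = (\<Sum>k<5. (b k)\<^sup>2)" unfolding n_def by (simp add: sum_nonneg)
    have "h p * n\<^sup>2 \<le> G5 a b b \<and> G5 a b b \<le> h r * n\<^sup>2"
    proof (cases "n = 0")
      case True
      then have "(\<Sum>k<5. (b k)\<^sup>2) = 0" using n2 by simp
      then have "b k = 0" if "k < 5" for k using that by (simp add: sum_nonneg_eq_0_iff)
      then have "G5 a b b = 0" by (subst G5_expand[OF aR]) simp
      then show ?thesis using True by simp
    next
      case False
      \<comment> \<open>The normalized vector, restricted to the index range so that it lies in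
        \<open>Rspace 5\<close>.\<close>
      define c where "c = (\<lambda>k\<in>{..<5}. b k / n)"
      have "(\<Sum>k<5. (c k)\<^sup>2) = (\<Sum>k<5. (b k)\<^sup>2) / n\<^sup>2" by (simp add: c_def power_divide sum_divide_distrib)
      then have "(\<Sum>k<5. (c k)\<^sup>2) = 1" using False unfolding n2[symmetric] by simp
      then have "c \<in> ?S" by (simp add: c_def Rspace_def)
      then have hc: "h p \<le> G5 a c c" "G5 a c c \<le> h r" using p(2)[of "(a, c)"] r(2)[of "(a, c)"] a by (auto simp: h_def)
      have "G5 a b b = (\<Sum>k<5. \<Sum>m<5. n\<^sup>2 * (c k * c m * G5 a (e_vec k) (e_vec m)))"
        unfolding G5_expand[OF aR, of b b] using False
        by (intro sum.cong refl) (simp add: c_def power2_eq_square)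
      also have "\<dots> = n\<^sup>2 * G5 a c c" by (simp add: G5_expand[OF aR, of c c] sum_distrib_left)
      finally have "G5 a b b = n\<^sup>2 * G5 a c c" .
      then show ?thesis
        using mult_left_mono[OF hc(1), of "n\<^sup>2"] mult_left_mono[OF hc(2), of "n\<^sup>2"] by (simp add: mult.commute)
    qed
    then show "h p * (\<Sum>k<5. (b k)\<^sup>2) \<le> G5 a b b" "G5 a b b \<le> h r * (\<Sum>k<5. (b k)\<^sup>2)" unfolding n2 by auto
  qed
qed

definition Gu :: "(nat \<Rightarrow> real) \<Rightarrow> (nat \<Rightarrow> real) \<Rightarrow> (nat \<Rightarrow> real) \<Rightarrow> real"
  where "Gu u b c = g (Psi u) (dPsi u b) (dPsi u c)"

lemma Gu_eq: "Gu u b c = G5 (A5 u) (dA5 u b) (dA5 u c)"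
  by (simp add: Gu_def G5_def Psi_eq dPsi_def)

text \<open>Conformality of the chart, with factor q^(-2), turns the uniform bounds of
  \<open>G5_bounds\<close> into these.\<close>

lemma Gu_inner4: "\<exists>l L. l > 0 \<and> L > 0 \<and> (\<forall>u. inner4 (Gu u) (l / (qq u)\<^sup>2) (L / (qq u)\<^sup>2))"
proof -
  obtain l L where lL: "l > 0" "L > 0"
    "\<And>a b. a \<in> unit_box \<Longrightarrow> l * (\<Sum>k<5. (b k)\<^sup>2) \<le> G5 a b b \<and> G5 a b b \<le> L * (\<Sum>k<5. (b k)\<^sup>2)"
    using G5_bounds by metis
  have "inner4 (Gu u) (l / (qq u)\<^sup>2) (L / (qq u)\<^sup>2)" for u
  proof
    note a = A5_in_Rspace[of u]
    have d: "dA5 u (\<lambda>i. x * b i + y * c i) = (\<lambda>k. x * dA5 u b k + y * dA5 u c k)" for x y b c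
    proof
      fix k show "dA5 u (\<lambda>i. x * b i + y * c i) k = x * dA5 u b k + y * dA5 u c k"
        by (subst (1 2 3) dA5_expand) (simp add: sum_distrib_left sum.distrib algebra_simps)
    qed
    show "lin4 (\<lambda>b. Gu u b c)" for c
    proof (rule lin4I)
      show "Gu u (\<lambda>i. x * b i + y * b' i) c = x * Gu u b c + y * Gu u b' c" for x y b b'
        unfolding Gu_eq d by (rule G5_facts(2)[OF a])
      show "Gu u b c = Gu u b' c" if "\<And>i. i < 4 \<Longrightarrow> b i = b' i" for b b'
      proof -
        have "dPsi u b = dPsi u b'" using that by (subst (1 2) dPsi_expand) simp
        then show ?thesis by (simp add: Gu_def)
      qed
    qed
    show "Gu u b c = Gu u c b" for b c unfolding Gu_eq by (rule G5_facts(1)[OF a])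
    show "l / (qq u)\<^sup>2 * (\<Sum>i<4. (b i)\<^sup>2) \<le> Gu u b b" "Gu u b b \<le> L / (qq u)\<^sup>2 * (\<Sum>i<4. (b i)\<^sup>2)" for b
      using lL(3)[OF A5_in_unit_box, of "dA5 u b" u] unfolding Gu_eq norm_dA5 by auto
    show "l / (qq u)\<^sup>2 > 0" using lL(1) qq_pos[of u] by simp
  qed
  then show ?thesis using lL by blast
qed

lemma gram_Psi: "i < 4 \<Longrightarrow> j < 4 \<Longrightarrow> gram g Psi u i j = Gu u (e_vec i) (e_vec j)"
  by (simp add: gram_def coord_vec_Psi Gu_def)

section \<open>The volume density\<close>

definition rho :: "(nat \<Rightarrow> real) \<Rightarrow> real"
  where "rho u = sqrt (Determinant.det (Matrix.mat 4 4 (\<lambda>(i, j). gram g Psi u i j)))"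

lemma continuous_on_Gu:
  assumes "i < 4" "j < 4"
  shows "continuous_on (Rspace 4) (\<lambda>u. Gu u (e_vec i) (e_vec j))"
proof -
  have cA: "continuous_on (Rspace 4) (\<lambda>u. A5 u k)" for k
  proof (cases "k < 5")
    case True
    show ?thesis by (rule smooth_on_imp_continuous_on[OF smooth_on_A5[OF openin_Rspace True]])
  qed (simp add: A5_def)
  have cA': "continuous_on (Rspace 4) A5"
    by (rule continuous_on_coordinatewise_then_product) (rule cA)
  have cd: "continuous_on (Rspace 4) (\<lambda>u. dA5 u (e_vec i) k)" if "k < 5" "i < 4" for k i
  proof -
    \<comment> \<open>As a partial derivative of the smooth map \<open>A5\<close> it is
      continuous.\<close>
    have "dA5 u (e_vec i) k = partial_deriv i (\<lambda>u. A5 u k) u" for u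
    proof (rule partial_deriv_eqI[symmetric])
      have s: "((\<lambda>t. A5 (u(i := t)) k) has_real_derivative partial_deriv i (\<lambda>u. A5 u k) (\<lambda>i\<in>{..<4}. u i)) (at (u i))"
        if "u \<in> Rspace 4" for u
        using smooth_on_DERIV[OF smooth_on_A5[OF openin_Rspace \<open>k < 5\<close>] that \<open>i < 4\<close>] that
        by (simp add: Rspace_def PiE_def extensional_restrict)
      have h: "((\<lambda>t. hvec (u(i := t)) k / qq (u(i := t))) has_real_derivative
        ((if k < 3 then e_vec i k else if k = 3 then - sin ((u(i := u i)) 3) * e_vec i 3 else cos ((u(i := u i)) 3) * e_vec i 3) * qq (u(i := u i))
        - hvec (u(i := u i)) k * (2 * ydot (u(i := u i)) (e_vec i))) / (qq (u(i := u i)) * qq (u(i := u i)))) (at (u i))"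
      proof (intro DERIV_divide hvec_curve qq_curve \<open>k < 5\<close>)
        show "((\<lambda>t. (u(i := t)) k) has_real_derivative e_vec i k) (at (u i))" for k
          by (cases "k = i") (auto simp: e_vec_def)
        then show "((\<lambda>t. (u(i := t)) k) has_real_derivative e_vec i k) (at (u i))" for k .
      qed (rule qq_nz)
      then show "((\<lambda>t. A5 (u(i := t)) k) has_real_derivative dA5 u (e_vec i) k) (at (u i))"
        using \<open>k < 5\<close> qq_nz[of u] unfolding dA5_def
        by (simp add: A5_def diff_divide_distrib power2_eq_square cong: if_cong)
    qed
    then show ?thesis
      using smooth_on_imp_continuous_on[OF smooth_on_partial_deriv[OF openin_Rspace smooth_on_A5[OF openin_Rspace that(1)] that(2)]]
      by simp
  qed
  have "Gu u (e_vec i) (e_vec j) =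
    (\<Sum>k<5. \<Sum>m<5. dA5 u (e_vec i) k * dA5 u (e_vec j) m * G5 (A5 u) (e_vec k) (e_vec m))" for u
    unfolding Gu_eq by (rule G5_expand[OF A5_in_Rspace])
  moreover have "continuous_on (Rspace 4) (\<lambda>u. \<Sum>k<5. \<Sum>m<5. dA5 u (e_vec i) k * dA5 u (e_vec j) m * G5 (A5 u) (e_vec k) (e_vec m))"
  proof (intro continuous_on_sum continuous_on_mult cd assms)
    fix k m :: nat assume "k \<in> {..<5}" "m \<in> {..<5}"
    then show "continuous_on (Rspace 4) (\<lambda>u. G5 (A5 u) (e_vec k) (e_vec m))"
      by (intro continuous_on_compose2[OF continuous_on_G5 cA']) (auto intro: A5_in_Rspace)
  qed auto
  ultimately show ?thesis by presburger
qed

lemma rho_eq: "rho u = sqrt (Determinant.det (Matrix.mat 4 4 (\<lambda>(i, j). Gu u (e_vec i) (e_vec j))))"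
proof -
  have "Matrix.mat 4 4 (\<lambda>(i, j). gram g Psi u i j) = Matrix.mat 4 4 (\<lambda>(i, j). Gu u (e_vec i) (e_vec j))"
    by (rule eq_matI) (auto simp: gram_Psi)
  then show ?thesis by (simp add: rho_def)
qed

lemma continuous_on_rho: "continuous_on (Rspace 4) rho"
  unfolding rho_eq[abs_def] det_mat_eq_sum
proof (intro continuous_on_real_sqrt continuous_on_sum continuous_on_mult continuous_on_const continuous_on_prod)
  fix p :: "nat \<Rightarrow> nat" and i :: nat assume "p \<in> {p. p permutes {0..<4}}" "i \<in> {0..<4}"
  then have "p i < 4" "i < 4" using permutes_in_image[of p "{0..<4}" i] by auto
  then show "continuous_on (Rspace 4) (\<lambda>u. Gu u (e_vec i) (e_vec (p i)))" by (intro continuous_on_Gu)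
qed

text \<open>The Gram matrix has entries of order q^(-2), so its determinant has order q^(-8) and
  \<open>rho\<close> has order q^(-4). Components of orthonormal frames have order at most q. One
  constant serves all these estimates.\<close>

lemma rho_bounds: "\<exists>C. C > 0 \<and> (\<forall>u. rho u > 0 \<and> rho u \<le> C / (qq u)^4 \<and> 1 / rho u \<le> C * (qq u)^4 \<and>
    (\<forall>i<4. \<forall>j<4. \<bar>Gu u (e_vec i) (e_vec j)\<bar> \<le> C / (qq u)\<^sup>2) \<and>
    (\<forall>E :: nat \<Rightarrow> nat \<Rightarrow> real. (\<forall>i<4. \<forall>j<4. Gu u (E i) (E j) = (if i = j then 1 else 0)) \<longrightarrow>
      (\<forall>i<4. \<forall>k<4. (E i k)\<^sup>2 \<le> C * (qq u)\<^sup>2)))"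
proof -
  obtain l L where lL: "l > 0" "L > 0" "\<And>u. inner4 (Gu u) (l / (qq u)\<^sup>2) (L / (qq u)\<^sup>2)"
    using Gu_inner4 by blast
  define C where "C = max (max L (1 / l)) (max (5 * L\<^sup>2) (24 / l\<^sup>2))"
  have C: "L \<le> C" "5 * L\<^sup>2 \<le> C" "24 / l\<^sup>2 \<le> C" "C > 0" "1 / l \<le> C" using lL(2) by (auto simp: C_def less_max_iff_disj)
  show ?thesis
  proof (intro exI[of _ C] conjI allI impI C(4))
    fix u
    interpret inner4 "Gu u" "l / (qq u)\<^sup>2" "L / (qq u)\<^sup>2" by (rule lL(3))
    have r: "rho u = sqrt (Determinant.det Gmat)" by (simp add: rho_eq Gmat_def)
    have q: "qq u > 0" by (rule qq_pos)
    show "rho u > 0" using det_Gmat_bounds(1) by (simp add: r)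
    have "rho u \<le> 5 * L\<^sup>2 / (qq u)^4"
      using det_Gmat_bounds(2) by (simp add: r power_divide flip: power_mult)
    also have "\<dots> \<le> C / (qq u)^4" using C(2) q by (simp add: divide_right_mono)
    finally show "rho u \<le> C / (qq u)^4" .
    have "1 / rho u \<le> 24 / l\<^sup>2 * (qq u)^4"
      using det_Gmat_bounds(3) by (simp add: r power_divide flip: power_mult)
    also have "\<dots> \<le> C * (qq u)^4" by (rule mult_right_mono[OF C(3)]) simp
    finally show "1 / rho u \<le> C * (qq u)^4" .
    show "\<bar>Gu u (e_vec i) (e_vec j)\<bar> \<le> C / (qq u)\<^sup>2" if "i < 4" "j < 4" for i j
      using entry_le[OF that] divide_right_mono[OF C(1), of "(qq u)\<^sup>2"] by simp
    show "(E i k)\<^sup>2 \<le> C * (qq u)\<^sup>2"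
      if "\<forall>i<4. \<forall>j<4. Gu u (E i) (E j) = (if i = j then 1 else 0)" "i < 4" "k < 4"
      for E :: "nat \<Rightarrow> nat \<Rightarrow> real" and i k
    proof -
      have "(E i k)\<^sup>2 \<le> 1 / (l / (qq u)\<^sup>2)" using frame_entry[of E i k] that by blast
      also have "\<dots> = 1 / l * (qq u)\<^sup>2" by simp
      also have "\<dots> \<le> C * (qq u)\<^sup>2" by (rule mult_right_mono[OF C(5)]) simp
      finally show ?thesis .
    qed
  qed
qed

text \<open>The frame chosen inside \<open>form_inner\<close> depends on \<open>g\<close> and the
  point alone, so one coordinate matrix \<open>E\<close> works for all degrees and all
  forms.\<close>

lemma form_inner_frame:
  "\<exists>E. (\<forall>i<4. \<forall>j<4. Gu u (E i) (E j) = (if i = j then 1 else 0)) \<and>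
    (\<forall>k \<alpha> \<beta>. form_inner 4 MM g k \<alpha> \<beta> (Psi u) =
      (\<Sum>I\<in>multi_indices 4 k. \<alpha> (Psi u) (map (\<lambda>i. dPsi u (E i)) I) * \<beta> (Psi u) (map (\<lambda>i. dPsi u (E i)) I)) / fact k)"
proof -
  obtain l L where "inner4 (Gu u) (l / (qq u)\<^sup>2) (L / (qq u)\<^sup>2)" using Gu_inner4 by blast
  then obtain F :: "nat \<Rightarrow> nat \<Rightarrow> real" where F: "\<forall>i<4. \<forall>j<4. Gu u (F i) (F j) = (if i = j then 1 else 0)"
    using inner4.orthonormal_exists by blast
  let ?e = "SOME e. orthonormal_frame 4 MM g (Psi u) e"
  have "orthonormal_frame 4 MM g (Psi u) (\<lambda>i. dPsi u (F i))"
    using F unfolding orthonormal_frame_def tangent_space_MM Gu_def by auto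
  then have e: "orthonormal_frame 4 MM g (Psi u) ?e"
    by (rule someI[of "orthonormal_frame 4 MM g (Psi u)"])
  then have "\<forall>i. \<exists>b. i < 4 \<longrightarrow> ?e i = dPsi u b" unfolding orthonormal_frame_def tangent_space_MM by blast
  then obtain E where E: "\<And>i. i < 4 \<Longrightarrow> ?e i = dPsi u (E i)" by metis
  have ortho: "Gu u (E i) (E j) = (if i = j then 1 else 0)" if "i < 4" "j < 4" for i j
    using e E that unfolding orthonormal_frame_def Gu_def by auto
  have mapE: "map ?e I = map (\<lambda>i. dPsi u (E i)) I" if "I \<in> multi_indices 4 k" for I k
    using that E by (auto simp: multi_indices_def)
  have "form_inner 4 MM g k \<alpha> \<beta> (Psi u) =
      (\<Sum>I\<in>multi_indices 4 k. \<alpha> (Psi u) (map (\<lambda>i. dPsi u (E i)) I) * \<beta> (Psi u) (map (\<lambda>i. dPsi u (E i)) I)) / fact k"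
    for k \<alpha> \<beta>
    unfolding form_inner_def Let_def
    by (rule arg_cong[of _ _ "\<lambda>x. x / fact k"], rule sum.cong[OF refl]) (simp only: mapE)
  then show ?thesis using ortho by blast
qed

end

section \<open>The Riemannian volume\<close>

lemma Um_pi_subset_strip: "Um pi \<subseteq> strip"
  by (auto simp: Um_def strip_def abs_less_iff)

lemma inj_on_Psi_strip: "inj_on Psi strip"
proof (rule inj_onI)
  fix u v assume uv: "u \<in> strip" "v \<in> strip" "Psi u = Psi v"
  obtain n :: int where n: "u 3 = v 3 + 2 * pi * n"
    using Psi_eqD(2,3)[OF uv(3)] sin_cos_eq_iff[of "u 3" "v 3"] by auto
  have "0 \<le> u 3" "u 3 < 2 * pi" "0 \<le> v 3" "v 3 < 2 * pi" using uv by (auto simp: strip_def)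
  then have "\<bar>2 * pi * n\<bar> < 2 * pi" using n by linarith
  then have "\<bar>real_of_int n\<bar> < 1" by (simp add: abs_mult)
  then have "n = 0" by linarith
  then have "u 3 = v 3" using n by simp
  moreover have "u i = v i" if "i < 3" for i using Psi_eqD(1)[OF uv(3) that] .
  moreover have "u i = v i" if "i \<ge> 4" for i
    using that uv by (simp add: strip_def Rspace_def PiE_iff extensional_def)
  moreover have "i < 3 \<or> i = 3 \<or> i \<ge> 4" for i :: nat by linarith
  ultimately show "u = v" by (metis ext)
qed

lemma continuous_on_Psi: "continuous_on (Rspace 4) Psi"
  by (rule continuous_on_coordinatewise_then_product)
    (rule smooth_on_imp_continuous_on[OF smooth_on_Psi[OF openin_Rspace]])

lemma measurable_Psi: "Psi \<in> measurable (Rmeas 4) (restrict_space borel MM)"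
proof (rule measurable_restrict_space2)
  show "Psi \<in> borel_measurable (Rmeas 4)"
    by (rule measurable_coordinatewise_then_product)
      (rule measurable_continuous_Rspace[OF smooth_on_imp_continuous_on[OF smooth_on_Psi[OF openin_Rspace]]])
qed (use Psi_in_MM in auto)

text \<open>The inverse charts \<open>Tm 0\<close> and \<open>Tm pi\<close> are continuous on two
  relatively open sets that cover the regular part.\<close>

lemma continuous_on_MM:
  fixes f :: "(nat \<times> nat \<Rightarrow> real) \<Rightarrow> real"
  assumes "continuous_on (Rspace 4) (\<lambda>u. f (Psi u))"
  shows "continuous_on MM f"
proof -
  have c: "continuous_on {P \<in> MM. den m P > 0} f" for m
  proof -
    have "continuous_on {P \<in> MM. den m P > 0} (\<lambda>P. f (Psi (Tm m P)))"
      by (rule continuous_on_compose2[OF assms continuous_on_Tm]) (use Tm_in_Rspace in auto)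
    then show ?thesis using Psi_Tm by (simp cong: continuous_on_cong_simp)
  qed
  have MM: "MM = {P \<in> MM. den 0 P > 0} \<union> {P \<in> MM. den pi P > 0}" using den_0_or_pi by auto
  show ?thesis
    by (subst MM, rule continuous_on_Un_local_open) (use c openin_den_pos MM in auto)
qed

text \<open>The image is a preimage under the continuous inverse of the chart, inside a relatively
  open set.\<close>

lemma sets_lp_image:
  assumes lp: "local_param 4 MM U \<psi>" and A: "A \<in> sets (Rmeas 4)" "A \<subseteq> U"
  shows "\<psi> ` A \<in> sets (restrict_space borel MM)"
proof -
  obtain \<phi> where h: "homeomorphism U (\<psi> ` U) \<psi> \<phi>" and o: "openin (top_of_set MM) (\<psi> ` U)"
    using lp unfolding local_param_def by blast
  obtain W where W: "open W" "\<psi> ` U = MM \<inter> W" using o by (auto simp: openin_open)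
  have UR: "U \<subseteq> Rspace 4" using lp_openin[OF lp] by (auto dest: openin_imp_subset)
  have "continuous_on (\<psi> ` U) \<phi>" using h by (simp add: homeomorphism_def)
  then have "continuous_on (\<psi> ` U) (\<lambda>P. \<phi> P i)" for i
    by (rule continuous_on_product_then_coordinatewise)
  then have "\<phi> \<in> measurable (restrict_space borel (\<psi> ` U)) (Rmeas 4)"
    using h UR by (intro measurable_into_Rmeas borel_measurable_continuous_on_restrict)
      (auto simp: space_restrict_space homeomorphism_def)
  from measurable_sets[OF this A(1)]
  have "\<phi> -` A \<inter> \<psi> ` U \<in> sets (restrict_space borel (\<psi> ` U))" by (simp add: space_restrict_space)
  moreover have "\<phi> -` A \<inter> \<psi> ` U = \<psi> ` A"
    using h A(2) by (auto simp: homeomorphism_def image_iff)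
  ultimately obtain X where X: "X \<in> sets borel" "\<psi> ` A = \<psi> ` U \<inter> X" by (auto simp: sets_restrict_space)
  then have "\<psi> ` A = MM \<inter> (W \<inter> X)" using W by auto
  moreover have "W \<inter> X \<in> sets borel" using W X by auto
  ultimately show ?thesis unfolding sets_restrict_space by blast
qed

context
  fixes g :: "(nat \<times> nat) metric"
  assumes g: "riemannian_metric 5 (RP 5) g"
begin

abbreviation "\<rho> \<equiv> rho g"

lemma rho_pos: "\<rho> u > 0"
  using rho_bounds[OF g] by blast

lemma measurable_rho: "\<rho> \<in> borel_measurable (Rmeas 4)"
  by (rule measurable_continuous_Rspace[OF continuous_on_rho[OF g]])

definition vol :: "(nat \<times> nat \<Rightarrow> real) measure"
  where "vol = distr (density (Rmeas 4) (\<lambda>u. ennreal (\<rho> u) * indicator strip u)) (restrict_space borel MM) Psi"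

lemma measurable_vol_density: "(\<lambda>u. ennreal (\<rho> u) * indicator strip u) \<in> borel_measurable (Rmeas 4)"
  using measurable_rho by measurable

lemma sets_vol: "sets vol = sets (restrict_space borel MM)" and space_vol: "space vol = MM"
  by (simp_all add: vol_def space_restrict_space)

lemma emeasure_vol:
  assumes "E \<in> sets (restrict_space borel MM)"
  shows "emeasure vol E = (\<integral>\<^sup>+ u \<in> strip \<inter> Psi -` E. ennreal (\<rho> u) \<partial>Rmeas 4)"
proof -
  have s: "Psi -` E \<inter> space (Rmeas 4) \<in> sets (Rmeas 4)" by (rule measurable_sets[OF measurable_Psi assms])
  have "emeasure vol E = emeasure (density (Rmeas 4) (\<lambda>u. ennreal (\<rho> u) * indicator strip u)) (Psi -` E \<inter> space (Rmeas 4))"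
    unfolding vol_def using measurable_Psi assms by (subst emeasure_distr) auto
  also have "\<dots> = (\<integral>\<^sup>+ u. ennreal (\<rho> u) * indicator strip u * indicator (Psi -` E \<inter> space (Rmeas 4)) u \<partial>Rmeas 4)"
    by (rule emeasure_density[OF measurable_vol_density s])
  also have "\<dots> = (\<integral>\<^sup>+ u \<in> strip \<inter> Psi -` E. ennreal (\<rho> u) \<partial>Rmeas 4)"
    by (rule nn_integral_cong) (auto simp: indicator_def)
  finally show ?thesis .
qed

text \<open>The Gram matrix of the chart is J G J^T with J given by \<open>jac\<close> and G the
  Gram matrix of the cylinder.\<close>

lemma gram_det_trans:
  assumes lp: "local_param 4 MM U \<psi>" and u: "u \<in> trans_dom U \<psi> m"
  shows "sqrt (Determinant.det (Matrix.mat 4 4 (\<lambda>(i, j). gram g \<psi> u i j))) =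
    \<rho> (Tm m (\<psi> u)) * \<bar>Determinant.det (Matrix.mat 4 4 (\<lambda>(i, j). partial_deriv j (\<lambda>v. Tm m (\<psi> v) i) u))\<bar>"
proof -
  let ?T = "Tm m (\<psi> u)" and ?J = "jac \<psi> m u"
  obtain l L where "inner4 (Gu g ?T) (l / (qq ?T)\<^sup>2) (L / (qq ?T)\<^sup>2)" using Gu_inner4[OF g] by blast
  then interpret inner4 "Gu g ?T" "l / (qq ?T)\<^sup>2" "L / (qq ?T)\<^sup>2" .
  have "Matrix.mat 4 4 (\<lambda>(i, j). gram g \<psi> u i j) = Matrix.mat 4 4 (\<lambda>(i, j). Gu g ?T (?J i) (?J j))"
    by (rule eq_matI) (auto simp: gram_def Gu_def[OF g] coord_vec_trans[OF lp u] Psi_trans[OF lp u])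
  moreover have "Matrix.mat 4 4 (\<lambda>(i, j). partial_deriv j (\<lambda>v. Tm m (\<psi> v) i) u) =
      transpose_mat (Matrix.mat 4 4 (\<lambda>(i, j). ?J i j))"
    by (rule eq_matI) (auto simp: jac_def[OF lp])
  moreover have "Determinant.det (transpose_mat (Matrix.mat 4 4 (\<lambda>(i, j). ?J i j))) =
      Determinant.det (Matrix.mat 4 4 (\<lambda>(i, j). ?J i j))"
    by (rule det_transpose[of _ 4]) simp
  moreover have "\<rho> ?T = sqrt (Determinant.det Gmat)" by (simp add: rho_eq[OF g] Gmat_def)
  ultimately show ?thesis by (simp add: det_gram_matrix real_sqrt_mult)
qed

text \<open>When the transition map takes values in \<open>strip\<close>, the part of
  \<open>strip\<close> over the image of \<open>S\<close> is precisely the image of \<open>S\<close>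
  under the transition map, and the change of variables formula applies.\<close>

lemma emeasure_vol_trans:
  assumes lp: "local_param 4 MM U \<psi>" and S: "S \<in> sets (Rmeas 4)" "S \<subseteq> trans_dom U \<psi> m"
    and strip: "\<And>u. u \<in> S \<Longrightarrow> Tm m (\<psi> u) \<in> strip"
  shows "emeasure vol (\<psi> ` S) =
    (\<integral>\<^sup>+ u \<in> S. ennreal (sqrt (Determinant.det (Matrix.mat 4 4 (\<lambda>(i, j). gram g \<psi> u i j)))) \<partial>Rmeas 4)"
proof -
  \<comment> \<open>The four-element type \<open>4\<close> provides the bijection that the change of
    variables formula asks for.\<close>
  obtain b :: "4 \<Rightarrow> nat" where b: "bij_betw b UNIV {..<4}"
    using finite_same_card_bij[of "UNIV :: 4 set" "{..<4::nat}"] by auto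
  let ?T = "\<lambda>u. Tm m (\<psi> u)" and ?V = "trans_dom U \<psi> m"
  have SU: "S \<subseteq> U" using S(2) trans_dom_subset[OF lp] by blast
  have pre: "strip \<inter> Psi -` (\<psi> ` S) = ?T ` S"
  proof (intro equalityI subsetI)
    fix v assume "v \<in> strip \<inter> Psi -` (\<psi> ` S)"
    then obtain u where u: "u \<in> S" "v \<in> strip" "Psi v = \<psi> u" by auto
    then have "Psi v = Psi (?T u)" using Psi_trans[OF lp, of u m] S(2) by auto
    then have "v = ?T u" using inj_onD[OF inj_on_Psi_strip _ u(2) strip[OF u(1)]] by blast
    then show "v \<in> ?T ` S" using u by blast
  next
    fix v assume "v \<in> ?T ` S"
    then show "v \<in> strip \<inter> Psi -` (\<psi> ` S)" using strip Psi_trans[OF lp] S(2) by auto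
  qed
  \<comment> \<open>Measurability of the image: it is cut out of \<open>Um m\<close> by a preimage
    under \<open>Psi\<close>.\<close>
  have TB: "?T ` B \<in> sets (Rmeas 4)" if B: "B \<in> sets (Rmeas 4)" "B \<subseteq> ?V" for B
  proof -
    have BU: "B \<subseteq> U" using B(2) trans_dom_subset[OF lp] by blast
    have "?T ` B = Um m \<inter> (Psi -` (\<psi> ` B) \<inter> space (Rmeas 4))"
    proof (intro equalityI subsetI)
      fix v assume "v \<in> ?T ` B"
      then show "v \<in> Um m \<inter> (Psi -` (\<psi> ` B) \<inter> space (Rmeas 4))"
        using B(2) trans_in_Um[OF lp] Psi_trans[OF lp] Tm_in_Rspace by auto
    next
      fix v assume "v \<in> Um m \<inter> (Psi -` (\<psi> ` B) \<inter> space (Rmeas 4))"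
      then obtain u where u: "v \<in> Um m" "u \<in> B" "Psi v = \<psi> u" by auto
      then have "v = ?T u" using Tm_Psi by metis
      then show "v \<in> ?T ` B" using u by blast
    qed
    then show ?thesis
      using openin_imp_sets_Rmeas[OF openin_Um, of m] measurable_sets[OF measurable_Psi sets_lp_image[OF lp B(1) BU]]
      by auto
  qed
  have "emeasure vol (\<psi> ` S) = (\<integral>\<^sup>+ u \<in> ?T ` S. ennreal (\<rho> u) \<partial>Rmeas 4)"
    unfolding emeasure_vol[OF sets_lp_image[OF lp S(1) SU]] pre ..
  also have "\<dots> = (\<integral>\<^sup>+ u \<in> S. ennreal (\<rho> (?T u)) *
      ennreal \<bar>Determinant.det (Matrix.mat 4 4 (\<lambda>(i, j). partial_deriv j (\<lambda>u. ?T u i) u))\<bar> \<partial>Rmeas 4)"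
    using Tm_in_Rspace TB measurable_rho S
    by (intro nn_integral_smooth_image[OF b openin_trans_dom[OF lp, of m] smooth_on_trans[OF lp] _ trans_inj[OF lp]]) auto
  also have "\<dots> = (\<integral>\<^sup>+ u \<in> S. ennreal (sqrt (Determinant.det (Matrix.mat 4 4 (\<lambda>(i, j). gram g \<psi> u i j)))) \<partial>Rmeas 4)"
  proof (rule nn_integral_cong)
    fix u
    show "ennreal (\<rho> (?T u)) * ennreal \<bar>Determinant.det (Matrix.mat 4 4 (\<lambda>(i, j). partial_deriv j (\<lambda>u. ?T u i) u))\<bar> * indicator S u =
      ennreal (sqrt (Determinant.det (Matrix.mat 4 4 (\<lambda>(i, j). gram g \<psi> u i j)))) * indicator S u"
    proof (cases "u \<in> S")
      case True
      then have u: "u \<in> ?V" using S(2) by blast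
      show ?thesis unfolding gram_det_trans[OF lp u] using rho_pos[of "?T u"] by (simp add: ennreal_mult less_imp_le)
    qed simp
  qed
  finally show ?thesis .
qed

lemma measurable_gram:
  assumes lp: "local_param 4 MM U \<psi>" and S: "S \<in> sets (Rmeas 4)" "S \<subseteq> trans_dom U \<psi> m"
  shows "(\<lambda>u. ennreal (sqrt (Determinant.det (Matrix.mat 4 4 (\<lambda>(i, j). gram g \<psi> u i j)))) * indicator S u)
    \<in> borel_measurable (Rmeas 4)"
proof -
  let ?V = "trans_dom U \<psi> m"
  let ?h = "\<lambda>u. sqrt (Determinant.det (Matrix.mat 4 4 (\<lambda>(i, j). gram g \<psi> u i j)))"
  let ?k = "\<lambda>u. \<rho> (Tm m (\<psi> u)) * \<bar>Determinant.det (Matrix.mat 4 4 (\<lambda>(i, j). partial_deriv j (\<lambda>v. Tm m (\<psi> v) i) u))\<bar>"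
  have V: "openin (top_of_set (Rspace 4)) ?V" by (rule openin_trans_dom[OF lp])
  have "continuous_on ?V (\<lambda>u. Tm m (\<psi> u) i)" for i
  proof (cases "i < 4")
    case True
    then show ?thesis by (rule smooth_on_imp_continuous_on[OF smooth_on_trans[OF lp]])
  qed (simp add: Tm_def)
  then have cT: "continuous_on ?V (\<lambda>u. Tm m (\<psi> u))"
    by (rule continuous_on_coordinatewise_then_product)
  have "continuous_on ?V ?k"
    unfolding det_mat_eq_sum
  proof (intro continuous_on_mult continuous_on_rabs continuous_on_sum continuous_on_const continuous_on_prod)
    show "continuous_on ?V (\<lambda>u. \<rho> (Tm m (\<psi> u)))"
      by (rule continuous_on_compose2[OF continuous_on_rho[OF g] cT]) (use Tm_in_Rspace in auto)
    fix p :: "nat \<Rightarrow> nat" and i :: nat assume "p \<in> {p. p permutes {0..<4}}" "i \<in> {0..<4}"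
    then have "p i < 4" "i < 4" using permutes_in_image[of p "{0..<4}" i] by auto
    then show "continuous_on ?V (\<lambda>u. partial_deriv (p i) (\<lambda>v. Tm m (\<psi> v) i) u)"
      using smooth_on_imp_continuous_on[OF smooth_on_partial_deriv[OF V smooth_on_trans[OF lp]]] by simp
  qed
  moreover have "?k u = ?h u" if "u \<in> ?V" for u using gram_det_trans[OF lp that] by simp
  ultimately have "continuous_on ?V ?h" by (rule continuous_on_eq)
  then have "?h \<in> borel_measurable (restrict_space (Rmeas 4) ?V)"
    using openin_imp_subset[OF V] by (rule continuous_on_imp_measurable_Rmeas)
  then have "?h \<in> borel_measurable (restrict_space (Rmeas 4) S)"
    using S(2) by (rule measurable_restrict_mono)
  then have "(\<lambda>u. ennreal (?h u)) \<in> borel_measurable (restrict_space (Rmeas 4) S)"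
    by (rule measurable_compose) simp
  moreover have "S \<inter> space (Rmeas 4) \<in> sets (Rmeas 4)" using S(1) by (rule sets.Int) (rule sets.top)
  ultimately show ?thesis by (simp only: borel_measurable_restrict_space_iff_ennreal)
qed

text \<open>Angles taken around pi land in \<open>strip\<close> and miss only the points of angle 0
  modulo 2 pi. Those are handled by the angle around 0, which is exactly 0 there and so lies in
  \<open>strip\<close> as well.\<close>

lemma is_riemannian_volume_vol: "is_riemannian_volume 4 MM g vol"
  unfolding is_riemannian_volume_def
proof (intro conjI allI impI)
  show "space vol = MM" by (rule space_vol)
  show "sets vol = sets (restrict_space borel MM)" by (rule sets_vol)
  fix U \<psi> A assume lp: "local_param 4 MM U \<psi>" and A: "A \<in> sets (Rmeas 4)" "A \<subseteq> U"
  let ?f = "\<lambda>u. ennreal (sqrt (Determinant.det (Matrix.mat 4 4 (\<lambda>(i, j). gram g \<psi> u i j))))"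
  let ?V = "trans_dom U \<psi> pi"
  define S1 where "S1 = A \<inter> ?V"
  define S2 where "S2 = A - ?V"
  have V: "?V \<in> sets (Rmeas 4)" by (rule openin_imp_sets_Rmeas[OF openin_trans_dom[OF lp]])
  have S: "S1 \<in> sets (Rmeas 4)" "S2 \<in> sets (Rmeas 4)" using A V by (auto simp: S1_def S2_def)
  have S2': "S2 \<subseteq> trans_dom U \<psi> 0" using trans_cover[OF lp] A(2) by (auto simp: S2_def)
  have 1: "emeasure vol (\<psi> ` S1) = (\<integral>\<^sup>+ u \<in> S1. ?f u \<partial>Rmeas 4)"
  proof (rule emeasure_vol_trans[OF lp S(1)])
    show "S1 \<subseteq> ?V" by (auto simp: S1_def)
    show "Tm pi (\<psi> u) \<in> strip" if "u \<in> S1" for u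
      using that trans_in_Um[OF lp, of u pi] Um_pi_subset_strip by (auto simp: S1_def)
  qed
  have 2: "emeasure vol (\<psi> ` S2) = (\<integral>\<^sup>+ u \<in> S2. ?f u \<partial>Rmeas 4)"
  proof (rule emeasure_vol_trans[OF lp S(2) S2'])
    fix u assume u: "u \<in> S2"
    let ?t = "Tm 0 (\<psi> u)"
    have t: "?t \<in> Um 0" "Psi ?t = \<psi> u" using u S2' trans_in_Um[OF lp] Psi_trans[OF lp] by blast+
    have "\<not> den pi (Psi ?t) > 0" using u A(2) t by (auto simp: S2_def trans_dom_def[OF lp])
    then have "\<not> 1 + cos (?t 3 - pi) > 0" using qq_pos[of ?t] by (simp add: den_Psi zero_less_divide_iff)
    then have "cos (?t 3) = 1" using cos_le_one[of "?t 3"] by (simp add: cos_diff)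
    then obtain n :: int where n: "?t 3 = real_of_int n * 2 * pi" using cos_one_2pi_int by blast
    have "\<bar>real_of_int n * 2 * pi\<bar> < pi" using t(1) n by (simp add: Um_def)
    then have "\<bar>real_of_int n * 2\<bar> < 1" by (simp add: abs_mult)
    then have "n = 0" by linarith
    then show "?t \<in> strip" using n Tm_in_Rspace by (simp add: strip_def)
  qed
  have SU: "S1 \<subseteq> U" "S2 \<subseteq> U" using A(2) by (auto simp: S1_def S2_def)
  have "A = S1 \<union> S2" "S1 \<inter> S2 = {}" by (auto simp: S1_def S2_def)
  then have "\<psi> ` A = \<psi> ` S1 \<union> \<psi> ` S2" "\<psi> ` S1 \<inter> \<psi> ` S2 = {}"
    using inj_on_image_Int[OF lp_inj[OF lp] SU] by auto
  then have "emeasure vol (\<psi> ` A) = emeasure vol (\<psi> ` S1) + emeasure vol (\<psi> ` S2)"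
    using sets_lp_image[OF lp S(1) SU(1)] sets_lp_image[OF lp S(2) SU(2)]
    by (simp add: plus_emeasure[symmetric] sets_vol)
  also have "\<dots> = (\<integral>\<^sup>+ u. ?f u * indicator S1 u + ?f u * indicator S2 u \<partial>Rmeas 4)"
    unfolding 1 2 using measurable_gram[OF lp S(1), of pi] measurable_gram[OF lp S(2) S2']
    by (subst nn_integral_add) (auto simp: S1_def)
  also have "\<dots> = (\<integral>\<^sup>+ u \<in> A. ?f u \<partial>Rmeas 4)"
    by (rule nn_integral_cong) (auto simp: S1_def S2_def indicator_def)
  finally show "emeasure vol (\<psi> ` A) = (\<integral>\<^sup>+ u \<in> A. ?f u \<partial>Rmeas 4)" .
qed

text \<open>A Borel set splits into the part with angle strictly between 0 and 2 pi and the part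
  with angle 0. Each is the image of a measurable set under one chart, where the measure is
  prescribed.\<close>

lemma riemannian_volume_unique:
  assumes \<mu>: "is_riemannian_volume 4 MM g \<mu>"
  shows "\<mu> = vol"
proof (rule measure_eqI)
  have sm: "sets \<mu> = sets (restrict_space borel MM)" using \<mu> by (simp add: is_riemannian_volume_def)
  then show "sets \<mu> = sets vol" by (simp add: sets_vol)
  fix E assume "E \<in> sets \<mu>"
  then have E: "E \<in> sets (restrict_space borel MM)" by (simp add: sm)
  then have EM: "E \<subseteq> MM" by (auto simp: sets_restrict_space)
  let ?P = "Psi -` E \<inter> space (Rmeas 4)"
  have P: "?P \<in> sets (Rmeas 4)" by (rule measurable_sets[OF measurable_Psi E])
  define E1 where "E1 = Um pi \<inter> ?P"
  define E2 where "E2 = (Um 0 \<inter> (strip - Um pi)) \<inter> ?P"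
  have S: "E1 \<in> sets (Rmeas 4)" "E2 \<in> sets (Rmeas 4)"
    unfolding E1_def E2_def using P openin_imp_sets_Rmeas[OF openin_Um] strip_in_sets by auto
  have sub: "E1 \<subseteq> Um pi" "E2 \<subseteq> Um 0" by (auto simp: E1_def E2_def)
  have st: "strip \<subseteq> Um pi \<union> (Um 0 \<inter> (strip - Um pi))"
    by (auto simp: strip_def Um_def abs_less_iff)
  have eq: "E = Psi ` E1 \<union> Psi ` E2"
  proof (intro equalityI subsetI)
    fix X assume X: "X \<in> E"
    then obtain u where u: "u \<in> strip" "X = Psi u" using MM_cases EM by blast
    then have "u \<in> ?P" using X by (auto simp: strip_def)
    then have "u \<in> E1 \<union> E2" using st u(1) by (auto simp: E1_def E2_def)
    then show "X \<in> Psi ` E1 \<union> Psi ` E2" using u(2) by blast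
  qed (auto simp: E1_def E2_def)
  have disj: "Psi ` E1 \<inter> Psi ` E2 = {}"
  proof -
    have "E1 \<subseteq> strip" "E2 \<subseteq> strip" "E1 \<inter> E2 = {}" using Um_pi_subset_strip by (auto simp: E1_def E2_def)
    then show ?thesis using inj_on_image_Int[OF inj_on_Psi_strip, of E1 E2] by simp
  qed
  have im: "Psi ` E1 \<in> sets (restrict_space borel MM)" "Psi ` E2 \<in> sets (restrict_space borel MM)"
    using sets_lp_image[OF local_param_Psi] S sub by blast+
  have *: "emeasure \<nu> (Psi ` E1) =
      (\<integral>\<^sup>+ u \<in> E1. ennreal (sqrt (Determinant.det (Matrix.mat 4 4 (\<lambda>(i, j). gram g Psi u i j)))) \<partial>Rmeas 4)"
    "emeasure \<nu> (Psi ` E2) =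
      (\<integral>\<^sup>+ u \<in> E2. ennreal (sqrt (Determinant.det (Matrix.mat 4 4 (\<lambda>(i, j). gram g Psi u i j)))) \<partial>Rmeas 4)"
    if "is_riemannian_volume 4 MM g \<nu>" for \<nu>
    using that S sub local_param_Psi unfolding is_riemannian_volume_def by blast+
  show "emeasure \<mu> E = emeasure vol E"
    unfolding eq using *[OF \<mu>] *[OF is_riemannian_volume_vol] im disj
    by (simp add: plus_emeasure[symmetric] sm sets_vol)
qed

lemma riemannian_volume_eq: "riemannian_volume 4 MM g = vol"
  unfolding riemannian_volume_def
  by (rule the_equality) (auto intro: is_riemannian_volume_vol riemannian_volume_unique)

lemma measurable_on_MM:
  assumes "continuous_on (Rspace 4) (\<lambda>u. f (Psi u) :: real)"
  shows "f \<in> borel_measurable (restrict_space borel MM)"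
  by (rule borel_measurable_continuous_on_restrict[OF continuous_on_MM[OF assms]])

lemma nn_integral_vol:
  assumes "f \<in> borel_measurable (restrict_space borel MM)"
  shows "(\<integral>\<^sup>+ P. f P \<partial>vol) = (\<integral>\<^sup>+ u \<in> strip. ennreal (\<rho> u) * f (Psi u) \<partial>Rmeas 4)"
proof -
  have m: "(\<lambda>u. f (Psi u)) \<in> borel_measurable (Rmeas 4)" by (rule measurable_compose[OF measurable_Psi assms])
  have "(\<integral>\<^sup>+ P. f P \<partial>vol) = (\<integral>\<^sup>+ u. f (Psi u) \<partial>density (Rmeas 4) (\<lambda>u. ennreal (\<rho> u) * indicator strip u))"
    unfolding vol_def using measurable_Psi assms by (subst nn_integral_distr) auto
  also have "\<dots> = (\<integral>\<^sup>+ u. ennreal (\<rho> u) * indicator strip u * f (Psi u) \<partial>Rmeas 4)"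
    by (rule nn_integral_density[OF measurable_vol_density m])
  finally show ?thesis by (simp add: mult_ac)
qed

lemma integral_vol:
  fixes f :: "(nat \<times> nat \<Rightarrow> real) \<Rightarrow> real"
  assumes "f \<in> borel_measurable (restrict_space borel MM)"
  shows "(\<integral>P. f P \<partial>vol) = (\<integral>u. indicator strip u * (\<rho> u * f (Psi u)) \<partial>Rmeas 4)"
proof -
  have m: "(\<lambda>u. f (Psi u)) \<in> borel_measurable (Rmeas 4)" by (rule measurable_compose[OF measurable_Psi assms])
  have d: "(\<lambda>u. ennreal (\<rho> u) * indicator strip u) = (\<lambda>u. ennreal (\<rho> u * indicator strip u))"
    by (auto simp: indicator_def)
  have "(\<integral>P. f P \<partial>vol) = (\<integral>u. f (Psi u) \<partial>density (Rmeas 4) (\<lambda>u. ennreal (\<rho> u * indicator strip u)))"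
    unfolding vol_def d using measurable_Psi assms by (subst integral_distr) auto
  also have "\<dots> = (\<integral>u. (\<rho> u * indicator strip u) *\<^sub>R f (Psi u) \<partial>Rmeas 4)"
    using m measurable_rho rho_pos by (intro integral_density) (auto simp: less_imp_le)
  finally show ?thesis by (simp add: mult_ac)
qed

end

section \<open>A smooth cutoff\<close>

text \<open>exp(-1/x) x^(-m), extended by 0. The exponent \<open>m\<close> is carried along because
  the linear combinations of these functions are closed under differentiation.\<close>

definition hexp :: "nat \<Rightarrow> real \<Rightarrow> real"
  where "hexp m x = (if x > 0 then exp (- (1 / x)) * (1 / x) ^ m else 0)"

lemma hexp_tendsto: "((\<lambda>x. hexp m x) \<longlongrightarrow> 0) (at_right 0)"
proof -
  have "((\<lambda>x::real. x ^ m / exp x) \<longlongrightarrow> 0) at_top" by (rule tendsto_power_div_exp_0)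
  then have "((\<lambda>x::real. (inverse x) ^ m / exp (inverse x)) \<longlongrightarrow> 0) (at_right 0)"
    by (rule filterlim_compose[OF _ filterlim_inverse_at_top_right])
  moreover have "\<forall>\<^sub>F x in at_right (0::real). (inverse x) ^ m / exp (inverse x) = hexp m x"
    unfolding eventually_at_right_field
    by (intro exI[of _ 1]) (auto simp: hexp_def exp_minus divide_inverse mult.commute)
  ultimately show ?thesis by (rule Lim_transform_eventually)
qed

lemma hexp_DERIV: "(hexp m has_real_derivative hexp (m + 2) x - real m * hexp (m + 1) x) (at x)"
proof (cases "x = 0")
  case False
  show ?thesis
  proof (cases "x > 0")
    case True
    have "((\<lambda>x. exp (- (1 / x)) * (1 / x) ^ m) has_real_derivative
        exp (- (1 / x)) * (1 / x) ^ (m + 2) - real m * (exp (- (1 / x)) * (1 / x) ^ (m + 1))) (at x)"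
      using True
      by (auto intro!: derivative_eq_intros simp: power2_eq_square divide_inverse)
        (cases m; simp add: algebra_simps)
    then have "((\<lambda>x. exp (- (1 / x)) * (1 / x) ^ m) has_real_derivative
        hexp (m + 2) x - real m * hexp (m + 1) x) (at x)"
      using True by (simp add: hexp_def)
    then show ?thesis
      by (rule has_field_derivative_transform_within_open[of _ _ _ "{0<..}"]) (use True in \<open>auto simp: hexp_def\<close>)
  next
    case 2: False
    then have "x < 0" using False by simp
    then have "((\<lambda>_. 0) has_real_derivative hexp (m + 2) x - real m * hexp (m + 1) x) (at x)"
      by (simp add: hexp_def)
    then show ?thesis
      by (rule has_field_derivative_transform_within_open[of _ _ _ "{..<0}"]) (use \<open>x < 0\<close> in \<open>auto simp: hexp_def\<close>)
  qed
next
  case True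
  \<comment> \<open>The difference quotient at 0 is 0 from the left and \<open>hexp (Suc m)\<close>
    from the right, which tends to 0.\<close>
  have "((\<lambda>h. (hexp m h - hexp m 0) / (h - 0)) \<longlongrightarrow> 0) (at 0)"
  proof (rule filterlim_split_at)
    have "\<forall>\<^sub>F h in at_left (0::real). 0 = (hexp m h - hexp m 0) / (h - 0)"
      unfolding eventually_at_left_field by (intro exI[of _ "-1"]) (auto simp: hexp_def)
    then show "((\<lambda>h. (hexp m h - hexp m 0) / (h - 0)) \<longlongrightarrow> 0) (at_left 0)"
      by (rule Lim_transform_eventually[OF tendsto_const])
    have "\<forall>\<^sub>F h in at_right (0::real). hexp (Suc m) h = (hexp m h - hexp m 0) / (h - 0)"
      unfolding eventually_at_right_field by (intro exI[of _ 1]) (auto simp: hexp_def)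
    then show "((\<lambda>h. (hexp m h - hexp m 0) / (h - 0)) \<longlongrightarrow> 0) (at_right 0)"
      by (rule Lim_transform_eventually[OF hexp_tendsto])
  qed
  then show ?thesis using True by (simp add: has_field_derivative_iff hexp_def)
qed

lemma smooth_on_hexp:
  assumes U: "openin (top_of_set (Rspace d)) U" and f: "smooth_on d U f"
  shows "smooth_on d U (\<lambda>u. hexp m (f u))"
  unfolding smooth_on_iff_Cn
proof
  fix n
  have fn: "Cn n d U f" for n using f unfolding smooth_on_iff_Cn by blast
  show "Cn n d U (\<lambda>u. hexp m (f u))"
  proof (induction n arbitrary: m)
    case 0
    show ?case by (rule Cn_0_compose[OF fn]) (rule hexp_DERIV)
  next
    case (Suc n)
    have "Cn n d U (\<lambda>u. hexp (m + 2) (f u) + (- real m) * hexp (m + 1) (f u))"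
      by (rule Cn_add[OF U Suc Cn_mult[OF U Cn_const[OF U] Suc]])
    then have "Cn n d U (\<lambda>u. hexp (m + 2) (f u) - real m * hexp (m + 1) (f u))" by simp
    then show ?case by (rule Cn_Suc_compose[OF U fn hexp_DERIV])
  qed
qed

lemma hexp_0_pos: "hexp 0 x > 0 \<longleftrightarrow> x > 0" and hexp_0_nonneg: "hexp 0 x \<ge> 0"
  by (auto simp: hexp_def)

text \<open>For positive \<open>a\<close> a smooth step from 0 below \<open>a\<close> to 1 above
  \<open>2 * a\<close>.\<close>

definition cutoff :: "real \<Rightarrow> real \<Rightarrow> real"
  where "cutoff a t = hexp 0 (t - a) / (hexp 0 (t - a) + hexp 0 (2 * a - t))"

lemma cutoff_denominator: "a > 0 \<Longrightarrow> hexp 0 (t - a) + hexp 0 (2 * a - t) > 0"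
  using hexp_0_nonneg[of "t - a"] hexp_0_nonneg[of "2 * a - t"] hexp_0_pos[of "t - a"] hexp_0_pos[of "2 * a - t"]
  by (cases "t > a") (auto intro: add_pos_nonneg add_nonneg_pos)

lemma cutoff_0: "t \<le> a \<Longrightarrow> cutoff a t = 0"
  by (simp add: cutoff_def hexp_def)

lemma cutoff_1: "a > 0 \<Longrightarrow> t \<ge> 2 * a \<Longrightarrow> cutoff a t = 1"
  by (simp add: cutoff_def hexp_def)

lemma smooth_on_cutoff:
  assumes U: "openin (top_of_set (Rspace d)) U" and f: "smooth_on d U f" and a: "a > 0"
  shows "smooth_on d U (\<lambda>u. cutoff a (f u))"
proof -
  have 1: "smooth_on d U (\<lambda>u. hexp 0 (f u - a))"
    by (rule smooth_on_hexp[OF U smooth_on_diff[OF U f smooth_on_const[OF U]]])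
  have 2: "smooth_on d U (\<lambda>u. hexp 0 (2 * a - f u))"
    by (rule smooth_on_hexp[OF U smooth_on_diff[OF U smooth_on_const[OF U] f]])
  show ?thesis unfolding cutoff_def
    by (intro smooth_on_divide[OF U 1] smooth_on_add[OF U 1 2]) (use cutoff_denominator[OF a] in \<open>metis less_irrefl\<close>)
qed

lemma cutoff_DERIV:
  assumes "a > 0"
  shows "(cutoff a has_real_derivative deriv (cutoff a) t) (at t)"
proof -
  have "((\<lambda>t. hexp 0 (t - a)) has_real_derivative (hexp (0 + 2) (t - a) - real 0 * hexp (0 + 1) (t - a)) * 1) (at t)"
    by (rule DERIV_chain2[OF hexp_DERIV]) (auto intro!: derivative_eq_intros)
  moreover have "((\<lambda>t. hexp 0 (2 * a - t)) has_real_derivative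
      (hexp (0 + 2) (2 * a - t) - real 0 * hexp (0 + 1) (2 * a - t)) * (-1)) (at t)"
    by (rule DERIV_chain2[OF hexp_DERIV]) (auto intro!: derivative_eq_intros)
  ultimately have "cutoff a field_differentiable (at t)"
    unfolding cutoff_def[abs_def] using cutoff_denominator[OF assms, of t]
    by (intro field_differentiable_divide field_differentiable_add) (auto simp: field_differentiable_def)
  then show ?thesis using DERIV_deriv_iff_field_differentiable by blast
qed

lemma deriv_cutoff_0:
  assumes "t < a \<or> (a > 0 \<and> t > 2 * a)"
  shows "deriv (cutoff a) t = 0"
proof -
  have "\<forall>\<^sub>F s in nhds t. cutoff a s = (if t < a then 0 else 1)"
  proof (cases "t < a")
    case True
    then have "\<forall>\<^sub>F s in nhds t. s \<in> {..<a}" by (intro eventually_nhds_in_open) auto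
    then show ?thesis by eventually_elim (use True in \<open>simp add: cutoff_0\<close>)
  next
    case False
    then have "\<forall>\<^sub>F s in nhds t. s \<in> {2 * a<..}" using assms by (intro eventually_nhds_in_open) auto
    then show ?thesis by eventually_elim (use False assms in \<open>auto simp: cutoff_1\<close>)
  qed
  then have "deriv (cutoff a) t = deriv (\<lambda>_. if t < a then 0 else 1) t"
    by (intro deriv_cong_ev) auto
  then show ?thesis by simp
qed

section \<open>Forms in the cylinder coordinates\<close>

lemma multi_indices_1: "(\<Sum>I\<in>multi_indices 4 (Suc 0). f I) = (\<Sum>i<4. f [i])"
proof -
  have "multi_indices 4 (Suc 0) = (\<lambda>i. [i]) ` {..<4}"
    by (auto simp: multi_indices_def length_Suc_conv)
  then show ?thesis by (simp add: sum.reindex inj_on_def)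
qed

lemma multi_indices_2: "(\<Sum>I\<in>multi_indices 4 (Suc (Suc 0)). f I) = (\<Sum>i<4. \<Sum>j<4. f [i, j])"
proof -
  have "multi_indices 4 (Suc (Suc 0)) = (\<lambda>(i, j). [i, j]) ` ({..<4} \<times> {..<4})"
    by (auto simp: multi_indices_def length_Suc_conv)
  moreover have "inj_on (\<lambda>(i, j). [i, j]) ({..<4::nat} \<times> {..<4::nat})" by (auto simp: inj_on_def)
  ultimately show ?thesis by (simp add: sum.reindex sum.cartesian_product case_prod_unfold)
qed

lemma dPsi_restrict: "(\<And>i. i < 4 \<Longrightarrow> b i = c i) \<Longrightarrow> dPsi u b = dPsi u c"
  by (subst (1 2) dPsi_expand) simp

lemma tangent_lists_1: "vs \<in> tangent_lists 4 MM (Suc 0) (Psi u) \<longleftrightarrow> (\<exists>b. vs = [dPsi u b])"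
  unfolding tangent_lists_def tangent_space_MM by (auto simp: length_Suc_conv)

lemma tangent_lists_2: "vs \<in> tangent_lists 4 MM (Suc (Suc 0)) (Psi u) \<longleftrightarrow> (\<exists>b c. vs = [dPsi u b, dPsi u c])"
  unfolding tangent_lists_def tangent_space_MM by (auto simp: length_Suc_conv)

text \<open>All tangent vectors at \<open>Psi u\<close> have the form \<open>dPsi u b\<close>, so
  linearity can be checked on the coefficients \<open>b\<close>.\<close>

lemma is_form_1I:
  assumes "\<And>u. lin4 (\<lambda>b. \<alpha> (Psi u) [dPsi u b])"
  shows "is_form 4 MM (Suc 0) \<alpha>"
  unfolding is_form_def
proof (intro ballI)
  fix P vs assume P: "P \<in> MM" and vs: "vs \<in> tangent_lists 4 MM (Suc 0) P"
  obtain u where u: "P = Psi u" using MM_cases[OF P] by blast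
  obtain b where b: "vs = [dPsi u b]" using vs unfolding u tangent_lists_1 by blast
  have "\<alpha> P [(\<lambda>j. x * v j + y * w j)] = x * \<alpha> P [v] + y * \<alpha> P [w]"
    if vw: "v \<in> tangent_space 4 MM P" "w \<in> tangent_space 4 MM P" for v w x y
  proof -
    obtain c c' where cc: "v = dPsi u c" "w = dPsi u c'" using vw unfolding u tangent_space_MM by blast
    show ?thesis unfolding cc u dPsi_linear[symmetric] by (rule lin4_add[OF assms])
  qed
  then show "(\<forall>l<Suc 0. \<forall>v\<in>tangent_space 4 MM P. \<forall>w\<in>tangent_space 4 MM P. \<forall>a b.
          \<alpha> P (vs[l := (\<lambda>j. a * v j + b * w j)]) = a * \<alpha> P (vs[l := v]) + b * \<alpha> P (vs[l := w])) \<and>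
       (\<forall>l<Suc 0. \<forall>m<Suc 0. l \<noteq> m \<longrightarrow> vs ! l = vs ! m \<longrightarrow> \<alpha> P vs = 0)"
    unfolding b by simp
qed

lemma is_form_2I:
  assumes lin: "\<And>u c. lin4 (\<lambda>b. \<alpha> (Psi u) [dPsi u b, dPsi u c])" "\<And>u b. lin4 (\<lambda>c. \<alpha> (Psi u) [dPsi u b, dPsi u c])"
    and alt: "\<And>u b. \<alpha> (Psi u) [dPsi u b, dPsi u b] = 0"
  shows "is_form 4 MM (Suc (Suc 0)) \<alpha>"
  unfolding is_form_def
proof (intro ballI)
  fix P vs assume P: "P \<in> MM" and vs: "vs \<in> tangent_lists 4 MM (Suc (Suc 0)) P"
  obtain u where u: "P = Psi u" using MM_cases[OF P] by blast
  obtain b b' where b: "vs = [dPsi u b, dPsi u b']" using vs unfolding u tangent_lists_2 by blast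
  have 1: "\<alpha> P [(\<lambda>j. x * v j + y * w j), dPsi u b'] = x * \<alpha> P [v, dPsi u b'] + y * \<alpha> P [w, dPsi u b']"
    and 2: "\<alpha> P [dPsi u b, (\<lambda>j. x * v j + y * w j)] = x * \<alpha> P [dPsi u b, v] + y * \<alpha> P [dPsi u b, w]"
    if vw: "v \<in> tangent_space 4 MM P" "w \<in> tangent_space 4 MM P" for v w x y
  proof -
    obtain c c' where cc: "v = dPsi u c" "w = dPsi u c'" using vw unfolding u tangent_space_MM by blast
    show "\<alpha> P [(\<lambda>j. x * v j + y * w j), dPsi u b'] = x * \<alpha> P [v, dPsi u b'] + y * \<alpha> P [w, dPsi u b']"
      unfolding cc u dPsi_linear[symmetric] by (rule lin4_add[OF lin(1)])
    show "\<alpha> P [dPsi u b, (\<lambda>j. x * v j + y * w j)] = x * \<alpha> P [dPsi u b, v] + y * \<alpha> P [dPsi u b, w]"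
      unfolding cc u dPsi_linear[symmetric] by (rule lin4_add[OF lin(2)])
  qed
  have "dPsi u b = dPsi u b' \<Longrightarrow> \<alpha> P [dPsi u b, dPsi u b'] = 0" using alt[of u b] u by metis
  then have 3: "dPsi u b = dPsi u b' \<Longrightarrow> \<alpha> P [dPsi u b', dPsi u b'] = 0" by simp
  show "(\<forall>l<Suc (Suc 0). \<forall>v\<in>tangent_space 4 MM P. \<forall>w\<in>tangent_space 4 MM P. \<forall>a b.
          \<alpha> P (vs[l := (\<lambda>j. a * v j + b * w j)]) = a * \<alpha> P (vs[l := v]) + b * \<alpha> P (vs[l := w])) \<and>
       (\<forall>l<Suc (Suc 0). \<forall>m<Suc (Suc 0). l \<noteq> m \<longrightarrow> vs ! l = vs ! m \<longrightarrow> \<alpha> P vs = 0)"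
    unfolding b using 1 2 3 by (auto simp: less_Suc_eq)
qed

lemma is_form_linD:
  assumes "is_form d M k \<omega>" "P \<in> M" "vs \<in> tangent_lists d M k P" "l < k"
    "v \<in> tangent_space d M P" "w \<in> tangent_space d M P"
  shows "\<omega> P (vs[l := (\<lambda>j. a * v j + b * w j)]) = a * \<omega> P (vs[l := v]) + b * \<omega> P (vs[l := w])"
  using assms unfolding is_form_def by blast

lemma is_form_altD:
  assumes "is_form d M k \<omega>" "P \<in> M" "vs \<in> tangent_lists d M k P" "l < k" "m < k" "l \<noteq> m" "vs ! l = vs ! m"
  shows "\<omega> P vs = 0"
  using assms unfolding is_form_def by blast

lemma form_1_lin:
  assumes "is_form 4 MM (Suc 0) \<alpha>"
  shows "lin4 (\<lambda>b. \<alpha> (Psi u) [dPsi u b])"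
proof (rule lin4I)
  fix x y and b c :: "nat \<Rightarrow> real"
  have "[dPsi u b] \<in> tangent_lists 4 MM (Suc 0) (Psi u)" unfolding tangent_lists_1 by blast
  from is_form_linD[OF assms Psi_in_MM this, of 0 "dPsi u b" "dPsi u c" x y]
  show "\<alpha> (Psi u) [dPsi u (\<lambda>i. x * b i + y * c i)] = x * \<alpha> (Psi u) [dPsi u b] + y * \<alpha> (Psi u) [dPsi u c]"
    unfolding dPsi_linear tangent_space_MM by simp
next
  fix b c :: "nat \<Rightarrow> real" assume "\<And>i. i < 4 \<Longrightarrow> b i = c i"
  then show "\<alpha> (Psi u) [dPsi u b] = \<alpha> (Psi u) [dPsi u c]" using dPsi_restrict[of b c u] by simp
qed

text \<open>\<open>is_form\<close> only states vanishing on repeated arguments; evaluation at b + c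
  in both places turns this into skew symmetry.\<close>

lemma form_2_lin:
  assumes "is_form 4 MM (Suc (Suc 0)) \<alpha>"
  shows "lin4 (\<lambda>b. \<alpha> (Psi u) [dPsi u b, dPsi u c])" and "lin4 (\<lambda>c. \<alpha> (Psi u) [dPsi u b, dPsi u c])"
    and "\<alpha> (Psi u) [dPsi u b, dPsi u c] = - \<alpha> (Psi u) [dPsi u c, dPsi u b]"
proof -
  have t: "[dPsi u b, dPsi u c] \<in> tangent_lists 4 MM (Suc (Suc 0)) (Psi u)" for b c
    unfolding tangent_lists_2 by blast
  note F = is_form_linD[OF assms Psi_in_MM t] and F' = is_form_altD[OF assms Psi_in_MM t]
  show l1: "lin4 (\<lambda>b. \<alpha> (Psi u) [dPsi u b, dPsi u c])" for c
  proof (rule lin4I)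
    fix x y and b b' :: "nat \<Rightarrow> real"
    show "\<alpha> (Psi u) [dPsi u (\<lambda>i. x * b i + y * b' i), dPsi u c] =
      x * \<alpha> (Psi u) [dPsi u b, dPsi u c] + y * \<alpha> (Psi u) [dPsi u b', dPsi u c]"
      using F[of 0 "dPsi u b" "dPsi u b'" b c x y]
      unfolding dPsi_linear tangent_space_MM by simp
  next
    fix b b' :: "nat \<Rightarrow> real" assume "\<And>i. i < 4 \<Longrightarrow> b i = b' i"
    then show "\<alpha> (Psi u) [dPsi u b, dPsi u c] = \<alpha> (Psi u) [dPsi u b', dPsi u c]"
      using dPsi_restrict[of b b' u] by simp
  qed
  show l2: "lin4 (\<lambda>c. \<alpha> (Psi u) [dPsi u b, dPsi u c])" for b
  proof (rule lin4I)
    fix x y and c c' :: "nat \<Rightarrow> real"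
    show "\<alpha> (Psi u) [dPsi u b, dPsi u (\<lambda>i. x * c i + y * c' i)] =
      x * \<alpha> (Psi u) [dPsi u b, dPsi u c] + y * \<alpha> (Psi u) [dPsi u b, dPsi u c']"
      using F[of 1 "dPsi u c" "dPsi u c'" b c x y]
      unfolding dPsi_linear tangent_space_MM by simp
  next
    fix c c' :: "nat \<Rightarrow> real" assume "\<And>i. i < 4 \<Longrightarrow> c i = c' i"
    then show "\<alpha> (Psi u) [dPsi u b, dPsi u c] = \<alpha> (Psi u) [dPsi u b, dPsi u c']"
      using dPsi_restrict[of c c' u] by simp
  qed
  have z: "\<alpha> (Psi u) [dPsi u b, dPsi u b] = 0" for b
    using F'[of 0 1 b b] by simp
  have "\<alpha> (Psi u) [dPsi u (\<lambda>i. 1 * b i + 1 * c i), dPsi u (\<lambda>i. 1 * b i + 1 * c i)] =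
    \<alpha> (Psi u) [dPsi u b, dPsi u b] + \<alpha> (Psi u) [dPsi u b, dPsi u c] +
    \<alpha> (Psi u) [dPsi u c, dPsi u b] + \<alpha> (Psi u) [dPsi u c, dPsi u c]"
    using lin4_add[OF l1, of 1 b 1 c] lin4_add[OF l2, of _ 1 b 1 c] by simp
  then show "\<alpha> (Psi u) [dPsi u b, dPsi u c] = - \<alpha> (Psi u) [dPsi u c, dPsi u b]" unfolding z by simp
qed

section \<open>Coefficients of forms in arbitrary charts\<close>

lemma continuous_on_lp:
  assumes lp: "local_param 4 MM U \<psi>" and c: "\<And>m. continuous_on (trans_dom U \<psi> m) f"
  shows "continuous_on U (f :: _ \<Rightarrow> real)"
proof -
  have U: "U = trans_dom U \<psi> 0 \<union> trans_dom U \<psi> pi"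
    using trans_cover[OF lp] trans_dom_subset[OF lp] by blast
  have o: "openin (top_of_set U) (trans_dom U \<psi> m)" for m
    using openin_trans_dom[OF lp, of m] trans_dom_subset[OF lp] openin_imp_subset[OF lp_openin[OF lp]]
    by (meson openin_subset_trans)
  show ?thesis
    by (subst U, rule continuous_on_Un_local_open) (use c o U in auto)
qed

lemma continuous_on_trans:
  assumes lp: "local_param 4 MM U \<psi>"
  shows "continuous_on (trans_dom U \<psi> m) (\<lambda>u. Tm m (\<psi> u))"
proof (rule continuous_on_coordinatewise_then_product)
  fix i
  show "continuous_on (trans_dom U \<psi> m) (\<lambda>u. Tm m (\<psi> u) i)"
  proof (cases "i < 4")
    case True
    then show ?thesis by (rule smooth_on_imp_continuous_on[OF smooth_on_trans[OF lp]])
  qed (simp add: Tm_def)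
qed

lemma continuous_on_jac:
  assumes lp: "local_param 4 MM U \<psi>" and "i < 4" "k < 4"
  shows "continuous_on (trans_dom U \<psi> m) (\<lambda>u. jac \<psi> m u i k)"
  unfolding jac_def[OF lp]
  by (rule smooth_on_imp_continuous_on[OF smooth_on_partial_deriv[OF openin_trans_dom[OF lp] smooth_on_trans[OF lp]]]) fact+

text \<open>In another chart the coefficients are combinations of the cylinder coefficients with
  entries of \<open>jac\<close>, hence even continuous.\<close>

lemma measurable_coeff_1:
  assumes lp: "local_param 4 MM U \<psi>" and lin: "\<And>u. lin4 (\<lambda>b. \<alpha> (Psi u) [dPsi u b])"
    and cont: "\<And>k. k < 4 \<Longrightarrow> continuous_on (Rspace 4) (\<lambda>u. \<alpha> (Psi u) [dPsi u (e_vec k)])"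
    and I: "I \<in> multi_indices 4 (Suc 0)"
  shows "form_coeff \<psi> \<alpha> I \<in> borel_measurable (restrict_space (Rmeas 4) U)"
proof (rule continuous_on_imp_measurable_Rmeas)
  show "U \<subseteq> Rspace 4" using lp_openin[OF lp] by (rule openin_imp_subset)
  obtain i where i: "I = [i]" "i < 4" using I by (auto simp: multi_indices_def length_Suc_conv)
  show "continuous_on U (form_coeff \<psi> \<alpha> I)"
  proof (rule continuous_on_lp[OF lp])
    fix m
    let ?V = "trans_dom U \<psi> m"
    have "continuous_on ?V (\<lambda>u. \<Sum>k<4. jac \<psi> m u i k * \<alpha> (Psi (Tm m (\<psi> u))) [dPsi (Tm m (\<psi> u)) (e_vec k)])"
    proof (intro continuous_on_sum continuous_on_mult continuous_on_jac[OF lp i(2)])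
      fix k :: nat assume "k \<in> {..<4}"
      then show "k < 4" by simp
      then show "continuous_on ?V (\<lambda>u. \<alpha> (Psi (Tm m (\<psi> u))) [dPsi (Tm m (\<psi> u)) (e_vec k)])"
        by (intro continuous_on_compose2[OF cont continuous_on_trans[OF lp]]) (use Tm_in_Rspace in auto)
    qed
    moreover have "(\<Sum>k<4. jac \<psi> m u i k * \<alpha> (Psi (Tm m (\<psi> u))) [dPsi (Tm m (\<psi> u)) (e_vec k)]) = form_coeff \<psi> \<alpha> I u"
      if "u \<in> ?V" for u
      using lin[of "Tm m (\<psi> u)", unfolded lin4_def, rule_format, of "jac \<psi> m u i"]
      by (simp add: i form_coeff_def coord_vec_trans[OF lp that] Psi_trans[OF lp that])
    ultimately show "continuous_on ?V (form_coeff \<psi> \<alpha> I)" by (rule continuous_on_eq)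
  qed
qed

lemma measurable_coeff_2:
  assumes lp: "local_param 4 MM U \<psi>"
    and lin: "\<And>u c. lin4 (\<lambda>b. \<alpha> (Psi u) [dPsi u b, dPsi u c])" "\<And>u b. lin4 (\<lambda>c. \<alpha> (Psi u) [dPsi u b, dPsi u c])"
    and cont: "\<And>k l. k < 4 \<Longrightarrow> l < 4 \<Longrightarrow> continuous_on (Rspace 4) (\<lambda>u. \<alpha> (Psi u) [dPsi u (e_vec k), dPsi u (e_vec l)])"
    and I: "I \<in> multi_indices 4 (Suc (Suc 0))"
  shows "form_coeff \<psi> \<alpha> I \<in> borel_measurable (restrict_space (Rmeas 4) U)"
proof (rule continuous_on_imp_measurable_Rmeas)
  show "U \<subseteq> Rspace 4" using lp_openin[OF lp] by (rule openin_imp_subset)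
  obtain i j where i: "I = [i, j]" "i < 4" "j < 4" using I by (auto simp: multi_indices_def length_Suc_conv)
  show "continuous_on U (form_coeff \<psi> \<alpha> I)"
  proof (rule continuous_on_lp[OF lp])
    fix m
    let ?V = "trans_dom U \<psi> m" and ?T = "\<lambda>u. Tm m (\<psi> u)"
    have "continuous_on ?V (\<lambda>u. \<Sum>k<4. jac \<psi> m u i k * (\<Sum>l<4. jac \<psi> m u j l * \<alpha> (Psi (?T u)) [dPsi (?T u) (e_vec k), dPsi (?T u) (e_vec l)]))"
    proof (intro continuous_on_sum continuous_on_mult continuous_on_jac[OF lp i(2)] continuous_on_jac[OF lp i(3)])
      fix k l :: nat assume "k \<in> {..<4}" "l \<in> {..<4}"
      then show "continuous_on ?V (\<lambda>u. \<alpha> (Psi (?T u)) [dPsi (?T u) (e_vec k), dPsi (?T u) (e_vec l)])"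
        by (intro continuous_on_compose2[OF cont continuous_on_trans[OF lp]]) (use Tm_in_Rspace in auto)
    qed auto
    moreover have "(\<Sum>k<4. jac \<psi> m u i k * (\<Sum>l<4. jac \<psi> m u j l * \<alpha> (Psi (?T u)) [dPsi (?T u) (e_vec k), dPsi (?T u) (e_vec l)])) = form_coeff \<psi> \<alpha> I u"
      if "u \<in> ?V" for u
    proof -
      have "form_coeff \<psi> \<alpha> I u = \<alpha> (Psi (?T u)) [dPsi (?T u) (jac \<psi> m u i), dPsi (?T u) (jac \<psi> m u j)]"
        using i by (simp add: form_coeff_def coord_vec_trans[OF lp that] Psi_trans[OF lp that])
      also have "\<dots> = (\<Sum>k<4. jac \<psi> m u i k * \<alpha> (Psi (?T u)) [dPsi (?T u) (e_vec k), dPsi (?T u) (jac \<psi> m u j)])"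
        using lin(1)[of "?T u" "jac \<psi> m u j"] unfolding lin4_def by blast
      also have "\<dots> = (\<Sum>k<4. jac \<psi> m u i k * (\<Sum>l<4. jac \<psi> m u j l * \<alpha> (Psi (?T u)) [dPsi (?T u) (e_vec k), dPsi (?T u) (e_vec l)]))"
        using lin(2)[of "?T u" "e_vec _"] unfolding lin4_def by (intro sum.cong refl arg_cong2[of _ _ _ _ "(*)"]) blast
      finally show ?thesis ..
    qed
    ultimately show "continuous_on ?V (form_coeff \<psi> \<alpha> I)" by (rule continuous_on_eq)
  qed
qed

lemma Psi_points: "Psi (SOME w. Psi w = Psi u) = Psi u"
  by (rule someI[of "\<lambda>w. Psi w = Psi u" u]) (rule refl)

text \<open>Allows forms on the variety to be defined by expressions in the parameters.\<close>

definition up :: "(nat \<times> nat \<Rightarrow> real) \<Rightarrow> nat \<Rightarrow> real"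
  where "up P = (SOME u. Psi u = P)"

lemma up_Psi:
  shows "i < 3 \<Longrightarrow> up (Psi u) i = u i" and "qq (up (Psi u)) = qq u" and "dPsi (up (Psi u)) = dPsi u"
proof -
  have P: "Psi (up (Psi u)) = Psi u" unfolding up_def by (rule Psi_points)
  show y: "up (Psi u) i = u i" if "i < 3" for i using Psi_eqD(1)[OF P that] .
  then show "qq (up (Psi u)) = qq u" by (simp add: qq_def)
  show "dPsi (up (Psi u)) = dPsi u"
  proof
    fix c show "dPsi (up (Psi u)) c = dPsi u c" by (rule dPsi_cong) (use y Psi_eqD[OF P] in auto)
  qed
qed

context
  fixes g :: "(nat \<times> nat) metric"
  assumes g: "riemannian_metric 5 (RP 5) g"
begin

lemma rho_up: "rho g (up (Psi u)) = rho g u"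
proof -
  have P: "Psi (up (Psi u)) = Psi u" unfolding up_def by (rule Psi_points)
  have "Gu g (up (Psi u)) b c = Gu g u b c" for b c
    unfolding Gu_def[OF g] P up_Psi(3) ..
  then show ?thesis by (simp add: rho_eq[OF g])
qed

text \<open>All three norms in question satisfy this bound. Domination by the explicit continuous
  function \<open>F\<close> moves the passage to coordinates from the frame-dependent
  \<open>form_inner\<close> to \<open>F\<close>, where \<open>rho\<close> cancels and q^(-2) is
  left.\<close>

lemma nn_integral_form_inner_finite:
  assumes "\<And>u. rho g u * form_inner 4 MM g k \<alpha> \<alpha> (Psi u) \<le> C / (qq u)\<^sup>2"
  shows "(\<integral>\<^sup>+ P. ennreal (form_inner 4 MM g k \<alpha> \<alpha> P) \<partial>riemannian_volume 4 MM g) < \<infinity>"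
proof -
  define F where "F P = C / (qq (up P))\<^sup>2 / rho g (up P)" for P
  have F: "F (Psi u) = C / (qq u)\<^sup>2 / rho g u" for u by (simp add: F_def up_Psi rho_up)
  have nz: "rho g u \<noteq> 0" for u using rho_pos[OF g, of u] by simp
  have "continuous_on (Rspace 4) (\<lambda>u. F (Psi u))"
    unfolding F
    by (intro continuous_intros continuous_on_rho[OF g] smooth_on_imp_continuous_on[OF smooth_on_qq[OF openin_Rspace]])
      (use qq_nz nz in auto)
  then have Fm: "F \<in> borel_measurable (restrict_space borel MM)" by (rule measurable_on_MM[OF g])
  have "(\<integral>\<^sup>+ P. ennreal (form_inner 4 MM g k \<alpha> \<alpha> P) \<partial>vol g) \<le> (\<integral>\<^sup>+ P. ennreal (F P) \<partial>vol g)"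
  proof (rule nn_integral_mono)
    fix P assume "P \<in> space (vol g)"
    then obtain u where u: "P = Psi u" using MM_cases by (auto simp: space_vol[OF g])
    have "form_inner 4 MM g k \<alpha> \<alpha> (Psi u) \<le> F (Psi u)"
      unfolding F pos_le_divide_eq[OF rho_pos[OF g, of u]] using assms[of u] by (simp only: mult.commute)
    then show "ennreal (form_inner 4 MM g k \<alpha> \<alpha> P) \<le> ennreal (F P)" unfolding u by (rule ennreal_leI)
  qed
  also have "\<dots> = (\<integral>\<^sup>+ u \<in> strip. ennreal (rho g u) * ennreal (F (Psi u)) \<partial>Rmeas 4)"
    using Fm by (intro nn_integral_vol[OF g]) simp
  also have "\<dots> \<le> (\<integral>\<^sup>+ u. ennreal \<bar>C\<bar> * (ennreal (1 / (qq u)\<^sup>2) * indicator strip u) \<partial>Rmeas 4)"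
  proof (rule nn_integral_mono)
    fix u
    have "ennreal (rho g u) * ennreal (F (Psi u)) = ennreal (rho g u * F (Psi u))"
      using rho_pos[OF g, of u] by (simp add: ennreal_mult' less_imp_le)
    also have "rho g u * F (Psi u) = C * (1 / (qq u)\<^sup>2)" using nz[of u] by (simp add: F)
    also have "ennreal (C * (1 / (qq u)\<^sup>2)) \<le> ennreal (\<bar>C\<bar> * (1 / (qq u)\<^sup>2))"
      by (intro ennreal_leI mult_right_mono) auto
    also have "\<dots> = ennreal \<bar>C\<bar> * ennreal (1 / (qq u)\<^sup>2)" by (rule ennreal_mult) auto
    finally show "ennreal (rho g u) * ennreal (F (Psi u)) * indicator strip u \<le>
      ennreal \<bar>C\<bar> * (ennreal (1 / (qq u)\<^sup>2) * indicator strip u)"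
      by (auto simp: indicator_def)
  qed
  also have "\<dots> = ennreal \<bar>C\<bar> * (\<integral>\<^sup>+ u \<in> strip. ennreal (1 / (qq u)\<^sup>2) \<partial>Rmeas 4)"
  proof (rule nn_integral_cmult)
    have "continuous_on (Rspace 4) (\<lambda>u. 1 / (qq u)\<^sup>2)"
      by (intro continuous_intros smooth_on_imp_continuous_on[OF smooth_on_qq[OF openin_Rspace]]) (use qq_nz in auto)
    then have "(\<lambda>u. 1 / (qq u)\<^sup>2) \<in> borel_measurable (Rmeas 4)" by (rule measurable_continuous_Rspace)
    then show "(\<lambda>u. ennreal (1 / (qq u)\<^sup>2) * indicator strip u) \<in> borel_measurable (Rmeas 4)" by measurable
  qed
  also have "\<dots> < \<infinity>" using nn_integral_strip_finite by (simp add: ennreal_mult_less_top)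
  finally show ?thesis unfolding riemannian_volume_eq[OF g] .
qed

text \<open>Pairing with the metric dual of a vector or bivector field needs no choice of frame.\<close>

lemma form_inner_1:
  assumes "is_form 4 MM (Suc 0) \<alpha>" and "\<And>b. \<beta> (Psi u) [dPsi u b] = z * Gu g u b (e_vec 3)"
  shows "form_inner 4 MM g (Suc 0) \<alpha> \<beta> (Psi u) = z * \<alpha> (Psi u) [dPsi u (e_vec 3)]"
proof -
  obtain l L where "inner4 (Gu g u) (l / (qq u)\<^sup>2) (L / (qq u)\<^sup>2)" using Gu_inner4[OF g] by blast
  then interpret inner4 "Gu g u" "l / (qq u)\<^sup>2" "L / (qq u)\<^sup>2" .
  obtain E where E: "\<forall>i<4. \<forall>j<4. Gu g u (E i) (E j) = (if i = j then 1 else 0)"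
    and fi: "\<And>k \<alpha> \<beta>. form_inner 4 MM g k \<alpha> \<beta> (Psi u) =
      (\<Sum>I\<in>multi_indices 4 k. \<alpha> (Psi u) (map (\<lambda>i. dPsi u (E i)) I) * \<beta> (Psi u) (map (\<lambda>i. dPsi u (E i)) I)) / fact k"
    using form_inner_frame[OF g, of u] by blast
  have E': "\<And>i j. i < 4 \<Longrightarrow> j < 4 \<Longrightarrow> Gu g u (E i) (E j) = (if i = j then 1 else 0)" using E by blast
  have "form_inner 4 MM g (Suc 0) \<alpha> \<beta> (Psi u) =
    (\<Sum>i<4. \<alpha> (Psi u) [dPsi u (E i)] * (z * Gu g u (E i) (e_vec 3)))"
    unfolding fi multi_indices_1 by (simp add: assms(2))
  also have "\<dots> = z * (\<Sum>i<4. \<alpha> (Psi u) [dPsi u (E i)] * Gu g u (E i) (e_vec 3))"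
    by (simp add: sum_distrib_left mult_ac)
  also have "(\<Sum>i<4. \<alpha> (Psi u) [dPsi u (E i)] * Gu g u (E i) (e_vec 3)) = \<alpha> (Psi u) [dPsi u (e_vec 3)]"
    by (rule contract1[OF E' form_1_lin[OF assms(1)]]) auto
  finally show ?thesis .
qed

text \<open>The two halves of the wedge product contract to the same value by skew symmetry. The
  resulting factor 2 cancels the 2! in \<open>form_inner\<close>.\<close>

lemma form_inner_2:
  assumes \<alpha>: "is_form 4 MM (Suc (Suc 0)) \<alpha>" and "\<And>b c. \<beta> (Psi u) [dPsi u b, dPsi u c] =
    (\<Sum>j<3. h j * (Gu g u b (e_vec 3) * Gu g u c (e_vec j) - Gu g u b (e_vec j) * Gu g u c (e_vec 3)))"
  shows "form_inner 4 MM g (Suc (Suc 0)) \<alpha> \<beta> (Psi u) =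
    (\<Sum>j<3. h j * \<alpha> (Psi u) [dPsi u (e_vec 3), dPsi u (e_vec j)])"
proof -
  obtain l L where "inner4 (Gu g u) (l / (qq u)\<^sup>2) (L / (qq u)\<^sup>2)" using Gu_inner4[OF g] by blast
  then interpret inner4 "Gu g u" "l / (qq u)\<^sup>2" "L / (qq u)\<^sup>2" .
  obtain E where E: "\<forall>i<4. \<forall>j<4. Gu g u (E i) (E j) = (if i = j then 1 else 0)"
    and fi: "\<And>k \<alpha> \<beta>. form_inner 4 MM g k \<alpha> \<beta> (Psi u) =
      (\<Sum>I\<in>multi_indices 4 k. \<alpha> (Psi u) (map (\<lambda>i. dPsi u (E i)) I) * \<beta> (Psi u) (map (\<lambda>i. dPsi u (E i)) I)) / fact k"
    using form_inner_frame[OF g, of u] by blast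
  have E': "\<And>i j. i < 4 \<Longrightarrow> j < 4 \<Longrightarrow> Gu g u (E i) (E j) = (if i = j then 1 else 0)" using E by blast
  let ?a = "\<lambda>b c. \<alpha> (Psi u) [dPsi u b, dPsi u c]"
  have c2: "(\<Sum>i<4. \<Sum>m<4. ?a (E i) (E m) * (Gu g u (E i) (e_vec j) * Gu g u (E m) (e_vec k))) = ?a (e_vec j) (e_vec k)"
    if "j < 4" "k < 4" for j k
    using contract2[of E ?a j k, OF E' form_2_lin(2)[OF \<alpha>] form_2_lin(1)[OF \<alpha>] that] .
  have sum3: "(\<Sum>i<4. \<Sum>m<4. \<Sum>j<3. X i m j) = (\<Sum>j<3. \<Sum>i<4. \<Sum>m<4. X i m j)"
    for X :: "nat \<Rightarrow> nat \<Rightarrow> nat \<Rightarrow> real"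
  proof -
    have "(\<Sum>m<4. \<Sum>j<3. X i m j) = (\<Sum>j<3. \<Sum>m<4. X i m j)" for i by (rule sum.swap)
    then show ?thesis by (simp only:) (rule sum.swap)
  qed
  have "form_inner 4 MM g (Suc (Suc 0)) \<alpha> \<beta> (Psi u) = (\<Sum>i<4. \<Sum>m<4. ?a (E i) (E m) *
      (\<Sum>j<3. h j * (Gu g u (E i) (e_vec 3) * Gu g u (E m) (e_vec j) - Gu g u (E i) (e_vec j) * Gu g u (E m) (e_vec 3)))) / 2"
    unfolding fi multi_indices_2 by (simp add: assms(2))
  also have "(\<Sum>i<4. \<Sum>m<4. ?a (E i) (E m) *
      (\<Sum>j<3. h j * (Gu g u (E i) (e_vec 3) * Gu g u (E m) (e_vec j) - Gu g u (E i) (e_vec j) * Gu g u (E m) (e_vec 3)))) =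
    (\<Sum>i<4. \<Sum>m<4. \<Sum>j<3. h j * (?a (E i) (E m) * (Gu g u (E i) (e_vec 3) * Gu g u (E m) (e_vec j))
      - ?a (E i) (E m) * (Gu g u (E i) (e_vec j) * Gu g u (E m) (e_vec 3))))"
    by (intro sum.cong refl) (simp add: sum_distrib_left algebra_simps)
  also have "\<dots> = (\<Sum>j<3. h j * ((\<Sum>i<4. \<Sum>m<4. ?a (E i) (E m) * (Gu g u (E i) (e_vec 3) * Gu g u (E m) (e_vec j)))
      - (\<Sum>i<4. \<Sum>m<4. ?a (E i) (E m) * (Gu g u (E i) (e_vec j) * Gu g u (E m) (e_vec 3)))))"
    unfolding sum_subtractf[symmetric] sum_distrib_left by (rule sum3)
  also have "\<dots> = (\<Sum>j<3. h j * (?a (e_vec 3) (e_vec j) - ?a (e_vec j) (e_vec 3)))"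
    by (intro sum.cong refl) (simp add: c2)
  also have "\<dots> = 2 * (\<Sum>j<3. h j * ?a (e_vec 3) (e_vec j))"
    using form_2_lin(3)[OF \<alpha>, of u "e_vec _" "e_vec 3"] by (simp add: sum_distrib_left mult_ac)
  finally show ?thesis by simp
qed

end

section \<open>The closed form given by the angle\<close>

text \<open>dtheta = (w_3 dw_4 - w_4 dw_3) / |w|^2, written in ambient coordinates because the angle
  itself is no global function.\<close>

definition dth :: "(nat \<times> nat \<Rightarrow> real) \<Rightarrow> (nat \<times> nat \<Rightarrow> real) \<Rightarrow> real"
  where "dth P v = (aff P 3 * daff P v 4 - aff P 4 * daff P v 3) / (wnorm P)\<^sup>2"

definition dwn :: "(nat \<times> nat \<Rightarrow> real) \<Rightarrow> (nat \<times> nat \<Rightarrow> real) \<Rightarrow> real"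
  where "dwn P v = (aff P 3 * daff P v 3 + aff P 4 * daff P v 4) / wnorm P"

definition omega :: "(nat \<times> nat) dform"
  where "omega P vs = dth P (vs ! 0)"

text \<open>The terms with \<open>y\<close>, which stem from the variation of q, are radial in the w
  plane and cancel.\<close>

lemma angle_identity:
  fixes c s q x y :: real
  shows "(c / q) * (c * x / q - s * y / q\<^sup>2) - (s / q) * (- s * x / q - c * y / q\<^sup>2) = (c\<^sup>2 + s\<^sup>2) * x / q\<^sup>2"
  by (simp add: power2_eq_square add_divide_distrib diff_divide_distrib algebra_simps)

lemma dth_dPsi: "dth (Psi u) (dPsi u c) = c 3"
proof -
  let ?q = "qq u" and ?c = "cos (u 3)" and ?s = "sin (u 3)"
  have "aff (Psi u) 3 * daff (Psi u) (dPsi u c) 4 - aff (Psi u) 4 * daff (Psi u) (dPsi u c) 3 =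
    (?c / ?q) * (?c * c 3 / ?q - ?s * (2 * ydot u c) / ?q\<^sup>2) - (?s / ?q) * (- ?s * c 3 / ?q - ?c * (2 * ydot u c) / ?q\<^sup>2)"
    by (simp add: aff_Psi daff_dPsi dA5_def hvec_simps)
  also have "\<dots> = (?c\<^sup>2 + ?s\<^sup>2) * c 3 / ?q\<^sup>2" by (rule angle_identity)
  finally show ?thesis using qq_pos[of u] by (simp add: dth_def wnorm_Psi power_divide)
qed

lemma omega_dPsi: "omega (Psi u) [dPsi u b] = b 3"
  by (simp add: omega_def dth_dPsi)

lemma is_form_omega: "is_form 4 MM (Suc 0) omega"
  by (rule is_form_1I) (simp add: omega_dPsi lin4_def e_vec_def if_distrib[of "\<lambda>c. _ * c"] cong: if_cong)



section \<open>Cutting off the angle form\<close>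

definition cform :: "real \<Rightarrow> (nat \<times> nat) dform"
  where "cform a P vs = cutoff a (wnorm P) * dth P (vs ! 0)"

text \<open>chi'(|w|) d|w| wedge dtheta, where chi is \<open>cutoff a\<close>. No further term
  occurs because dtheta is closed.\<close>

definition dcform :: "real \<Rightarrow> (nat \<times> nat) dform"
  where "dcform a P vs = deriv (cutoff a) (wnorm P) * (dwn P (vs ! 0) * dth P (vs ! 1) - dwn P (vs ! 1) * dth P (vs ! 0))"

lemma dwn_lin: "lin4 (\<lambda>b. dwn (Psi u) (dPsi u b))"
proof (rule lin4I)
  fix x y and b c :: "nat \<Rightarrow> real"
  have "daff (Psi u) (dPsi u (\<lambda>i. x * b i + y * c i)) k = x * daff (Psi u) (dPsi u b) k + y * daff (Psi u) (dPsi u c) k" for k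
    unfolding dPsi_linear daff_def by (simp add: add_divide_distrib diff_divide_distrib algebra_simps)
  then show "dwn (Psi u) (dPsi u (\<lambda>i. x * b i + y * c i)) = x * dwn (Psi u) (dPsi u b) + y * dwn (Psi u) (dPsi u c)"
    unfolding dwn_def by (simp add: add_divide_distrib algebra_simps)
next
  fix b c :: "nat \<Rightarrow> real" assume "\<And>i. i < 4 \<Longrightarrow> b i = c i"
  then show "dwn (Psi u) (dPsi u b) = dwn (Psi u) (dPsi u c)" using dPsi_restrict[of b c u] by simp
qed

lemma lin4_cmult: "lin4 f \<Longrightarrow> lin4 (\<lambda>b. a * f b)"
proof -
  assume f: "lin4 f"
  show ?thesis unfolding lin4_def
  proof
    fix b
    have "f b = (\<Sum>k<4. b k * f (e_vec k))" using f unfolding lin4_def by blast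
    then show "a * f b = (\<Sum>k<4. b k * (a * f (e_vec k)))" by (simp add: sum_distrib_left mult_ac)
  qed
qed

lemma lin4_diff: "lin4 f \<Longrightarrow> lin4 h \<Longrightarrow> lin4 (\<lambda>b. f b - h b)"
proof -
  assume f: "lin4 f" and h: "lin4 h"
  show ?thesis unfolding lin4_def
  proof
    fix b
    have "f b = (\<Sum>k<4. b k * f (e_vec k))" "h b = (\<Sum>k<4. b k * h (e_vec k))"
      using f h unfolding lin4_def by blast+
    then show "f b - h b = (\<Sum>k<4. b k * (f (e_vec k) - h (e_vec k)))"
      by (simp add: sum_subtractf right_diff_distrib)
  qed
qed

lemma dth_lin: "lin4 (\<lambda>b. dth (Psi u) (dPsi u b))"
  using form_1_lin[OF is_form_omega, of u] by (simp add: omega_def)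

lemma is_form_cform: "is_form 4 MM (Suc 0) (cform a)"
  by (rule is_form_1I) (simp add: cform_def lin4_cmult[OF dth_lin])

lemma is_form_dcform: "is_form 4 MM (Suc (Suc 0)) (dcform a)"
proof (rule is_form_2I)
  fix u c
  have "lin4 (\<lambda>b. deriv (cutoff a) (wnorm (Psi u)) * (dth (Psi u) (dPsi u c) * dwn (Psi u) (dPsi u b)
      - dwn (Psi u) (dPsi u c) * dth (Psi u) (dPsi u b)))"
    by (intro lin4_cmult lin4_diff dth_lin dwn_lin)
  then show "lin4 (\<lambda>b. dcform a (Psi u) [dPsi u b, dPsi u c])" by (simp add: dcform_def mult.commute)
  have "lin4 (\<lambda>b. deriv (cutoff a) (wnorm (Psi u)) * (dwn (Psi u) (dPsi u c) * dth (Psi u) (dPsi u b)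
      - dth (Psi u) (dPsi u c) * dwn (Psi u) (dPsi u b)))"
    by (intro lin4_cmult lin4_diff dth_lin dwn_lin)
  then show "lin4 (\<lambda>b. dcform a (Psi u) [dPsi u c, dPsi u b])" by (simp add: dcform_def mult.commute)
qed (simp add: dcform_def)

context
  fixes U and \<psi> :: "(nat \<Rightarrow> real) \<Rightarrow> nat \<times> nat \<Rightarrow> real"
  assumes lp: "local_param 4 MM U \<psi>"
begin

text \<open>In each angle chart dtheta is the differential of an actual function. Smoothness and
  closedness thereby reduce to facts on partial derivatives.\<close>

lemma dth_coord_vec:
  assumes "u \<in> trans_dom U \<psi> m" "i < 4"
  shows "dth (\<psi> u) (coord_vec \<psi> u i) = partial_deriv i (\<lambda>v. Tm m (\<psi> v) 3) u"
proof -
  have "dth (\<psi> u) (coord_vec \<psi> u i) = dth (Psi (Tm m (\<psi> u))) (dPsi (Tm m (\<psi> u)) (jac \<psi> m u i))"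
    by (simp add: coord_vec_trans[OF lp assms] Psi_trans[OF lp assms(1)])
  then show ?thesis by (simp add: dth_dPsi jac_def[OF lp])
qed

lemma dwn_coord_vec:
  assumes u: "u \<in> U" and i: "i < 4"
  shows "dwn (\<psi> u) (coord_vec \<psi> u i) = partial_deriv i (\<lambda>v. wnorm (\<psi> v)) u"
proof (rule partial_deriv_eqI[symmetric])
  let ?P = "\<lambda>t. \<psi> (u(i := t))" and ?v = "coord_vec \<psi> u i"
  have D: "((\<lambda>t. ?P t jl) has_real_derivative ?v jl) (at (u i))" for jl
    unfolding coord_vec_def by (rule smooth_on_DERIV[OF lp_smooth[OF lp] u i])
  have pos: "wnorm (\<psi> u) > 0" by (rule wnorm_pos[OF lp_MM[OF lp u]])
  have a: "((\<lambda>t. aff (?P t) k) has_real_derivative daff (\<psi> u) ?v k) (at (u i))" for k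
    using aff_curve[of ?P k ?v "u i", OF D D] MM_55[OF lp_MM[OF lp u]] by simp
  have "((\<lambda>t. (aff (?P t) 3)\<^sup>2 + (aff (?P t) 4)\<^sup>2) has_real_derivative
      (2 * aff (\<psi> u) 3 * daff (\<psi> u) ?v 3 + 2 * aff (\<psi> u) 4 * daff (\<psi> u) ?v 4)) (at (u i))"
    by (auto intro!: derivative_eq_intros a)
  moreover have "(sqrt has_real_derivative inverse (wnorm (\<psi> u)) / 2) (at ((aff (?P (u i)) 3)\<^sup>2 + (aff (?P (u i)) 4)\<^sup>2))"
    using DERIV_real_sqrt[of "(aff (\<psi> u) 3)\<^sup>2 + (aff (\<psi> u) 4)\<^sup>2"] pos by (simp add: wnorm_def)
  ultimately have "((\<lambda>t. wnorm (?P t)) has_real_derivative inverse (wnorm (\<psi> u)) / 2 *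
      (2 * aff (\<psi> u) 3 * daff (\<psi> u) ?v 3 + 2 * aff (\<psi> u) 4 * daff (\<psi> u) ?v 4)) (at (u i))"
    unfolding wnorm_def by (intro DERIV_chain2[of sqrt]) auto
  also have "inverse (wnorm (\<psi> u)) / 2 * (2 * aff (\<psi> u) 3 * daff (\<psi> u) ?v 3 + 2 * aff (\<psi> u) 4 * daff (\<psi> u) ?v 4)
      = dwn (\<psi> u) ?v"
    using pos by (simp add: dwn_def field_simps)
  finally show "((\<lambda>t. wnorm (\<psi> (u(i := t)))) has_real_derivative dwn (\<psi> u) ?v) (at (u i))" .
qed

context
  fixes a :: real
  assumes a: "a > 0"
begin

lemma smooth_on_cw: "smooth_on 4 U (\<lambda>u. cutoff a (wnorm (\<psi> u)))"
  by (rule smooth_on_cutoff[OF lp_openin[OF lp] smooth_on_wnorm[OF lp] a])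

lemma partial_deriv_cw:
  assumes u: "u \<in> U" and i: "i < 4"
  shows "partial_deriv i (\<lambda>v. cutoff a (wnorm (\<psi> v))) u = deriv (cutoff a) (wnorm (\<psi> u)) * dwn (\<psi> u) (coord_vec \<psi> u i)"
proof (rule partial_deriv_eqI)
  have "((\<lambda>t. wnorm (\<psi> (u(i := t)))) has_real_derivative dwn (\<psi> u) (coord_vec \<psi> u i)) (at (u i))"
    unfolding dwn_coord_vec[OF u i] by (rule smooth_on_DERIV[OF smooth_on_wnorm[OF lp] u i])
  moreover have "(cutoff a has_real_derivative deriv (cutoff a) (wnorm (\<psi> u))) (at (wnorm (\<psi> (u(i := u i)))))"
    using cutoff_DERIV[OF a, of "wnorm (\<psi> u)"] by simp
  ultimately show "((\<lambda>t. cutoff a (wnorm (\<psi> (u(i := t))))) has_real_derivative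
      deriv (cutoff a) (wnorm (\<psi> u)) * dwn (\<psi> u) (coord_vec \<psi> u i)) (at (u i))"
    by (intro DERIV_chain2[of "cutoff a"])
qed

lemma coeff_cform:
  assumes "u \<in> trans_dom U \<psi> m" "i < 4"
  shows "form_coeff \<psi> (cform a) [i] u = cutoff a (wnorm (\<psi> u)) * partial_deriv i (\<lambda>v. Tm m (\<psi> v) 3) u"
  by (simp add: form_coeff_def cform_def dth_coord_vec[OF assms])

lemma coeff_dcform:
  assumes u: "u \<in> trans_dom U \<psi> m" and ij: "i < 4" "j < 4"
  shows "form_coeff \<psi> (dcform a) [i, j] u =
    partial_deriv i (\<lambda>v. cutoff a (wnorm (\<psi> v))) u * partial_deriv j (\<lambda>v. Tm m (\<psi> v) 3) u
    - partial_deriv j (\<lambda>v. cutoff a (wnorm (\<psi> v))) u * partial_deriv i (\<lambda>v. Tm m (\<psi> v) 3) u"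
proof -
  have uU: "u \<in> U" using u trans_dom_subset[OF lp] by blast
  show ?thesis
    by (simp add: form_coeff_def dcform_def dth_coord_vec[OF u] partial_deriv_cw[OF uU] ij algebra_simps)
qed

lemma trans_nbhd: "u \<in> U \<Longrightarrow> \<exists>m. u \<in> trans_dom U \<psi> m"
  using trans_cover[OF lp] by blast

lemma smooth_on_angle: "smooth_on 4 (trans_dom U \<psi> m) (\<lambda>v. Tm m (\<psi> v) 3)"
  by (rule smooth_on_trans[OF lp]) simp

lemma smooth_on_coeff_cform:
  assumes "i < 4"
  shows "smooth_on 4 U (form_coeff \<psi> (cform a) [i])"
proof (rule smooth_on_local[OF lp_openin[OF lp]])
  fix u assume "u \<in> U"
  then obtain m where m: "u \<in> trans_dom U \<psi> m" using trans_nbhd by blast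
  let ?V = "trans_dom U \<psi> m"
  note V = openin_trans_dom[OF lp, of m]
  have "smooth_on 4 ?V (\<lambda>u. cutoff a (wnorm (\<psi> u)) * partial_deriv i (\<lambda>v. Tm m (\<psi> v) 3) u)"
    by (intro smooth_on_mult[OF V] smooth_on_partial_deriv[OF V] smooth_on_angle assms
        smooth_on_subset[OF smooth_on_cw trans_dom_subset[OF lp]])
  then have "smooth_on 4 ?V (form_coeff \<psi> (cform a) [i])"
    by (rule smooth_on_cong[OF V, rotated]) (rule coeff_cform[OF _ assms])
  then show "\<exists>V. u \<in> V \<and> openin (top_of_set (Rspace 4)) V \<and> smooth_on 4 V (form_coeff \<psi> (cform a) [i])"
    using m V by blast
qed

lemma smooth_on_coeff_dcform:
  assumes ij: "i < 4" "j < 4"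
  shows "smooth_on 4 U (form_coeff \<psi> (dcform a) [i, j])"
proof (rule smooth_on_local[OF lp_openin[OF lp]])
  fix u assume "u \<in> U"
  then obtain m where m: "u \<in> trans_dom U \<psi> m" using trans_nbhd by blast
  let ?V = "trans_dom U \<psi> m"
  note V = openin_trans_dom[OF lp, of m]
  have "smooth_on 4 ?V (\<lambda>u. partial_deriv i (\<lambda>v. cutoff a (wnorm (\<psi> v))) u * partial_deriv j (\<lambda>v. Tm m (\<psi> v) 3) u
    - partial_deriv j (\<lambda>v. cutoff a (wnorm (\<psi> v))) u * partial_deriv i (\<lambda>v. Tm m (\<psi> v) 3) u)"
    by (intro smooth_on_diff[OF V] smooth_on_mult[OF V] smooth_on_partial_deriv[OF V] smooth_on_angle ij
        smooth_on_subset[OF smooth_on_cw trans_dom_subset[OF lp]])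
  then have "smooth_on 4 ?V (form_coeff \<psi> (dcform a) [i, j])"
    by (rule smooth_on_cong[OF V, rotated]) (rule coeff_dcform[OF _ ij])
  then show "\<exists>V. u \<in> V \<and> openin (top_of_set (Rspace 4)) V \<and> smooth_on 4 V (form_coeff \<psi> (dcform a) [i, j])"
    using m V by blast
qed

text \<open>The second derivatives of the angle cancel.\<close>

lemma ext_deriv_cform:
  assumes u: "u \<in> U" and ij: "i < 4" "j < 4"
  shows "form_coeff \<psi> (dcform a) [i, j] u =
    partial_deriv i (form_coeff \<psi> (cform a) [j]) u - partial_deriv j (form_coeff \<psi> (cform a) [i]) u"
proof -
  obtain m where m: "u \<in> trans_dom U \<psi> m" using trans_nbhd[OF u] by blast
  let ?V = "trans_dom U \<psi> m" and ?c = "\<lambda>v. cutoff a (wnorm (\<psi> v))" and ?t = "\<lambda>v. Tm m (\<psi> v) 3"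
  note V = openin_trans_dom[OF lp, of m]
  have sc: "smooth_on 4 ?V ?c" by (rule smooth_on_subset[OF smooth_on_cw trans_dom_subset[OF lp]])
  have C0: "smooth_on 4 ?V f \<Longrightarrow> Cn 0 4 ?V f" for f unfolding smooth_on_iff_Cn by blast
  have D: "partial_deriv k (form_coeff \<psi> (cform a) [l]) u =
      ?c u * partial_deriv k (partial_deriv l ?t) u + partial_deriv k ?c u * partial_deriv l ?t u"
    if kl: "k < 4" "l < 4" for k l
  proof -
    have "partial_deriv k (form_coeff \<psi> (cform a) [l]) u = partial_deriv k (\<lambda>v. ?c v * partial_deriv l ?t v) u"
      by (rule partial_deriv_cong[OF V _ m kl(1)]) (rule coeff_cform[OF _ kl(2)])
    also have "\<dots> = ?c u * partial_deriv k (partial_deriv l ?t) u + partial_deriv k ?c u * partial_deriv l ?t u"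
      by (rule partial_deriv_mult[OF V C0[OF sc] C0[OF smooth_on_partial_deriv[OF V smooth_on_angle kl(2)]] m kl(1)])
    finally show ?thesis .
  qed
  show ?thesis
    unfolding D[OF ij] D[OF ij(2,1)] coeff_dcform[OF m ij]
    using partial_deriv_commute[OF V smooth_on_angle m ij] by simp
qed

end

end

section \<open>Supports away from the apex\<close>

lemma sq_le_qq: "k < 3 \<Longrightarrow> (u k)\<^sup>2 \<le> qq u"
proof -
  assume "k < 3"
  then consider "k = 0" | "k = 1" | "k = 2" by linarith
  then show ?thesis by cases (auto simp: qq_def)
qed

lemma wnorm_Psi_less:
  assumes "a > 0" "k < 3" "\<bar>u k\<bar> > 1 / a + 1"
  shows "wnorm (Psi u) < a"
proof -
  \<comment> \<open>Larger than both 1 and 1/a, so that q >= (u k)^2 > R^2 >= R > 1/a.\<close>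
  define R where "R = 1 / a + 1"
  have R: "R > 1" "1 / a < R" "\<bar>u k\<bar> > R" using assms by (simp_all add: R_def)
  have "R * R < \<bar>u k\<bar> * \<bar>u k\<bar>" using R by (intro mult_strict_mono) auto
  also have "\<dots> \<le> qq u" using sq_le_qq[OF assms(2), of u] by (simp add: power2_eq_square)
  finally have "R * R < qq u" .
  moreover have "R \<le> R * R" using R by simp
  ultimately have "1 / a < qq u" using R(2) by linarith
  then show ?thesis using assms(1) qq_pos[of u] by (simp add: wnorm_Psi field_simps)
qed

text \<open>Where |w| >= a the coordinates y are bounded, so these points lie in the image of a
  compact box of parameters.\<close>

lemma compact_support_wnorm:
  assumes "a > 0"
  shows "\<exists>K\<subseteq>MM. compact K \<and> (\<forall>P\<in>MM - K. wnorm P < a)"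
proof -
  define R where "R = 1 / a + 1"
  have R: "R > 1" using assms by (simp add: R_def)
  let ?B = "{u \<in> Rspace 4. \<forall>k<4. (if k < 3 then -R else 0) \<le> u k \<and> u k \<le> (if k < 3 then R else 2 * pi)}"
  show ?thesis
  proof (intro exI[of _ "Psi ` ?B"] conjI ballI)
    show "Psi ` ?B \<subseteq> MM" using Psi_in_MM by blast
    show "compact (Psi ` ?B)"
      by (rule compact_continuous_image[OF continuous_on_subset[OF continuous_on_Psi] compact_box_Rspace]) auto
    fix P assume P: "P \<in> MM - Psi ` ?B"
    then obtain u where u: "u \<in> strip" "P = Psi u" using MM_cases by blast
    then have "u \<notin> ?B" using P by blast
    then obtain k where k: "k < 4" "\<not> ((if k < 3 then -R else 0) \<le> u k \<and> u k \<le> (if k < 3 then R else 2 * pi))"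
      using u(1) by (auto simp: strip_def)
    have "k < 3"
    proof (rule ccontr)
      assume "\<not> k < 3"
      then have "k = 3" using k(1) by simp
      then show False using k(2) u(1) by (simp add: strip_def)
    qed
    then have "\<bar>u k\<bar> > R" using k(2) by auto
    then show "wnorm P < a" using wnorm_Psi_less[OF assms \<open>k < 3\<close>, of u] by (simp add: u R_def)
  qed
qed

text \<open>Supplies the pairs against which formal adjoints are tested: \<open>cform a\<close>
  equals dtheta wherever |w| >= 2 a.\<close>

lemma d_graph_cform:
  assumes a: "a > 0"
  shows "(cform a, dcform a) \<in> d_graph 4 MM (Suc 0)"
proof -
  obtain K where K: "K \<subseteq> MM" "compact K" "\<And>P. P \<in> MM - K \<Longrightarrow> wnorm P < a"
    using compact_support_wnorm[OF a] by blast
  have "test_form 4 MM (Suc 0) (cform a)"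
    unfolding test_form_def
  proof (intro conjI allI impI ballI)
    show "is_form 4 MM (Suc 0) (cform a)" by (rule is_form_cform)
    show "\<exists>K\<subseteq>MM. compact K \<and> (\<forall>P\<in>MM - K. \<forall>vs\<in>tangent_lists 4 MM (Suc 0) P. cform a P vs = 0)"
      using K by (intro exI[of _ K]) (auto simp: cform_def cutoff_0 less_imp_le)
    fix U \<psi> I assume lp: "local_param 4 MM U \<psi>" and "I \<in> multi_indices 4 (Suc 0)"
    then obtain i where "I = [i]" "i < 4" by (auto simp: multi_indices_def length_Suc_conv)
    then show "smooth_on 4 U (form_coeff \<psi> (cform a) I)" using smooth_on_coeff_cform[OF lp a] by simp
  qed
  moreover have "test_form 4 MM (Suc (Suc 0)) (dcform a)"
    unfolding test_form_def
  proof (intro conjI allI impI ballI)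
    show "is_form 4 MM (Suc (Suc 0)) (dcform a)" by (rule is_form_dcform)
    show "\<exists>K\<subseteq>MM. compact K \<and> (\<forall>P\<in>MM - K. \<forall>vs\<in>tangent_lists 4 MM (Suc (Suc 0)) P. dcform a P vs = 0)"
      using K by (intro exI[of _ K]) (auto simp: dcform_def deriv_cutoff_0)
    fix U \<psi> I assume lp: "local_param 4 MM U \<psi>" and "I \<in> multi_indices 4 (Suc (Suc 0))"
    then obtain i j where "I = [i, j]" "i < 4" "j < 4" by (auto simp: multi_indices_def length_Suc_conv)
    then show "smooth_on 4 U (form_coeff \<psi> (dcform a) I)" using smooth_on_coeff_dcform[OF lp a] by simp
  qed
  moreover have "is_ext_deriv 4 MM (Suc 0) (cform a) (dcform a)"
    unfolding is_ext_deriv_def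
  proof (intro allI impI ballI)
    fix U \<psi> u I assume lp: "local_param 4 MM U \<psi>" and u: "u \<in> U" and "I \<in> multi_indices 4 (Suc (Suc 0))"
    then obtain i j where I: "I = [i, j]" "i < 4" "j < 4" by (auto simp: multi_indices_def length_Suc_conv)
    show "form_coeff \<psi> (dcform a) I u =
         (\<Sum>l\<le>Suc 0. (-1) ^ l * partial_deriv (I ! l) (form_coeff \<psi> (cform a) (take l I @ drop (Suc l) I)) u)"
      using ext_deriv_cform[OF lp a u I(2,3)] by (simp add: I)
  qed
  ultimately show ?thesis by (simp add: d_graph_def)
qed

section \<open>The coclosed partner\<close>

text \<open>The vector field \<open>BB = y / q\<^sup>3\<^sup>/\<^sup>2\<close> on \<open>R\<^sup>3\<close> behaves like \<open>y / |y|\<^sup>3\<close> at infinity, so its flux through large spheres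
  does not tend to \<open>0\<close>.\<close>

definition BB :: "nat \<Rightarrow> (nat \<Rightarrow> real) \<Rightarrow> real"
  where "BB j u = u j / (qq u * sqrt (qq u))"

text \<open>The \<open>j\<close>-th partial derivative of \<open>BB j\<close>, namely (q - 3 y_j^2)
  q^(-5/2), with the root kept in the numerator.\<close>

definition dBB :: "nat \<Rightarrow> (nat \<Rightarrow> real) \<Rightarrow> real"
  where "dBB j u = sqrt (qq u) * (qq u - 3 * (u j)\<^sup>2) / (qq u) ^ 3"

definition divB :: "(nat \<Rightarrow> real) \<Rightarrow> real"
  where "divB u = 3 * sqrt (qq u) / (qq u) ^ 3"

text \<open>Because 3 q - 3 |y|^2 = 3. The divergence 3 q^(-5/2) is thus positive
  everywhere.\<close>

lemma sum_dBB: "(\<Sum>j<3. dBB j u) = divB u"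
proof -
  have "(\<Sum>j<3. dBB j u) = sqrt (qq u) * (\<Sum>j<3. qq u - 3 * (u j)\<^sup>2) / (qq u) ^ 3"
    by (simp add: dBB_def sum_divide_distrib sum_distrib_left)
  also have "(\<Sum>j<3. qq u - 3 * (u j)\<^sup>2) = 3" by (simp add: lessThan_3 qq_def)
  finally show ?thesis by (simp add: divB_def)
qed

lemma smooth_on_BB:
  assumes "openin (top_of_set (Rspace d)) U"
  shows "smooth_on d U (BB j)"
proof -
  have "smooth_on d U (\<lambda>u. u j / (qq u * sqrt (qq u)))"
    using qq_pos by (intro smooth_on_divide[OF assms] smooth_on_mult[OF assms] smooth_on_sqrt[OF assms]
        smooth_on_qq[OF assms] smooth_on_coord[OF assms]) (auto simp: qq_nz)
  then show ?thesis by (simp add: BB_def[abs_def])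
qed

lemma BB_DERIV:
  assumes "j < 3"
  shows "((\<lambda>t. BB j (u(j := t))) has_real_derivative dBB j u) (at (u j))"
proof -
  let ?q = "\<lambda>t. qq (u(j := t))"
  have dq: "(?q has_real_derivative 2 * u j) (at (u j))"
  proof -
    have "(?q has_real_derivative 2 * ydot (u(j := u j)) (e_vec j)) (at (u j))"
    proof (rule qq_curve)
      show "((\<lambda>t. (u(j := t)) k) has_real_derivative e_vec j k) (at (u j))" for k
        by (cases "k = j") (auto simp: e_vec_def)
    qed
    moreover have "ydot u (e_vec j) = u j"
    proof -
      consider "j = 0" | "j = 1" | "j = 2" using assms by linarith
      then show ?thesis by cases (auto simp: ydot_def e_vec_def)
    qed
    ultimately show ?thesis by simp
  qed
  have s: "sqrt (qq u) * sqrt (qq u) = qq u" using qq_pos[of u] by simp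
  have pos: "qq u > 0" "sqrt (qq u) > 0" using qq_pos[of u] by simp_all
  have "((\<lambda>t. sqrt (?q t)) has_real_derivative inverse (sqrt (qq u)) / 2 * (2 * u j)) (at (u j))"
    by (rule DERIV_chain2[of sqrt]) (use DERIV_real_sqrt[OF qq_pos[of u]] dq in auto)
  from DERIV_mult[OF dq this]
  have "((\<lambda>t. ?q t * sqrt (?q t)) has_real_derivative
      2 * u j * sqrt (qq u) + inverse (sqrt (qq u)) / 2 * (2 * u j) * qq u) (at (u j))" by simp
  from DERIV_divide[OF DERIV_ident this]
  have D: "((\<lambda>t. t / (?q t * sqrt (?q t))) has_real_derivative
      (1 * (qq u * sqrt (qq u)) - u j * (2 * u j * sqrt (qq u) + inverse (sqrt (qq u)) / 2 * (2 * u j) * qq u)) /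
      ((qq u * sqrt (qq u)) * (qq u * sqrt (qq u)))) (at (u j))" using pos by simp
  have e1: "inverse (sqrt (qq u)) / 2 * (2 * u j) * qq u = u j * sqrt (qq u)"
  proof -
    have "inverse (sqrt (qq u)) * qq u = sqrt (qq u)" using s pos by (metis divide_inverse mult.commute nonzero_mult_div_cancel_left less_irrefl)
    then show ?thesis by simp
  qed
  have e2: "(qq u * sqrt (qq u)) * (qq u * sqrt (qq u)) = (qq u) ^ 3"
    using s by (simp add: power3_eq_cube mult_ac)
  have "((\<lambda>t. t / (?q t * sqrt (?q t))) has_real_derivative
      (1 * (qq u * sqrt (qq u)) - u j * (2 * u j * sqrt (qq u) + u j * sqrt (qq u))) / (qq u) ^ 3) (at (u j))"
    using D unfolding e1 e2 .
  also have "1 * (qq u * sqrt (qq u)) - u j * (2 * u j * sqrt (qq u) + u j * sqrt (qq u)) = sqrt (qq u) * (qq u - 3 * (u j)\<^sup>2)"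
    by (simp add: power2_eq_square algebra_simps)
  finally have "((\<lambda>t. t / (?q t * sqrt (?q t))) has_real_derivative dBB j u) (at (u j))"
    unfolding dBB_def .
  moreover have "(\<lambda>t. BB j (u(j := t))) = (\<lambda>t. t / (?q t * sqrt (?q t)))" by (simp add: BB_def)
  ultimately show ?thesis by (simp only:)
qed

lemma BB_bound: "j < 3 \<Longrightarrow> \<bar>BB j u\<bar> \<le> 1 / qq u"
proof -
  assume "j < 3"
  then have "(u j)\<^sup>2 \<le> qq u" by (rule sq_le_qq)
  then have "\<bar>u j\<bar> \<le> sqrt (qq u)" by (metis real_sqrt_abs real_sqrt_le_iff)
  then have "\<bar>u j\<bar> / (qq u * sqrt (qq u)) \<le> sqrt (qq u) / (qq u * sqrt (qq u))"
    using qq_pos[of u] by (intro divide_right_mono) auto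
  then show ?thesis using qq_pos[of u] by (simp add: BB_def abs_mult)
qed

lemma divB_pos: "divB u > 0"
  using qq_pos[of u] by (simp add: divB_def)

lemma divB_le: "divB u \<le> 3 / (qq u)\<^sup>2"
proof -
  have "sqrt (qq u) \<le> qq u" using qq_ge_1[of u] by (intro real_le_lsqrt) (auto simp: power2_eq_square)
  then have "3 * sqrt (qq u) / (qq u) ^ 3 \<le> 3 * qq u / (qq u) ^ 3"
    using qq_pos[of u] by (intro divide_right_mono) auto
  then show ?thesis using qq_pos[of u] by (simp add: divB_def power3_eq_cube power2_eq_square)
qed

section \<open>Supports and pairings\<close>

text \<open>\<open>Psi\<close> is not injective on all of \<open>Rspace 4\<close>, but it is a chart
  on each window \<open>Um (u 3)\<close>, which suffices for a local property.\<close>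

lemma smooth_on_form_coeff_Psi:
  assumes "test_form 4 MM k \<alpha>" "I \<in> multi_indices 4 k"
  shows "smooth_on 4 (Rspace 4) (form_coeff Psi \<alpha> I)"
proof (rule smooth_on_local[OF openin_Rspace])
  fix u assume "u \<in> Rspace 4"
  then have "u \<in> Um (u 3)" by (simp add: Um_def)
  moreover have "smooth_on 4 (Um (u 3)) (form_coeff Psi \<alpha> I)"
    using assms local_param_Psi unfolding test_form_def by blast
  ultimately show "\<exists>V. u \<in> V \<and> openin (top_of_set (Rspace 4)) V \<and> smooth_on 4 V (form_coeff Psi \<alpha> I)"
    using openin_Um by blast
qed

text \<open>On a compact set the positive continuous function \<open>wnorm\<close> has a positive
  lower bound.\<close>

lemma test_form_support:
  assumes "test_form 4 MM k \<alpha>"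
  obtains a where "a > 0" "\<And>P vs. P \<in> MM \<Longrightarrow> wnorm P < a \<Longrightarrow> vs \<in> tangent_lists 4 MM k P \<Longrightarrow> \<alpha> P vs = 0"
proof -
  obtain K where K: "K \<subseteq> MM" "compact K" "\<And>P vs. P \<in> MM - K \<Longrightarrow> vs \<in> tangent_lists 4 MM k P \<Longrightarrow> \<alpha> P vs = 0"
    using assms unfolding test_form_def by blast
  have "\<exists>a>0. \<forall>P\<in>K. a \<le> wnorm P"
  proof (cases "K = {}")
    case False
    obtain P where P: "P \<in> K" "\<forall>Q\<in>K. wnorm P \<le> wnorm Q"
      using continuous_attains_inf[OF K(2) False continuous_on_subset[OF continuous_on_wnorm K(1)]] by blast
    moreover have "wnorm P > 0" using P(1) K(1) by (intro wnorm_pos) blast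
    ultimately show ?thesis by blast
  qed (auto intro: exI[of _ 1])
  then obtain a where a: "a > 0" "\<And>P. P \<in> K \<Longrightarrow> a \<le> wnorm P" by blast
  show ?thesis
  proof (rule that[OF a(1)])
    fix P vs assume P: "P \<in> MM" "wnorm P < a" "vs \<in> tangent_lists 4 MM k P"
    then have "P \<notin> K" using a(2)[of P] by auto
    then show "\<alpha> P vs = 0" using K(3)[of P vs] P by blast
  qed
qed

lemma frame_tangent_list: "I \<in> multi_indices 4 k \<Longrightarrow> map (\<lambda>i. dPsi u (E i)) I \<in> tangent_lists 4 MM k (Psi u)"
  by (auto simp: multi_indices_def tangent_lists_def tangent_space_MM)

lemma lin4_sum': "(\<And>j. j < (n::nat) \<Longrightarrow> lin4 (f j)) \<Longrightarrow> lin4 (\<lambda>b. \<Sum>j<n. f j b)"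
proof -
  assume f: "\<And>j. j < n \<Longrightarrow> lin4 (f j)"
  show ?thesis unfolding lin4_def
  proof
    fix b
    have "(\<Sum>j<n. f j b) = (\<Sum>j<n. \<Sum>k<4. b k * f j (e_vec k))"
      using f unfolding lin4_def by (intro sum.cong refl) auto
    also have "\<dots> = (\<Sum>k<4. \<Sum>j<n. b k * f j (e_vec k))" by (rule sum.swap)
    finally show "(\<Sum>j<n. f j b) = (\<Sum>k<4. b k * (\<Sum>j<n. f j (e_vec k)))" by (simp add: sum_distrib_left)
  qed
qed

lemma L2_form_zero: "L2_form d M g k (\<lambda>_ _. 0)"
  by (simp add: L2_form_def is_form_def form_coeff_def[abs_def] form_inner_def Let_def)

lemma L2_inner_zero: "L2_inner d M g k (\<lambda>_ _. 0) \<beta> = 0" "L2_inner d M g k \<alpha> (\<lambda>_ _. 0) = 0"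
  by (simp_all add: L2_inner_def form_inner_def Let_def)

text \<open>\<open>eta\<close> is the metric dual of the bivector field \<open>\<partial>\<^sub>\<theta> \<and> BB\<close>, and \<open>zeta\<close> that of the vector field \<open>div BB \<partial>\<^sub>\<theta>\<close>;
  dividing by \<open>rho\<close> turns integrals over the volume into integrals over the coordinates. The
  preimage \<open>up P\<close> is determined up to the choice of the angle, on which nothing here depends.\<close>

definition eta :: "(nat \<times> nat) metric \<Rightarrow> (nat \<times> nat) dform"
  where "eta g P vs = (\<Sum>j<3. BB j (up P) / rho g (up P) *
    (g P (vs ! 0) (dPsi (up P) (e_vec 3)) * g P (vs ! 1) (dPsi (up P) (e_vec j))
      - g P (vs ! 0) (dPsi (up P) (e_vec j)) * g P (vs ! 1) (dPsi (up P) (e_vec 3))))"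

definition zeta :: "(nat \<times> nat) metric \<Rightarrow> (nat \<times> nat) dform"
  where "zeta g P vs = divB (up P) / rho g (up P) * g P (vs ! 0) (dPsi (up P) (e_vec 3))"

context
  fixes g :: "(nat \<times> nat) metric"
  assumes g: "riemannian_metric 5 (RP 5) g"
begin


section \<open>Pairings and square-integrability\<close>

lemma L2_inner_cong:
  assumes "\<And>u. form_inner 4 MM g k \<alpha> \<beta> (Psi u) = form_inner 4 MM g l \<alpha>' \<beta>' (Psi u)"
  shows "L2_inner 4 MM g k \<alpha> \<beta> = L2_inner 4 MM g l \<alpha>' \<beta>'"
  unfolding L2_inner_def riemannian_volume_eq[OF g]
proof (rule Bochner_Integration.integral_cong[OF refl])
  fix P assume "P \<in> space (vol g)"
  then obtain u where "P = Psi u" using MM_cases by (auto simp: space_vol[OF g])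
  then show "form_inner 4 MM g k \<alpha> \<beta> P = form_inner 4 MM g l \<alpha>' \<beta>' P" using assms by simp
qed

text \<open>Stated for products, so that one form may be altered wherever the other one
  vanishes.\<close>

lemma form_inner_cong:
  assumes "\<And>vs. vs \<in> tangent_lists 4 MM k (Psi u) \<Longrightarrow> \<alpha> (Psi u) vs * \<beta> (Psi u) vs = \<alpha>' (Psi u) vs * \<beta>' (Psi u) vs"
  shows "form_inner 4 MM g k \<alpha> \<beta> (Psi u) = form_inner 4 MM g k \<alpha>' \<beta>' (Psi u)"
proof -
  obtain E where fi: "\<And>k \<alpha> \<beta>. form_inner 4 MM g k \<alpha> \<beta> (Psi u) =
      (\<Sum>I\<in>multi_indices 4 k. \<alpha> (Psi u) (map (\<lambda>i. dPsi u (E i)) I) * \<beta> (Psi u) (map (\<lambda>i. dPsi u (E i)) I)) / fact k"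
    using form_inner_frame[OF g, of u] by blast
  show ?thesis unfolding fi
    by (intro arg_cong2[of _ _ _ _ "(/)"] sum.cong refl assms frame_tangent_list)
qed

text \<open>On the compact supports of a pair of test forms, the angle form agrees with a closed test form.\<close>

lemma L2_inner_omega_dt_graph:
  assumes "(\<eta>, \<zeta>) \<in> dt_graph 4 MM g (Suc 0)"
  shows "L2_inner 4 MM g (Suc 0) \<zeta> omega = 0"
proof -
  have t: "test_form 4 MM (Suc (Suc 0)) \<eta>" "test_form 4 MM (Suc 0) \<zeta>"
    and adj: "\<And>\<alpha> \<sigma>. (\<alpha>, \<sigma>) \<in> d_graph 4 MM (Suc 0) \<Longrightarrow>
      L2_inner 4 MM g (Suc (Suc 0)) \<sigma> \<eta> = L2_inner 4 MM g (Suc 0) \<alpha> \<zeta>"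
    using assms unfolding dt_graph_def by auto
  obtain a1 where a1: "a1 > 0" "\<And>P vs. P \<in> MM \<Longrightarrow> wnorm P < a1 \<Longrightarrow> vs \<in> tangent_lists 4 MM (Suc (Suc 0)) P \<Longrightarrow> \<eta> P vs = 0"
    using test_form_support[OF t(1)] by metis
  obtain a2 where a2: "a2 > 0" "\<And>P vs. P \<in> MM \<Longrightarrow> wnorm P < a2 \<Longrightarrow> vs \<in> tangent_lists 4 MM (Suc 0) P \<Longrightarrow> \<zeta> P vs = 0"
    using test_form_support[OF t(2)] by metis
  \<comment> \<open>\<open>cutoff a\<close> is constant beyond 2 a. A third instead of a half of the
    minimum leaves room for its derivative to vanish also where \<open>wnorm\<close> equals the
    minimum.\<close>
  define a where "a = min a1 a2 / 3"
  have a: "a > 0" "3 * a \<le> a1" "3 * a \<le> a2" using a1(1) a2(1) by (auto simp: a_def)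
  have "L2_inner 4 MM g (Suc 0) \<zeta> omega = L2_inner 4 MM g (Suc 0) (cform a) \<zeta>"
  proof (rule L2_inner_cong, rule form_inner_cong)
    fix u vs assume vs: "vs \<in> tangent_lists 4 MM (Suc 0) (Psi u)"
    show "\<zeta> (Psi u) vs * omega (Psi u) vs = cform a (Psi u) vs * \<zeta> (Psi u) vs"
    proof (cases "wnorm (Psi u) < a2")
      case True
      then show ?thesis using a2(2)[OF Psi_in_MM True vs] by simp
    next
      case False
      then have "cutoff a (wnorm (Psi u)) = 1" using a by (intro cutoff_1) auto
      then show ?thesis by (simp add: cform_def omega_def)
    qed
  qed
  also have "\<dots> = L2_inner 4 MM g (Suc (Suc 0)) (dcform a) \<eta>"
    using adj[OF d_graph_cform[OF a(1)]] by simp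
  also have "\<dots> = L2_inner 4 MM g (Suc (Suc 0)) (\<lambda>_ _. 0) (\<lambda>_ _. 0)"
  proof (rule L2_inner_cong, rule form_inner_cong)
    fix u vs assume vs: "vs \<in> tangent_lists 4 MM (Suc (Suc 0)) (Psi u)"
    show "dcform a (Psi u) vs * \<eta> (Psi u) vs = 0 * 0"
    proof (cases "wnorm (Psi u) < a1")
      case True
      then show ?thesis using a1(2)[OF Psi_in_MM True vs] by simp
    next
      case False
      then have "deriv (cutoff a) (wnorm (Psi u)) = 0" using a by (intro deriv_cutoff_0) auto
      then show ?thesis by (simp add: dcform_def)
    qed
  qed
  finally show ?thesis by (simp add: L2_inner_zero)
qed

lemma L2_form_omega: "L2_form 4 MM g (Suc 0) omega"
  unfolding L2_form_def
proof (intro conjI allI impI ballI)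
  show "is_form 4 MM (Suc 0) omega" by (rule is_form_omega)
  show "form_coeff \<psi> omega I \<in> borel_measurable (restrict_space (Rmeas 4) U)"
    if "local_param 4 MM U \<psi>" "I \<in> multi_indices 4 (Suc 0)" for U \<psi> I
    by (rule measurable_coeff_1[OF that(1) form_1_lin[OF is_form_omega] _ that(2)]) (simp add: omega_dPsi)
  obtain C where C: "C > 0" "\<And>u. rho g u > 0" "\<And>u. rho g u \<le> C / (qq u)^4"
    "\<And>u E i k. (\<forall>i<4. \<forall>j<4. Gu g u (E i) (E j) = (if i = j then 1 else 0)) \<Longrightarrow> i < 4 \<Longrightarrow> k < 4 \<Longrightarrow>
      ((E :: nat \<Rightarrow> nat \<Rightarrow> real) i k)\<^sup>2 \<le> C * (qq u)\<^sup>2"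
    using rho_bounds[OF g] by metis
  have "rho g u * form_inner 4 MM g (Suc 0) omega omega (Psi u) \<le> (4 * C * C) / (qq u)\<^sup>2" for u
  proof -
    obtain E where E: "\<forall>i<4. \<forall>j<4. Gu g u (E i) (E j) = (if i = j then 1 else 0)"
      and fi: "\<And>k \<alpha> \<beta>. form_inner 4 MM g k \<alpha> \<beta> (Psi u) =
        (\<Sum>I\<in>multi_indices 4 k. \<alpha> (Psi u) (map (\<lambda>i. dPsi u (E i)) I) * \<beta> (Psi u) (map (\<lambda>i. dPsi u (E i)) I)) / fact k"
      using form_inner_frame[OF g, of u] by blast
    \<comment> \<open>The square norm of dtheta is the sum of the squared angular components of the
      frame, of order q^2. Against \<open>rho\<close> of order q^(-4) this leaves q^(-2).\<close>
    have "form_inner 4 MM g (Suc 0) omega omega (Psi u) = (\<Sum>i<4. (E i 3)\<^sup>2)"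
      unfolding fi multi_indices_1 by (simp add: omega_dPsi power2_eq_square)
    also have "\<dots> \<le> (\<Sum>i<(4::nat). C * (qq u)\<^sup>2)" by (intro sum_mono C(4)[OF E]) auto
    finally have "form_inner 4 MM g (Suc 0) omega omega (Psi u) \<le> 4 * (C * (qq u)\<^sup>2)" by simp
    then have "rho g u * form_inner 4 MM g (Suc 0) omega omega (Psi u) \<le> (C / (qq u)^4) * (4 * (C * (qq u)\<^sup>2))"
      using C(1) C(2)[of u] C(3)[of u] qq_pos[of u]
      by (intro order_trans[OF mult_left_mono mult_right_mono]) (auto simp: less_imp_le)
    also have "\<dots> = (4 * C * C) / (qq u)\<^sup>2" using qq_pos[of u] by (simp add: field_simps eval_nat_numeral)
    finally show ?thesis .
  qed
  then show "(\<integral>\<^sup>+ P. ennreal (form_inner 4 MM g (Suc 0) omega omega P) \<partial>riemannian_volume 4 MM g) < \<infinity>"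
    by (rule nn_integral_form_inner_finite[OF g])
qed

lemma BB_up: "j < 3 \<Longrightarrow> BB j (up (Psi u)) = BB j u"
  by (simp add: BB_def up_Psi)

lemma eta_dPsi: "eta g (Psi u) [dPsi u b, dPsi u c] =
    (\<Sum>j<3. BB j u / rho g u * (Gu g u b (e_vec 3) * Gu g u c (e_vec j) - Gu g u b (e_vec j) * Gu g u c (e_vec 3)))"
  unfolding eta_def by (intro sum.cong refl) (simp add: BB_up up_Psi(3) rho_up[OF g] Gu_def[OF g])

lemma zeta_dPsi: "zeta g (Psi u) [dPsi u b] = divB u / rho g u * Gu g u b (e_vec 3)"
  by (simp add: zeta_def divB_def up_Psi(2,3) rho_up[OF g] Gu_def[OF g])

lemma form_inner_zeta:
  assumes "is_form 4 MM (Suc 0) \<alpha>"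
  shows "form_inner 4 MM g (Suc 0) \<alpha> (zeta g) (Psi u) = divB u / rho g u * \<alpha> (Psi u) [dPsi u (e_vec 3)]"
  by (rule form_inner_1[where \<beta> = "zeta g" and u = u, OF g assms]) (rule zeta_dPsi)

lemma form_inner_eta:
  assumes "is_form 4 MM (Suc (Suc 0)) \<alpha>"
  shows "form_inner 4 MM g (Suc (Suc 0)) \<alpha> (eta g) (Psi u) =
    (\<Sum>j<3. BB j u / rho g u * \<alpha> (Psi u) [dPsi u (e_vec 3), dPsi u (e_vec j)])"
  by (rule form_inner_2[where \<beta> = "eta g" and u = u, OF g assms]) (rule eta_dPsi)

lemma lin4_G: "lin4 (\<lambda>b. Gu g u b c)"
proof -
  obtain l L where "inner4 (Gu g u) l L" using Gu_inner4[OF g] by blast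
  then show ?thesis by (rule inner4.lin)
qed

lemma is_form_zeta: "is_form 4 MM (Suc 0) (zeta g)"
  by (rule is_form_1I) (simp only: zeta_dPsi, intro lin4_cmult lin4_G)

lemma is_form_eta: "is_form 4 MM (Suc (Suc 0)) (eta g)"
proof (rule is_form_2I)
  fix u c
  have "lin4 (\<lambda>b. \<Sum>j<3. BB j u / rho g u * (Gu g u c (e_vec j) * Gu g u b (e_vec 3) - Gu g u c (e_vec 3) * Gu g u b (e_vec j)))"
    by (intro lin4_sum' lin4_cmult lin4_diff lin4_G)
  then show "lin4 (\<lambda>b. eta g (Psi u) [dPsi u b, dPsi u c])" by (simp only: eta_dPsi mult.commute)
  have "lin4 (\<lambda>b. \<Sum>j<3. BB j u / rho g u * (Gu g u c (e_vec 3) * Gu g u b (e_vec j) - Gu g u c (e_vec j) * Gu g u b (e_vec 3)))"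
    by (intro lin4_sum' lin4_cmult lin4_diff lin4_G)
  then show "lin4 (\<lambda>b. eta g (Psi u) [dPsi u c, dPsi u b])" by (simp only: eta_dPsi)
qed (simp add: eta_dPsi)

lemma rho_nz: "rho g u \<noteq> 0"
  using rho_pos[OF g, of u] by simp

lemma continuous_on_qq: "continuous_on (Rspace 4) qq"
  by (rule smooth_on_imp_continuous_on[OF smooth_on_qq[OF openin_Rspace]])

lemma continuous_on_BB: "continuous_on (Rspace 4) (BB j)"
  by (rule smooth_on_imp_continuous_on[OF smooth_on_BB[OF openin_Rspace]])

lemma continuous_on_divB: "continuous_on (Rspace 4) divB"
  unfolding divB_def[abs_def] by (intro continuous_intros continuous_on_qq) (use qq_nz in auto)

lemma continuous_on_dBB: "continuous_on (Rspace 4) (dBB j)"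
  unfolding dBB_def[abs_def]
  by (intro continuous_intros continuous_on_qq smooth_on_imp_continuous_on[OF smooth_on_coord[OF openin_Rspace]])
    (use qq_nz in auto)

lemma L2_form_zeta: "L2_form 4 MM g (Suc 0) (zeta g)"
  unfolding L2_form_def
proof (intro conjI allI impI ballI)
  show "is_form 4 MM (Suc 0) (zeta g)" by (rule is_form_zeta)
  have "continuous_on (Rspace 4) (\<lambda>u. zeta g (Psi u) [dPsi u (e_vec k)])" if "k < 4" for k
    unfolding zeta_dPsi
    by (intro continuous_intros continuous_on_divB continuous_on_rho[OF g] continuous_on_Gu[OF g]) (use that rho_nz in auto)
  then show "form_coeff \<psi> (zeta g) I \<in> borel_measurable (restrict_space (Rmeas 4) U)"
    if "local_param 4 MM U \<psi>" "I \<in> multi_indices 4 (Suc 0)" for U \<psi> I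
    by (rule measurable_coeff_1[OF that(1) form_1_lin[OF is_form_zeta] _ that(2)])
  obtain C where C: "C > 0" "\<And>u. rho g u > 0" "\<And>u. 1 / rho g u \<le> C * (qq u)^4"
    "\<And>u i j. i < 4 \<Longrightarrow> j < 4 \<Longrightarrow> \<bar>Gu g u (e_vec i) (e_vec j)\<bar> \<le> C / (qq u)\<^sup>2"
    using rho_bounds[OF g] by metis
  have "rho g u * form_inner 4 MM g (Suc 0) (zeta g) (zeta g) (Psi u) \<le> (9 * C * C) / (qq u)\<^sup>2" for u
  proof -
    \<comment> \<open>Pairing \<open>zeta\<close> with itself through \<open>form_inner_zeta\<close>
      avoids the frame. The 9 below is the square of the 3 in \<open>divB_le\<close>, and the powers
      of q are -4 + 4 - 2.\<close>
    have "rho g u * form_inner 4 MM g (Suc 0) (zeta g) (zeta g) (Psi u) =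
        (divB u * divB u) * (1 / rho g u) * Gu g u (e_vec 3) (e_vec 3)"
      using rho_nz[of u] by (simp add: form_inner_zeta[OF is_form_zeta] zeta_dPsi)
    also have "\<dots> \<le> (3 / (qq u)\<^sup>2 * (3 / (qq u)\<^sup>2)) * (C * (qq u)^4) * (C / (qq u)\<^sup>2)"
    proof (intro mult_mono divB_le C(3))
      show "Gu g u (e_vec 3) (e_vec 3) \<le> C / (qq u)\<^sup>2" using C(4)[of 3 3 u] by simp
      obtain l L where "inner4 (Gu g u) l L" using Gu_inner4[OF g] by blast
      then show "0 \<le> Gu g u (e_vec 3) (e_vec 3)" by (rule inner4.nonneg)
    qed (use C(1,2) divB_pos in \<open>auto simp: less_imp_le\<close>)
    also have "\<dots> = (9 * C * C) / (qq u)\<^sup>2" using qq_pos[of u] by (simp add: field_simps eval_nat_numeral)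
    finally show ?thesis .
  qed
  then show "(\<integral>\<^sup>+ P. ennreal (form_inner 4 MM g (Suc 0) (zeta g) (zeta g) P) \<partial>riemannian_volume 4 MM g) < \<infinity>"
    by (rule nn_integral_form_inner_finite[OF g])
qed

lemma L2_form_eta: "L2_form 4 MM g (Suc (Suc 0)) (eta g)"
  unfolding L2_form_def
proof (intro conjI allI impI ballI)
  show "is_form 4 MM (Suc (Suc 0)) (eta g)" by (rule is_form_eta)
  have "continuous_on (Rspace 4) (\<lambda>u. eta g (Psi u) [dPsi u (e_vec k), dPsi u (e_vec l)])" if "k < 4" "l < 4" for k l
    unfolding eta_dPsi
    by (intro continuous_intros continuous_on_BB continuous_on_rho[OF g] continuous_on_Gu[OF g]) (use that rho_nz in auto)
  then show "form_coeff \<psi> (eta g) I \<in> borel_measurable (restrict_space (Rmeas 4) U)"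
    if "local_param 4 MM U \<psi>" "I \<in> multi_indices 4 (Suc (Suc 0))" for U \<psi> I
    by (rule measurable_coeff_2[OF that(1) form_2_lin(1)[OF is_form_eta] form_2_lin(2)[OF is_form_eta] _ that(2)])
  obtain C where C: "C > 0" "\<And>u. rho g u > 0" "\<And>u. 1 / rho g u \<le> C * (qq u)^4"
    "\<And>u i j. i < 4 \<Longrightarrow> j < 4 \<Longrightarrow> \<bar>Gu g u (e_vec i) (e_vec j)\<bar> \<le> C / (qq u)\<^sup>2"
    using rho_bounds[OF g] by metis
  have "rho g u * form_inner 4 MM g (Suc (Suc 0)) (eta g) (eta g) (Psi u) \<le> (18 * C * C * C) / (qq u)\<^sup>2" for u
  proof -
    let ?e = "\<lambda>j. eta g (Psi u) [dPsi u (e_vec 3), dPsi u (e_vec j)]"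
    let ?c = "C / (qq u)\<^sup>2"
    have c: "?c \<ge> 0" using C(1) by simp
    have Gm: "\<bar>Gu g u (e_vec i) (e_vec j) * Gu g u (e_vec k) (e_vec l)\<bar> \<le> ?c * ?c" if "i < 4" "j < 4" "k < 4" "l < 4" for i j k l
      unfolding abs_mult using that c by (intro mult_mono C(4)) auto
    \<comment> \<open>Three summands, each with a difference of two products of metric entries, give
      the factor 6. The powers of q are -1 from the field, 4 from 1/rho and -4 from the
      metric.\<close>
    have e: "\<bar>?e j\<bar> \<le> 6 * C * C * C / qq u" if "j < 3" for j
    proof -
      have "\<bar>?e j\<bar> \<le> (\<Sum>k<3. \<bar>BB k u / rho g u * (Gu g u (e_vec 3) (e_vec 3) * Gu g u (e_vec j) (e_vec k)
          - Gu g u (e_vec 3) (e_vec k) * Gu g u (e_vec j) (e_vec 3))\<bar>)"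
        unfolding eta_dPsi by (rule sum_abs)
      also have "\<dots> \<le> (\<Sum>k<(3::nat). (1 / qq u) * (C * (qq u)^4) * (2 * (?c * ?c)))"
      proof (rule sum_mono)
        fix k :: nat assume k: "k \<in> {..<3}"
        have "\<bar>Gu g u (e_vec 3) (e_vec 3) * Gu g u (e_vec j) (e_vec k) - Gu g u (e_vec 3) (e_vec k) * Gu g u (e_vec j) (e_vec 3)\<bar> \<le> 2 * (?c * ?c)"
          using Gm[of 3 3 j k] Gm[of 3 k j 3] that k by (intro order_trans[OF abs_triangle_ineq4]) auto
        moreover have "\<bar>BB k u / rho g u\<bar> \<le> (1 / qq u) * (C * (qq u)^4)"
        proof -
          have "\<bar>BB k u / rho g u\<bar> = \<bar>BB k u\<bar> * (1 / rho g u)" using C(2)[of u] by simp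
          also have "\<dots> \<le> (1 / qq u) * (C * (qq u)^4)"
            using k C(2)[of u] qq_pos[of u] by (intro mult_mono BB_bound C(3)) (auto simp: less_imp_le)
          finally show ?thesis .
        qed
        ultimately show "\<bar>BB k u / rho g u * (Gu g u (e_vec 3) (e_vec 3) * Gu g u (e_vec j) (e_vec k)
            - Gu g u (e_vec 3) (e_vec k) * Gu g u (e_vec j) (e_vec 3))\<bar> \<le> (1 / qq u) * (C * (qq u)^4) * (2 * (?c * ?c))"
          unfolding abs_mult[of "BB k u / rho g u"] using C(1) qq_pos[of u] by (intro mult_mono) auto
      qed
      also have "\<dots> = 6 * C * C * C / qq u" using qq_pos[of u] by (simp add: field_simps eval_nat_numeral)
      finally show ?thesis .
    qed
    have "rho g u * form_inner 4 MM g (Suc (Suc 0)) (eta g) (eta g) (Psi u) = rho g u * (\<Sum>j<3. BB j u / rho g u * ?e j)"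
      by (simp only: form_inner_eta[OF is_form_eta])
    also have "\<dots> = (\<Sum>j<3. BB j u * ?e j)" using rho_nz[of u] by (simp add: sum_distrib_left)
    also have "\<dots> \<le> (\<Sum>j<(3::nat). (1 / qq u) * (6 * C * C * C / qq u))"
    proof (rule sum_mono)
      fix j :: nat assume j: "j \<in> {..<3}"
      have "\<bar>BB j u * ?e j\<bar> \<le> (1 / qq u) * (6 * C * C * C / qq u)"
        unfolding abs_mult using j qq_pos[of u] by (intro mult_mono BB_bound e) (auto simp: less_imp_le)
      then show "BB j u * ?e j \<le> (1 / qq u) * (6 * C * C * C / qq u)" by linarith
    qed
    also have "\<dots> = (18 * C * C * C) / (qq u)\<^sup>2" by (simp add: power2_eq_square)
    finally show ?thesis .
  qed
  then show "(\<integral>\<^sup>+ P. ennreal (form_inner 4 MM g (Suc (Suc 0)) (eta g) (eta g) P) \<partial>riemannian_volume 4 MM g) < \<infinity>"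
    by (rule nn_integral_form_inner_finite[OF g])
qed


text \<open>Integration by parts in the cylinder coordinates; the field \<open>BB\<close> does not depend on the angle.\<close>

lemma L2_inner_eta_zeta:
  assumes "(\<alpha>, \<sigma>) \<in> d_graph 4 MM (Suc 0)"
  shows "L2_inner 4 MM g (Suc (Suc 0)) \<sigma> (eta g) = L2_inner 4 MM g (Suc 0) \<alpha> (zeta g)"
proof -
  have t: "test_form 4 MM (Suc 0) \<alpha>" "test_form 4 MM (Suc (Suc 0)) \<sigma>" "is_ext_deriv 4 MM (Suc 0) \<alpha> \<sigma>"
    using assms unfolding d_graph_def by auto
  have form: "is_form 4 MM (Suc 0) \<alpha>" "is_form 4 MM (Suc (Suc 0)) \<sigma>"
    using t(1,2) unfolding test_form_def by blast+
  define A where "A i u = \<alpha> (Psi u) [dPsi u (e_vec i)]" for i u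
  define S where "S j u = \<sigma> (Psi u) [dPsi u (e_vec 3), dPsi u (e_vec j)]" for j u
  have A: "form_coeff Psi \<alpha> [i] = A i" if "i < 4" for i
    using that by (auto simp: form_coeff_def A_def coord_vec_Psi)
  have sA: "smooth_on 4 (Rspace 4) (A i)" if "i < 4" for i
    using smooth_on_form_coeff_Psi[OF t(1), of "[i]"] that A by (simp add: multi_indices_def)
  have cA: "continuous_on (Rspace 4) (A i)" if "i < 4" for i
    using smooth_on_imp_continuous_on[OF sA[OF that]] .
  have cdA: "continuous_on (Rspace 4) (partial_deriv k (A i))" if "i < 4" "k < 4" for i k
    using smooth_on_imp_continuous_on[OF smooth_on_partial_deriv[OF openin_Rspace sA that(2)]] that by simp
  have S: "S j u = partial_deriv 3 (A j) u - partial_deriv j (A 3) u" if "j < 3" "u \<in> Rspace 4" for j u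
  proof -
    have "u \<in> Um (u 3)" using that by (simp add: Um_def)
    moreover have "[3, j] \<in> multi_indices 4 (Suc (Suc 0))" using that by (simp add: multi_indices_def)
    ultimately have "form_coeff Psi \<sigma> [3, j] u =
        (\<Sum>l\<le>Suc 0. (-1) ^ l * partial_deriv ([3, j] ! l) (form_coeff Psi \<alpha> (take l [3, j] @ drop (Suc l) [3, j])) u)"
      using t(3) local_param_Psi unfolding is_ext_deriv_def by blast
    then show ?thesis using that by (simp add: A form_coeff_def S_def coord_vec_Psi)
  qed
  obtain a where a: "a > 0" "\<And>P vs. P \<in> MM \<Longrightarrow> wnorm P < a \<Longrightarrow> vs \<in> tangent_lists 4 MM (Suc 0) P \<Longrightarrow> \<alpha> P vs = 0"
    using test_form_support[OF t(1)] by metis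
  define R where "R = 1 / a + 1"
  have A0: "A i u = 0" if "k < 3" "\<bar>u k\<bar> > R" for i u k
  proof -
    have "wnorm (Psi u) < a" using that by (intro wnorm_Psi_less[OF a(1)]) (auto simp: R_def)
    then show ?thesis unfolding A_def by (rule a(2)[OF Psi_in_MM]) (auto simp: tangent_lists_1)
  qed
  have dA0: "partial_deriv l (A i) u = 0" if "u \<in> Rspace 4" "k < 3" "\<bar>u k\<bar> > R" "l < 4" for i u k l
  proof -
    let ?V = "Rspace 4 \<inter> (\<lambda>u. \<bar>u k\<bar>) -` {R<..}"
    have V: "openin (top_of_set (Rspace 4)) ?V"
      by (intro continuous_openin_preimage_gen continuous_on_rabs continuous_on_coord) simp
    have "partial_deriv l (A i) u = partial_deriv l (\<lambda>_. 0) u"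
      by (rule partial_deriv_cong[OF V]) (use that A0[of k] in auto)
    then show ?thesis by (simp add: partial_deriv_def)
  qed
  \<comment> \<open>\<open>D1 j\<close> is the angular derivative of B_j A_j, and
    \<open>D2 j\<close> is the \<open>j\<close>-th derivative of B_j A_3. The sum of B_j S_j equals
    the sum of D1 - D2 plus \<open>Y\<close>, and only \<open>Y\<close> survives
    integration.\<close>
  define D1 where "D1 j u = BB j u * partial_deriv 3 (A j) u" for j u
  define D2 where "D2 j u = BB j u * partial_deriv j (A 3) u + dBB j u * A 3 u" for j u
  define Y where "Y u = divB u * A 3 u" for u
  have c: "continuous_on (Rspace 4) (D1 j)" "continuous_on (Rspace 4) (D2 j)" if "j < 3" for j
    unfolding D1_def[abs_def] D2_def[abs_def]
    using that by (auto intro!: continuous_on_mult continuous_on_add continuous_on_BB continuous_on_dBB cA cdA)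
  have cY: "continuous_on (Rspace 4) Y"
    unfolding Y_def[abs_def] by (intro continuous_on_mult continuous_on_divB cA) simp
  have z: "D1 j u = 0" "D2 j u = 0" "Y u = 0" if "j < 3" "u \<in> Rspace 4" "k < 3" "\<bar>u k\<bar> > R" for j u k
    using that A0[of k u] dA0[of u k] by (simp_all add: D1_def D2_def Y_def)
  have iD1: "integrable (Rmeas 4) (\<lambda>u. indicator strip u * D1 j u)"
    and iD2: "integrable (Rmeas 4) (\<lambda>u. indicator strip u * D2 j u)" if "j < 3" for j
    by (rule integrable_on_strip[OF c(1)[OF that], of R], use z(1)[OF that] in blast)
      (rule integrable_on_strip[OF c(2)[OF that], of R], use z(2)[OF that] in blast)
  have iY: "integrable (Rmeas 4) (\<lambda>u. indicator strip u * Y u)"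
    by (rule integrable_on_strip[OF cY, of R]) (use z(3)[of 0] in auto)
  have BB3: "BB j (u(3 := t)) = BB j u" if "j < 3" for j u t
    using that by (simp add: BB_def qq_def)
  have D1: "(\<integral>u. indicator strip u * D1 j u \<partial>Rmeas 4) = 0" if j: "j < 3" for j
  proof (rule integral_strip_deriv_periodic[OF c(1)[OF j], of "\<lambda>u. BB j u * A j u" R])
    fix u assume u: "u \<in> Rspace 4"
    have "((\<lambda>t. A j (u(3 := t))) has_real_derivative partial_deriv 3 (A j) u) (at (u 3))"
      by (rule smooth_on_DERIV[OF sA u]) (use j in auto)
    then show "((\<lambda>t. BB j (u(3 := t)) * A j (u(3 := t))) has_real_derivative D1 j u) (at (u 3))"
      unfolding BB3[OF j] D1_def by (rule DERIV_cmult)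
    \<comment> \<open>Angles 0 and 2 pi give the same point and the same tangent vectors, so the
      coefficients of \<open>\<alpha>\<close> are periodic.\<close>
    have "Psi (u(3 := 2 * pi)) = Psi (u(3 := 0))" "dPsi (u(3 := 2 * pi)) b = dPsi (u(3 := 0)) b" for b
      by (auto intro!: Psi_cong dPsi_cong)
    then show "BB j (u(3 := 2 * pi)) * A j (u(3 := 2 * pi)) = BB j (u(3 := 0)) * A j (u(3 := 0))"
      by (simp add: BB3[OF j] A_def)
  qed (use z(1)[OF j] in blast)
  have D2: "(\<integral>u. indicator strip u * D2 j u \<partial>Rmeas 4) = 0" if j: "j < 3" for j
  proof (rule integral_strip_deriv_radial[OF c(2)[OF j] j, of "\<lambda>u. BB j u * A 3 u" R])
    fix u assume u: "u \<in> Rspace 4"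
    have "((\<lambda>t. A 3 (u(j := t))) has_real_derivative partial_deriv j (A 3) u) (at (u j))"
      by (rule smooth_on_DERIV[OF sA u]) (use j in auto)
    from DERIV_mult[OF BB_DERIV[OF j, of u] this]
    show "((\<lambda>t. BB j (u(j := t)) * A 3 (u(j := t))) has_real_derivative D2 j u) (at (u j))"
      by (simp add: D2_def algebra_simps)
  qed (use z(2)[OF j] A0 in auto)
  have 2: "L2_inner 4 MM g (Suc (Suc 0)) \<sigma> (eta g) = (\<integral>u. indicator strip u * (\<Sum>j<3. BB j u * S j u) \<partial>Rmeas 4)"
  proof -
    have fi: "form_inner 4 MM g (Suc (Suc 0)) \<sigma> (eta g) (Psi u) = (\<Sum>j<3. BB j u / rho g u * S j u)" for u
      unfolding S_def by (rule form_inner_eta[OF form(2)])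
    have "continuous_on (Rspace 4) (\<lambda>u. \<Sum>j<3. BB j u / rho g u * (partial_deriv 3 (A j) u - partial_deriv j (A 3) u))"
      by (intro continuous_on_sum continuous_on_mult continuous_on_divide continuous_on_diff
          continuous_on_BB continuous_on_rho[OF g] cdA) (use rho_nz in auto)
    then have "continuous_on (Rspace 4) (\<lambda>u. form_inner 4 MM g (Suc (Suc 0)) \<sigma> (eta g) (Psi u))"
      by (rule continuous_on_eq) (simp add: fi S)
    then have "L2_inner 4 MM g (Suc (Suc 0)) \<sigma> (eta g) =
        (\<integral>u. indicator strip u * (rho g u * form_inner 4 MM g (Suc (Suc 0)) \<sigma> (eta g) (Psi u)) \<partial>Rmeas 4)"
      unfolding L2_inner_def riemannian_volume_eq[OF g] by (intro integral_vol[OF g] measurable_on_MM[OF g])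
    also have "(\<lambda>u. rho g u * form_inner 4 MM g (Suc (Suc 0)) \<sigma> (eta g) (Psi u)) = (\<lambda>u. \<Sum>j<3. BB j u * S j u)"
      using rho_nz by (simp add: fi sum_distrib_left)
    finally show ?thesis .
  qed
  have 1: "L2_inner 4 MM g (Suc 0) \<alpha> (zeta g) = (\<integral>u. indicator strip u * Y u \<partial>Rmeas 4)"
  proof -
    have fi: "form_inner 4 MM g (Suc 0) \<alpha> (zeta g) (Psi u) = divB u / rho g u * A 3 u" for u
      unfolding A_def by (rule form_inner_zeta[OF form(1)])
    have "continuous_on (Rspace 4) (\<lambda>u. form_inner 4 MM g (Suc 0) \<alpha> (zeta g) (Psi u))"
      unfolding fi by (intro continuous_on_mult continuous_on_divide continuous_on_divB continuous_on_rho[OF g] cA)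
        (use rho_nz in auto)
    then have "L2_inner 4 MM g (Suc 0) \<alpha> (zeta g) =
        (\<integral>u. indicator strip u * (rho g u * form_inner 4 MM g (Suc 0) \<alpha> (zeta g) (Psi u)) \<partial>Rmeas 4)"
      unfolding L2_inner_def riemannian_volume_eq[OF g] by (intro integral_vol[OF g] measurable_on_MM[OF g])
    also have "(\<lambda>u. rho g u * form_inner 4 MM g (Suc 0) \<alpha> (zeta g) (Psi u)) = Y"
      using rho_nz by (simp add: fi Y_def fun_eq_iff)
    finally show ?thesis .
  qed
  have "(\<integral>u. indicator strip u * (\<Sum>j<3. BB j u * S j u) \<partial>Rmeas 4) =
      (\<integral>u. (\<Sum>j<3. indicator strip u * D1 j u) - (\<Sum>j<3. indicator strip u * D2 j u) + indicator strip u * Y u \<partial>Rmeas 4)"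
  proof (rule Bochner_Integration.integral_cong[OF refl])
    fix u
    have "indicator strip u * (\<Sum>j<3. BB j u * S j u) =
        indicator strip u * (\<Sum>j<3. D1 j u - D2 j u + dBB j u * A 3 u)"
    proof (cases "u \<in> strip")
      case True
      then have "u \<in> Rspace 4" by (simp add: strip_def)
      then have "(\<Sum>j<3. BB j u * S j u) = (\<Sum>j<3. D1 j u - D2 j u + dBB j u * A 3 u)"
        by (intro sum.cong refl) (simp add: S D1_def D2_def right_diff_distrib)
      then show ?thesis by simp
    qed simp
    also have "(\<Sum>j<3. D1 j u - D2 j u + dBB j u * A 3 u) = (\<Sum>j<3. D1 j u) - (\<Sum>j<3. D2 j u) + Y u"
      by (simp add: sum.distrib sum_subtractf Y_def flip: sum_dBB sum_distrib_right)
    finally show "indicator strip u * (\<Sum>j<3. BB j u * S j u) =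
        (\<Sum>j<3. indicator strip u * D1 j u) - (\<Sum>j<3. indicator strip u * D2 j u) + indicator strip u * Y u"
      by (simp add: distrib_left right_diff_distrib flip: sum_distrib_left)
  qed
  also have "\<dots> = (\<Sum>j<3. \<integral>u. indicator strip u * D1 j u \<partial>Rmeas 4) - (\<Sum>j<3. \<integral>u. indicator strip u * D2 j u \<partial>Rmeas 4)
      + (\<integral>u. indicator strip u * Y u \<partial>Rmeas 4)"
  proof -
    have s1: "integrable (Rmeas 4) (\<lambda>u. \<Sum>j<3. indicator strip u * D1 j u)"
      and s2: "integrable (Rmeas 4) (\<lambda>u. \<Sum>j<3. indicator strip u * D2 j u)"
      by (rule Bochner_Integration.integrable_sum, use iD1 in simp)
        (rule Bochner_Integration.integrable_sum, use iD2 in simp)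
    have e1: "(\<integral>u. (\<Sum>j<3. indicator strip u * D1 j u) \<partial>Rmeas 4) = (\<Sum>j<3. \<integral>u. indicator strip u * D1 j u \<partial>Rmeas 4)"
      by (rule Bochner_Integration.integral_sum) (use iD1 in auto)
    have e2: "(\<integral>u. (\<Sum>j<3. indicator strip u * D2 j u) \<partial>Rmeas 4) = (\<Sum>j<3. \<integral>u. indicator strip u * D2 j u \<partial>Rmeas 4)"
      by (rule Bochner_Integration.integral_sum) (use iD2 in auto)
    show ?thesis
      unfolding Bochner_Integration.integral_add[OF Bochner_Integration.integrable_diff[OF s1 s2] iY]
        Bochner_Integration.integral_diff[OF s1 s2] e1 e2 ..
  qed
  also have "\<dots> = (\<integral>u. indicator strip u * Y u \<partial>Rmeas 4)" by (simp add: D1 D2)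
  finally show ?thesis unfolding 1 2 .
qed

text \<open>As dtheta takes the value 1 on the angular field, the pairing is the integral over
  \<open>strip\<close> of the divergence, an integrable and strictly positive function on a set of
  positive measure.\<close>

lemma L2_inner_omega_zeta: "L2_inner 4 MM g (Suc 0) omega (zeta g) \<noteq> 0"
proof -
  have fi: "form_inner 4 MM g (Suc 0) omega (zeta g) (Psi u) = divB u / rho g u" for u
    by (simp add: form_inner_zeta[OF is_form_omega] omega_dPsi e_vec_def)
  have "continuous_on (Rspace 4) (\<lambda>u. form_inner 4 MM g (Suc 0) omega (zeta g) (Psi u))"
    unfolding fi by (intro continuous_on_divide continuous_on_divB continuous_on_rho[OF g]) (use rho_nz in auto)
  then have "L2_inner 4 MM g (Suc 0) omega (zeta g) =
      (\<integral>u. indicator strip u * (rho g u * form_inner 4 MM g (Suc 0) omega (zeta g) (Psi u)) \<partial>Rmeas 4)"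
    unfolding L2_inner_def riemannian_volume_eq[OF g] by (intro integral_vol[OF g] measurable_on_MM[OF g])
  then have eq: "L2_inner 4 MM g (Suc 0) omega (zeta g) = (\<integral>u. indicator strip u * divB u \<partial>Rmeas 4)"
    using rho_nz by (simp add: fi)
  have m: "(\<lambda>u. indicator strip u * divB u) \<in> borel_measurable (Rmeas 4)"
    using measurable_continuous_Rspace[OF continuous_on_divB] by measurable
  have int: "integrable (Rmeas 4) (\<lambda>u. indicator strip u * divB u)"
  proof (rule integrableI_bounded[OF m])
    have "(\<integral>\<^sup>+ u. ennreal (norm (indicator strip u * divB u)) \<partial>Rmeas 4) \<le>
        (\<integral>\<^sup>+ u. 3 * (ennreal (1 / (qq u)\<^sup>2) * indicator strip u) \<partial>Rmeas 4)"
    proof (rule nn_integral_mono)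
      fix u
      have "ennreal (divB u) \<le> ennreal (3 * (1 / (qq u)\<^sup>2))" using divB_le[of u] by (intro ennreal_leI) simp
      also have "\<dots> = 3 * ennreal (1 / (qq u)\<^sup>2)" by (subst ennreal_mult) auto
      finally show "ennreal (norm (indicator strip u * divB u)) \<le> 3 * (ennreal (1 / (qq u)\<^sup>2) * indicator strip u)"
        using divB_pos[of u] by (auto simp: indicator_def)
    qed
    also have "\<dots> = 3 * (\<integral>\<^sup>+ u \<in> strip. ennreal (1 / (qq u)\<^sup>2) \<partial>Rmeas 4)"
    proof (rule nn_integral_cmult)
      have "continuous_on (Rspace 4) (\<lambda>u. 1 / (qq u)\<^sup>2)" by (intro continuous_intros continuous_on_qq) (use qq_nz in auto)
      then have "(\<lambda>u. 1 / (qq u)\<^sup>2) \<in> borel_measurable (Rmeas 4)" by (rule measurable_continuous_Rspace)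
      then show "(\<lambda>u. ennreal (1 / (qq u)\<^sup>2) * indicator strip u) \<in> borel_measurable (Rmeas 4)" by measurable
    qed
    also have "\<dots> < \<infinity>" using nn_integral_strip_finite by (simp add: ennreal_mult_less_top)
    finally show "(\<integral>\<^sup>+ u. ennreal (norm (indicator strip u * divB u)) \<partial>Rmeas 4) < \<infinity>" .
  qed
  have "(\<integral>u. indicator strip u * divB u \<partial>Rmeas 4) \<noteq> 0"
  proof
    assume 0: "(\<integral>u. indicator strip u * divB u \<partial>Rmeas 4) = 0"
    have "AE u in Rmeas 4. 0 \<le> indicator strip u * divB u"
      using divB_pos by (intro AE_I2 mult_nonneg_nonneg) (auto simp: less_imp_le)
    then have "AE u in Rmeas 4. indicator strip u * divB u = 0"
      using integral_nonneg_eq_0_iff_AE[OF int] 0 by blast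
    then have "AE u in Rmeas 4. u \<notin> strip"
      by eventually_elim (use divB_pos in \<open>auto simp: less_le\<close>)
    moreover have "{u \<in> space (Rmeas 4). \<not> u \<notin> strip} = strip"
      using sets.sets_into_space[OF strip_in_sets] by auto
    ultimately have "emeasure (Rmeas 4) strip = 0"
      using AE_iff_measurable[OF strip_in_sets, of "\<lambda>u. u \<notin> strip"] by simp
    \<comment> \<open>A cube of measure 1 inside \<open>strip\<close>, since 1 < 2 pi, contradicts
      measure 0.\<close>
    moreover have "emeasure (Rmeas 4) (\<Pi>\<^sub>E k\<in>{..<4}. {0..1}) = (\<Prod>k<(4::nat). emeasure lborel {0..1::real})"
      unfolding Rmeas_def by (rule lborel_prod.emeasure_PiM) auto
    moreover have "(\<Pi>\<^sub>E k\<in>{..<4}. {0..1}) \<subseteq> strip"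
    proof
      fix u :: "nat \<Rightarrow> real" assume u: "u \<in> (\<Pi>\<^sub>E k\<in>{..<4}. {0..1})"
      then have "u 3 \<in> {0..1}" by (rule PiE_mem) simp
      then have "0 \<le> u 3 \<and> u 3 < 2 * pi" using pi_gt3 unfolding atLeastAtMost_iff by linarith
      moreover have "u \<in> Rspace 4" using u unfolding Rspace_def by (blast intro: PiE_mono[THEN subsetD])
      ultimately show "u \<in> strip" by (simp add: strip_def)
    qed
    ultimately show False using emeasure_mono[OF _ strip_in_sets, of "\<Pi>\<^sub>E k\<in>{..<4}. {0..1}"] by simp
  qed
  then show ?thesis unfolding eq .
qed

lemma not_L2_Stokes_MM: "\<not> L2_Stokes 4 MM g"
proof
  assume S: "L2_Stokes 4 MM g"
  have "(omega, \<lambda>_ _. 0) \<in> d_max 4 MM g (Suc 0)"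
    unfolding d_max_def using L2_form_omega L2_form_zero L2_inner_omega_dt_graph by (auto simp: L2_inner_zero)
  moreover have "(eta g, zeta g) \<in> dt_max 4 MM g (Suc 0)"
    unfolding dt_max_def using L2_form_eta L2_form_zeta L2_inner_eta_zeta by auto
  ultimately have "L2_inner 4 MM g (Suc (Suc 0)) (\<lambda>_ _. 0) (eta g) = L2_inner 4 MM g (Suc 0) omega (zeta g)"
    using S unfolding L2_Stokes_def by blast
  then show False using L2_inner_omega_zeta by (simp add: L2_inner_zero)
qed

end

theorem theorem1p1:
  shows "\<exists>N V. projective_variety N V \<and> even (variety_dim N V) \<and> (\<exists>p. sing N V = {p}) \<and>
    (\<forall>g. riemannian_metric N (RP N) g \<longrightarrow> \<not> L2_Stokes (variety_dim N V) (V - sing N V) g)"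
proof (rule exI[of _ 5], rule exI[of _ VV], intro conjI allI impI)
  show "projective_variety 5 VV" by (rule projective_variety_VV)
  show "even (variety_dim 5 VV)" by (simp add: variety_dim_VV)
  show "\<exists>p. sing 5 VV = {p}" by (simp add: sing_VV)
  fix g :: "(nat \<times> nat) metric"
  assume "riemannian_metric 5 (RP 5) g"
  then show "\<not> L2_Stokes (variety_dim 5 VV) (VV - sing 5 VV) g"
    using not_L2_Stokes_MM by (simp add: variety_dim_VV sing_VV flip: MM_def)
qed

end
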